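(* Let $\Phi:\mathbb{R}^2\to\mathbb{R}^2$, $\Phi(z)=\frac{\sqrt2}{2}(z_1+z_2,\,z_2-z_1)^T$. Let $p\in[1,3]$, $\Omega=(0,1)\times\Phi^{-1}((0,1)^2)\subset\mathbb{R}^3$, $$K_2=K_{2,12}=\{\operatorname{diag}(0,0,0),\ \operatorname{diag}(1,0,0),\ \operatorname{diag}(\tfrac12,1,-1)\},$$ and $F=\operatorname{diag}(\frac12,\frac12,-\frac12)$ (which lies in $K_2^{(2)}\setminus K_2^{(1)}$). Then there exists a constant $C>0$ such that for every $\epsilon\in(0,1)$ $$E^{(p)}_{\epsilon,3}(\mathcal{A}_F^{\rm dir})\le C\,\epsilon^{2p/(2p+3)},$$ where $E^{(p)}_{\epsilon,3}(\mathcal{A}_F^{\rm dir})$ is the minimal singularly perturbed energy on $\Omega$ for the wells $K_2$ with Dirichlet datum $F$ (defined in the context).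
   Context: **Energy.** $\operatorname{sym}(M)=\frac12(M+M^T)$. Let $K=\{A_0,\dots,A_m\}\subset\mathbb{R}^{d\times d}_{\rm sym}$ be a set of $m+1$ matrices (wells), here $d=3$, $m=2$. A function $\chi:\Omega\to K$ is written $\chi=\sum_{j=0}^m\chi_jA_j$ with $\chi_j:\Omega\to\{0,1\}$, $\sum_{j=0}^m\chi_j=1$. Define $$E^{(p)}_{\epsilon,m+1}(u;\chi)=\int_\Omega|\operatorname{sym}(\nabla u)-\chi|^p\,dx+\epsilon\sum_{j=1}^m\|D\chi_j\|_{TV(\Omega)}.$$ For $F\in\mathbb{R}^{d\times d}_{\rm sym}$ let $$\mathcal{A}_F^{\rm dir}=\{u\in W^{1,p}_{\rm loc}(\mathbb{R}^d;\mathbb{R}^d): u(x)=Fx+b\text{ in }\mathbb{R}^d\setminus\Omega\text{ for some }b\in\mathbb{R}^d\},$$ $$E^{(p)}_{\epsilon,m+1}(\mathcal{A}_F^{\rm dir})=\inf_{\chi\in BV(\Omega;K)}\ \inf_{u\in\mathcal{A}_F^{\rm dir}}E^{(p)}_{\epsilon,m+1}(u;\chi).$$ **Laminates.** Two distinct matrices $A,B\in\mathbb{R}^{d\times d}_{\rm sym}$ are compatible if $A-B=a\odot b:=\frac12(a\otimes b+b\otimes a)$ for some $a,b\in\mathbb{R}^d\setminus\{0\}$. For $K\subset\mathbb{R}^{d\times d}_{\rm sym}$ set $K^{(0)}=K$ and, for $j\ge1$, $$K^{(j)}=K^{(j-1)}\cup\{\lambda B_1+(1-\lambda)B_2:\ \lambda\in(0,1),\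 B_1,B_2\in K^{(j-1)}\text{ compatible}\}.$$ *)

theory Defs
  imports "HOL-Analysis.Analysis"
begin

section \<open>Matrices and laminates\<close>

definition sym_part :: "real^'n^'n \<Rightarrow> real^'n^'n" where
  "sym_part M = (1/2) *\<^sub>R (M + transpose M)"

definition tensor :: "real^'n \<Rightarrow> real^'n \<Rightarrow> real^'n^'n" where
  "tensor a b = (\<chi> i j. a $ i * b $ j)"

definition sym_tensor :: "real^'n \<Rightarrow> real^'n \<Rightarrow> real^'n^'n" where
  "sym_tensor a b = (1/2) *\<^sub>R (tensor a b + tensor b a)"

definition compatible :: "real^'n^'n \<Rightarrow> real^'n^'n \<Rightarrow> bool" where
  "compatible A B \<longleftrightarrow> A \<noteq> B \<and> (\<exists>a b. a \<noteq> 0 \<and> b \<noteq> 0 \<and> A - B = sym_tensor a b)"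

primrec laminates :: "(real^'n^'n) set \<Rightarrow> nat \<Rightarrow> (real^'n^'n) set" where
  "laminates K 0 = K"
| "laminates K (Suc j) = laminates K j \<union>
     {l *\<^sub>R B1 + (1 - l) *\<^sub>R B2 | l B1 B2.
        0 < l \<and> l < 1 \<and> B1 \<in> laminates K j \<and> B2 \<in> laminates K j \<and> compatible B1 B2}"

definition diag3 :: "real \<Rightarrow> real \<Rightarrow> real \<Rightarrow> real^3^3" where
  "diag3 a b c = vector [vector [a, 0, 0], vector [0, b, 0], vector [0, 0, c]]"


section \<open>Sobolev functions\<close>

text \<open>Continuously differentiable functions with compact support in \<open>S\<close>. The functions are total and
  differentiable on the whole space; for open \<open>S\<close> these are the extensions by zero of the
  usual space.\<close>

definition C1c :: "'a::euclidean_space set \<Rightarrow> ('a \<Rightarrow> 'b::real_normed_vector) set" where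
  "C1c S = {\<phi>.
     (\<exists>\<phi>' :: 'a \<Rightarrow> 'a \<Rightarrow>\<^sub>L 'b. continuous_on UNIV \<phi>' \<and>
        (\<forall>x. (\<phi> has_derivative blinfun_apply (\<phi>' x)) (at x))) \<and>
     (\<exists>T. compact T \<and> T \<subseteq> S \<and> (\<forall>x. x \<notin> T \<longrightarrow> \<phi> x = 0))}"

definition partial_deriv :: "'n::finite \<Rightarrow> (real^'n \<Rightarrow> 'b::real_normed_vector) \<Rightarrow> real^'n \<Rightarrow> 'b" where
  "partial_deriv j \<phi> x = frechet_derivative \<phi> (at x) (axis j 1)"

definition Lp_loc :: "real \<Rightarrow> ('a::euclidean_space \<Rightarrow> 'b::euclidean_space) set" where
  "Lp_loc p = {f. f \<in> borel_measurable lebesgue \<and>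
     (\<forall>T. compact T \<longrightarrow> set_integrable lebesgue T (\<lambda>x. norm (f x) powr p))}"

text \<open>\<open>G x $ i $ j\<close> represents the weak derivative of the \<open>i\<close>-th component in direction \<open>j\<close>.
  Testing with \<open>C\<^sup>1\<close> functions is equivalent to testing with smooth ones.\<close>

definition has_weak_gradient :: "(real^'n \<Rightarrow> real^'n) \<Rightarrow> (real^'n \<Rightarrow> real^'n^'n) \<Rightarrow> bool" where
  "has_weak_gradient u G \<longleftrightarrow> u \<in> Lp_loc 1 \<and> G \<in> Lp_loc 1 \<and>
     (\<forall>\<phi> \<in> C1c UNIV. \<forall>i j.
        (\<integral>x. u x $ i * partial_deriv j \<phi> x \<partial>lebesgue) = - (\<integral>x. G x $ i $ j * \<phi> x \<partial>lebesgue))"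

text \<open>Weak gradients are unique up to null sets, so the choice below is immaterial under
  integrals.\<close>

definition weak_gradient :: "(real^'n \<Rightarrow> real^'n) \<Rightarrow> real^'n \<Rightarrow> real^'n^'n" where
  "weak_gradient u = (SOME G. has_weak_gradient u G)"

definition W1p_loc :: "real \<Rightarrow> (real^'n \<Rightarrow> real^'n) set" where
  "W1p_loc p = {u \<in> Lp_loc p. \<exists>G \<in> Lp_loc p. has_weak_gradient u G}"

text \<open>Functions in \<open>W1p_loc\<close> are representatives of Sobolev classes, hence the boundary
  condition is imposed almost everywhere outside \<open>\<Omega>\<close>.\<close>

definition A_dir ::
  "real \<Rightarrow> (real^'n) set \<Rightarrow> real^'n^'n \<Rightarrow> (real^'n \<Rightarrow> real^'n) set" where
  "A_dir p \<Omega> F = {u \<in> W1p_loc p. \<exists>b. AE x in lebesgue. x \<notin> \<Omega> \<longrightarrow> u x = F *v x + b}"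


section \<open>Functions of bounded variation\<close>

definition divergence :: "(real^'n \<Rightarrow> real^'n) \<Rightarrow> real^'n \<Rightarrow> real" where
  "divergence \<phi> x = (\<Sum>i\<in>UNIV. partial_deriv i \<phi> x $ i)"

definition total_variation :: "(real^'n) set \<Rightarrow> (real^'n \<Rightarrow> real) \<Rightarrow> ennreal" where
  "total_variation \<Omega> f =
     (SUP \<phi> \<in> {\<phi> \<in> C1c \<Omega>. \<forall>x. norm (\<phi> x) \<le> 1}.
        ennreal (set_lebesgue_integral lebesgue \<Omega> (\<lambda>x. f x * divergence \<phi> x)))"

definition BV :: "(real^'n) set \<Rightarrow> (real^'n \<Rightarrow> real) set" where
  "BV \<Omega> = {f. set_integrable lebesgue \<Omega> f \<and> total_variation \<Omega> f < \<infinity>}"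

text \<open>Matrix-valued functions on \<open>\<Omega>\<close> with values in \<open>K\<close>; bounded variation is understood entrywise.
  Values outside \<open>\<Omega>\<close> are irrelevant.\<close>

definition BV_into :: "(real^'n) set \<Rightarrow> (real^'n^'n) set \<Rightarrow> (real^'n \<Rightarrow> real^'n^'n) set" where
  "BV_into \<Omega> K = {c. (\<forall>x\<in>\<Omega>. c x \<in> K) \<and> (\<forall>i j. (\<lambda>x. c x $ i $ j) \<in> BV \<Omega>)}"


section \<open>Singularly perturbed energy\<close>

text \<open>The wells are given as a list \<open>[A\<^sub>0, \<dots>, A\<^sub>m]\<close> of distinct matrices; the phase indicator
  \<open>\<chi>\<^sub>j\<close> of a phase distribution \<open>c\<close> is then the indicator of \<open>{x. c x = A\<^sub>j}\<close>. Matrix norms are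
  Frobenius norms.\<close>

definition phase :: "(real^'n^'n) list \<Rightarrow> (real^'n \<Rightarrow> real^'n^'n) \<Rightarrow> nat \<Rightarrow> real^'n \<Rightarrow> real" where
  "phase As c j = indicator {x. c x = As ! j}"

definition energy ::
  "real \<Rightarrow> real \<Rightarrow> (real^'n) set \<Rightarrow> (real^'n^'n) list \<Rightarrow>
   (real^'n \<Rightarrow> real^'n) \<Rightarrow> (real^'n \<Rightarrow> real^'n^'n) \<Rightarrow> ennreal" where
  "energy p \<epsilon> \<Omega> As u c =
     (\<integral>\<^sup>+x\<in>\<Omega>. ennreal (norm (sym_part (weak_gradient u x) - c x) powr p) \<partial>lebesgue)
     + ennreal \<epsilon> * (\<Sum>j\<in>{1..<length As}. total_variation \<Omega> (phase As c j))"

definition min_energy ::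
  "real \<Rightarrow> real \<Rightarrow> (real^'n) set \<Rightarrow> (real^'n^'n) list \<Rightarrow> real^'n^'n \<Rightarrow> ennreal" where
  "min_energy p \<epsilon> \<Omega> As F =
     (INF c \<in> BV_into \<Omega> (set As). INF u \<in> A_dir p \<Omega> F. energy p \<epsilon> \<Omega> As u c)"


section \<open>The three-well example\<close>

definition \<Phi> :: "real^2 \<Rightarrow> real^2" where
  "\<Phi> z = (sqrt 2 / 2) *\<^sub>R vector [z $ 1 + z $ 2, z $ 2 - z $ 1]"

definition \<Omega>2 :: "(real^3) set" where
  "\<Omega>2 = {x. 0 < x $ 1 \<and> x $ 1 < 1 \<and>
     vector [x $ 2, x $ 3] \<in> \<Phi> -` {z. \<forall>i. 0 < z $ i \<and> z $ i < 1}}"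

definition wells2 :: "(real^3^3) list" where
  "wells2 = [diag3 0 0 0, diag3 1 0 0, diag3 (1/2) 1 (-1)]"

definition F2 :: "real^3^3" where
  "F2 = diag3 (1/2) (1/2) (-1/2)"

end

theory Submission
  imports Defs
begin

text \<open>In coordinates rotated by \<open>\<Phi>\<close> the domain is a cube, and after subtracting \<open>F2\<close> the three wells become
  multiples of \<open>e\<^sub>x \<otimes> e\<^sub>x\<close> and of the symmetrised \<open>e\<^sub>s \<odot> e\<^sub>t\<close>. The inner laminate, between the first two wells,
  branches towards the faces of a brick. It is generated by a scalar potential \<open>W\<close> through the displacement
  \<open>(\<partial>\<^sub>x W, - \<partial>\<^sub>s W, 0)\<close>, for which the shear component in the \<open>x\<close>, \<open>s\<close> plane vanishes identically. The outer laminate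
  mixes it with the third well in a second branching construction whose cells are such bricks, and the
  thin regions left over at the boundary are filled recursively by smaller dyadic copies. Balancing the length scales of the two
  laminates gives the exponent \<open>2 p / (2 p + 3)\<close>. Surfaces are measured through the
  measure of the symmetric difference of a set with its translates, which bounds the total variation
  and adds up under scaling and under countable patching.\<close>

text \<open>The potential makes the shear error quadratic: a slab of thickness \<open>d\<close>,
  length \<open>L\<close> in \<open>s\<close> and width \<open>c\<close> in \<open>t\<close> has
  relative error of order \<open>(d / L)^2 + d / c\<close>, where the linear term involves only the
  long side. This square produces the inner exponent \<open>2 p / (2 p + 1)\<close>. The main
  obstacle is that displacements must vanish on curved boundaries. Curved regions are therefore
  exhausted by dyadic bricks, although smaller bricks cost more per volume. For
  \<open>p \<le> 3\<close> the cost density of a brick shrunk by \<open>2^k\<close> grows at most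
  like \<open>2^(6 k / 7)\<close>, while the total volume of the bricks of generation
  \<open>k\<close> decays like \<open>2^(-k)\<close>, so the costs form a convergent geometric
  series. The same range of \<open>p\<close> makes the elastic costs of the generations of one
  branching slab summable. No limit of displacements is formed: each construction stops at finite
  depth, the rest is filled with the zero displacement, and only numerical bounds pass to the
  limit.\<close>

section \<open>Energy bounds for displacements supported in a set\<close>

type_synonym r3 = "real \<times> real \<times> real"

text \<open>The entrywise l1 distance between \<open>D + D^T\<close> over 2, in coordinates
  \<open>(x, s, t)\<close>, and the symmetric matrix whose \<open>xx\<close> entry is
  \<open>fst T\<close>, whose \<open>st\<close> entry is \<open>snd T\<close>, and whose other
  independent entries are zero. Each off-diagonal pair enters with both entries, hence the factor 2
  in front of \<open>snd T\<close>.\<close>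

definition err :: "(r3 \<Rightarrow> r3) \<Rightarrow> real \<times> real \<Rightarrow> real" where
  "err D T = \<bar>fst (D (1,0,0)) - fst T\<bar> + \<bar>fst (snd (D (0,0,1))) + snd (snd (D (0,1,0))) - 2 * snd T\<bar>
    + \<bar>fst (snd (D (0,1,0)))\<bar> + \<bar>snd (snd (D (0,0,1)))\<bar>
    + \<bar>fst (D (0,1,0)) + fst (snd (D (1,0,0)))\<bar> + \<bar>fst (D (0,0,1)) + snd (snd (D (1,0,0)))\<bar>"

text \<open>A perimeter bound in integrated form: sets of finite perimeter satisfy such an estimate,
  and conversely difference quotients of the indicator turn it into a bound on distributional
  derivatives. It involves no derivative and is stable under unions and isometries.\<close>

definition pbound :: "'a::euclidean_space set \<Rightarrow> real \<Rightarrow> bool" where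
  "pbound E P \<longleftrightarrow> E \<in> sets borel \<and> 0 \<le> P \<and>
     (\<forall>y. emeasure lborel (sym_diff E ((+) y ` E)) \<le> ennreal (P * norm y))"

definition target :: "(nat \<Rightarrow> real \<times> real) \<Rightarrow> r3 set \<Rightarrow> r3 set \<Rightarrow> r3 \<Rightarrow> real \<times> real" where
  "target T E1 E2 z = (if z \<in> E1 then T 1 else if z \<in> E2 then T 2 else T 0)"

text \<open>\<open>v\<close> is the deviation from the affine datum; as it vanishes off
  \<open>R\<close>, constructions on disjoint sets can be added. The part of \<open>R\<close>
  outside \<open>E1\<close> and \<open>E2\<close> carries phase 0. The function \<open>g\<close> is
  a measurable majorant of the elastic density, so that measurability of the derivative never has to
  be discussed. The clause \<open>D = 0\<close> off \<open>R\<close> also speaks about boundary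
  points: almost everywhere there, a neighbouring piece may be added without changing its
  error.\<close>

definition adm0 :: "real \<Rightarrow> real \<Rightarrow> (nat \<Rightarrow> real \<times> real) \<Rightarrow> r3 set \<Rightarrow> real \<Rightarrow> bool" where
  "adm0 p \<epsilon> T R e \<longleftrightarrow> R \<in> sets borel \<and> (\<exists>v E1 E2 g P1 P2 I.
     (\<exists>K. K-lipschitz_on UNIV v) \<and> (\<forall>z. z \<notin> R \<longrightarrow> v z = 0) \<and>
     E1 \<subseteq> R \<and> E2 \<subseteq> R \<and> E1 \<inter> E2 = {} \<and> pbound E1 P1 \<and> pbound E2 P2 \<and>
     g \<in> borel_measurable borel \<and>
     (AE z in lborel. \<exists>D. (v has_derivative D) (at z) \<and> (z \<notin> R \<longrightarrow> D = (\<lambda>_. 0)) \<and>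
        (z \<in> R \<longrightarrow> err D (target T E1 E2 z) powr p \<le> g z)) \<and>
     (\<integral>\<^sup>+z\<in>R. ennreal (g z) \<partial>lborel) \<le> ennreal I \<and> 0 \<le> I \<and> I + \<epsilon> * (P1 + P2) \<le> e)"

text \<open>Says that the infimum of the attainable costs is at most \<open>e\<close>. Unlike
  \<open>adm0\<close>, this is closed under limits in \<open>e\<close>.\<close>

definition adm :: "real \<Rightarrow> real \<Rightarrow> (nat \<Rightarrow> real \<times> real) \<Rightarrow> r3 set \<Rightarrow> real \<Rightarrow> bool" where
  "adm p \<epsilon> T R e \<longleftrightarrow> (\<forall>\<eta>>0. adm0 p \<epsilon> T R (e + \<eta>))"

lemma adm0I:
  assumes "R \<in> sets borel" "K-lipschitz_on UNIV v" "\<And>z. z \<notin> R \<Longrightarrow> v z = 0"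
    "E1 \<subseteq> R" "E2 \<subseteq> R" "E1 \<inter> E2 = {}" "pbound E1 P1" "pbound E2 P2" "g \<in> borel_measurable borel"
    "AE z in lborel. \<exists>D. (v has_derivative D) (at z) \<and> (z \<notin> R \<longrightarrow> D = (\<lambda>_. 0)) \<and>
        (z \<in> R \<longrightarrow> err D (target T E1 E2 z) powr p \<le> g z)"
    "(\<integral>\<^sup>+z\<in>R. ennreal (g z) \<partial>lborel) \<le> ennreal I" "0 \<le> I" "I + \<epsilon> * (P1 + P2) \<le> e"
  shows "adm0 p \<epsilon> T R e"
  unfolding adm0_def using assms by blast

lemma adm0_mono: "adm0 p \<epsilon> T R e \<Longrightarrow> e \<le> e' \<Longrightarrow> adm0 p \<epsilon> T R e'"
  unfolding adm0_def by (meson order_trans)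

lemma adm0_imp_adm: "adm0 p \<epsilon> T R e \<Longrightarrow> adm p \<epsilon> T R e"
  unfolding adm_def by (auto elim: adm0_mono)

lemma adm_mono: "adm p \<epsilon> T R e \<Longrightarrow> e \<le> e' \<Longrightarrow> adm p \<epsilon> T R e'"
  unfolding adm_def by (meson adm0_mono add_right_mono)

text \<open>Lets a recursion truncated at arbitrary finite depth yield the bound from which the
  truncation error has disappeared.\<close>

lemma adm_closure:
  assumes "\<And>\<eta>. \<eta> > 0 \<Longrightarrow> adm p \<epsilon> T R (e + \<eta>)"
  shows "adm p \<epsilon> T R e"
  unfolding adm_def
proof (intro allI impI)
  fix \<eta> :: real assume "\<eta> > 0"
  then have "adm0 p \<epsilon> T R (e + \<eta>/2 + \<eta>/2)"
    using assms[of "\<eta>/2"] unfolding adm_def by (metis half_gt_zero)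
  then show "adm0 p \<epsilon> T R (e + \<eta>)" by (simp add: add.assoc)
qed

lemma adm_sets: "adm p \<epsilon> T R e \<Longrightarrow> R \<in> sets borel"
  unfolding adm_def adm0_def using zero_less_one by blast

section \<open>Translation, disjoint union and trivial filling\<close>

lemma pbound_empty: "pbound {} 0"
  by (simp add: pbound_def)

lemma in_translate: "z \<in> (+) a ` S \<longleftrightarrow> z - a \<in> S" for z :: "'a::ab_group_add"
  by (auto simp: image_iff intro!: bexI[of _ "z - a"])

lemma borel_translate:
  fixes E :: "'a::euclidean_space set"
  assumes "E \<in> sets borel" shows "(+) y ` E \<in> sets borel"
proof -
  have "(+) y ` E = (\<lambda>x. x - y) -` E \<inter> space borel" using in_translate by auto
  also have "\<dots> \<in> sets borel" using assms by measurable
  finally show ?thesis .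
qed

lemma emeasure_translate:
  fixes E :: "'a::euclidean_space set"
  assumes "E \<in> sets borel" shows "emeasure lborel ((+) y ` E) = emeasure lborel E"
proof -
  have "(+) y ` E = (\<lambda>x. -y + x) -` E \<inter> space lborel" using in_translate by auto
  moreover have "emeasure (distr lborel borel ((+) (-y))) E = emeasure lborel ((+) (-y) -` E \<inter> space lborel)"
    by (rule emeasure_distr) (use assms in auto)
  ultimately show ?thesis by (simp only: lborel_distr_plus)
qed

lemma pbound_union:
  assumes "pbound A P" "pbound B Q"
  shows "pbound (A \<union> B) (P + Q)"
  unfolding pbound_def
proof (intro conjI allI)
  show "A \<union> B \<in> sets borel" "0 \<le> P + Q" using assms by (auto simp: pbound_def)
  fix y
  have m: "sym_diff A ((+) y ` A) \<in> sets lborel" "sym_diff B ((+) y ` B) \<in> sets lborel"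
    using assms borel_translate by (auto simp: pbound_def)
  have "emeasure lborel (sym_diff (A \<union> B) ((+) y ` (A \<union> B)))
      \<le> emeasure lborel (sym_diff A ((+) y ` A) \<union> sym_diff B ((+) y ` B))"
    using m by (intro emeasure_mono) auto
  also have "\<dots> \<le> emeasure lborel (sym_diff A ((+) y ` A)) + emeasure lborel (sym_diff B ((+) y ` B))"
    by (rule emeasure_subadditive[OF m])
  also have "\<dots> \<le> ennreal (P * norm y) + ennreal (Q * norm y)"
    using assms by (intro add_mono) (auto simp: pbound_def)
  also have "\<dots> = ennreal ((P + Q) * norm y)"
    using assms by (simp add: pbound_def algebra_simps flip: ennreal_plus)
  finally show "emeasure lborel (sym_diff (A \<union> B) ((+) y ` (A \<union> B))) \<le> ennreal ((P + Q) * norm y)" .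
qed

lemma pbound_translate:
  fixes E :: "'a::euclidean_space set"
  assumes "pbound E P" shows "pbound ((+) a ` E) P"
  unfolding pbound_def
proof (intro conjI allI)
  have E: "E \<in> sets borel" using assms by (simp add: pbound_def)
  then show "(+) a ` E \<in> sets borel" by (rule borel_translate)
  show "0 \<le> P" using assms by (simp add: pbound_def)
  fix y
  have "sym_diff ((+) a ` E) ((+) y ` (+) a ` E) = (+) a ` sym_diff E ((+) y ` E)"
  proof -
    have "(+) y ` (+) a ` E = (+) a ` (+) y ` E" by (simp add: image_image ac_simps)
    then show ?thesis by (simp add: image_Un image_set_diff)
  qed
  moreover have "sym_diff E ((+) y ` E) \<in> sets borel"
    using E borel_translate by auto
  ultimately show "emeasure lborel (sym_diff ((+) a ` E) ((+) y ` (+) a ` E)) \<le> ennreal (P * norm y)"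
    using assms by (simp add: emeasure_translate pbound_def)
qed

lemma AE_translate:
  fixes a :: "'a::euclidean_space"
  assumes "AE z in lborel. Q z"
  shows "AE z in lborel. Q (z - a)"
proof -
  have "AE z in distr lborel borel ((+) (-a)). Q z" using assms by (subst lborel_distr_plus)
  then have "AE z in lborel. Q (-a + z)"
    by (intro AE_distrD[of "(+) (-a)" lborel borel Q]) auto
  then show ?thesis by simp
qed

lemma adm0_translate:
  assumes "adm0 p \<epsilon> T R e"
  shows "adm0 p \<epsilon> T ((+) a ` R) e"
proof -
  from assms obtain v E1 E2 g P1 P2 I K where *:
    "R \<in> sets borel" "K-lipschitz_on UNIV v" "\<And>z. z \<notin> R \<Longrightarrow> v z = 0"
    "E1 \<subseteq> R" "E2 \<subseteq> R" "E1 \<inter> E2 = {}" "pbound E1 P1" "pbound E2 P2" "g \<in> borel_measurable borel"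
    "AE z in lborel. \<exists>D. (v has_derivative D) (at z) \<and> (z \<notin> R \<longrightarrow> D = (\<lambda>_. 0)) \<and>
        (z \<in> R \<longrightarrow> err D (target T E1 E2 z) powr p \<le> g z)"
    "(\<integral>\<^sup>+z\<in>R. ennreal (g z) \<partial>lborel) \<le> ennreal I" "0 \<le> I" "I + \<epsilon> * (P1 + P2) \<le> e"
    unfolding adm0_def by blast
  note im = in_translate
  show ?thesis
  proof (rule adm0I[where v="\<lambda>z. v (z - a)" and K=K and ?E1.0="(+) a ` E1" and ?E2.0="(+) a ` E2"
        and g="\<lambda>z. g (z - a)"])
    show "(+) a ` R \<in> sets borel" using * by (intro borel_translate)
    show "K-lipschitz_on UNIV (\<lambda>z. v (z - a))"

    proof (rule lipschitz_onI)
      show "dist (v (z - a)) (v (w - a)) \<le> K * dist z w" for z w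
        using lipschitz_onD[OF *(2), of "z-a" "w-a"] by (simp add: dist_norm)
      show "0 \<le> K" using lipschitz_on_nonneg[OF *(2)] .
    qed
    show "v (z - a) = 0" if "z \<notin> (+) a ` R" for z using that *(3)[of "z - a"] unfolding im by blast
    show "(+) a ` E1 \<subseteq> (+) a ` R" "(+) a ` E2 \<subseteq> (+) a ` R" using * by auto
    show "(+) a ` E1 \<inter> (+) a ` E2 = {}" using *(6) by auto
    show "pbound ((+) a ` E1) P1" "pbound ((+) a ` E2) P2" using * pbound_translate by auto
    show "(\<lambda>z. g (z - a)) \<in> borel_measurable borel" using *(9) by measurable
    show "AE z in lborel. \<exists>D. ((\<lambda>z. v (z - a)) has_derivative D) (at z) \<and> (z \<notin> (+) a ` R \<longrightarrow> D = (\<lambda>_. 0)) \<and>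
        (z \<in> (+) a ` R \<longrightarrow> err D (target T ((+) a ` E1) ((+) a ` E2) z) powr p \<le> g (z - a))"
      using AE_translate[OF *(10), of a]
    proof eventually_elim
      case (elim z)
      then obtain D where D: "(v has_derivative D) (at (z - a))" "(z - a \<notin> R \<longrightarrow> D = (\<lambda>_. 0))"
        "(z - a \<in> R \<longrightarrow> err D (target T E1 E2 (z - a)) powr p \<le> g (z - a))" by blast
      have "((\<lambda>z. v (z - a)) has_derivative D) (at z)"
        by (rule has_derivative_compose[of "\<lambda>z. z - a" "\<lambda>h. h" z UNIV v D])
          (auto intro!: derivative_eq_intros D(1))
      moreover have "target T ((+) a ` E1) ((+) a ` E2) z = target T E1 E2 (z - a)"
        unfolding target_def im ..
      ultimately show ?case using D unfolding im by auto
    qed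
    have "(\<integral>\<^sup>+z\<in>(+) a ` R. ennreal (g (z - a)) \<partial>lborel)
        = (\<integral>\<^sup>+z. (\<lambda>z. ennreal (g z) * indicator R z) (- a + z) \<partial>lborel)"
      by (intro nn_integral_cong) (auto simp: im indicator_def)
    also have "\<dots> = (\<integral>\<^sup>+z. ennreal (g z) * indicator R z \<partial>distr lborel borel ((+) (- a)))"
      using * by (subst nn_integral_distr) auto
    also have "\<dots> \<le> ennreal I" using * by (simp add: lborel_distr_plus)
    finally show "(\<integral>\<^sup>+z\<in>(+) a ` R. ennreal (g (z - a)) \<partial>lborel) \<le> ennreal I" .
  qed (use * in auto)
qed

lemma adm_translate: "adm p \<epsilon> T R e \<Longrightarrow> adm p \<epsilon> T ((+) a ` R) e"
  unfolding adm_def using adm0_translate by blast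

text \<open>At almost every point of \<open>R\<close> the other displacement has derivative zero, so
  the sum keeps the derivative and the target of the piece living there. Bulk integrals and surface
  bounds then add; \<open>pbound\<close> needs no disjointness for this.\<close>

lemma adm0_union:
  assumes "adm0 p \<epsilon> T R e" "adm0 p \<epsilon> T R' e'" "R \<inter> R' = {}"
  shows "adm0 p \<epsilon> T (R \<union> R') (e + e')"
proof -
  from assms(1) obtain v E1 E2 g P1 P2 I K where *:
    "R \<in> sets borel" "K-lipschitz_on UNIV v" "\<And>z. z \<notin> R \<Longrightarrow> v z = 0"
    "E1 \<subseteq> R" "E2 \<subseteq> R" "E1 \<inter> E2 = {}" "pbound E1 P1" "pbound E2 P2" "g \<in> borel_measurable borel"
    "AE z in lborel. \<exists>D. (v has_derivative D) (at z) \<and> (z \<notin> R \<longrightarrow> D = (\<lambda>_. 0)) \<and>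
        (z \<in> R \<longrightarrow> err D (target T E1 E2 z) powr p \<le> g z)"
    "(\<integral>\<^sup>+z\<in>R. ennreal (g z) \<partial>lborel) \<le> ennreal I" "0 \<le> I" "I + \<epsilon> * (P1 + P2) \<le> e"
    unfolding adm0_def by blast
  from assms(2) obtain v' E1' E2' g' P1' P2' I' K' where **:
    "R' \<in> sets borel" "K'-lipschitz_on UNIV v'" "\<And>z. z \<notin> R' \<Longrightarrow> v' z = 0"
    "E1' \<subseteq> R'" "E2' \<subseteq> R'" "E1' \<inter> E2' = {}" "pbound E1' P1'" "pbound E2' P2'" "g' \<in> borel_measurable borel"
    "AE z in lborel. \<exists>D. (v' has_derivative D) (at z) \<and> (z \<notin> R' \<longrightarrow> D = (\<lambda>_. 0)) \<and>
        (z \<in> R' \<longrightarrow> err D (target T E1' E2' z) powr p \<le> g' z)"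
    "(\<integral>\<^sup>+z\<in>R'. ennreal (g' z) \<partial>lborel) \<le> ennreal I'" "0 \<le> I'" "I' + \<epsilon> * (P1' + P2') \<le> e'"
    unfolding adm0_def by blast
  let ?g = "\<lambda>z. if z \<in> R then g z else g' z"
  show ?thesis
  proof (rule adm0I[where v="\<lambda>z. v z + v' z" and K="K + K'" and ?E1.0="E1 \<union> E1'" and ?E2.0="E2 \<union> E2'"
        and g="?g" and I="I + I'" and ?P1.0="P1 + P1'" and ?P2.0="P2+P2'"])
    show "AE z in lborel. \<exists>D. ((\<lambda>z. v z + v' z) has_derivative D) (at z) \<and> (z \<notin> R \<union> R' \<longrightarrow> D = (\<lambda>_. 0)) \<and>
        (z \<in> R \<union> R' \<longrightarrow> err D (target T (E1 \<union> E1') (E2 \<union> E2') z) powr p \<le> ?g z)"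
      using *(10) **(10)
    proof eventually_elim
      case (elim z)
      then obtain D D' where D: "(v has_derivative D) (at z)" "(z \<notin> R \<longrightarrow> D = (\<lambda>_. 0))"
        "(z \<in> R \<longrightarrow> err D (target T E1 E2 z) powr p \<le> g z)"
        and D': "(v' has_derivative D') (at z)" "(z \<notin> R' \<longrightarrow> D' = (\<lambda>_. 0))"
        "(z \<in> R' \<longrightarrow> err D' (target T E1' E2' z) powr p \<le> g' z)" by blast
      have d: "((\<lambda>z. v z + v' z) has_derivative (\<lambda>h. D h + D' h)) (at z)"
        using D(1) D'(1) by (rule has_derivative_add)
      have t1: "target T (E1 \<union> E1') (E2 \<union> E2') z = target T E1 E2 z" if "z \<in> R"
        using that *(4,5) **(4,5) assms(3) unfolding target_def by auto
      have t2: "target T (E1 \<union> E1') (E2 \<union> E2') z = target T E1' E2' z" if "z \<in> R'"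
        using that *(4,5) **(4,5) assms(3) unfolding target_def by auto
      show ?case
        using d D D' t1 t2 assms(3) by (intro exI[of _ "\<lambda>h. D h + D' h"]) auto
    qed
    have "(\<integral>\<^sup>+z\<in>R \<union> R'. ennreal (?g z) \<partial>lborel)
       = (\<integral>\<^sup>+z. ennreal (g z) * indicator R z + ennreal (g' z) * indicator R' z \<partial>lborel)"
      using assms(3) by (intro nn_integral_cong) (auto simp: indicator_def)
    also have "\<dots> = (\<integral>\<^sup>+z\<in>R. ennreal (g z) \<partial>lborel) + (\<integral>\<^sup>+z\<in>R'. ennreal (g' z) \<partial>lborel)"
      using * ** by (intro nn_integral_add) auto
    also have "\<dots> \<le> ennreal I + ennreal I'" using * ** by (intro add_mono) auto
    also have "\<dots> = ennreal (I + I')" using * ** by simp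
    finally show "(\<integral>\<^sup>+z\<in>R \<union> R'. ennreal (?g z) \<partial>lborel) \<le> ennreal (I + I')" .
    show "I + I' + \<epsilon> * (P1 + P1' + (P2 + P2')) \<le> e + e'"
      using *(13) **(13) by (simp add: algebra_simps)
    show "?g \<in> borel_measurable borel" using * ** by measurable
    show "(K + K')-lipschitz_on UNIV (\<lambda>z. v z + v' z)" using *(2) **(2) by (rule lipschitz_on_add)
    show "(E1 \<union> E1') \<inter> (E2 \<union> E2') = {}" using *(4-6) **(4-6) assms(3) by blast
  qed (use * ** in \<open>auto intro: pbound_union\<close>)
qed

lemma adm_union:
  assumes "adm p \<epsilon> T R e" "adm p \<epsilon> T R' e'" "R \<inter> R' = {}"
  shows "adm p \<epsilon> T (R \<union> R') (e + e')"
  unfolding adm_def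
proof (intro allI impI)
  fix \<eta> :: real assume "\<eta> > 0"
  then have "adm0 p \<epsilon> T R (e + \<eta>/2)" "adm0 p \<epsilon> T R' (e' + \<eta>/2)"
    using assms(1,2) unfolding adm_def by (metis half_gt_zero)+
  from adm0_union[OF this assms(3)] show "adm0 p \<epsilon> T (R \<union> R') (e + e' + \<eta>)"
    by (simp add: algebra_simps)
qed

lemma adm0_empty: "adm0 p \<epsilon> T {} 0"
  by (rule adm0I[where v="\<lambda>_. 0" and g="\<lambda>_. 0" and ?E1.0="{}" and ?E2.0="{}" and I=0 and ?P1.0=0 and ?P2.0=0 and K=0])
    (auto simp: pbound_empty lipschitz_on_constant intro!: AE_I2 exI[of _ "\<lambda>_. 0"])

lemma adm_UN:
  assumes "finite I" "\<And>i. i \<in> I \<Longrightarrow> adm p \<epsilon> T (R i) (e i)" "disjoint_family_on R I"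
  shows "adm p \<epsilon> T (\<Union>i\<in>I. R i) (\<Sum>i\<in>I. e i)"
  using assms
proof (induction I rule: finite_induct)
  case empty
  then show ?case by (simp add: adm0_empty adm0_imp_adm)
next
  case (insert i I)
  have "adm p \<epsilon> T (R i \<union> (\<Union>i\<in>I. R i)) (e i + (\<Sum>i\<in>I. e i))"
    using insert by (intro adm_union) (auto simp: disjoint_family_on_def)
  then show ?case using insert by simp
qed

definition tame :: "(nat \<Rightarrow> real \<times> real) \<Rightarrow> bool" where
  "tame T \<longleftrightarrow> \<bar>fst (T 0)\<bar> + 2 * \<bar>snd (T 0)\<bar> \<le> 3/2"

text \<open>The zero displacement with phase 0 everywhere: tameness bounds its error by 3/2, and
  \<open>(3/2)^3 = 27/8\<close> is below 4. There is no interface, hence no term in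
  \<open>\<epsilon>\<close>.\<close>

lemma adm_trivial:
  assumes "tame T" "0 \<le> p" "p \<le> 3" "R \<in> sets borel" "emeasure lborel R \<le> ennreal m" "0 \<le> m"
  shows "adm p \<epsilon> T R (4 * m)"
proof (rule adm0_imp_adm, rule adm0I[where v="\<lambda>_. 0" and g="\<lambda>_. 4" and ?E1.0="{}" and ?E2.0="{}" and I="4*m" and ?P1.0=0 and ?P2.0=0 and K=0])
  have "err (\<lambda>_. 0) (T 0) \<le> 3/2" using assms(1) by (simp add: err_def tame_def)
  moreover have "0 \<le> err (\<lambda>_. 0) (T 0)" by (simp add: err_def)
  ultimately have "err (\<lambda>_. 0) (T 0) powr p \<le> (3/2) powr p"
    using assms by (intro powr_mono2) auto
  also have "\<dots> \<le> (3/2) powr 3" using assms by (intro powr_mono) auto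
  also have "\<dots> = (3/2)^3" by (subst powr_numeral) auto
  also have "\<dots> \<le> (4::real)" by (simp add: power3_eq_cube)
  finally show "AE z in lborel. \<exists>D. ((\<lambda>_. 0) has_derivative D) (at z) \<and> (z \<notin> R \<longrightarrow> D = (\<lambda>_. 0)) \<and>
        (z \<in> R \<longrightarrow> err D (target T {} {} z) powr p \<le> 4)"
    by (intro AE_I2 exI[of _ "\<lambda>_. 0"]) (auto simp: target_def)
  have "(\<integral>\<^sup>+z\<in>R. ennreal 4 \<partial>lborel) = 4 * emeasure lborel R"
    using assms by (simp add: nn_integral_cmult_indicator)
  also have "\<dots> \<le> 4 * ennreal m" using assms by (intro mult_left_mono) auto
  also have "\<dots> = ennreal (4 * m)" by (simp add: ennreal_mult')
  finally show "(\<integral>\<^sup>+z\<in>R. ennreal 4 \<partial>lborel) \<le> ennreal (4*m)" .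
qed (use assms in \<open>auto simp: pbound_empty lipschitz_on_constant\<close>)

lemma adm_superset:
  assumes "adm p \<epsilon> T R e" "R \<subseteq> S" "S \<in> sets borel" "tame T" "0 \<le> p" "p \<le> 3"
    "emeasure lborel (S - R) \<le> ennreal m" "0 \<le> m"
  shows "adm p \<epsilon> T S (e + 4 * m)"
proof -
  have "adm p \<epsilon> T (R \<union> (S - R)) (e + 4 * m)"
    using assms adm_sets[OF assms(1)] by (intro adm_union adm_trivial) auto
  then show ?thesis using assms(2) by (simp add: Un_absorb1)
qed

section \<open>Surface bounds for regions between graphs\<close>

lemma slice_emeasure:
  fixes A :: "(real \<times> 'b::euclidean_space) set"
  assumes "A \<in> sets borel"
  shows "emeasure lborel A = (\<integral>\<^sup>+z. emeasure lborel ((\<lambda>x. (x, z)) -` A) \<partial>lborel)"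
proof -
  have "A \<in> sets (lborel \<Otimes>\<^sub>M (lborel :: 'b measure))" using assms by (subst lborel_prod) simp
  from lborel_pair.emeasure_pair_measure_alt2[OF this] show ?thesis by (simp add: lborel_prod)
qed

text \<open>Each line in the first direction meets the graph once, so Fubini gives measure zero. It
  serves to discard the interfaces, where piecewise displacements may fail to be
  differentiable.\<close>

lemma AE_off_graph:
  fixes b :: "'b::euclidean_space \<Rightarrow> real"
  assumes "continuous_on UNIV b"
  shows "AE p in lborel. fst p \<noteq> b (snd p)"
proof -
  let ?A = "{p. fst p = b (snd p)}"
  have "closed ?A"
    by (intro closed_Collect_eq continuous_intros continuous_on_compose2[OF assms]) auto
  then have m: "?A \<in> sets borel" by simp
  have "emeasure lborel ?A = (\<integral>\<^sup>+z. emeasure lborel ((\<lambda>x. (x, z)) -` ?A) \<partial>lborel)"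
    by (rule slice_emeasure[OF m])
  also have "\<dots> = (\<integral>\<^sup>+z. 0 \<partial>(lborel :: 'b measure))"
  proof (intro nn_integral_cong)
    fix z have "(\<lambda>x. (x, z)) -` ?A = {b z}" by auto
    then show "emeasure lborel ((\<lambda>x. (x, z)) -` ?A) = 0" by simp
  qed
  finally have "emeasure lborel ?A = 0" by simp
  then have "?A \<in> null_sets lborel" using m by (auto simp: null_sets_def)
  then show ?thesis by (rule AE_not_in[THEN eventually_mono]) auto
qed

text \<open>Translating by \<open>y = (y1, y2)\<close> moves a graph vertically by at most
  \<open>\<bar>y1\<bar> + K * norm y2\<close>. A point whose membership changes is therefore within
  \<open>\<eta> = (K + 1) * norm y\<close> of one of the two graphs, and it lies over
  \<open>Q\<close> or over the translate of \<open>Q\<close>. The two strips have total height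
  \<open>4 * \<eta>\<close> over a base of measure at most \<open>2 * m\<close>, whence the factor
  8.\<close>

lemma pbound_graph:
  fixes b b' :: "'b::euclidean_space \<Rightarrow> real"
  assumes b: "K-lipschitz_on UNIV b" "K-lipschitz_on UNIV b'"
    and Q: "Q \<in> sets borel" "emeasure lborel Q \<le> ennreal m" "0 \<le> m"
    and off: "\<And>z. z \<notin> Q \<Longrightarrow> b' z \<le> b z"
  shows "pbound {(x, z). b z \<le> x \<and> x < b' z} (8 * (K + 1) * m)" (is "pbound ?E _")
  unfolding pbound_def
proof (intro conjI allI)
  have c: "continuous_on UNIV b" "continuous_on UNIV b'"
    using b lipschitz_on_continuous_on by blast+
  have mm: "b \<in> borel_measurable borel" "b' \<in> borel_measurable borel"
    using c borel_measurable_continuous_onI by auto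
  have K: "0 \<le> K" using b lipschitz_on_nonneg by auto
  show "0 \<le> 8 * (K + 1) * m" using K Q by simp
  have "?E = {p. b (snd p) \<le> fst p} \<inter> {p. fst p < b' (snd p)}" by auto
  moreover have "closed {p. b (snd p) \<le> fst p}"
    by (intro closed_Collect_le continuous_intros continuous_on_compose2[OF c(1)]) auto
  moreover have "open {p. fst p < b' (snd p)}"
    by (intro open_Collect_less continuous_intros continuous_on_compose2[OF c(2)]) auto
  ultimately show "?E \<in> sets borel" by auto
  fix y :: "real \<times> 'b"
  obtain y1 y2 where y: "y = (y1, y2)" by (cases y)
  define \<eta> where "\<eta> = (K + 1) * norm y"
  have y12: "\<bar>y1\<bar> \<le> norm y" "norm y2 \<le> norm y"
    unfolding y using norm_fst_le[of y1 y2] norm_snd_le[of y2 y1] by auto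
  have eta0: "0 \<le> \<eta>" using K by (simp add: \<eta>_def)
  have shift: "\<bar>f z - (f (z - y2) + y1)\<bar> \<le> \<eta>" if f: "K-lipschitz_on UNIV f" for f z
  proof -
    have "\<bar>f z - f (z - y2)\<bar> \<le> K * norm y2"
      using lipschitz_onD[OF f, of z "z - y2"] by (simp add: dist_norm)
    also have "\<dots> \<le> K * norm y" using y12 K by (intro mult_left_mono) auto
    finally show ?thesis using y12 unfolding \<eta>_def by (simp add: algebra_simps)
  qed
  let ?Q = "Q \<union> (+) y2 ` Q"
  have Qm: "?Q \<in> sets borel" using Q borel_translate by auto
  have "emeasure lborel ?Q \<le> emeasure lborel Q + emeasure lborel ((+) y2 ` Q)"
    using Q borel_translate by (intro emeasure_subadditive) auto
  also have "\<dots> \<le> ennreal m + ennreal m" using Q by (intro add_mono) (auto simp: emeasure_translate)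
  finally have Qe: "emeasure lborel ?Q \<le> ennreal (2 * m)" using Q by (simp flip: ennreal_plus)
  let ?S = "{p. \<bar>fst p - b (snd p)\<bar> \<le> \<eta>} \<union> {p. \<bar>fst p - b' (snd p)\<bar> \<le> \<eta>}"
  let ?A = "snd -` ?Q \<inter> ?S"
  have Sm: "closed ?S"
    by (intro closed_Un closed_Collect_le continuous_intros continuous_on_compose2[OF c(2)] continuous_on_compose2[OF c(1)]) auto
  have "(snd :: real \<times> 'b \<Rightarrow> 'b) \<in> borel_measurable borel" by (intro borel_measurable_continuous_onI continuous_intros)
  from measurable_sets[OF this Qm] have "snd -` ?Q \<in> sets (borel :: (real \<times> 'b) measure)" by simp
  then have Am: "?A \<in> sets borel" using Sm by auto
  have sub: "sym_diff ?E ((+) y ` ?E) \<subseteq> ?A"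
  proof
    fix p assume p: "p \<in> sym_diff ?E ((+) y ` ?E)"
    obtain x z where xz: "p = (x, z)" by (cases p)
    have *: "p \<in> (+) y ` ?E \<longleftrightarrow> b (z - y2) \<le> x - y1 \<and> x - y1 < b' (z - y2)"
      unfolding in_translate xz y by simp
    have **: "p \<in> ?E \<longleftrightarrow> b z \<le> x \<and> x < b' z" by (simp add: xz)
    have s: "\<bar>b z - (b (z - y2) + y1)\<bar> \<le> \<eta>" "\<bar>b' z - (b' (z - y2) + y1)\<bar> \<le> \<eta>"
      using shift b by auto
    have "\<bar>x - b z\<bar> \<le> \<eta> \<or> \<bar>x - b' z\<bar> \<le> \<eta>"
      using p * ** s by auto
    moreover have "z \<in> ?Q"
    proof (cases "p \<in> ?E")
      case True then have "z \<in> Q" using ** off[of z] by force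
      then show ?thesis by simp
    next
      case False then have "z - y2 \<in> Q" using p * off[of "z - y2"] by force
      then show ?thesis by (metis UnI2 in_translate)
    qed
    ultimately show "p \<in> ?A" by (simp add: xz)
  qed
  have "emeasure lborel (sym_diff ?E ((+) y ` ?E)) \<le> emeasure lborel ?A"
    using Am by (intro emeasure_mono[OF sub]) auto
  also have "\<dots> = (\<integral>\<^sup>+z. emeasure lborel ((\<lambda>x. (x, z)) -` ?A) \<partial>lborel)"
    by (rule slice_emeasure[OF Am])
  also have "\<dots> \<le> (\<integral>\<^sup>+z. ennreal (4 * \<eta>) * indicator ?Q z \<partial>lborel)"
  proof (intro nn_integral_mono)
    fix z
    show "emeasure lborel ((\<lambda>x. (x, z)) -` ?A) \<le> ennreal (4 * \<eta>) * indicator ?Q z"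
    proof (cases "z \<in> ?Q")
      case True
      have "(\<lambda>x. (x, z)) -` ?A \<subseteq> {b z - \<eta>..b z + \<eta>} \<union> {b' z - \<eta>..b' z + \<eta>}"
        by auto
      then have "emeasure lborel ((\<lambda>x. (x, z)) -` ?A) \<le> emeasure lborel ({b z - \<eta>..b z + \<eta>} \<union> {b' z - \<eta>..b' z + \<eta>})"
        by (intro emeasure_mono) auto
      also have "\<dots> \<le> emeasure lborel {b z - \<eta>..b z + \<eta>} + emeasure lborel {b' z - \<eta>..b' z + \<eta>}"
        by (intro emeasure_subadditive) auto
      also have "\<dots> = ennreal (4 * \<eta>)" using eta0 by (simp flip: ennreal_plus)
      finally show ?thesis using True by simp
    next
      case False
      then have "(\<lambda>x. (x, z)) -` ?A = {}" by auto
      then show ?thesis by simp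
    qed
  qed
  also have "\<dots> = ennreal (4 * \<eta>) * emeasure lborel ?Q"
    using Qm by (subst nn_integral_cmult_indicator) auto
  also have "\<dots> \<le> ennreal (4 * \<eta>) * ennreal (2 * m)" by (intro mult_left_mono Qe) auto
  also have "\<dots> = ennreal (8 * (K + 1) * m * norm y)"
    using Q eta0 by (simp add: \<eta>_def algebra_simps flip: ennreal_mult)
  finally show "emeasure lborel (sym_diff ?E ((+) y ` ?E)) \<le> ennreal (8 * (K + 1) * m * norm y)" .
qed

section \<open>Lipschitz calculus with hidden constants\<close>

text \<open>\<open>adm0\<close> asks for the existence of a Lipschitz constant and not for its size,
  so composite displacements can be treated without tracking it.\<close>

definition lip :: "('a::metric_space \<Rightarrow> 'b::metric_space) \<Rightarrow> bool" where
  "lip f \<longleftrightarrow> (\<exists>K. K-lipschitz_on UNIV f)"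

lemma lip_add: "lip f \<Longrightarrow> lip g \<Longrightarrow> lip (\<lambda>x. f x + g x)"
  and lip_diff: "lip f \<Longrightarrow> lip g \<Longrightarrow> lip (\<lambda>x. f x - g x)"
  for f g :: "'a::metric_space \<Rightarrow> 'b::real_normed_vector"
  unfolding lip_def by (blast intro: lipschitz_on_add lipschitz_on_diff)+

lemma lip_cmult: "lip f \<Longrightarrow> lip (\<lambda>x. c * f x)" for f :: "'a::metric_space \<Rightarrow> real"
  unfolding lip_def by (blast intro: lipschitz_on_cmult_real)

lemma lip_const: "lip (\<lambda>x. c)" unfolding lip_def by (blast intro: lipschitz_on_constant)

lemma lip_Pair: "lip f \<Longrightarrow> lip g \<Longrightarrow> lip (\<lambda>x. (f x, g x))"
  unfolding lip_def by (blast intro: lipschitz_on_Pair)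

lemma lip_fst: "lip fst" and lip_snd: "lip snd"
  unfolding lip_def by (rule exI[of _ 1], rule lipschitz_onI, simp_all add: dist_fst_le dist_snd_le)+

lemma lip_compose: "lip f \<Longrightarrow> lip g \<Longrightarrow> lip (\<lambda>x. f (g x))"
  unfolding lip_def by (metis lipschitz_on_compose2 lipschitz_on_subset subset_UNIV)

lemma lip_max: "lip f \<Longrightarrow> lip g \<Longrightarrow> lip (\<lambda>x. max (f x) (g x))"
  and lip_min: "lip f \<Longrightarrow> lip g \<Longrightarrow> lip (\<lambda>x. min (f x) (g x))"
  for f g :: "'a::metric_space \<Rightarrow> real"
proof -
  assume "lip f" "lip g"
  then obtain K L where k: "K-lipschitz_on UNIV f" "L-lipschitz_on UNIV g" unfolding lip_def by blast
  then have nn: "0 \<le> K" "0 \<le> L" using lipschitz_on_nonneg by auto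
  have *: "\<bar>f x - f y\<bar> \<le> (K + L) * dist x y" "\<bar>g x - g y\<bar> \<le> (K + L) * dist x y" for x y
    using lipschitz_onD[OF k(1), of x y] lipschitz_onD[OF k(2), of x y] nn
    by (auto simp: dist_real_def algebra_simps intro: add_increasing add_increasing2)
  have "(K + L)-lipschitz_on UNIV (\<lambda>x. max (f x) (g x))" "(K + L)-lipschitz_on UNIV (\<lambda>x. min (f x) (g x))"
  proof (safe intro!: lipschitz_onI)
    fix x y show "dist (max (f x) (g x)) (max (f y) (g y)) \<le> (K + L) * dist x y"
      "dist (min (f x) (g x)) (min (f y) (g y)) \<le> (K + L) * dist x y"
      using *[of x y] unfolding dist_real_def by linarith+
  qed (use nn in auto)
  then show "lip (\<lambda>x. max (f x) (g x))" "lip (\<lambda>x. min (f x) (g x))" unfolding lip_def by blast+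
qed

lemma lip_mult:
  fixes f g :: "'a::metric_space \<Rightarrow> real"
  assumes "lip f" "lip g" "\<And>x. \<bar>f x\<bar> \<le> A" "\<And>x. \<bar>g x\<bar> \<le> B"
  shows "lip (\<lambda>x. f x * g x)"
proof -
  obtain K L where k: "K-lipschitz_on UNIV f" "L-lipschitz_on UNIV g" using assms unfolding lip_def by blast
  then have nn: "0 \<le> K" "0 \<le> L" using lipschitz_on_nonneg by auto
  have AB: "0 \<le> A" "0 \<le> B" using assms(3,4) abs_ge_zero order_trans by blast+
  have "(A * L + B * K)-lipschitz_on UNIV (\<lambda>x. f x * g x)"
  proof (rule lipschitz_onI)
    fix x y
    have "\<bar>f x * g x - f y * g y\<bar> = \<bar>f x * (g x - g y) + g y * (f x - f y)\<bar>" by (simp add: algebra_simps)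
    also have "\<dots> \<le> \<bar>f x\<bar> * \<bar>g x - g y\<bar> + \<bar>g y\<bar> * \<bar>f x - f y\<bar>"
      using abs_triangle_ineq[of "f x * (g x - g y)" "g y * (f x - f y)"] by (simp only: abs_mult)
    also have "\<dots> \<le> A * (L * dist x y) + B * (K * dist x y)"
      using assms(3)[of x] assms(4)[of y] lipschitz_onD[OF k(1), of x y] lipschitz_onD[OF k(2), of x y]
      by (intro add_mono mult_mono) (auto simp: dist_real_def AB)
    finally show "dist (f x * g x) (f y * g y) \<le> (A * L + B * K) * dist x y"
      by (simp add: dist_real_def algebra_simps)
  qed (use nn AB in auto)
  then show ?thesis unfolding lip_def by blast
qed

lemma lip_continuous: "lip f \<Longrightarrow> continuous_on UNIV f"
  unfolding lip_def using lipschitz_on_continuous_on by blast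

lemma lipschitz_2d:
  fixes f fs ft :: "real \<times> real \<Rightarrow> real"
  assumes "\<And>z. (f has_derivative (\<lambda>h. fs z * fst h + ft z * snd h)) (at z)"
    "\<And>z. \<bar>fs z\<bar> \<le> A" "\<And>z. \<bar>ft z\<bar> \<le> B"
  shows "(A + B)-lipschitz_on UNIV f"
proof (rule bounded_derivative_imp_lipschitz)
  have AB: "0 \<le> A" "0 \<le> B" using assms(2,3) abs_ge_zero order_trans by blast+
  then show "0 \<le> A + B" by simp
  fix z :: "real \<times> real"
  show "(f has_derivative (\<lambda>h. fs z * fst h + ft z * snd h)) (at z within UNIV)" using assms(1) by simp
  show "onorm (\<lambda>h. fs z * fst h + ft z * snd h) \<le> A + B"
  proof (rule onorm_le)
    fix h :: "real \<times> real"
    have "\<bar>fst h\<bar> \<le> norm h" "\<bar>snd h\<bar> \<le> norm h"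
      using norm_fst_le[of "fst h" "snd h"] norm_snd_le[of "snd h" "fst h"] by auto
    then have "\<bar>fs z\<bar> * \<bar>fst h\<bar> + \<bar>ft z\<bar> * \<bar>snd h\<bar> \<le> A * norm h + B * norm h"
      using assms(2,3) AB by (intro add_mono mult_mono) auto
    then show "norm (fs z * fst h + ft z * snd h) \<le> (A + B) * norm h"
      using abs_triangle_ineq[of "fs z * fst h" "ft z * snd h"] by (simp add: abs_mult algebra_simps)
  qed
qed auto

lemma pbound_mono: "pbound E P \<Longrightarrow> P \<le> P' \<Longrightarrow> pbound E P'"
  unfolding pbound_def
  by (meson ennreal_leI mult_right_mono norm_ge_zero order_trans)

section \<open>The elementary cell of the inner laminate\<close>

text \<open>The first two wells relative to their mean, index 1 being \<open>diag3 1 0 0\<close>.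
  Index 2 repeats index 0, so that the set \<open>E2\<close> of an inner construction can later be
  merged into phase 0.\<close>

definition mixT :: "nat \<Rightarrow> real \<times> real" where
  "mixT i = (if i = 1 then (1/2, 0) else (-1/2, 0))"

text \<open>With \<open>f\<close> the height \<open>y\<close> above the lower graph and
  \<open>g\<close> the width \<open>w\<close>, this is the zigzag with slopes 1/2, -1/2, 1/2 on
  \<open>[0, w/4]\<close>, \<open>[w/4, 3w/4]\<close>, \<open>[3w/4, w]\<close>, extended by zero.
  Writing it as one formula of minima and maxima gives the global Lipschitz property at
  once.\<close>

lemma lip_piece_q:
  fixes f g :: "'a::metric_space \<Rightarrow> real"
  assumes "lip f" "lip g"
  shows "lip (\<lambda>x. (max 0 (min (f x) (g x / 2 - f x)) - max 0 (min (g x - f x) (f x - g x / 2))) / 2)"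
proof -
  note l = lip_max lip_min lip_add lip_diff lip_cmult lip_const assms
  have "lip (\<lambda>x. (1/2) * (max 0 (min (f x) ((1/2) * g x - f x)) - max 0 (min (g x - f x) (f x - (1/2) * g x))))"
    by (intro l)
  then show ?thesis by simp
qed

text \<open>This is the derivative, with respect to the width \<open>w\<close> at fixed height
  \<open>y\<close>, of the primitive of the zigzag. The zigzag has mean zero over
  \<open>[0, w]\<close>, so that its primitive vanishes at both ends and this function does
  too.\<close>

lemma lip_piece_k:
  fixes f g :: "'a::metric_space \<Rightarrow> real"
  assumes "lip f" "lip g"
  shows "lip (\<lambda>x. max 0 (min ((f x - g x / 4) / 2) (g x - f x)) / 2)"
proof -
  note l = lip_max lip_min lip_add lip_diff lip_cmult lip_const assms
  have "lip (\<lambda>x. (1/2) * max 0 (min ((1/2) * (f x - (1/4) * g x)) (g x - f x)))"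
    by (intro l)
  then show ?thesis by simp
qed

text \<open>Potential structure: with \<open>v = (\<partial>\<^sub>x W, - \<partial>\<^sub>s W, 0)\<close> the shear component \<open>e\<^sub>x\<^sub>s\<close> vanishes identically. Here
  \<open>W\<close> is a bump in \<open>x\<close> on the interval \<open>[\<beta>, \<beta> + w]\<close> with \<open>\<partial>\<^sub>x\<^sub>x W = \<plusminus>1/2\<close>.\<close>

lemma atom_adm:
  fixes \<beta> w \<beta>s \<beta>t \<beta>ss \<beta>st ws wt wss wst :: "real \<times> real \<Rightarrow> real"
  assumes d\<beta>: "\<And>z. (\<beta> has_derivative (\<lambda>h. \<beta>s z * fst h + \<beta>t z * snd h)) (at z)"
    and d\<beta>s: "\<And>z. (\<beta>s has_derivative (\<lambda>h. \<beta>ss z * fst h + \<beta>st z * snd h)) (at z)"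
    and dw: "\<And>z. (w has_derivative (\<lambda>h. ws z * fst h + wt z * snd h)) (at z)"
    and dws: "\<And>z. (ws has_derivative (\<lambda>h. wss z * fst h + wst z * snd h)) (at z)"
    and b: "\<And>z. \<bar>\<beta>s z\<bar> \<le> S" "\<And>z. \<bar>ws z\<bar> \<le> S" "\<And>z. \<bar>\<beta>t z\<bar> \<le> Tt" "\<And>z. \<bar>wt z\<bar> \<le> Tt"
      "\<And>z. \<bar>\<beta>ss z\<bar> \<le> SS" "\<And>z. \<bar>wss z\<bar> \<le> SS" "\<And>z. \<bar>\<beta>st z\<bar> \<le> ST" "\<And>z. \<bar>wst z\<bar> \<le> ST"
    and w: "\<And>z. 0 \<le> w z" "\<And>z. w z \<le> \<delta>"
    and Q: "Q \<in> sets borel" "emeasure lborel Q \<le> ennreal m" "0 \<le> m" "\<And>z. z \<notin> Q \<Longrightarrow> w z = 0"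
    and p: "0 \<le> p" and eps: "0 \<le> \<epsilon>"
  shows "adm p \<epsilon> mixT {(x, z). \<beta> z \<le> x \<and> x < \<beta> z + w z}
      ((2 * S\<^sup>2 + 2 * \<delta> * SS + Tt + 2 * Tt * S + 2 * \<delta> * ST) powr p * (\<delta> * m) + \<epsilon> * (32 * (S + Tt + 1) * m))"
    (is "adm _ _ _ ?R (?X powr p * _ + _)")
proof (rule adm0_imp_adm)
  define R where "R = {(x, z). \<beta> z \<le> x \<and> x < \<beta> z + w z}"
  define y where "y = (\<lambda>p :: r3. fst p - \<beta> (snd p))"
  define W where "W = (\<lambda>p :: r3. w (snd p))"
  define q where "q = (\<lambda>p. (max 0 (min (y p) (W p / 2 - y p)) - max 0 (min (W p - y p) (y p - W p / 2))) / 2)"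
  define k where "k = (\<lambda>p. max 0 (min ((y p - W p / 4) / 2) (W p - y p)) / 2)"
  \<comment> \<open>The potential depends on \<open>x\<close> and the base point only through the
    height \<open>y\<close> and the width \<open>W\<close>. By the chain rule, minus its
    \<open>s\<close>-derivative is \<open>q * \<beta>s - k * ws\<close>, with \<open>q\<close> and
    \<open>k\<close> its derivatives in height and width.\<close>
  define v where "v = (\<lambda>p. (q p, q p * \<beta>s (snd p) - k p * ws (snd p), 0 :: real))"
  have nn: "0 \<le> S" "0 \<le> Tt" "0 \<le> SS" "0 \<le> ST" "0 \<le> \<delta>"
    using b(1)[of 0] b(3)[of 0] b(5)[of 0] b(7)[of 0] w(1)[of 0] w(2)[of 0] by (auto intro: order_trans)
  have L\<beta>: "(S + Tt)-lipschitz_on UNIV \<beta>" and Lw: "(S + Tt)-lipschitz_on UNIV w"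
    and L\<beta>s: "(SS + ST)-lipschitz_on UNIV \<beta>s" and Lws: "(SS + ST)-lipschitz_on UNIV ws"
    using lipschitz_2d d\<beta> d\<beta>s dw dws b by blast+
  then have l: "lip \<beta>" "lip w" "lip \<beta>s" "lip ws" unfolding lip_def by blast+
  have ly: "lip y" unfolding y_def by (intro lip_diff lip_fst lip_compose[OF l(1)] lip_snd)
  have lW: "lip W" unfolding W_def by (intro lip_compose[OF l(2)] lip_snd)
  have lq: "lip q" unfolding q_def by (rule lip_piece_q[OF ly lW])
  have lk: "lip k" unfolding k_def by (rule lip_piece_k[OF ly lW])
  have W0: "0 \<le> W p" "W p \<le> \<delta>" for p using w by (auto simp: W_def)
  have qb: "\<bar>q p\<bar> \<le> \<delta>" for p
  proof -
    have "0 \<le> max 0 (min (y p) (W p / 2 - y p))" "max 0 (min (y p) (W p / 2 - y p)) \<le> \<delta>"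
      "0 \<le> max 0 (min (W p - y p) (y p - W p / 2))" "max 0 (min (W p - y p) (y p - W p / 2)) \<le> \<delta>"
      using W0[of p] by (simp, linarith, simp, linarith)
    moreover have "\<bar>(a - b) / 2\<bar> \<le> \<delta>" if "0 \<le> a" "a \<le> \<delta>" "0 \<le> b" "b \<le> \<delta>" for a b
      using that by (auto simp: abs_le_iff)
    ultimately show ?thesis unfolding q_def by blast
  qed
  have kb: "\<bar>k p\<bar> \<le> \<delta>" for p
    using W0[of p] unfolding k_def by (auto simp: max_def min_def abs_if)
  have lv: "lip v" unfolding v_def
    by (intro lip_Pair lip_diff lip_const lq lip_mult[OF lq, of _ \<delta> S] lip_mult[OF lk, of _ \<delta> S] lip_compose[OF l(3)]
       lip_compose[OF l(4)] lip_snd qb kb b)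
  then obtain Kv where Kv: "Kv-lipschitz_on UNIV v" unfolding lip_def by blast
  have memR: "p \<in> R \<longleftrightarrow> 0 \<le> y p \<and> y p < W p" for p
    by (cases p) (auto simp: y_def W_def R_def)
  \<comment> \<open>The two outer quarters, where \<open>q\<close> has slope 1/2. They fill half of
    every fibre, as the mean of the two wells requires.\<close>
  define E where "E = {p. 0 \<le> y p \<and> y p < W p / 4} \<union> {p. 3/4 * W p \<le> y p \<and> y p < W p}"
  \<comment> \<open>On each of the three pieces \<open>q = c1 * y + c2 * W\<close> and
    \<open>k = d1 * y + d2 * W\<close>; all derivative computations are done once for these linear
    forms.\<close>
  define V where "V = (\<lambda>c1 c2 d1 d2 p. (c1 * y p + c2 * W p,
      (c1 * y p + c2 * W p) * \<beta>s (snd p) - (d1 * y p + d2 * W p) * ws (snd p), 0 :: real))"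
  have dsnd: "((\<lambda>p :: r3. f (snd p)) has_derivative (\<lambda>h. fs (snd p) * fst (snd h) + ft (snd p) * snd (snd h))) (at p)"
    if "\<And>z. (f has_derivative (\<lambda>h. fs z * fst h + ft z * snd h)) (at z)" for f fs ft :: "real \<times> real \<Rightarrow> real" and p
    by (rule has_derivative_compose[OF _ that, of snd snd]) (auto intro: derivative_eq_intros)
  have dy: "(y has_derivative (\<lambda>h. fst h - (\<beta>s (snd p) * fst (snd h) + \<beta>t (snd p) * snd (snd h)))) (at p)" for p
    unfolding y_def by (intro has_derivative_diff has_derivative_fst has_derivative_ident dsnd[OF d\<beta>])
  have dW: "(W has_derivative (\<lambda>h. ws (snd p) * fst (snd h) + wt (snd p) * snd (snd h))) (at p)" for p
    unfolding W_def by (rule dsnd[OF dw])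
  define D1 where "D1 = (\<lambda>c1 c2 (p::r3) (h::r3). c1 * (fst h - (\<beta>s (snd p) * fst (snd h) + \<beta>t (snd p) * snd (snd h)))
       + c2 * (ws (snd p) * fst (snd h) + wt (snd p) * snd (snd h)))"
  have dlin: "((\<lambda>p. c1 * y p + c2 * W p) has_derivative D1 c1 c2 p) (at p)" for c1 c2 p
    unfolding D1_def by (intro has_derivative_add has_derivative_mult_right dy dW)
  define DV where "DV = (\<lambda>c1 c2 d1 d2 p (h::r3). (D1 c1 c2 p h,
      ((c1 * y p + c2 * W p) * (\<beta>ss (snd p) * fst (snd h) + \<beta>st (snd p) * snd (snd h)) + D1 c1 c2 p h * \<beta>s (snd p))
      - ((d1 * y p + d2 * W p) * (wss (snd p) * fst (snd h) + wst (snd p) * snd (snd h)) + D1 d1 d2 p h * ws (snd p)), 0 :: real))"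
  have dV: "(V c1 c2 d1 d2 has_derivative DV c1 c2 d1 d2 p) (at p)" for c1 c2 d1 d2 p
    unfolding V_def DV_def
    by (intro has_derivative_Pair has_derivative_diff has_derivative_mult dlin has_derivative_const dsnd[OF d\<beta>s] dsnd[OF dws])
  have DV0: "DV 0 0 0 0 p = (\<lambda>_. 0)" for p by (auto simp: DV_def D1_def zero_prod_def)
  \<comment> \<open>The condition \<open>c2 = d1\<close> is the symmetry of the mixed second
    derivatives of the potential, and it cancels the \<open>xs\<close> shear. The \<open>xx\<close>
    entry equals \<open>c1\<close> exactly. What remains is the \<open>st\<close> shear, the
    \<open>ss\<close> entry and the \<open>xt\<close> shear, in this order in the expansion below;
    only the last is linear in a first derivative of the graphs.\<close>
  have errV: "err (DV c1 c2 d1 d2 p) (c1, 0) \<le> ?X"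
    if c: "\<bar>c1\<bar> \<le> 1/2" "\<bar>c2\<bar> \<le> 1/2" "\<bar>d1\<bar> \<le> 1/2" "\<bar>d2\<bar> \<le> 1/2" "c2 = d1" and pR: "p \<in> R" for c1 c2 d1 d2 p
  proof -
    have y: "0 \<le> y p" "y p \<le> W p" "W p \<le> \<delta>" using pR W0 unfolding memR by auto
    define a0 a1 a2 a3 e0 e1 e2 e3 where "a0 = \<beta>s (snd p)" and "a1 = \<beta>t (snd p)" and "a2 = \<beta>ss (snd p)" and "a3 = \<beta>st (snd p)"
      and "e0 = ws (snd p)" and "e1 = wt (snd p)" and "e2 = wss (snd p)" and "e3 = wst (snd p)"
    note defs = this
    have bb: "\<bar>a0\<bar> \<le> S" "\<bar>e0\<bar> \<le> S" "\<bar>a1\<bar> \<le> Tt" "\<bar>e1\<bar> \<le> Tt" "\<bar>a2\<bar> \<le> SS" "\<bar>e2\<bar> \<le> SS" "\<bar>a3\<bar> \<le> ST" "\<bar>e3\<bar> \<le> ST"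
      using b unfolding defs by auto
    have M: "\<bar>x * y\<bar> \<le> X * Y" if "\<bar>x\<bar> \<le> X" "\<bar>y\<bar> \<le> Y" for x y X Y :: real
      using that unfolding abs_mult by (intro mult_mono) auto
    have lin: "\<bar>x1 * y p + x2 * W p\<bar> \<le> \<delta>" if "\<bar>x1\<bar> \<le> 1/2" "\<bar>x2\<bar> \<le> 1/2" for x1 x2
      using M[OF that(1), of "y p" \<delta>] M[OF that(2), of "W p" \<delta>] y by linarith
    have two: "\<bar>x2 * f - x1 * g\<bar> \<le> B" if "\<bar>x1\<bar> \<le> 1/2" "\<bar>x2\<bar> \<le> 1/2" "\<bar>f\<bar> \<le> B" "\<bar>g\<bar> \<le> B" for x1 x2 f g B :: real
      using M[OF that(1,4)] M[OF that(2,3)] by linarith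
    have E: "err (DV c1 c2 d1 d2 p) (c1, 0) =
        \<bar>(c1 * y p + c2 * W p) * a3 + (c2 * e1 - c1 * a1) * a0 - (d1 * y p + d2 * W p) * e3 - (d2 * e1 - d1 * a1) * e0\<bar>
      + \<bar>(c1 * y p + c2 * W p) * a2 + (c2 * e0 - c1 * a0) * a0 - (d1 * y p + d2 * W p) * e2 - (d2 * e0 - d1 * a0) * e0\<bar>
      + \<bar>c2 * e1 - c1 * a1\<bar>"
      using c(5) unfolding err_def DV_def D1_def defs by (simp add: algebra_simps)
    have tri: "\<bar>a + b - c - d\<bar> \<le> A + B + C + D" if "\<bar>a\<bar> \<le> A" "\<bar>b\<bar> \<le> B" "\<bar>c\<bar> \<le> C" "\<bar>d\<bar> \<le> D" for a b c d A B C D :: real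
      using that by (auto simp: abs_le_iff)
    have m: "\<bar>(c1 * y p + c2 * W p) * a3\<bar> \<le> \<delta> * ST" "\<bar>(d1 * y p + d2 * W p) * e3\<bar> \<le> \<delta> * ST"
      "\<bar>(c2 * e1 - c1 * a1) * a0\<bar> \<le> Tt * S" "\<bar>(d2 * e1 - d1 * a1) * e0\<bar> \<le> Tt * S"
      "\<bar>(c1 * y p + c2 * W p) * a2\<bar> \<le> \<delta> * SS" "\<bar>(d1 * y p + d2 * W p) * e2\<bar> \<le> \<delta> * SS"
      "\<bar>(c2 * e0 - c1 * a0) * a0\<bar> \<le> S * S" "\<bar>(d2 * e0 - d1 * a0) * e0\<bar> \<le> S * S" "\<bar>c2 * e1 - c1 * a1\<bar> \<le> Tt"
      by (intro M lin two bb c)+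
    have "err (DV c1 c2 d1 d2 p) (c1, 0) \<le> (\<delta> * ST + Tt * S + \<delta> * ST + Tt * S) + (\<delta> * SS + S * S + \<delta> * SS + S * S) + Tt"
      unfolding E by (intro add_mono tri m)
    then show ?thesis unfolding power2_eq_square by (simp add: algebra_simps)
  qed
  have X0: "0 \<le> ?X" using nn by simp
  have op: "open {p. a * W p < y p}" "open {p. y p < a * W p}" for a
    by (intro open_Collect_less continuous_intros lip_continuous ly lW)+
  have cl: "closed {p. a * W p \<le> y p}" "closed {p. y p \<le> a * W p}" for a
    by (intro closed_Collect_le continuous_intros lip_continuous ly lW)+
  have vout: "v p = 0" if "p \<notin> R" for p
  proof -
    have "y p < 0 \<or> W p \<le> y p" using that unfolding memR by auto
    then have "max 0 (min (y p) (W p / 2 - y p)) = 0" "max 0 (min (W p - y p) (y p - W p / 2)) = 0"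
      "max 0 (min ((y p - W p / 4) / 2) (W p - y p)) = 0"
      using W0[of p] by (auto simp: max_def min_def)
    then show ?thesis unfolding v_def q_def k_def by (simp add: zero_prod_def)
  qed
  have AEg: "AE p in lborel. y p \<noteq> a * W p" for a
  proof -
    have "AE p in lborel. fst p \<noteq> (\<lambda>z. \<beta> z + a * w z) (snd p)"
      by (intro AE_off_graph continuous_intros lip_continuous l)
    then show ?thesis by eventually_elim (auto simp: y_def W_def)
  qed
  have main: "\<exists>D. (v has_derivative D) (at p) \<and> (p \<notin> R \<longrightarrow> D = (\<lambda>_. 0)) \<and>
        (p \<in> R \<longrightarrow> err D (target mixT E {} p) powr p' \<le> ?X powr p')"
    if n: "y p \<noteq> 0 * W p" "y p \<noteq> 1/4 * W p" "y p \<noteq> 3/4 * W p" "y p \<noteq> 1 * W p" "0 \<le> p'" for p p'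
  proof -
    have fin: "\<exists>D. (v has_derivative D) (at p) \<and> (p \<notin> R \<longrightarrow> D = (\<lambda>_. 0)) \<and>
        (p \<in> R \<longrightarrow> err D (target mixT E {} p) powr p' \<le> ?X powr p')"
      if "open U" "p \<in> U" "\<And>p. p \<in> U \<Longrightarrow> v p = V c1 c2 d1 d2 p"
        "p \<notin> R \<Longrightarrow> c1 = 0 \<and> c2 = 0 \<and> d1 = 0 \<and> d2 = 0"
        "p \<in> R \<Longrightarrow> target mixT E {} p = (c1, 0)"
        "\<bar>c1\<bar> \<le> 1/2" "\<bar>c2\<bar> \<le> 1/2" "\<bar>d1\<bar> \<le> 1/2" "\<bar>d2\<bar> \<le> 1/2" "c2 = d1" for U c1 c2 d1 d2
    proof -
      note z4 = that(4)
      show ?thesis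
      proof (intro exI conjI impI)
      show "(v has_derivative DV c1 c2 d1 d2 p) (at p)"
        using that(1-3) by (intro has_derivative_transform_within_open[OF dV]) auto
      show "DV c1 c2 d1 d2 p = (\<lambda>_. 0)" if "p \<notin> R" using z4[OF that] DV0 by simp
      assume pR: "p \<in> R"
      have "err (DV c1 c2 d1 d2 p) (target mixT E {} p) \<le> ?X" using errV[OF that(6-10) pR] that(5)[OF pR] by simp
      moreover have "0 \<le> err (DV c1 c2 d1 d2 p) (target mixT E {} p)" by (simp add: err_def)
      ultimately show "err (DV c1 c2 d1 d2 p) (target mixT E {} p) powr p' \<le> ?X powr p'"
        using n(5) by (intro powr_mono2) auto
      qed
    qed
    have "W p \<ge> 0" by (rule W0)
    then consider "y p < 0 * W p" | "0 * W p < y p \<and> y p < 1/4 * W p" | "1/4 * W p < y p \<and> y p < 3/4 * W p"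
      | "3/4 * W p < y p \<and> y p < 1 * W p" | "1 * W p < y p"
      using n by linarith
    then show ?thesis
    proof cases
      case 1
      show ?thesis
        by (rule fin[OF op(2)[of 0], of 0 0 0 0])
          (use 1 vout in \<open>auto simp: memR V_def zero_prod_def\<close>)
    next
      case 2
      show ?thesis
        by (rule fin[OF open_Int[OF op(1)[of 0] op(2)[of "1/4"]], of "1/2" 0 0 0])
          (use 2 in \<open>auto simp: memR V_def v_def q_def k_def target_def mixT_def E_def\<close>)
    next
      \<comment> \<open>Here \<open>q = W/4 - y/2\<close> and \<open>k = y/4 - W/16\<close>; in the
        last quarter they become \<open>(y - W)/2\<close> and \<open>(W - y)/2\<close>, and
        continuity at the kinks fixes the constants.\<close>
      case 3
      show ?thesis
        by (rule fin[OF open_Int[OF op(1)[of "1/4"] op(2)[of "3/4"]], of "-1/2" "1/4" "1/4" "-1/16"])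
          (use 3 in \<open>auto simp: memR V_def v_def q_def k_def target_def mixT_def E_def max_def min_def field_simps\<close>)
    next
      case 4
      show ?thesis
        by (rule fin[OF open_Int[OF op(1)[of "3/4"] op(2)[of 1]], of "1/2" "-1/2" "-1/2" "1/2"])
          (use 4 W0[of p] in \<open>auto simp: memR V_def v_def q_def k_def target_def mixT_def E_def max_def min_def field_simps\<close>)
    next
      case 5
      show ?thesis
        by (rule fin[OF op(1)[of 1], of 0 0 0 0])
          (use 5 vout in \<open>auto simp: memR V_def zero_prod_def\<close>)
    qed
  qed
  have pE: "pbound E (32 * (S + Tt + 1) * m)"
  proof -
    have L2: "(2 * (S + Tt))-lipschitz_on UNIV (\<lambda>z. \<beta> z + a * w z)" if "0 \<le> a" "a \<le> 1" for a
    proof -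
      have "(S + Tt + \<bar>a\<bar> * (S + Tt))-lipschitz_on UNIV (\<lambda>z. \<beta> z + a * w z)"
        by (intro lipschitz_on_add L\<beta> lipschitz_on_cmult_real Lw)
      moreover have "\<bar>a\<bar> * (S + Tt) \<le> 1 * (S + Tt)" using that nn by (intro mult_right_mono) auto
      ultimately show ?thesis by (auto intro: lipschitz_on_le)
    qed
    have "pbound {(x, z). \<beta> z + 0 * w z \<le> x \<and> x < \<beta> z + 1/4 * w z} (8 * (2 * (S + Tt) + 1) * m)"
      "pbound {(x, z). \<beta> z + 3/4 * w z \<le> x \<and> x < \<beta> z + 1 * w z} (8 * (2 * (S + Tt) + 1) * m)"
      by (intro pbound_graph[OF _ _ Q(1-3)] L2; simp add: Q(4))+
    from pbound_union[OF this]
    have "pbound E (8 * (2 * (S + Tt) + 1) * m + 8 * (2 * (S + Tt) + 1) * m)"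
      by (rule back_subst[where P="\<lambda>A. pbound A _"]) (auto simp: E_def y_def W_def)
    moreover have "8 * (2 * (S + Tt) + 1) * m + 8 * (2 * (S + Tt) + 1) * m \<le> 32 * (S + Tt + 1) * m"
      using Q(3) by (simp add: algebra_simps)
    ultimately show ?thesis by (auto intro: pbound_mono)
  qed
  have Rm: "R \<in> sets borel"
  proof -
    have "R = {p. 0 * W p \<le> y p} \<inter> {p. y p < 1 * W p}" using memR by auto
    then show ?thesis using cl(1)[of 0] op(2)[of 1] by auto
  qed
  have Re: "emeasure lborel R \<le> ennreal (\<delta> * m)"
  proof -
    have "emeasure lborel R = (\<integral>\<^sup>+z. emeasure lborel ((\<lambda>x. (x, z)) -` R) \<partial>lborel)"
      by (rule slice_emeasure[OF Rm])
    also have "\<dots> \<le> (\<integral>\<^sup>+z. ennreal \<delta> * indicator Q z \<partial>lborel)"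
    proof (intro nn_integral_mono)
      fix z
      have "(\<lambda>x. (x, z)) -` R = {\<beta> z..<\<beta> z + w z}" by (auto simp: R_def)
      then show "emeasure lborel ((\<lambda>x. (x, z)) -` R) \<le> ennreal \<delta> * indicator Q z"
        using w[of z] Q(4)[of z] by (auto simp: indicator_def intro: ennreal_leI)
    qed
    also have "\<dots> = ennreal \<delta> * emeasure lborel Q" using Q by (subst nn_integral_cmult_indicator) auto
    also have "\<dots> \<le> ennreal \<delta> * ennreal m" using Q by (intro mult_left_mono) auto
    also have "\<dots> = ennreal (\<delta> * m)" using nn by (simp add: ennreal_mult')
    finally show ?thesis .
  qed
  show "adm0 p \<epsilon> mixT {(x, z). \<beta> z \<le> x \<and> x < \<beta> z + w z} (?X powr p * (\<delta> * m) + \<epsilon> * (32 * (S + Tt + 1) * m))"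
    unfolding R_def[symmetric]
  proof (rule adm0I[OF Rm Kv vout, where ?E1.0=E and ?E2.0="{}" and g="\<lambda>_. ?X powr p" and I="?X powr p * (\<delta> * m)"
        and ?P1.0="32 * (S + Tt + 1) * m" and ?P2.0=0])
    show "E \<subseteq> R" using W0 by (auto simp only: E_def memR)
    show "AE z in lborel. \<exists>D. (v has_derivative D) (at z) \<and> (z \<notin> R \<longrightarrow> D = (\<lambda>_. 0)) \<and>
        (z \<in> R \<longrightarrow> err D (target mixT E {} z) powr p \<le> ?X powr p)"
      using AEg[of 0] AEg[of "1/4"] AEg[of "3/4"] AEg[of 1]
      by eventually_elim (rule main[OF _ _ _ _ p])
    have "(\<integral>\<^sup>+z\<in>R. ennreal (?X powr p) \<partial>lborel) = ennreal (?X powr p) * emeasure lborel R"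
      using Rm by (subst nn_integral_cmult_indicator) auto
    also have "\<dots> \<le> ennreal (?X powr p) * ennreal (\<delta> * m)" by (intro mult_left_mono Re) auto
    also have "\<dots> = ennreal (?X powr p * (\<delta> * m))" by (simp add: ennreal_mult')
    finally show "(\<integral>\<^sup>+z\<in>R. ennreal (?X powr p) \<partial>lborel) \<le> ennreal (?X powr p * (\<delta> * m))" .
  qed (use nn Q pE in \<open>auto simp: pbound_empty\<close>)
qed

section \<open>Twice differentiable cutoff functions\<close>

definition clamp01 :: "real \<Rightarrow> real" where "clamp01 x = max 0 (min 1 x)"

text \<open>The quintic smooth step. Two derivatives are required because the displacement already
  contains first derivatives of the graphs, and its gradient contains second ones.\<close>

definition step :: "real \<Rightarrow> real" where
  "step x = (let y = clamp01 x in y^3 * (6 * y^2 - 15 * y + 10))"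
definition step1 :: "real \<Rightarrow> real" where
  "step1 x = (let y = clamp01 x in 30 * y^2 * (1 - y)^2)"
definition step2 :: "real \<Rightarrow> real" where
  "step2 x = (let y = clamp01 x in 60 * y * (1 - y) * (1 - 2 * y))"

lemma DERIV_quadratic_zero:
  fixes f :: "real \<Rightarrow> real"
  assumes "\<And>y. \<bar>f y - f x\<bar> \<le> C * (y - x)\<^sup>2"
  shows "(f has_real_derivative 0) (at x)"
  unfolding has_field_derivative_iff
proof (rule Lim_null_comparison[where g="\<lambda>y. C * \<bar>y - x\<bar>"])
  have "\<bar>(f y - f x) / (y - x)\<bar> \<le> C * \<bar>y - x\<bar>" if "y \<noteq> x" for y
    using assms[of y] that
    by (simp add: abs_divide divide_le_eq power2_eq_square abs_mult_self_eq[of "y - x", symmetric] mult.assoc del: abs_mult_self_eq)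
  then show "\<forall>\<^sub>F y in at x. norm ((f y - f x) / (y - x)) \<le> C * \<bar>y - x\<bar>"
    by (auto simp: eventually_at_filter)
  show "((\<lambda>y. C * \<bar>y - x\<bar>) \<longlongrightarrow> 0) (at x)" by (auto intro!: tendsto_eq_intros)
qed

text \<open>Away from 0 and 1 the composition is locally constant or equal to \<open>P\<close>. At
  the two junctions quadratic contact forces derivative 0, which agrees with \<open>P' 0\<close> and
  \<open>P' 1\<close>.\<close>

lemma clamp_deriv:
  fixes P P' :: "real \<Rightarrow> real"
  assumes "\<And>x. (P has_real_derivative P' x) (at x)" "P' 0 = 0" "P' 1 = 0"
    and q: "\<And>x. 0 \<le> x \<Longrightarrow> x \<le> 1 \<Longrightarrow> \<bar>P x - P 0\<bar> \<le> C * x\<^sup>2" "\<And>x. 0 \<le> x \<Longrightarrow> x \<le> 1 \<Longrightarrow> \<bar>P x - P 1\<bar> \<le> C * (x - 1)\<^sup>2"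
    and C: "0 \<le> C"
  shows "((\<lambda>x. P (clamp01 x)) has_real_derivative P' (clamp01 x)) (at x)"
proof -
  consider "x < 0" | "x = 0" | "0 < x \<and> x < 1" | "x = 1" | "1 < x" by linarith
  then show ?thesis
  proof cases
    case 1
    have "((\<lambda>_. P 0) has_real_derivative 0) (at x)" by simp
    then have "((\<lambda>x. P (clamp01 x)) has_real_derivative 0) (at x)"
      by (rule DERIV_cong_ev[THEN iffD1, rotated 3])
         (use 1 in \<open>auto simp: clamp01_def max_def min_def intro!: eventually_mono[OF eventually_nhds_in_open[of "{..<0}" x]]\<close>)
    then show ?thesis using 1 assms by (simp add: clamp01_def)
  next
    case 2
    have "\<bar>P (clamp01 y) - P (clamp01 0)\<bar> \<le> C * (y - 0)\<^sup>2" for y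
    proof -
      have "\<bar>P (clamp01 y) - P 0\<bar> \<le> C * (clamp01 y)\<^sup>2" by (rule q) (auto simp: clamp01_def)
      also have "\<dots> \<le> C * y\<^sup>2" using C by (intro mult_left_mono, simp flip: abs_le_square_iff) (auto simp: clamp01_def)
      finally show ?thesis by (simp add: clamp01_def)
    qed
    then have "((\<lambda>x. P (clamp01 x)) has_real_derivative 0) (at 0)" by (rule DERIV_quadratic_zero)
    then show ?thesis using 2 assms by (simp add: clamp01_def)
  next
    case 3
    have "(P has_real_derivative P' x) (at x)" by (rule assms)
    then have "((\<lambda>x. P (clamp01 x)) has_real_derivative P' x) (at x)"
      by (rule DERIV_cong_ev[THEN iffD1, rotated 3])
         (use 3 in \<open>auto simp: clamp01_def max_def min_def intro!: eventually_mono[OF eventually_nhds_in_open[of "{0<..<1}" x]]\<close>)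
    then show ?thesis using 3 assms by (simp add: clamp01_def)
  next
    case 4
    have "\<bar>P (clamp01 y) - P (clamp01 1)\<bar> \<le> C * (y - 1)\<^sup>2" for y
    proof -
      have "\<bar>P (clamp01 y) - P 1\<bar> \<le> C * (clamp01 y - 1)\<^sup>2" by (rule q) (auto simp: clamp01_def)
      also have "\<dots> \<le> C * (y - 1)\<^sup>2" using C by (intro mult_left_mono, simp flip: abs_le_square_iff) (auto simp: clamp01_def)
      finally show ?thesis by (simp add: clamp01_def)
    qed
    then have "((\<lambda>x. P (clamp01 x)) has_real_derivative 0) (at 1)" by (rule DERIV_quadratic_zero)
    then show ?thesis using 4 assms by (simp add: clamp01_def)
  next
    case 5
    have "((\<lambda>_. P 1) has_real_derivative 0) (at x)" by simp
    then have "((\<lambda>x. P (clamp01 x)) has_real_derivative 0) (at x)"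
      by (rule DERIV_cong_ev[THEN iffD1, rotated 3])
         (use 5 in \<open>auto simp: clamp01_def max_def min_def intro!: eventually_mono[OF eventually_nhds_in_open[of "{1<..}" x]]\<close>)
    then show ?thesis using 5 assms by (simp add: clamp01_def)
  qed
qed

lemma step_deriv: "(step has_real_derivative step1 x) (at x)"
proof -
  have "((\<lambda>x. (\<lambda>y. y^3 * (6 * y^2 - 15 * y + 10)) (clamp01 x)) has_real_derivative (\<lambda>y. 30 * y^2 * (1 - y)^2) (clamp01 x)) (at x)"
  proof (rule clamp_deriv[where C=31])
    show "((\<lambda>y. y^3 * (6 * y^2 - 15 * y + 10)) has_real_derivative 30 * x^2 * (1 - x)^2) (at x)" for x :: real
      by (auto intro!: derivative_eq_intros simp: power2_eq_square power3_eq_cube algebra_simps)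
    fix x :: real assume x: "0 \<le> x" "x \<le> 1"
    have "x * (6 * x^2 - 15 * x + 10) \<le> 1 * 16" "0 \<le> 6 * x^2 - 15 * x + 10"
    proof -
      \<comment> \<open>Six times this square is \<open>6 * x^2 - 15 * x + 75/8\<close>, which lies
        below the quadratic factor of the smooth step.\<close>
      have "(x - 5/4)^2 \<ge> 0" by simp
      then show "0 \<le> 6 * x^2 - 15 * x + 10" by (simp add: power2_eq_square algebra_simps)
      have "x^2 \<le> 1" using x by (simp add: power_le_one)
      then show "x * (6 * x^2 - 15 * x + 10) \<le> 1 * 16" using x \<open>0 \<le> 6 * x^2 - 15 * x + 10\<close> by (intro mult_mono) auto
    qed
    then have "x\<^sup>2 * (x * (6 * x^2 - 15 * x + 10)) \<le> x\<^sup>2 * 31" "0 \<le> x\<^sup>2 * (x * (6 * x^2 - 15 * x + 10))"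
      using x by (auto intro!: mult_left_mono)
    then show "\<bar>x^3 * (6 * x^2 - 15 * x + 10) - 0^3 * (6 * 0^2 - 15 * 0 + 10)\<bar> \<le> 31 * x\<^sup>2"
      by (simp add: power2_eq_square power3_eq_cube algebra_simps)
    \<comment> \<open>The smooth step has contact of third order with the value 1 at
      \<open>x = 1\<close>; a factor \<open>(x - 1)^2\<close> is split off for the quadratic
      estimate.\<close>
    have e: "1 - x^3 * (6 * x^2 - 15 * x + 10) = (x - 1)\<^sup>2 * ((1 - x) * (6 * x^2 + 3 * x + 1))"
      by (simp add: power2_eq_square power3_eq_cube algebra_simps)
    have "(1 - x) * (6 * x^2 + 3 * x + 1) \<le> 1 * 10"
    proof -
      have "x^2 \<le> 1" using x by (simp add: power_le_one)
      then show ?thesis using x by (intro mult_mono) auto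
    qed
    moreover have "0 \<le> (1 - x) * (6 * x^2 + 3 * x + 1)" using x by simp
    ultimately have "(x - 1)\<^sup>2 * ((1 - x) * (6 * x^2 + 3 * x + 1)) \<le> (x-1)\<^sup>2 * 31" "0 \<le> (x - 1)\<^sup>2 * ((1 - x) * (6 * x^2 + 3 * x + 1))"
      by (auto intro!: mult_left_mono)
    then show "\<bar>x^3 * (6 * x^2 - 15 * x + 10) - 1^3 * (6 * 1^2 - 15 * 1 + 10)\<bar> \<le> 31 * (x - 1)\<^sup>2"
      using e by simp
  qed auto
  then show ?thesis unfolding step_def[abs_def] step1_def Let_def by simp
qed

lemma step1_deriv: "(step1 has_real_derivative step2 x) (at x)"
proof -
  have "((\<lambda>x. (\<lambda>y. 30 * y^2 * (1 - y)^2) (clamp01 x)) has_real_derivative (\<lambda>y. 60 * y * (1 - y) * (1 - 2 * y)) (clamp01 x)) (at x)"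
  proof (rule clamp_deriv[where C=30])
    show "((\<lambda>y. 30 * y^2 * (1 - y)^2) has_real_derivative 60 * x * (1 - x) * (1 - 2 * x)) (at x)" for x :: real
      by (auto intro!: derivative_eq_intros simp: power2_eq_square power3_eq_cube algebra_simps)
    fix x :: real assume x: "0 \<le> x" "x \<le> 1"
    have "x\<^sup>2 \<le> 1" "(1 - x)\<^sup>2 \<le> 1" using x by (auto simp: power_le_one)
    then have "x\<^sup>2 * (1 - x)\<^sup>2 \<le> x\<^sup>2 * 1" "x\<^sup>2 * (1 - x)\<^sup>2 \<le> 1 * (1 - x)\<^sup>2"
      by (intro mult_left_mono mult_right_mono; simp)+
    then show "\<bar>30 * x^2 * (1 - x)^2 - 30 * 0^2 * (1 - 0)^2\<bar> \<le> 30 * x\<^sup>2"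
      "\<bar>30 * x^2 * (1 - x)^2 - 30 * 1^2 * (1 - 1)^2\<bar> \<le> 30 * (x - 1)\<^sup>2"
      using x by (auto simp: power2_commute[of x 1])
  qed auto
  then show ?thesis unfolding step2_def step1_def[abs_def] Let_def by simp
qed

lemma clamp01: "0 \<le> clamp01 x" "clamp01 x \<le> 1" by (auto simp: clamp01_def)

lemma step1_bound: "0 \<le> step1 x" "step1 x \<le> 60"
proof -
  have "(clamp01 x)\<^sup>2 * (1 - clamp01 x)\<^sup>2 \<le> 1 * 1" using clamp01[of x]
    by (intro mult_mono) (auto simp: power_le_one)
  then show "0 \<le> step1 x" "step1 x \<le> 60" by (auto simp: step1_def Let_def)
qed

lemma step1_abs: "\<bar>step1 x\<bar> \<le> 60" using step1_bound[of x] by simp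

lemma step2_bound: "\<bar>step2 x\<bar> \<le> 60"
proof -
  have "\<bar>clamp01 x\<bar> * \<bar>1 - clamp01 x\<bar> * \<bar>1 - 2 * clamp01 x\<bar> \<le> 1 * 1 * 1" using clamp01[of x]
    by (intro mult_mono) auto
  then show "\<bar>step2 x\<bar> \<le> 60" by (simp add: step2_def Let_def abs_mult)
qed

lemma step_le0: "x \<le> 0 \<Longrightarrow> step x = 0" "x \<le> 0 \<Longrightarrow> step1 x = 0" "x \<le> 0 \<Longrightarrow> step2 x = 0"
  by (auto simp: step_def step1_def step2_def clamp01_def)

lemma step_ge1: "x \<ge> 1 \<Longrightarrow> step x = 1"
  by (simp add: step_def clamp01_def)

lemma step_bound: "0 \<le> step x" "step x \<le> 1"
proof -
  have mono: "step x \<le> step y" if "x \<le> y" for x y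
    by (rule DERIV_nonneg_imp_nondecreasing[OF that]) (use step_deriv step1_bound in blast)
  show "0 \<le> step x" using mono[of "min x 0" x] step_le0[of "min x 0"] by simp
  show "step x \<le> 1" using mono[of x "max x 1"] step_ge1[of "max x 1"] by simp
qed

text \<open>The product \<open>y * (1 - y)\<close> is a smooth substitute for the distance to the
  ends of \<open>[0, 1]\<close>, so one formula produces both flanks of the cutoff.\<close>

definition cut :: "real \<Rightarrow> real \<Rightarrow> real \<Rightarrow> real" where
  "cut a b y = step ((y * (1 - y) - a) / (b - a))"
definition cut1 :: "real \<Rightarrow> real \<Rightarrow> real \<Rightarrow> real" where
  "cut1 a b y = step1 ((y * (1 - y) - a) / (b - a)) * ((1 - 2 * y) / (b - a))"
definition cut2 :: "real \<Rightarrow> real \<Rightarrow> real \<Rightarrow> real" where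
  "cut2 a b y = step2 ((y * (1 - y) - a) / (b - a)) * ((1 - 2 * y) / (b - a))\<^sup>2
     - step1 ((y * (1 - y) - a) / (b - a)) * (2 / (b - a))"

lemma inner_deriv: "((\<lambda>y. (y * (1 - y) - a) / (b - a)) has_real_derivative (1 - 2 * y) / (b - a)) (at y)" for a b y :: real
  by (rule DERIV_cdivide) (auto intro!: derivative_eq_intros)

lemma cut_deriv: "(cut a b has_real_derivative cut1 a b y) (at y)"
proof -
  have "((\<lambda>y. step ((y * (1 - y) - a) / (b - a))) has_real_derivative
      step1 ((y * (1 - y) - a) / (b - a)) * ((1 - 2 * y) / (b - a))) (at y)"
    by (rule DERIV_chain2[OF step_deriv inner_deriv])
  then show ?thesis unfolding cut_def[abs_def] cut1_def by simp
qed

lemma cut1_deriv: "(cut1 a b has_real_derivative cut2 a b y) (at y)"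
proof -
  have "((\<lambda>y. step1 ((y * (1 - y) - a) / (b - a))) has_real_derivative
      step2 ((y * (1 - y) - a) / (b - a)) * ((1 - 2 * y) / (b - a))) (at y)"
    by (rule DERIV_chain2[OF step1_deriv inner_deriv])
  moreover have "((\<lambda>y. (1 - 2 * y) / (b - a)) has_real_derivative - 2 / (b - a)) (at y)"
    by (rule DERIV_cdivide) (auto intro!: derivative_eq_intros)
  ultimately have "((\<lambda>y. step1 ((y * (1 - y) - a) / (b - a)) * ((1 - 2 * y) / (b - a))) has_real_derivative
      step2 ((y * (1 - y) - a) / (b - a)) * ((1 - 2 * y) / (b - a)) * ((1 - 2 * y) / (b - a)) +
      (- 2 / (b - a)) * step1 ((y * (1 - y) - a) / (b - a))) (at y)" by (rule DERIV_mult)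
  moreover have "A * q * q + (- 2 / e) * s = A * q\<^sup>2 - s * (2 / e)" for A q e s :: real
    by (simp add: power2_eq_square)
  ultimately show ?thesis unfolding cut1_def[abs_def] cut2_def by (simp only:)
qed

lemma cut_bound: "0 \<le> cut a b y" "cut a b y \<le> 1"
  using step_bound by (auto simp: cut_def)

lemma cut_zero: "a < b \<Longrightarrow> y * (1 - y) \<le> a \<Longrightarrow> cut a b y = 0"
  by (auto simp: cut_def intro!: step_le0 divide_nonpos_pos)

lemma cut_one: "a < b \<Longrightarrow> b \<le> y * (1 - y) \<Longrightarrow> cut a b y = 1"
  by (auto simp: cut_def intro!: step_ge1)

lemma bump_outside: "y \<le> 0 \<or> 1 \<le> y \<Longrightarrow> y * (1 - y) \<le> (0::real)"
  by (auto simp: mult_le_0_iff)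

text \<open>The inner derivative \<open>1 - 2 * y\<close> is unbounded, but outside
  \<open>[0, 1]\<close> the product \<open>y * (1 - y)\<close> is nonpositive and
  \<open>step1\<close> vanishes there.\<close>

lemma cut1_bound: assumes "0 \<le> a" "a < b" shows "\<bar>cut1 a b y\<bar> \<le> 60 / (b - a)"
proof (cases "y \<le> 0 \<or> 1 \<le> y")
  case True
  then have "cut1 a b y = 0" using bump_outside[OF True] assms step_le0(2)[of "(y * (1 - y) - a) / (b - a)"]
    by (simp add: cut1_def divide_nonpos_pos)
  then show ?thesis using assms by simp
next
  case False
  then have "\<bar>step1 ((y * (1 - y) - a) / (b - a))\<bar> * \<bar>(1 - 2 * y) / (b - a)\<bar> \<le> 60 * (1 / (b - a))"
    using assms step1_abs by (intro mult_mono) (auto simp: abs_divide intro!: divide_right_mono)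
  then show ?thesis by (simp add: cut1_def abs_mult)
qed

lemma cut2_bound: assumes "0 \<le> a" "a < b" "b \<le> 1" shows "\<bar>cut2 a b y\<bar> \<le> 180 / (b - a)\<^sup>2"
proof (cases "y \<le> 0 \<or> 1 \<le> y")
  case True
  then have "cut2 a b y = 0" using bump_outside[OF True] assms step_le0(2,3)[of "(y * (1 - y) - a) / (b - a)"]
    by (simp add: cut2_def divide_nonpos_pos)
  then show ?thesis using assms by simp
next
  case False
  have "\<bar>1 - 2 * y\<bar> \<le> 1" using False by auto
  then have q: "((1 - 2 * y) / (b - a))\<^sup>2 \<le> 1 / (b - a)\<^sup>2"
    using assms by (simp add: power_divide divide_right_mono abs_square_le_1)
  have "\<bar>step2 ((y * (1 - y) - a) / (b - a)) * ((1 - 2 * y) / (b - a))\<^sup>2\<bar> \<le> 60 * (1 / (b - a)\<^sup>2)"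
    unfolding abs_mult using q step2_bound by (intro mult_mono) auto
  moreover have "\<bar>step1 ((y * (1 - y) - a) / (b - a)) * (2 / (b - a))\<bar> \<le> 60 * (2 / (b - a))"
    unfolding abs_mult using assms step1_bound by (intro mult_mono) auto
  \<comment> \<open>Since \<open>b - a \<le> 1\<close>, the term of lower order is absorbed into the
    quadratic one, which gives \<open>180 = 60 + 2 * 60\<close>.\<close>
  moreover have "2 / (b - a) \<le> 2 / (b - a)\<^sup>2"
    using assms by (auto simp: power2_eq_square divide_simps mult_le_cancel_right1)
  ultimately have "\<bar>cut2 a b y\<bar> \<le> 60 * (1 / (b - a)\<^sup>2) + 60 * (2 / (b - a)\<^sup>2)"
    unfolding cut2_def by linarith
  then show ?thesis by (simp add: add_divide_distrib[symmetric])
qed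

definition cutoff :: "real \<Rightarrow> real \<Rightarrow> real \<Rightarrow> real \<Rightarrow> real \<times> real \<Rightarrow> real" where
  "cutoff a b L c z = cut a b (fst z / L) * cut a b (snd z / c)"
definition cutoff_s :: "real \<Rightarrow> real \<Rightarrow> real \<Rightarrow> real \<Rightarrow> real \<times> real \<Rightarrow> real" where
  "cutoff_s a b L c z = cut1 a b (fst z / L) / L * cut a b (snd z / c)"
definition cutoff_t :: "real \<Rightarrow> real \<Rightarrow> real \<Rightarrow> real \<Rightarrow> real \<times> real \<Rightarrow> real" where
  "cutoff_t a b L c z = cut a b (fst z / L) * (cut1 a b (snd z / c) / c)"
definition cutoff_ss :: "real \<Rightarrow> real \<Rightarrow> real \<Rightarrow> real \<Rightarrow> real \<times> real \<Rightarrow> real" where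
  "cutoff_ss a b L c z = cut2 a b (fst z / L) / L / L * cut a b (snd z / c)"
definition cutoff_st :: "real \<Rightarrow> real \<Rightarrow> real \<Rightarrow> real \<Rightarrow> real \<times> real \<Rightarrow> real" where
  "cutoff_st a b L c z = cut1 a b (fst z / L) / L * (cut1 a b (snd z / c) / c)"

lemma has_derivative_scaled:
  fixes f :: "real \<Rightarrow> real" and g :: "'a::real_normed_vector \<Rightarrow> real"
  assumes "\<And>y. (f has_real_derivative f' y) (at y)" "bounded_linear g"
  shows "((\<lambda>z. f (g z / L)) has_derivative (\<lambda>h. f' (g z / L) / L * g h)) (at z)"
proof -
  have "((\<lambda>z. g z / L) has_derivative (\<lambda>h. g h / L)) (at z)"
    by (intro bounded_linear.has_derivative[OF bounded_linear_divide] bounded_linear_imp_has_derivative assms)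
  from has_derivative_compose[OF this, of f "\<lambda>h. f' (g z / L) * h"]
  show ?thesis using assms(1) by (simp add: has_field_derivative_def)
qed

lemma cutoff_deriv:
  "(cutoff a b L c has_derivative (\<lambda>h. cutoff_s a b L c z * fst h + cutoff_t a b L c z * snd h)) (at z)"
proof -
  have "((\<lambda>z. cut a b (fst z / L) * cut a b (snd z / c)) has_derivative
     (\<lambda>h. cut a b (fst z / L) * (cut1 a b (snd z / c) / c * snd h) + (cut1 a b (fst z / L) / L * fst h) * cut a b (snd z / c))) (at z)"
    by (intro has_derivative_mult has_derivative_scaled cut_deriv bounded_linear_fst bounded_linear_snd)
  then show ?thesis unfolding cutoff_def[abs_def] cutoff_s_def cutoff_t_def by (simp add: algebra_simps)
qed

lemma cutoff_s_deriv:
  "(cutoff_s a b L c has_derivative (\<lambda>h. cutoff_ss a b L c z * fst h + cutoff_st a b L c z * snd h)) (at z)"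
proof -
  have "((\<lambda>z. cut1 a b (fst z / L) / L * cut a b (snd z / c)) has_derivative
     (\<lambda>h. cut1 a b (fst z / L) / L * (cut1 a b (snd z / c) / c * snd h) + (cut2 a b (fst z / L) / L * fst h) / L * cut a b (snd z / c))) (at z)"
    by (intro has_derivative_mult bounded_linear.has_derivative[OF bounded_linear_divide] has_derivative_scaled cut1_deriv cut_deriv bounded_linear_fst bounded_linear_snd)
  then show ?thesis unfolding cutoff_s_def[abs_def] cutoff_ss_def cutoff_st_def by (simp add: algebra_simps)
qed

lemma cutoff_range: "0 \<le> cutoff a b L c z" "cutoff a b L c z \<le> 1"
  using cut_bound by (auto simp: cutoff_def intro: mult_le_one)

lemma cutoff_bounds:
  assumes "0 \<le> a" "a < b" "b \<le> 1" "0 < L" "0 < c"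
  shows "\<bar>cutoff_s a b L c z\<bar> \<le> 60 / (b - a) / L" "\<bar>cutoff_t a b L c z\<bar> \<le> 60 / (b - a) / c"
    "\<bar>cutoff_ss a b L c z\<bar> \<le> 180 / (b - a)\<^sup>2 / L\<^sup>2" "\<bar>cutoff_st a b L c z\<bar> \<le> 3600 / (b - a)\<^sup>2 / (L * c)"
proof -
  have c: "\<bar>cut a b y\<bar> \<le> 1" for y using cut_bound by simp
  have c1: "\<bar>cut1 a b y / l\<bar> \<le> 60 / (b - a) / l" if "0 < l" for y l
    using divide_right_mono[OF cut1_bound[OF assms(1,2), of y], of l] that by simp
  have c2: "\<bar>cut2 a b y / l / l\<bar> \<le> 180 / (b - a)\<^sup>2 / l\<^sup>2" if "0 < l" for y l
    using divide_right_mono[OF cut2_bound[OF assms(1,2,3), of y], of "l\<^sup>2"] that by (simp add: power2_eq_square)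
  have M: "\<bar>x * y\<bar> \<le> X * Y" if "\<bar>x\<bar> \<le> X" "\<bar>y\<bar> \<le> Y" for x y X Y :: real
    using that unfolding abs_mult by (intro mult_mono) auto
  show "\<bar>cutoff_s a b L c z\<bar> \<le> 60 / (b - a) / L" using M[OF c1[OF assms(4)] c] by (simp add: cutoff_s_def)
  show "\<bar>cutoff_t a b L c z\<bar> \<le> 60 / (b - a) / c" using M[OF c c1[OF assms(5)]] by (simp add: cutoff_t_def)
  show "\<bar>cutoff_ss a b L c z\<bar> \<le> 180 / (b - a)\<^sup>2 / L\<^sup>2" using M[OF c2[OF assms(4)] c] by (simp add: cutoff_ss_def)
  have "\<bar>cutoff_st a b L c z\<bar> \<le> 60 / (b - a) / L * (60 / (b - a) / c)"
    unfolding cutoff_st_def by (intro M c1 assms)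
  also have "\<dots> = 3600 / (b - a)\<^sup>2 / (L * c)" by (simp add: power2_eq_square)
  finally show "\<bar>cutoff_st a b L c z\<bar> \<le> 3600 / (b - a)\<^sup>2 / (L * c)" .
qed

lemma cutoff_outside:
  assumes "0 \<le> a" "a < b" "0 < L" "0 < c" "z \<notin> {0..<L} \<times> {0..<c}"
  shows "cutoff a b L c z = 0"
proof -
  have "fst z / L \<le> 0 \<or> 1 \<le> fst z / L \<or> snd z / c \<le> 0 \<or> 1 \<le> snd z / c"
    using assms(3-5) by (cases z) (auto simp: divide_simps)
  then have "fst z / L * (1 - fst z / L) \<le> a \<or> snd z / c * (1 - snd z / c) \<le> a"
    using bump_outside assms(1) by (meson order_trans)
  then show ?thesis using cut_zero[OF assms(2)] unfolding cutoff_def by auto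
qed

text \<open>Where the inner cutoff is nonzero, both relative distances exceed \<open>a'\<close> and
  hence \<open>b\<close>, so the outer cutoff is saturated. In a nested family, at most one cutoff
  is strictly between 0 and 1 at any point.\<close>

lemma cutoff_nested:
  assumes "0 \<le> a" "a < b" "b \<le> a'" "a' < b'" "cutoff a' b' L c z \<noteq> 0"
  shows "cutoff a b L c z = 1"
proof -
  have "cut a' b' (fst z / L) \<noteq> 0" "cut a' b' (snd z / c) \<noteq> 0" using assms(5) by (auto simp: cutoff_def)
  then have "a' < fst z / L * (1 - fst z / L)" "a' < snd z / c * (1 - snd z / c)"
    using cut_zero[OF assms(4)] by (meson not_le)+
  then have "cut a b (fst z / L) = 1" "cut a b (snd z / c) = 1"
    using assms by (intro cut_one; linarith)+
  then show ?thesis by (simp add: cutoff_def)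
qed

section \<open>Branching of the inner laminate in one slab\<close>

text \<open>\<open>\<theta>\<close> is the ratio of consecutive distances to the boundary, and the
  next constant is \<open>\<rho> = 2 * \<theta>\<close>. The value satisfies three demands:
  \<open>\<theta>\<close> is above the maximum 1/4 of \<open>y * (1 - y)\<close>, so generation 0
  has no cutoff; \<open>2 * \<theta> < 1\<close> makes the interface areas summable;
  \<open>\<theta> < \<rho>^6\<close> makes the elastic costs summable up to
  \<open>p = 3\<close>.\<close>

abbreviation "\<theta> \<equiv> (9/20 :: real)"
abbreviation "\<rho> \<equiv> (9/10 :: real)"

abbreviation "rect L c \<equiv> {0..<L} \<times> {0..<c :: real}"

lemma emeasure_rect:
  fixes A :: "'a::euclidean_space set" and B :: "'b::euclidean_space set"
  assumes "A \<in> sets borel" "B \<in> sets borel"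
  shows "emeasure lborel (A \<times> B) = emeasure lborel A * emeasure lborel B"
  using lborel.emeasure_pair_measure_Times[of A lborel B] assms by (simp add: lborel_prod)

text \<open>In \<open>y * (1 - y)\<close> one factor is at least 1/2, so a product below
  \<open>b\<close> puts \<open>y\<close> within relative distance \<open>2 * b\<close> of an end.
  Two ends in each of the two directions give the factor 8.\<close>

lemma cutoff_lt1_measure:
  assumes "0 \<le> a" "a < b" "0 < L" "0 < c"
  shows "{z \<in> rect L c. cutoff a b L c z < 1} \<in> sets borel"
    "emeasure lborel {z \<in> rect L c. cutoff a b L c z < 1} \<le> ennreal (8 * b * L * c)"
proof -
  have m: "cutoff a b L c \<in> borel_measurable borel"
    by (intro borel_measurable_continuous_onI continuous_at_imp_continuous_on ballI has_derivative_continuous[OF cutoff_deriv])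
  have "rect L c \<inter> {z. cutoff a b L c z < 1} \<in> sets borel"
    using m by (intro sets.Int) (auto intro!: borel_Times)
  moreover have eq: "{z \<in> rect L c. cutoff a b L c z < 1} = rect L c \<inter> {z. cutoff a b L c z < 1}" by auto
  ultimately show "{z \<in> rect L c. cutoff a b L c z < 1} \<in> sets borel" by simp
  let ?N = "\<lambda>l. {0..2 * b * l} \<union> {l - 2 * b * l..l}"
  have near: "y \<in> ?N l" if "0 < l" "y \<in> {0..<l}" "y / l * (1 - y / l) < b" for y l :: real
  proof (rule ccontr)
    assume "y \<notin> ?N l"
    then have h: "2 * b < y / l" "2 * b < 1 - y / l" using that by (auto simp: field_simps)
    have "0 \<le> y / l" "y / l \<le> 1" using that by auto
    consider "y / l \<ge> 1/2" | "1 - y / l \<ge> 1/2" by linarith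
    then have "b \<le> y / l * (1 - y / l)"
    proof cases
      case 1
      then have "1/2 * (2 * b) \<le> y / l * (1 - y / l)" using h assms \<open>0 \<le> y / l\<close> by (intro mult_mono; linarith)
      then show ?thesis by simp
    next
      case 2
      then have "(2 * b) * (1/2) \<le> y / l * (1 - y / l)" using h assms \<open>0 \<le> y / l\<close> by (intro mult_mono) auto
      then show ?thesis by simp
    qed
    then show False using that by simp
  qed
  have Nm: "emeasure lborel (?N l) \<le> ennreal (4 * b * l)" if "0 < l" for l
  proof -
    have "emeasure lborel (?N l) \<le> emeasure lborel {0..2 * b * l} + emeasure lborel {l - 2 * b * l..l}"
      by (intro emeasure_subadditive) auto
    also have "\<dots> = ennreal (4 * b * l)" using that assms by (simp flip: ennreal_plus)
    finally show ?thesis .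
  qed
  have "{z \<in> rect L c. cutoff a b L c z < 1} \<subseteq> ?N L \<times> {0..<c} \<union> {0..<L} \<times> ?N c"
  proof
    fix z assume "z \<in> {z \<in> rect L c. cutoff a b L c z < 1}"
    then have z: "fst z \<in> {0..<L}" "snd z \<in> {0..<c}" "cutoff a b L c z < 1" by auto
    have "fst z / L * (1 - fst z / L) < b \<or> snd z / c * (1 - snd z / c) < b"
    proof (rule ccontr)
      assume "\<not> ?thesis"
      then have "cut a b (fst z / L) = 1" "cut a b (snd z / c) = 1" using cut_one[OF assms(2)] by auto
      then show False using z(3) by (simp add: cutoff_def)
    qed
    then show "z \<in> ?N L \<times> {0..<c} \<union> {0..<L} \<times> ?N c"
      using near[OF assms(3) z(1)] near[OF assms(4) z(2)] z(1,2) by (cases z) auto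
  qed
  then have "emeasure lborel {z \<in> rect L c. cutoff a b L c z < 1} \<le> emeasure lborel (?N L \<times> {0..<c} \<union> {0..<L} \<times> ?N c)"
    by (intro emeasure_mono) (auto intro!: borel_Times)
  also have "\<dots> \<le> emeasure lborel (?N L \<times> {0..<c}) + emeasure lborel ({0..<L} \<times> ?N c)"
    by (intro emeasure_subadditive) (auto intro!: borel_Times)
  also have "\<dots> \<le> ennreal (4 * b * L) * ennreal c + ennreal L * ennreal (4 * b * c)"
    using assms Nm by (intro add_mono) (subst emeasure_rect; auto intro!: mult_mono)+
  also have "\<dots> = ennreal (8 * b * L * c)" using assms by (simp add: algebra_simps flip: ennreal_plus ennreal_mult)
  finally show "emeasure lborel {z \<in> rect L c. cutoff a b L c z < 1} \<le> ennreal (8 * b * L * c)" .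
qed

text \<open>The cutoff of generation \<open>j\<close> is \<open>1\<close> at relative distance \<open>\<theta>\<^sup>j\<close> from the boundary and vanishes within
  relative distance \<open>\<theta>\<^sup>j\<^sup>+\<^sup>1\<close>; it vanishes identically for \<open>j = 0\<close>.\<close>

abbreviation gen :: "nat \<Rightarrow> real \<Rightarrow> real \<Rightarrow> real \<times> real \<Rightarrow> real" where
  "gen j \<equiv> cutoff (\<theta> ^ Suc j) (\<theta> ^ j)"

text \<open>A strip of generation \<open>j\<close> over the part of the rectangle near the boundary:
  its width is \<open>d / 2^j\<close> where the cutoff vanishes and shrinks to zero where the cutoff
  is 1. \<open>\<kappa>\<close> is the resting position of its left side and \<open>\<mu>\<close>
  the displacement of that side by the cutoff.\<close>

definition slab :: "real \<Rightarrow> real \<Rightarrow> real \<Rightarrow> nat \<Rightarrow> real \<Rightarrow> real \<Rightarrow> r3 set" where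
  "slab d L c j \<kappa> \<mu> = {(x, z). z \<in> rect L c \<and> \<kappa> + \<mu> * gen j L c z \<le> x \<and>
      x < \<kappa> + \<mu> * gen j L c z + d / 2^j * (1 - gen j L c z)}"

lemma gen_order: "0 \<le> \<theta> ^ Suc j" "\<theta> ^ Suc j < \<theta> ^ j" "\<theta> ^ j \<le> 1"
  by (auto simp: power_le_one)

text \<open>Since \<open>y * (1 - y)\<close> never reaches 9/20, the slab of generation 0 is the
  straight box from which branching starts.\<close>

lemma gen_0: "gen 0 L c z = 0"
proof -
  have "y * (1 - y) \<le> 9/20" for y :: real
  proof -
    have "0 \<le> (y - 1/2)\<^sup>2" by simp
    then show ?thesis by (simp add: power2_eq_square algebra_simps)
  qed
  then show ?thesis using cut_zero[of "9/20" 1] by (simp add: cutoff_def)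
qed

lemma gen_nested: "gen j L c z \<noteq> 0 \<Longrightarrow> gen (Suc j) L c z = 1"
  by (rule cutoff_nested[of _ _ "\<theta> ^ Suc j" "\<theta> ^ j"]) (auto simp: power_le_one)

lemma gen_mono: "gen j L c z \<le> gen (Suc j) L c z"
  using gen_nested[of j L c z] cutoff_range by (cases "gen j L c z = 0") auto

text \<open>The part of a slab that carries a single zigzag. It tapers to zero towards the boundary,
  where finer slabs take over, and towards the interior, where coarser lenses are in place.\<close>

definition lens :: "real \<Rightarrow> real \<Rightarrow> real \<Rightarrow> nat \<Rightarrow> real \<Rightarrow> real \<Rightarrow> r3 set" where
  "lens d L c j \<kappa> \<mu> = {(x, z). \<kappa> + \<mu> * gen j L c z \<le> x \<and>
      x < \<kappa> + \<mu> * gen j L c z + d / 2^j * (gen (Suc j) L c z - gen j L c z)}"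

text \<open>Where \<open>gen j\<close> is nonzero, \<open>gen (Suc j)\<close> equals 1: the two
  children are empty and the lens is the whole slab. Where \<open>gen j\<close> vanishes, the slab
  is \<open>[\<kappa>, \<kappa> + \<delta>)\<close> with \<open>\<delta> = d / 2^j\<close>; the lens
  takes the initial length \<open>\<delta> * g'\<close> and the rest is halved. The left ends of the
  halves are \<open>\<kappa> + \<delta> * g'\<close> and
  \<open>\<kappa> + \<delta>/2 + (\<delta>/2) * g'\<close>, which explains the parameters of the
  children.\<close>

lemma slab_split:
  assumes "0 < L" "0 < c" "0 < d"
  shows "slab d L c j \<kappa> \<mu> = lens d L c j \<kappa> \<mu> \<union>
      (slab d L c (Suc j) \<kappa> (d / 2^j) \<union> slab d L c (Suc j) (\<kappa> + d / 2^Suc j) (d / 2^Suc j))"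
    and "lens d L c j \<kappa> \<mu> \<inter> (slab d L c (Suc j) \<kappa> (d / 2^j) \<union> slab d L c (Suc j) (\<kappa> + d / 2^Suc j) (d / 2^Suc j)) = {}"
    and "slab d L c (Suc j) \<kappa> (d / 2^j) \<inter> slab d L c (Suc j) (\<kappa> + d / 2^Suc j) (d / 2^Suc j) = {}"
proof -
  let ?A = "lens d L c j \<kappa> \<mu>" and ?B = "slab d L c (Suc j) \<kappa> (d / 2^j)"
    and ?C = "slab d L c (Suc j) (\<kappa> + d / 2^Suc j) (d / 2^Suc j)" and ?S = "slab d L c j \<kappa> \<mu>"
  have "((x, z) \<in> ?S \<longleftrightarrow> (x, z) \<in> ?A \<or> (x, z) \<in> ?B \<or> (x, z) \<in> ?C) \<and> ((x, z) \<in> ?A \<longrightarrow> (x, z) \<notin> ?B \<and> (x, z) \<notin> ?C)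
     \<and> ((x, z) \<in> ?B \<longrightarrow> (x, z) \<notin> ?C)" for x z
  proof -
    define g where "g = gen j L c z"
    define g' where "g' = gen (Suc j) L c z"
    define \<delta> where "\<delta> = d / 2^j"
    define h where "h = \<delta> * g'"
    have \<delta>0: "0 < \<delta>" using assms by (simp add: \<delta>_def)
    have g': "0 \<le> g'" "g' \<le> 1" using cutoff_range by (auto simp: g'_def)
    have out: "g' \<noteq> 0 \<Longrightarrow> z \<in> rect L c"
      using cutoff_outside[OF gen_order(1,2) assms(1,2), of z "Suc j"] by (auto simp: g'_def)
    have out0: "g \<noteq> 0 \<Longrightarrow> z \<in> rect L c"
      using cutoff_outside[OF gen_order(1,2) assms(1,2), of z j] by (auto simp: g_def)
    have hb: "0 \<le> h" "h \<le> \<delta>" using g' \<delta>0 by (auto simp: h_def mult_left_le)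
    have d2: "d / 2 ^ Suc j = \<delta> / 2" by (simp add: \<delta>_def)
    have S: "(x, z) \<in> ?S \<longleftrightarrow> z \<in> rect L c \<and> \<kappa> + \<mu> * g \<le> x \<and> x < \<kappa> + \<mu> * g + \<delta> * (1 - g)"
      by (simp add: slab_def g_def \<delta>_def)
    have A: "(x, z) \<in> ?A \<longleftrightarrow> \<kappa> + \<mu> * g \<le> x \<and> x < \<kappa> + \<mu> * g + (h - \<delta> * g)"
      by (simp add: lens_def g_def g'_def \<delta>_def h_def right_diff_distrib)
    have mem: "(x, z) \<in> slab d L c k \<kappa> \<mu> \<longleftrightarrow> z \<in> rect L c \<and> \<kappa> + \<mu> * gen k L c z \<le> x \<and>
      x < \<kappa> + \<mu> * gen k L c z + d / 2^k * (1 - gen k L c z)" for k \<kappa> \<mu>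
      unfolding slab_def by (simp only: mem_Collect_eq prod.case)
    have hs: "\<delta> * g' = h" "\<delta> / 2 * g' = h / 2" "\<delta> / 2 * (1 - g') = (\<delta> - h) / 2" by (simp_all add: h_def algebra_simps)
    have B: "(x, z) \<in> ?B \<longleftrightarrow> z \<in> rect L c \<and> \<kappa> + h \<le> x \<and> x < \<kappa> + h + (\<delta> - h) / 2"
      unfolding mem d2 g'_def[symmetric] \<delta>_def[symmetric] hs ..
    have C: "(x, z) \<in> ?C \<longleftrightarrow> z \<in> rect L c \<and> \<kappa> + \<delta> / 2 + h / 2 \<le> x \<and> x < \<kappa> + \<delta> / 2 + h / 2 + (\<delta> - h) / 2"
      unfolding mem d2 g'_def[symmetric] \<delta>_def[symmetric] hs ..
    show ?thesis
    proof (cases "g = 0")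
      case True
      define P where "P = \<kappa> + h"
      define P' where "P' = \<kappa> + \<delta> / 2 + h / 2"
      define P'' where "P'' = \<kappa> + \<delta>"
      have ends: "P + (\<delta> - h) / 2 = P'" "P' + (\<delta> - h) / 2 = P''"
        by (simp_all add: P_def P'_def P''_def field_simps)
      have ord: "\<kappa> \<le> P" "P \<le> P'" "P' \<le> P''" using hb by (simp_all add: P_def P'_def P''_def)
      have S': "(x, z) \<in> ?S \<longleftrightarrow> z \<in> rect L c \<and> \<kappa> \<le> x \<and> x < P''" unfolding S True by (simp add: P''_def)
      have A': "(x, z) \<in> ?A \<longleftrightarrow> \<kappa> \<le> x \<and> x < P" unfolding A True by (simp add: P_def)
      have "h \<noteq> 0 \<Longrightarrow> z \<in> rect L c" using out by (auto simp: h_def)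
      then have "(x, z) \<in> ?A \<Longrightarrow> z \<in> rect L c" unfolding A' P_def by (cases "h = 0") auto
      then show ?thesis using ord unfolding S' A' B C P_def[symmetric] P'_def[symmetric] ends by (cases "z \<in> rect L c"; auto)
    next
      case False
      then have "g' = 1" using gen_nested[of j L c z] by (simp add: g_def g'_def)
      then have "h = \<delta>" by (simp add: h_def)
      then show ?thesis using out0[OF False] unfolding S A B C by (auto simp: right_diff_distrib)
    qed
  qed
  then have *: "(q \<in> ?S \<longleftrightarrow> q \<in> ?A \<or> q \<in> ?B \<or> q \<in> ?C) \<and> (q \<in> ?A \<longrightarrow> q \<notin> ?B \<and> q \<notin> ?C)
     \<and> (q \<in> ?B \<longrightarrow> q \<notin> ?C)" for q by (cases q) simp
  show "?S = ?A \<union> (?B \<union> ?C)" using * by blast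
  show "?A \<inter> (?B \<union> ?C) = {}" using * by blast
  show "?B \<inter> ?C = {}" using * by blast
qed

definition err_const :: real where "err_const = 2 * (8 * 70000\<^sup>2 + 4 * 70000)"

text \<open>A thickness \<open>d / 2^j\<close> tapering over relative distances of order
  \<open>\<theta>^j\<close> gives interface slopes of order \<open>d / (L * \<rho>^j)\<close> in
  \<open>s\<close> and \<open>d / (c * \<rho>^j)\<close> in \<open>t\<close>. The error is quadratic
  in the first and linear in the second, hence at most a multiple of
  \<open>\<Gamma> / (\<rho>^2)^j\<close>. The upper bound on \<open>\<Gamma>\<close> keeps the
  slopes bounded, so that the interfaces have area comparable to that of the layer beneath
  them.\<close>

lemma lens_adm:
  assumes d: "0 < d" "0 < L" "0 < c" "d \<le> c" and mu: "0 \<le> \<mu>" "\<mu> \<le> 2 * d / 2^j" and p: "0 \<le> p" and eps: "0 \<le> \<epsilon>"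
    and G: "\<Gamma> = (d / L)\<^sup>2 + d / c" "\<Gamma> \<le> (\<rho>\<^sup>2)^j"
  shows "adm p \<epsilon> mixT (lens d L c j \<kappa> \<mu>)
    ((err_const * (\<Gamma> / (\<rho>\<^sup>2)^j)) powr p * (d / 2^j * (8 * \<theta>^j * L * c)) + \<epsilon> * (32 * 280001 * (8 * \<theta>^j * L * c)))"
proof -
  \<comment> \<open>Dominates \<open>3600 / (99/400)^2\<close>, the largest constant that arises
    when the gaps between consecutive cutoff levels are written as multiples of
    \<open>\<theta>^j\<close>. It also yields \<open>280001 = 4 * M + 1\<close> as a bound for the
    slopes plus one.\<close>
  define M :: real where "M = 70000"
  define \<delta> where "\<delta> = d / 2^j"
  define A where "A = (\<theta>^Suc j)"
  define B where "B = (\<theta>^j)"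
  define A' where "A' = (\<theta>^Suc (Suc j))"
  have ord0: "0 \<le> A" "A < B" "B \<le> 1" "0 \<le> A'" "A' < A" "B > 0"
    unfolding A_def B_def A'_def by (auto simp: power_le_one)
  then have "A \<le> 1" by linarith
  note ord = ord0(1-5) this ord0(6)
  have BA: "B - A = 11/20 * B" "A - A' = 99/400 * B" by (auto simp: A_def B_def A'_def)
  define a0 where "a0 = M / B / L"
  define a1 where "a1 = M / B / c"
  define a2 where "a2 = M / B\<^sup>2 / L\<^sup>2"
  define a3 where "a3 = M / B\<^sup>2 / (L * c)"
  have M0: "M > 0" by (simp add: M_def)
  have nn: "0 \<le> a0" "0 \<le> a1" "0 \<le> a2" "0 \<le> a3" using ord d M0 by (auto simp: a0_def a1_def a2_def a3_def)
  have num: "60 / (11/20 * B) \<le> M / B" "180 / (11/20 * B)\<^sup>2 \<le> M / B\<^sup>2" "3600 / (11/20 * B)\<^sup>2 \<le> M / B\<^sup>2"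
    using ord by (simp_all add: M_def power2_eq_square field_simps)
  have num': "60 / (99/400 * B) \<le> M / B" "180 / (99/400 * B)\<^sup>2 \<le> M / B\<^sup>2" "3600 / (99/400 * B)\<^sup>2 \<le> M / B\<^sup>2"
    using ord by (simp_all add: M_def power2_eq_square field_simps)
  have c1: "\<bar>cutoff_s A B L c z\<bar> \<le> a0" "\<bar>cutoff_t A B L c z\<bar> \<le> a1" "\<bar>cutoff_ss A B L c z\<bar> \<le> a2" "\<bar>cutoff_st A B L c z\<bar> \<le> a3" for z
    unfolding a0_def a1_def a2_def a3_def
    using order_trans[OF cutoff_bounds(1)[of A B L c, unfolded BA] divide_right_mono[OF num(1)]]
      order_trans[OF cutoff_bounds(2)[of A B L c, unfolded BA] divide_right_mono[OF num(1)]]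
      order_trans[OF cutoff_bounds(3)[of A B L c, unfolded BA] divide_right_mono[OF num(2)]]
      order_trans[OF cutoff_bounds(4)[of A B L c, unfolded BA] divide_right_mono[OF num(3)]] ord d unfolding BA by auto
  have c2: "\<bar>cutoff_s A' A L c z\<bar> \<le> a0" "\<bar>cutoff_t A' A L c z\<bar> \<le> a1" "\<bar>cutoff_ss A' A L c z\<bar> \<le> a2" "\<bar>cutoff_st A' A L c z\<bar> \<le> a3" for z
    unfolding a0_def a1_def a2_def a3_def
    using order_trans[OF cutoff_bounds(1)[of A' A L c, unfolded BA] divide_right_mono[OF num'(1)]]
      order_trans[OF cutoff_bounds(2)[of A' A L c, unfolded BA] divide_right_mono[OF num'(1)]]
      order_trans[OF cutoff_bounds(3)[of A' A L c, unfolded BA] divide_right_mono[OF num'(2)]]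
      order_trans[OF cutoff_bounds(4)[of A' A L c, unfolded BA] divide_right_mono[OF num'(3)]] ord d unfolding BA by auto
  have \<delta>0: "0 < \<delta>" using d by (simp add: \<delta>_def)
  have mb: "\<bar>\<mu> * x\<bar> \<le> 2 * \<delta> * X" if "\<bar>x\<bar> \<le> X" for x X
    unfolding abs_mult using that mu by (intro mult_mono) (auto simp: \<delta>_def)
  have db: "\<bar>\<delta> * (x - y)\<bar> \<le> 2 * \<delta> * X" if "\<bar>x\<bar> \<le> X" "\<bar>y\<bar> \<le> X" for x y X
  proof -
    have "\<bar>\<delta> * (x - y)\<bar> \<le> \<delta> * (2 * X)" unfolding abs_mult using that \<delta>0 by (intro mult_mono) auto
    then show ?thesis by simp
  qed
  define Q where "Q = {z \<in> rect L c. cutoff A B L c z < 1}"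
  have Q: "Q \<in> sets borel" "emeasure lborel Q \<le> ennreal (8 * B * L * c)"
    unfolding Q_def using cutoff_lt1_measure[OF ord(1,2) d(2,3)] by auto
  have Qw: "\<delta> * (cutoff A' A L c z - cutoff A B L c z) = 0" if "z \<notin> Q" for z
  proof (cases "z \<in> rect L c")
    case True
    then have "cutoff A B L c z = 1" using that cutoff_range(2)[of A B L c z] by (auto simp: Q_def)
    moreover have "cutoff A' A L c z = 1" using gen_nested[of j L c z] calculation unfolding A_def A'_def B_def by simp
    ultimately show ?thesis by simp
  next
    case False
    then show ?thesis using cutoff_outside[of A B L c z] cutoff_outside[of A' A L c z] ord d by simp
  qed
  have wmon: "cutoff A B L c z \<le> cutoff A' A L c z" for z
    using gen_mono[of j L c z] unfolding A_def A'_def B_def by simp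
  let ?S = "2 * \<delta> * a0" and ?T = "2 * \<delta> * a1" and ?SS = "2 * \<delta> * a2" and ?ST = "2 * \<delta> * a3"
  have "adm p \<epsilon> mixT {(x, z). \<kappa> + \<mu> * cutoff A B L c z \<le> x \<and> x < \<kappa> + \<mu> * cutoff A B L c z + \<delta> * (cutoff A' A L c z - cutoff A B L c z)}
    ((2 * ?S\<^sup>2 + 2 * \<delta> * ?SS + ?T + 2 * ?T * ?S + 2 * \<delta> * ?ST) powr p * (\<delta> * (8 * B * L * c)) + \<epsilon> * (32 * (?S + ?T + 1) * (8 * B * L * c)))"
  proof (rule atom_adm[where \<beta>s="\<lambda>z. \<mu> * cutoff_s A B L c z" and \<beta>t="\<lambda>z. \<mu> * cutoff_t A B L c z" and \<beta>ss="\<lambda>z. \<mu> * cutoff_ss A B L c z"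
        and \<beta>st="\<lambda>z. \<mu> * cutoff_st A B L c z" and Q=Q
        and ws="\<lambda>z. \<delta> * (cutoff_s A' A L c z - cutoff_s A B L c z)" and wt="\<lambda>z. \<delta> * (cutoff_t A' A L c z - cutoff_t A B L c z)"
        and wss="\<lambda>z. \<delta> * (cutoff_ss A' A L c z - cutoff_ss A B L c z)" and wst="\<lambda>z. \<delta> * (cutoff_st A' A L c z - cutoff_st A B L c z)"])
    fix z
    have "((\<lambda>z. \<kappa> + \<mu> * cutoff A B L c z) has_derivative (\<lambda>h. 0 + \<mu> * (cutoff_s A B L c z * fst h + cutoff_t A B L c z * snd h))) (at z)"
      by (intro has_derivative_add has_derivative_mult_right has_derivative_const cutoff_deriv)
    then show "((\<lambda>z. \<kappa> + \<mu> * cutoff A B L c z) has_derivative (\<lambda>h. \<mu> * cutoff_s A B L c z * fst h + \<mu> * cutoff_t A B L c z * snd h)) (at z)"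
      by (simp add: algebra_simps)
    have "((\<lambda>z. \<mu> * cutoff_s A B L c z) has_derivative (\<lambda>h. \<mu> * (cutoff_ss A B L c z * fst h + cutoff_st A B L c z * snd h))) (at z)"
      by (intro has_derivative_mult_right cutoff_s_deriv)
    then show "((\<lambda>z. \<mu> * cutoff_s A B L c z) has_derivative (\<lambda>h. \<mu> * cutoff_ss A B L c z * fst h + \<mu> * cutoff_st A B L c z * snd h)) (at z)"
      by (simp add: algebra_simps)
    have "((\<lambda>z. \<delta> * (cutoff A' A L c z - cutoff A B L c z)) has_derivative (\<lambda>h. \<delta> * ((cutoff_s A' A L c z * fst h + cutoff_t A' A L c z * snd h) - (cutoff_s A B L c z * fst h + cutoff_t A B L c z * snd h)))) (at z)"
      by (intro has_derivative_mult_right has_derivative_diff cutoff_deriv)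
    then show "((\<lambda>z. \<delta> * (cutoff A' A L c z - cutoff A B L c z)) has_derivative
      (\<lambda>h. \<delta> * (cutoff_s A' A L c z - cutoff_s A B L c z) * fst h + \<delta> * (cutoff_t A' A L c z - cutoff_t A B L c z) * snd h)) (at z)"
      by (simp add: algebra_simps)
    have "((\<lambda>z. \<delta> * (cutoff_s A' A L c z - cutoff_s A B L c z)) has_derivative (\<lambda>h. \<delta> * ((cutoff_ss A' A L c z * fst h + cutoff_st A' A L c z * snd h) - (cutoff_ss A B L c z * fst h + cutoff_st A B L c z * snd h)))) (at z)"
      by (intro has_derivative_mult_right has_derivative_diff cutoff_s_deriv)
    then show "((\<lambda>z. \<delta> * (cutoff_s A' A L c z - cutoff_s A B L c z)) has_derivative
      (\<lambda>h. \<delta> * (cutoff_ss A' A L c z - cutoff_ss A B L c z) * fst h + \<delta> * (cutoff_st A' A L c z - cutoff_st A B L c z) * snd h)) (at z)"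
      by (simp add: algebra_simps)
    show "0 \<le> \<delta> * (cutoff A' A L c z - cutoff A B L c z)" using wmon[of z] \<delta>0 by simp
    have "cutoff A' A L c z - cutoff A B L c z \<le> 1" using cutoff_range(2)[of A' A L c z] cutoff_range(1)[of A B L c z] by linarith
    then show "\<delta> * (cutoff A' A L c z - cutoff A B L c z) \<le> \<delta>" using \<delta>0 by (simp add: mult_left_le)
  next
    fix z assume "z \<notin> Q" then show "\<delta> * (cutoff A' A L c z - cutoff A B L c z) = 0" by (rule Qw)
  qed (use Q p eps ord d in \<open>auto intro!: mb db c1 c2\<close>)
  moreover have "(2 * ?S\<^sup>2 + 2 * \<delta> * ?SS + ?T + 2 * ?T * ?S + 2 * \<delta> * ?ST) powr p \<le> (err_const * (\<Gamma> / (\<rho>\<^sup>2)^j)) powr p"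
    and "?S + ?T + 1 \<le> 280001"
  proof -
    define X where "X = d / L / \<rho>^j"
    define Y where "Y = d / c / \<rho>^j"
    have rj: "0 < \<rho>^j" "\<rho>^j \<le> 1" by (auto simp: power_le_one)
    have XY: "0 \<le> X" "0 \<le> Y" using d by (auto simp: X_def Y_def)
    \<comment> \<open>Thickness halves while the transition distance shrinks by
      \<open>\<theta>\<close>: each generation steepens the interfaces only by the factor
      \<open>1 / \<rho>\<close>.\<close>
    have "2^j * B = \<rho>^j" unfolding B_def by (simp flip: power_mult_distrib)
    then have dB: "\<delta> / B = d / \<rho>^j" unfolding \<delta>_def by (metis divide_divide_eq_left)
    have e0: "\<delta> * a0 = M * X" "\<delta> * a1 = M * Y"
    proof -
      have "\<delta> * a0 = \<delta> / B * (M / L)" "\<delta> * a1 = \<delta> / B * (M / c)" by (simp_all add: a0_def a1_def)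
      then show "\<delta> * a0 = M * X" "\<delta> * a1 = M * Y" unfolding dB X_def Y_def by (simp_all add: mult_ac)
    qed
    have "\<delta> * \<delta> / B\<^sup>2 = (d / \<rho>^j)\<^sup>2" unfolding dB[symmetric] by (simp add: power2_eq_square)
    then have e2: "\<delta> * \<delta> * a2 = M * X\<^sup>2" "\<delta> * \<delta> * a3 = M * (X * Y)"
    proof -
      assume *: "\<delta> * \<delta> / B\<^sup>2 = (d / \<rho>^j)\<^sup>2"
      have "\<delta> * \<delta> * a2 = \<delta> * \<delta> / B\<^sup>2 * (M / L\<^sup>2)" "\<delta> * \<delta> * a3 = \<delta> * \<delta> / B\<^sup>2 * (M / (L * c))"
        by (simp_all add: a2_def a3_def)
      then show "\<delta> * \<delta> * a2 = M * X\<^sup>2" "\<delta> * \<delta> * a3 = M * (X * Y)"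
        unfolding * X_def Y_def by (simp_all add: power_divide power2_eq_square mult_ac)
    qed
    define g where "g = \<Gamma> / (\<rho>\<^sup>2)^j"
    have rr: "(\<rho>\<^sup>2)^j = \<rho>^j * \<rho>^j" by (simp only: power2_eq_square power_mult_distrib)
    have X2: "X\<^sup>2 = (d/L)\<^sup>2 / (\<rho>\<^sup>2)^j" "Y\<^sup>2 = (d/c)\<^sup>2 / (\<rho>\<^sup>2)^j" unfolding X_def Y_def rr by (simp_all add: power2_eq_square)
    have dc: "0 \<le> d / c" "d / c \<le> 1" using d by auto
    then have dc2: "(d/c)\<^sup>2 \<le> d / c" unfolding power2_eq_square by (rule mult_left_le[rotated])
    have gg: "(d/L)\<^sup>2 / (\<rho>\<^sup>2)^j + (d/c) / (\<rho>\<^sup>2)^j = g" unfolding g_def G by (simp add: add_divide_distrib)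
    \<comment> \<open>The linear term would only need \<open>\<rho>^j\<close> in the denominator; it
      is weakened to the smaller \<open>(\<rho>^2)^j\<close> so that both terms combine to
      \<open>\<Gamma> / (\<rho>^2)^j\<close>.\<close>
    have t: "(d/c) / \<rho>^j \<le> (d/c) / (\<rho>\<^sup>2)^j"
      unfolding rr using dc rj by (intro divide_left_mono) (auto simp: mult_left_le)
    have t2: "(d/c)\<^sup>2 / (\<rho>\<^sup>2)^j \<le> (d/c) / (\<rho>\<^sup>2)^j" using dc2 by (intro divide_right_mono) auto
    have b1: "X\<^sup>2 + Y \<le> g" "X\<^sup>2 + Y\<^sup>2 \<le> g" unfolding X2 using gg t t2 by (auto simp: Y_def)
    have "0 \<le> (X - Y)\<^sup>2" by simp
    then have xy: "X * Y \<le> X\<^sup>2 + Y\<^sup>2" using mult_nonneg_nonneg[OF XY] unfolding power2_diff by linarith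
    have "2 * ?S\<^sup>2 + 2 * \<delta> * ?SS + ?T + 2 * ?T * ?S + 2 * \<delta> * ?ST
      = 8 * (\<delta> * a0)\<^sup>2 + 4 * (\<delta> * \<delta> * a2) + 2 * (\<delta> * a1) + 8 * ((\<delta> * a1) * (\<delta> * a0)) + 4 * (\<delta> * \<delta> * a3)"
      by (simp add: power2_eq_square)
    also have "\<dots> = (8 * M\<^sup>2 + 4 * M) * X\<^sup>2 + 2 * M * Y + (8 * M\<^sup>2 + 4 * M) * (X * Y)"
      unfolding e0 e2 by (simp add: power2_eq_square algebra_simps)
    also have "\<dots> \<le> (8 * M\<^sup>2 + 4 * M) * X\<^sup>2 + (8 * M\<^sup>2 + 4 * M) * Y + (8 * M\<^sup>2 + 4 * M) * (X * Y)"
      using XY M0 by (intro add_mono mult_right_mono) auto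
    also have "\<dots> = (8 * M\<^sup>2 + 4 * M) * (X\<^sup>2 + Y + X * Y)" by (simp add: algebra_simps)
    also have "\<dots> \<le> (8 * M\<^sup>2 + 4 * M) * (2 * g)" using b1 xy M0 by (intro mult_left_mono) auto
    also have "\<dots> = err_const * g" by (simp add: err_const_def M_def)
    finally have "2 * ?S\<^sup>2 + 2 * \<delta> * ?SS + ?T + 2 * ?T * ?S + 2 * \<delta> * ?ST \<le> err_const * g" .
    then show "(2 * ?S\<^sup>2 + 2 * \<delta> * ?SS + ?T + 2 * ?T * ?S + 2 * \<delta> * ?ST) powr p \<le> (err_const * (\<Gamma> / (\<rho>\<^sup>2)^j)) powr p"
      unfolding g_def[symmetric] using p nn \<delta>0 by (intro powr_mono2) auto
    have "g \<le> 1" unfolding g_def using G(2) by simp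
    then have "X\<^sup>2 \<le> 1" "Y\<^sup>2 \<le> 1" using b1(2) zero_le_power2[of X] zero_le_power2[of Y] by linarith+
    then have "X \<le> 1" "Y \<le> 1" using XY abs_square_le_1 by (metis abs_of_nonneg)+
    then have "2 * (\<delta> * a0) + 2 * (\<delta> * a1) + 1 \<le> 280001" unfolding e0 M_def by simp
    then show "?S + ?T + 1 \<le> 280001" by simp
  qed
  then have "(2 * ?S\<^sup>2 + 2 * \<delta> * ?SS + ?T + 2 * ?T * ?S + 2 * \<delta> * ?ST) powr p * (\<delta> * (8 * B * L * c)) + \<epsilon> * (32 * (?S + ?T + 1) * (8 * B * L * c))
    \<le> (err_const * (\<Gamma> / (\<rho>\<^sup>2)^j)) powr p * (\<delta> * (8 * B * L * c)) + \<epsilon> * (32 * 280001 * (8 * B * L * c))"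
    using ord d \<delta>0 eps by (intro add_mono mult_right_mono mult_left_mono) auto
  ultimately show ?thesis
    unfolding lens_def A_def[symmetric] B_def[symmetric] A'_def[symmetric] \<delta>_def[symmetric] by (rule adm_mono)
qed

lemma slab_measure:
  assumes d: "0 < d" "0 < L" "0 < c"
  shows "slab d L c j \<kappa> \<mu> \<in> sets borel" "emeasure lborel (slab d L c j \<kappa> \<mu>) \<le> ennreal (d / 2^j * (8 * \<theta>^j * L * c))"
proof -
  define g where "g = gen j L c"
  have g: "continuous_on UNIV g" unfolding g_def
    by (intro continuous_at_imp_continuous_on ballI has_derivative_continuous[OF cutoff_deriv])
  have eq: "slab d L c j \<kappa> \<mu> = (UNIV \<times> rect L c) \<inter> {p. \<kappa> + \<mu> * g (snd p) \<le> fst p} \<inter> {p. fst p < \<kappa> + \<mu> * g (snd p) + d / 2^j * (1 - g (snd p))}"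
    unfolding slab_def g_def by auto
  have "closed {p. \<kappa> + \<mu> * g (snd p) \<le> (fst p :: real)}"
    by (intro closed_Collect_le continuous_intros continuous_on_compose2[OF g]) auto
  moreover have "open {p. (fst p :: real) < \<kappa> + \<mu> * g (snd p) + d / 2^j * (1 - g (snd p))}"
    by (intro open_Collect_less continuous_intros continuous_on_compose2[OF g]) auto
  moreover have "(UNIV :: real set) \<times> rect L c \<in> sets borel" by (intro borel_Times) auto
  ultimately show m: "slab d L c j \<kappa> \<mu> \<in> sets borel" unfolding eq by (simp only: sets.Int borel_closed borel_open)
  let ?Q = "{z \<in> rect L c. g z < 1}"
  have Q: "?Q \<in> sets borel" "emeasure lborel ?Q \<le> ennreal (8 * \<theta>^j * L * c)"
    unfolding g_def using cutoff_lt1_measure[OF gen_order(1,2) d(2,3)] by auto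
  have "emeasure lborel (slab d L c j \<kappa> \<mu>) = (\<integral>\<^sup>+z. emeasure lborel ((\<lambda>x. (x, z)) -` slab d L c j \<kappa> \<mu>) \<partial>lborel)"
    by (rule slice_emeasure[OF m])
  also have "\<dots> \<le> (\<integral>\<^sup>+z. ennreal (d / 2^j) * indicator ?Q z \<partial>lborel)"
  proof (intro nn_integral_mono)
    fix z
    show "emeasure lborel ((\<lambda>x. (x, z)) -` slab d L c j \<kappa> \<mu>) \<le> ennreal (d / 2^j) * indicator ?Q z"
    proof (cases "z \<in> ?Q")
      case True
      have "(\<lambda>x. (x, z)) -` slab d L c j \<kappa> \<mu> = {\<kappa> + \<mu> * g z..<\<kappa> + \<mu> * g z + d / 2^j * (1 - g z)}"
        using True unfolding slab_def g_def by auto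
      moreover have "d / 2^j * (1 - g z) \<le> d / 2^j" "0 \<le> d / 2^j * (1 - g z)"
      proof -
        have b: "0 \<le> 1 - g z" "1 - g z \<le> 1" unfolding g_def by (simp_all add: cutoff_range)
        have e: "0 \<le> d / 2^j" using d by simp
        show "d / 2^j * (1 - g z) \<le> d / 2^j" by (rule mult_left_le[OF b(2) e])
        show "0 \<le> d / 2^j * (1 - g z)" by (rule mult_nonneg_nonneg[OF e b(1)])
      qed
      ultimately show ?thesis using True by (auto intro!: ennreal_leI)
    next
      case False
      have "1 \<le> g z" if "z \<in> rect L c" using that False by auto
      then have "z \<in> rect L c \<Longrightarrow> g z = 1"
        using cutoff_range(2)[of "\<theta> ^ Suc j" "\<theta> ^ j" L c z] unfolding g_def by force
      then have "(\<lambda>x. (x, z)) -` slab d L c j \<kappa> \<mu> = {}"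
        unfolding slab_def g_def[symmetric] by auto
      then show ?thesis by simp
    qed
  qed
  also have "\<dots> = ennreal (d / 2^j) * emeasure lborel ?Q" using Q by (subst nn_integral_cmult_indicator) auto
  also have "\<dots> \<le> ennreal (d / 2^j) * ennreal (8 * \<theta>^j * L * c)" using Q by (intro mult_left_mono) auto
  also have "\<dots> = ennreal (d / 2^j * (8 * \<theta>^j * L * c))" using d by (simp flip: ennreal_mult)
  finally show "emeasure lborel (slab d L c j \<kappa> \<mu>) \<le> ennreal (d / 2^j * (8 * \<theta>^j * L * c))" .
qed

lemma tame_mixT: "tame mixT" by (simp add: tame_def mixT_def)

text \<open>Unrolled, a slab of generation \<open>n\<close> consists of \<open>2^(k - n)\<close>
  lenses of each generation \<open>k < J\<close> and \<open>2^(J - n)\<close> slabs of generation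
  \<open>J\<close>, which are filled with the zero displacement. The common divisor
  \<open>2^n\<close> makes the bounds of two children add up to the one required of the
  parent.\<close>

lemma slab_adm:
  fixes d L c \<epsilon> p \<Gamma> :: real and J :: nat
  assumes d: "0 < d" "0 < L" "0 < c" "d \<le> c" and p: "0 \<le> p" "p \<le> 3" and eps: "0 \<le> \<epsilon>"
    and G: "\<Gamma> = (d / L)\<^sup>2 + d / c" "\<Gamma> \<le> (\<rho>\<^sup>2)^J"
  defines "atom \<equiv> \<lambda>k. (err_const * (\<Gamma> / (\<rho>\<^sup>2)^k)) powr p * (d / 2^k * (8 * \<theta>^k * L * c)) + \<epsilon> * (32 * 280001 * (8 * \<theta>^k * L * c))"
  assumes n: "n \<le> J" and mu: "0 \<le> \<mu>" "\<mu> \<le> 2 * d / 2^n"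
  shows "adm p \<epsilon> mixT (slab d L c n \<kappa> \<mu>) (((\<Sum>k=n..<J. 2^k * atom k) + 2^J * (4 * (d / 2^J * (8 * \<theta>^J * L * c)))) / 2^n)"
  using n mu
proof (induction n arbitrary: \<kappa> \<mu> rule: inc_induct)
  case base
  have "adm p \<epsilon> mixT (slab d L c J \<kappa> \<mu>) (4 * (d / 2^J * (8 * \<theta>^J * L * c)))"
    using slab_measure[OF d(1-3)] d p by (intro adm_trivial tame_mixT) auto
  then show ?case by simp
next
  case (step n)
  let ?Z = "2^J * (4 * (d / 2^J * (8 * \<theta>^J * L * c)))"
  let ?B = "(\<Sum>k=Suc n..<J. 2^k * atom k) + ?Z"
  have "(\<rho>\<^sup>2)^J \<le> (\<rho>\<^sup>2)^n" using step(2) by (intro power_decreasing) (auto simp: power2_eq_square)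
  then have A: "adm p \<epsilon> mixT (lens d L c n \<kappa> \<mu>) (atom n)"
    unfolding atom_def using G by (intro lens_adm d p eps step) auto
  have B: "adm p \<epsilon> mixT (slab d L c (Suc n) \<kappa> (d / 2^n)) (?B / 2^Suc n)"
    using d by (intro step.IH) auto
  have C: "adm p \<epsilon> mixT (slab d L c (Suc n) (\<kappa> + d / 2^Suc n) (d / 2^Suc n)) (?B / 2^Suc n)"
    using d by (intro step.IH) (auto simp: field_simps)
  have "adm p \<epsilon> mixT (slab d L c n \<kappa> \<mu>) (atom n + (?B / 2^Suc n + ?B / 2^Suc n))"
    unfolding slab_split(1)[OF d(2,3,1), of n \<kappa> \<mu>]
    by (intro adm_union A B C slab_split d)
  moreover have "atom n + (?B / 2^Suc n + ?B / 2^Suc n) = ((\<Sum>k=n..<J. 2^k * atom k) + ?Z) / 2^n"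
    using step(2) by (subst sum.atLeast_Suc_lessThan) (auto simp: field_simps)
  ultimately show ?case by simp
qed

text \<open>Branching continues as long as the error bound \<open>\<Gamma> / (\<rho>^2)^k\<close> is
  at most 1. The lenses of generation \<open>k\<close> together have relative volume of order
  \<open>\<theta>^k\<close>, so their elastic cost is of order
  \<open>\<Gamma>^p * (\<theta> / \<rho>^6)^k\<close> because \<open>p \<le> 3\<close>, and their
  interface area is of order \<open>(2 * \<theta>)^k = \<rho>^k\<close>. Both series are geometric.
  If \<open>\<Gamma> > 1\<close>, the zero displacement is good enough.\<close>

lemma inner_slab:
  fixes d L c \<epsilon> p \<Gamma> :: real
  assumes d: "0 < d" "0 < L" "0 < c" and p: "1 \<le> p" "p \<le> 3" and eps: "0 \<le> \<epsilon>"
    and G: "\<Gamma> = (d / L)\<^sup>2 + d / c"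
  shows "adm p \<epsilon> mixT ({0..<d} \<times> rect L c) ((200 * err_const^3 + 1000000000) * (d * L * c * \<Gamma> powr p + \<epsilon> * L * c))"
proof -
  have ec: "1 \<le> err_const" by (simp add: err_const_def)
  have G0: "0 < \<Gamma>" unfolding G using d by (intro add_pos_pos) auto
  have box: "{0..<d} \<times> rect L c = slab d L c 0 0 0" unfolding slab_def gen_0 by auto
  show ?thesis
  proof (cases "\<Gamma> \<le> 1")
    case False
    have "emeasure lborel ({0..<d} \<times> rect L c) = ennreal (d * (L * c))"
      using d by (simp add: emeasure_rect borel_Times ennreal_mult)
    then have "adm p \<epsilon> mixT ({0..<d} \<times> rect L c) (4 * (d * (L * c)))"
      using d p by (intro adm_trivial tame_mixT) (auto simp: borel_Times)
    moreover have "4 * (d * (L * c)) \<le> (200 * err_const^3 + 1000000000) * (d * L * c * \<Gamma> powr p + \<epsilon> * L * c)"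
    proof -
      have "1 \<le> \<Gamma> powr p" using False p by (intro ge_one_powr_ge_zero) auto
      then have "d * L * c * 1 \<le> d * L * c * \<Gamma> powr p" using d by (intro mult_left_mono) auto
      moreover have "0 \<le> \<epsilon> * L * c" using d eps by simp
      moreover have "4 \<le> 200 * err_const^3 + 1000000000" using ec by (simp add: add_increasing)
      ultimately have "4 * (d * L * c) \<le> (200 * err_const^3 + 1000000000) * (d * L * c * \<Gamma> powr p + \<epsilon> * L * c)"
        using mult_pos_pos[OF mult_pos_pos[OF d(1,2)] d(3)] by (intro mult_mono) linarith+
      then show ?thesis by simp
    qed
    ultimately show ?thesis by (rule adm_mono)
  next
    case True
    have "0 < d / L" using d by simp
    then have "d / c \<le> 1" using True unfolding G by (smt (verit) zero_le_power2)
    then have dc: "d \<le> c" using d by simp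
    obtain n0 where n0: "(\<rho>\<^sup>2)^n0 < \<Gamma>" using real_arch_pow_inv[OF G0, of "\<rho>\<^sup>2"] by (auto simp: power2_eq_square)
    have ex: "\<exists>n. (\<rho>\<^sup>2)^Suc n < \<Gamma>"
    proof -
      have "(\<rho>\<^sup>2)^Suc n0 \<le> (\<rho>\<^sup>2)^n0" by (intro power_decreasing) (auto simp: power2_eq_square)
      then show ?thesis using n0 by (meson le_less_trans)
    qed
    \<comment> \<open>The last generation with \<open>\<Gamma> \<le> (\<rho>^2)^J\<close>.\<close>
    define J where "J = (LEAST n. (\<rho>\<^sup>2)^Suc n < \<Gamma>)"
    have J1: "(\<rho>\<^sup>2)^Suc J < \<Gamma>" unfolding J_def using ex by (rule LeastI_ex)
    have J2: "\<Gamma> \<le> (\<rho>\<^sup>2)^J"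
    proof (cases J)
      case 0 then show ?thesis using True by simp
    next
      case (Suc k)
      then have "\<not> (\<rho>\<^sup>2)^Suc k < \<Gamma>" using not_less_Least[of k "\<lambda>n. (\<rho>\<^sup>2)^Suc n < \<Gamma>"] unfolding J_def by simp
      then show ?thesis using Suc by simp
    qed
    have pw: "(\<rho>^6)^k \<le> ((\<rho>\<^sup>2)^k) powr p" for k
    proof -
      have "(\<rho>^6)^k = ((\<rho>\<^sup>2)^k)^3" by (simp add: power_mult[symmetric] mult_ac del: power_divide)
      also have "\<dots> = ((\<rho>\<^sup>2)^k) powr 3" by (subst powr_numeral) auto
      also have "\<dots> \<le> ((\<rho>\<^sup>2)^k) powr p" using p by (intro powr_mono') (auto simp: power_le_one)
      finally show ?thesis .
    qed
    have th6: "\<theta>^k / (\<rho>^6)^k \<le> (17/20)^k" for k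
      unfolding power_divide[symmetric] by (intro power_mono) (simp_all add: eval_nat_numeral)
    \<comment> \<open>The unbranched remainder has relative volume of order
      \<open>\<theta>^J\<close>. Since \<open>\<theta> \<le> \<rho>^6\<close>, the stopping rule
      bounds \<open>\<theta>^(J+1)\<close> by \<open>\<Gamma>^p\<close>; undoing the extra
      generation costs \<open>1 / \<theta> = 20/9\<close>.\<close>
    have thJ: "\<theta>^J \<le> 20/9 * \<Gamma> powr p"
    proof -
      have "\<theta>^Suc J \<le> (\<rho>^6)^Suc J" by (intro power_mono) (simp_all add: eval_nat_numeral)
      also have "\<dots> \<le> ((\<rho>\<^sup>2)^Suc J) powr p" by (rule pw)
      also have "\<dots> \<le> \<Gamma> powr p" using J1 p by (intro powr_mono2) auto
      finally show ?thesis by simp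
    qed
    define V where "V = d * L * c * \<Gamma> powr p"
    have V0: "0 \<le> V" using d by (simp add: V_def)
    define atom where "atom = (\<lambda>k. (err_const * (\<Gamma> / (\<rho>\<^sup>2)^k)) powr p * (d / 2^k * (8 * \<theta>^k * L * c)) + \<epsilon> * (32 * 280001 * (8 * \<theta>^k * L * c)))"
    have at: "2^k * atom k \<le> 8 * err_const^3 * V * (17/20)^k + 256 * 280001 * (\<epsilon> * L * c) * \<rho>^k" for k
    proof -
      have "(err_const * (\<Gamma> / (\<rho>\<^sup>2)^k)) powr p = err_const powr p * (\<Gamma> powr p / ((\<rho>\<^sup>2)^k) powr p)"
        using ec G0 by (simp add: powr_mult powr_divide)
      also have "\<dots> \<le> err_const^3 * (\<Gamma> powr p / (\<rho>^6)^k)"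
      proof (intro mult_mono divide_left_mono pw)
        have "err_const powr p \<le> err_const powr 3" using ec p by (intro powr_mono) auto
        then show "err_const powr p \<le> err_const^3" using ec by (simp add: powr_numeral)
      qed (use ec in auto)
      finally have e: "(err_const * (\<Gamma> / (\<rho>\<^sup>2)^k)) powr p \<le> err_const^3 * (\<Gamma> powr p / (\<rho>^6)^k)" .
      have "2^k * atom k = (err_const * (\<Gamma> / (\<rho>\<^sup>2)^k)) powr p * (8 * d * L * c * \<theta>^k) + 256 * 280001 * (\<epsilon> * L * c) * (2^k * \<theta>^k)"
        by (simp add: atom_def distrib_left)
      also have "(2::real)^k * \<theta>^k = \<rho>^k" by (simp flip: power_mult_distrib)
      also have "(err_const * (\<Gamma> / (\<rho>\<^sup>2)^k)) powr p * (8 * d * L * c * \<theta>^k) \<le> err_const^3 * (\<Gamma> powr p / (\<rho>^6)^k) * (8 * d * L * c * \<theta>^k)"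
        using e d by (intro mult_right_mono) auto
      also have "\<dots> = 8 * err_const^3 * V * (\<theta>^k / (\<rho>^6)^k)" by (simp add: V_def)
      also have "\<dots> \<le> 8 * err_const^3 * V * (17/20)^k" using ec V0 by (intro mult_left_mono th6) auto
      finally show ?thesis by simp
    qed
    have geo: "(\<Sum>k=0..<J. x^k) \<le> 1 / (1 - x)" if "0 \<le> x" "x < 1" for x :: real
      using that sum_gp_strict[of x J] by (simp add: atLeast0LessThan divide_right_mono)
    have "(\<Sum>k=0..<J. 2^k * atom k) \<le> (\<Sum>k=0..<J. 8 * err_const^3 * V * (17/20)^k + 256 * 280001 * (\<epsilon> * L * c) * \<rho>^k)"
      by (intro sum_mono at)
    also have "\<dots> = 8 * err_const^3 * V * (\<Sum>k=0..<J. (17/20)^k) + 256 * 280001 * (\<epsilon> * L * c) * (\<Sum>k=0..<J. \<rho>^k)"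
      by (simp only: sum.distrib sum_distrib_left)
    also have "\<dots> \<le> 8 * err_const^3 * V * (20/3) + 256 * 280001 * (\<epsilon> * L * c) * 10"
      using geo[of "17/20"] geo[of \<rho>] ec V0 eps d by (intro add_mono mult_left_mono) auto
    finally have s1: "(\<Sum>k=0..<J. 2^k * atom k) \<le> 8 * err_const^3 * V * (20/3) + 256 * 280001 * (\<epsilon> * L * c) * 10" .
    have "2^J * (4 * (d / 2^J * (8 * \<theta>^J * L * c))) = 32 * (d * L * c) * \<theta>^J" by simp
    also have "\<dots> \<le> 32 * (d * L * c) * (20/9 * \<Gamma> powr p)" using d by (intro mult_left_mono thJ) auto
    also have "\<dots> = 640/9 * V" by (simp add: V_def)
    also have "\<dots> \<le> 72 * V" using V0 by simp
    finally have s2: "2^J * (4 * (d / 2^J * (8 * \<theta>^J * L * c))) \<le> 72 * V" .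
    have "adm p \<epsilon> mixT (slab d L c 0 0 0) (((\<Sum>k=0..<J. 2^k * atom k) + 2^J * (4 * (d / 2^J * (8 * \<theta>^J * L * c)))) / 2^0)"
      unfolding atom_def using d dc p eps G J2 by (intro slab_adm) auto
    moreover have "((\<Sum>k=0..<J. 2^k * atom k) + 2^J * (4 * (d / 2^J * (8 * \<theta>^J * L * c)))) / 2^0 \<le> (200 * err_const^3 + 1000000000) * (V + \<epsilon> * L * c)"
    proof -
      have e0: "0 \<le> \<epsilon> * L * c" using eps d by simp
      have "V \<le> err_const^3 * V" using ec V0 by (simp add: mult_le_cancel_right1)
      moreover have "0 \<le> err_const^3 * (\<epsilon> * L * c)" using ec e0 by simp
      moreover have "8 * err_const^3 * V * (20/3) = 160/3 * (err_const^3 * V)" by simp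
      moreover have "(200 * err_const^3 + 1000000000) * (V + \<epsilon> * L * c)
        = 200 * (err_const^3 * V) + 1000000000 * V + 200 * (err_const^3 * (\<epsilon> * L * c)) + 1000000000 * (\<epsilon> * L * c)"
        by (simp add: distrib_left distrib_right)
      moreover have "S + Z \<le> R" if "V \<le> W" "0 \<le> U" "A = 160/3 * W" "R = 200 * W + 1000000000 * V + 200 * U + 1000000000 * E"
        "S \<le> A + 256 * 280001 * E * 10" "Z \<le> 72 * V" "0 \<le> E" "0 \<le> V" for S Z R V W U A E :: real
        using that by linarith
      ultimately show ?thesis using s1 s2 e0 V0 unfolding power_0 div_by_1 by blast
    qed
    ultimately show ?thesis unfolding box V_def by (rule adm_mono)
  qed
qed

section \<open>The inner laminate in a brick\<close>

abbreviation "brick l L \<equiv> {0..<l} \<times> rect L (l :: real)"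

text \<open>Energy per volume of a brick, up to constants: the first term stems from lateral bending
  over the length \<open>l\<close>, the second is the optimal cost of inner branching over the
  length \<open>L\<close>.\<close>

definition rate :: "real \<Rightarrow> real \<Rightarrow> real \<Rightarrow> real \<Rightarrow> real" where
  "rate p \<epsilon> l L = (L / l) powr p + (\<epsilon> / L) powr (2 * p / (2 * p + 1))"

lemma brick_measure:
  assumes "0 \<le> l" "0 \<le> L"
  shows "brick l L \<in> sets borel" "emeasure lborel (brick l L) = ennreal (l * (L * l))"
  using assms by (simp_all add: emeasure_rect borel_Times ennreal_mult)

lemma interval_tiles:
  assumes "0 < (d::real)"
  shows "{0..<real n * d} = (\<Union>i<n. (+) (real i * d) ` {0..<d})"
proof (induction n)
  case (Suc n)
  have "{0..<real (Suc n) * d} = {0..<real n * d} \<union> {real n * d..<real n * d + d}"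
    using assms ivl_disj_un_two(3)[of 0 "real n * d" "real n * d + d"] by (simp add: distrib_right add.commute)
  also have "{real n * d..<real n * d + d} = (+) (real n * d) ` {0..<d}" by (simp add: add.commute)
  finally show ?case using Suc by (simp add: lessThan_Suc Un_commute)
qed simp

lemma interval_tiles_disjoint:
  assumes "0 < (d::real)" "x \<in> (+) (real i * d) ` {0..<d}" "x \<in> (+) (real j * d) ` {0..<d}"
  shows "i = j"
proof -
  have "x / d - real i \<ge> 0" "x / d - real i < 1" "x / d - real j \<ge> 0" "x / d - real j < 1"
    using assms by (auto simp: field_simps)
  then show ?thesis by linarith
qed

definition mix_const :: real where "mix_const = 200 * err_const^3 + 1000000000"

lemma mix_const_ge: "mix_const \<ge> 4"
  by (simp add: mix_const_def err_const_def)

lemma powr_sum_le: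
  fixes a b p :: real
  assumes "0 \<le> a" "0 \<le> b" "0 \<le> p" "p \<le> 3"
  shows "(a + b) powr p \<le> 8 * (a powr p + b powr p)"
proof -
  have "(a + b) powr p \<le> (2 * max a b) powr p" using assms by (intro powr_mono2) auto
  also have "\<dots> = 2 powr p * max a b powr p" using assms by (simp add: powr_mult)
  also have "\<dots> \<le> 2 powr 3 * (a powr p + b powr p)"
    using assms by (intro mult_mono powr_mono) (auto simp: max_def)
  finally show ?thesis by (simp add: powr_numeral)
qed

text \<open>The brick is stacked in \<open>x\<close> from \<open>n\<close> slabs of thickness
  \<open>d\<close> comparable to \<open>h\<close>. The energy per volume is of order
  \<open>(d / L)^(2p) + (d / l)^p + \<epsilon> / d\<close>. The choice of \<open>h\<close> equates
  the first and the last term, both becoming \<open>(\<epsilon> / L)^(2p / (2p + 1))\<close>, and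
  \<open>d \<le> L\<close> bounds the middle one by \<open>(L / l)^p\<close>. For
  \<open>\<epsilon> \<ge> L\<close> the rate is at least 1 and the zero displacement
  suffices.\<close>

lemma inner_brick:
  fixes l L \<epsilon> p :: real
  assumes L: "0 < L" "L \<le> l" and p: "1 \<le> p" "p \<le> 3" and eps: "0 < \<epsilon>"
  shows "adm p \<epsilon> mixT (brick l L) (10 * mix_const * (l * (L * l) * rate p \<epsilon> l L))"
proof (cases "\<epsilon> < L")
  case False
  then have "1 \<le> (\<epsilon> / L) powr (2 * p / (2 * p + 1))" using L p by (intro ge_one_powr_ge_zero) auto
  then have r: "1 \<le> rate p \<epsilon> l L" using powr_ge_zero[of "L / l" p] unfolding rate_def by linarith
  have "adm p \<epsilon> mixT (brick l L) (4 * (l * (L * l)))"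
    using L p brick_measure[of l L] by (intro adm_trivial tame_mixT) auto
  moreover have "4 * (l * (L * l)) \<le> 10 * mix_const * (l * (L * l) * rate p \<epsilon> l L)"
  proof -
    have "l * (L * l) * 1 \<le> l * (L * l) * rate p \<epsilon> l L" using r L by (intro mult_left_mono) auto
    moreover have "0 \<le> l * (L * l)" using L by simp
    moreover have "4 * V \<le> (10 * mix_const) * (V * r)" if "V * 1 \<le> V * r" "0 \<le> V" for V r
      using that mix_const_ge by (intro mult_mono) auto
    ultimately have "4 * (l * (L * l)) \<le> (10 * mix_const) * (l * (L * l) * rate p \<epsilon> l L)" by blast
    then show ?thesis by simp
  qed
  ultimately show ?thesis by (rule adm_mono)
next
  case True
  define x where "x = \<epsilon> / L"
  have x: "0 < x" "x < 1" using True eps by (auto simp: x_def)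
  define \<alpha> where "\<alpha> = 2 * p / (2 * p + 1)"
  define h where "h = L * x powr (1 / (2 * p + 1))"
  have xp: "0 < x powr (1 / (2 * p + 1))" "x powr (1 / (2 * p + 1)) \<le> 1" using x p by (auto intro: powr_le1)
  have h: "0 < h" "h \<le> L" unfolding h_def using xp L by (auto simp: mult_left_le)
  define n where "n = nat \<lceil>l / h\<rceil>"
  have lh: "1 \<le> l / h" using h L by simp
  then have n: "l / h \<le> real n" "real n \<le> l / h + 1" "0 < n" unfolding n_def by linarith+
  define d where "d = l / real n"
  have d: "0 < d" "d \<le> h" "real n * d = l" using n L h by (auto simp: d_def field_simps)
  have n2: "real n \<le> 2 * l / h" using n(2) lh by simp
  define \<Gamma> where "\<Gamma> = (d / L)\<^sup>2 + d / l"
  have S: "adm p \<epsilon> mixT ({0..<d} \<times> rect L l) (mix_const * (d * L * l * \<Gamma> powr p + \<epsilon> * L * l))"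
    unfolding mix_const_def using d L p eps by (intro inner_slab) (auto simp: \<Gamma>_def)
  have img: "(+) (real i * d, 0) ` ({0..<d} \<times> rect L l) = ((+) (real i * d) ` {0..<d}) \<times> rect L l" for i
  proof (intro set_eqI)
    fix q :: r3 show "q \<in> (+) (real i * d, 0) ` ({0..<d} \<times> rect L l) \<longleftrightarrow> q \<in> ((+) (real i * d) ` {0..<d}) \<times> rect L l"
      by (cases q) (simp only: in_translate mem_Times_iff diff_Pair fst_conv snd_conv diff_0_right)
  qed
  have "adm p \<epsilon> mixT (\<Union>i<n. (+) (real i * d, 0) ` ({0..<d} \<times> rect L l)) (\<Sum>i<n. mix_const * (d * L * l * \<Gamma> powr p + \<epsilon> * L * l))"
  proof (intro adm_UN adm_translate S)
    show "disjoint_family_on (\<lambda>i. (+) (real i * d, 0) ` ({0..<d} \<times> rect L l)) {..<n}"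
      unfolding disjoint_family_on_def
    proof (intro ballI impI equals0I)
      fix i j q assume "i \<noteq> j" "q \<in> (+) (real i * d, 0) ` ({0..<d} \<times> rect L l) \<inter> (+) (real j * d, 0) ` ({0..<d} \<times> rect L l)"
      then have "fst q \<in> (+) (real i * d) ` {0..<d}" "fst q \<in> (+) (real j * d) ` {0..<d}" unfolding img by (simp_all only: Int_iff mem_Times_iff)
      then show False using interval_tiles_disjoint[OF d(1)] \<open>i \<noteq> j\<close> by blast
    qed
  qed simp
  moreover have "(\<Union>i<n. (+) (real i * d, 0) ` ({0..<d} \<times> rect L l)) = brick l L"
  proof -
    have "(\<Union>i<n. (+) (real i * d, 0) ` ({0..<d} \<times> rect L l)) = (\<Union>i<n. (+) (real i * d) ` {0..<d}) \<times> rect L l"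
      unfolding img by blast
    then show ?thesis unfolding interval_tiles[OF d(1), symmetric] d(3) .
  qed
  moreover have "(\<Sum>i<n. mix_const * (d * L * l * \<Gamma> powr p + \<epsilon> * L * l)) \<le> 10 * mix_const * (l * (L * l) * rate p \<epsilon> l L)"
  proof -
    have "(\<Sum>i<n. mix_const * (d * L * l * \<Gamma> powr p + \<epsilon> * L * l)) = mix_const * ((real n * d) * L * l * \<Gamma> powr p + (real n * \<epsilon>) * L * l)"
      by (simp add: algebra_simps)
    also have "\<dots> = mix_const * (l * L * l * \<Gamma> powr p + (real n * \<epsilon>) * L * l)" unfolding d(3) ..
    also have "\<dots> \<le> mix_const * (l * L * l * (8 * (x powr \<alpha> + (L / l) powr p)) + (2 * l * x powr \<alpha>) * L * l)"
    proof -
      have "\<Gamma> \<le> (h / L)\<^sup>2 + L / l"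
        unfolding \<Gamma>_def using d h L by (intro add_mono power_mono divide_right_mono) auto
      then have "\<Gamma> powr p \<le> ((h / L)\<^sup>2 + L / l) powr p"
        using d L p by (intro powr_mono2) (auto simp: \<Gamma>_def)
      also have "\<dots> \<le> 8 * (((h / L)\<^sup>2) powr p + (L / l) powr p)" using p L by (intro powr_sum_le) auto
      also have "((h / L)\<^sup>2) powr p = x powr \<alpha>"
      proof -
        have "(h / L)\<^sup>2 = (x powr (1 / (2 * p + 1))) powr 2" using L xp by (simp add: h_def powr_numeral)
        also have "\<dots> = x powr (2 / (2 * p + 1))" by (simp add: powr_powr)
        finally show ?thesis by (simp add: powr_powr \<alpha>_def mult.commute)
      qed
      finally have 1: "\<Gamma> powr p \<le> 8 * (x powr \<alpha> + (L / l) powr p)" .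
      have "\<epsilon> / h = x / x powr (1 / (2 * p + 1))" using L by (simp add: h_def x_def)
      also have "\<dots> = x powr (1 - 1 / (2 * p + 1))" using x by (simp add: powr_diff)
      also have "1 - 1 / (2 * p + 1) = \<alpha>" using p by (simp add: \<alpha>_def field_simps)
      finally have eh: "\<epsilon> / h = x powr \<alpha>" .
      have "real n * \<epsilon> \<le> 2 * l / h * \<epsilon>" using n2 eps by (intro mult_right_mono) auto
      also have "\<dots> = 2 * l * x powr \<alpha>" by (simp flip: eh)
      finally have 2: "real n * \<epsilon> \<le> 2 * l * x powr \<alpha>" .
      show ?thesis using mix_const_ge L by (intro mult_left_mono add_mono mult_right_mono 1 2) auto
    qed
    also have "\<dots> = mix_const * (l * (L * l) * (10 * x powr \<alpha> + 8 * (L / l) powr p))" by (simp add: algebra_simps)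
    also have "\<dots> \<le> mix_const * (l * (L * l) * (10 * rate p \<epsilon> l L))"
      unfolding rate_def \<alpha>_def[symmetric] x_def[symmetric] using mix_const_ge L by (intro mult_left_mono) auto
    finally show ?thesis by simp
  qed
  ultimately show ?thesis by (auto elim: adm_mono)
qed

section \<open>Dyadic cells and the filling of sets\<close>

text \<open>Cells are defined as fibres of this map, which makes disjointness and covering
  immediate. All cells keep the proportions of the brick.\<close>

definition cell_index :: "real \<Rightarrow> real \<Rightarrow> nat \<Rightarrow> r3 \<Rightarrow> nat \<times> nat \<times> nat" where
  "cell_index l L k q = (nat \<lfloor>2^k * (fst q / l)\<rfloor>, nat \<lfloor>2^k * (fst (snd q) / L)\<rfloor>, nat \<lfloor>2^k * (snd (snd q) / l)\<rfloor>)"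

definition cell :: "real \<Rightarrow> real \<Rightarrow> nat \<Rightarrow> nat \<times> nat \<times> nat \<Rightarrow> r3 set" where
  "cell l L k i = {q \<in> brick l L. cell_index l L k q = i}"

definition cells :: "nat \<Rightarrow> (nat \<times> nat \<times> nat) set" where
  "cells k = {..<2^k} \<times> {..<2^k} \<times> {..<2^k}"

lemma floor_scaled:
  fixes u a :: real assumes "0 < a" "0 \<le> u"
  shows "nat \<lfloor>2^k * (u / a)\<rfloor> = i \<longleftrightarrow> a / 2^k * real i \<le> u \<and> u < a / 2^k * real i + a / 2^k"
proof -
  have "nat \<lfloor>2^k * (u / a)\<rfloor> = i \<longleftrightarrow> \<lfloor>2^k * (u / a)\<rfloor> = int i" using assms by (auto simp: nat_eq_iff)
  also have "\<dots> \<longleftrightarrow> real i \<le> 2^k * (u / a) \<and> 2^k * (u / a) < real i + 1" by (simp add: floor_eq_iff)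
  also have "\<dots> \<longleftrightarrow> a / 2^k * real i \<le> u \<and> u < a / 2^k * real i + a / 2^k"
    using assms by (simp add: field_simps)
  finally show ?thesis .
qed

lemma floor_parent: "0 \<le> w \<Longrightarrow> nat \<lfloor>2 * w\<rfloor> div 2 = nat \<lfloor>w\<rfloor>" for w :: real
proof -
  assume w: "0 \<le> w"
  have "2 * \<lfloor>w\<rfloor> \<le> \<lfloor>2 * w\<rfloor>" "\<lfloor>2 * w\<rfloor> < 2 * \<lfloor>w\<rfloor> + 2" by linarith+
  then have "\<lfloor>2 * w\<rfloor> div 2 = \<lfloor>w\<rfloor>" by linarith
  moreover have "nat \<lfloor>2 * w\<rfloor> div 2 = nat (\<lfloor>2 * w\<rfloor> div 2)" using nat_div_distrib[of "\<lfloor>2 * w\<rfloor>" 2] w by simp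
  ultimately show ?thesis by simp
qed

text \<open>Connects the fibre description with translated small bricks, the form in which energy
  bounds are available.\<close>

lemma cell_translate:
  assumes "0 < l" "0 < L" "(i, j, m) \<in> cells k"
  shows "cell l L k (i, j, m) = (+) (l / 2^k * real i, L / 2^k * real j, l / 2^k * real m) ` brick (l / 2^k) (L / 2^k)"
proof -
  have up: "x < a" if "x < a / 2^k * real i + a / 2^k" "i < 2^k" "0 < a" for x a :: real and i
  proof -
    have "real (Suc i) \<le> real (2^k)" using that(2) by (simp only: of_nat_le_iff Suc_le_eq)
    then have "real (Suc i) \<le> 2^k" by simp
    then have "a / 2^k * real (Suc i) \<le> a / 2^k * 2^k" using that(3) by (intro mult_left_mono) auto
    moreover have "a / 2^k * real (Suc i) = a / 2^k * real i + a / 2^k" by (simp add: distrib_left)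
    moreover have "a / 2^k * 2^k = a" by simp
    ultimately show ?thesis using that(1) by linarith
  qed
  have lo: "0 \<le> x" if "a / 2^k * real i \<le> x" "0 < a" for x a :: real and i
  proof -
    have "0 \<le> a / 2^k * real i" using that(2) by simp
    then show ?thesis using that(1) by linarith
  qed
  have coord: "0 \<le> u \<and> u < a \<and> nat \<lfloor>2^k * (u / a)\<rfloor> = i \<longleftrightarrow> a / 2^k * real i \<le> u \<and> u < a / 2^k * real i + a / 2^k"
    if "0 < a" "i < 2^k" for u a :: real and i
  proof
    assume "0 \<le> u \<and> u < a \<and> nat \<lfloor>2^k * (u / a)\<rfloor> = i"
    then show "a / 2^k * real i \<le> u \<and> u < a / 2^k * real i + a / 2^k"
      using floor_scaled[OF that(1), of u k i] by simp
  next
    assume *: "a / 2^k * real i \<le> u \<and> u < a / 2^k * real i + a / 2^k"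
    have "0 \<le> u" using * that(1) by (intro lo[of a i u]) auto
    moreover have "u < a" using * that by (intro up[of u a i]) auto
    ultimately show "0 \<le> u \<and> u < a \<and> nat \<lfloor>2^k * (u / a)\<rfloor> = i"
      using floor_scaled[OF that(1), of u k i] * by simp
  qed
  have ijm: "i < 2^k" "j < 2^k" "m < 2^k" using assms(3) by (auto simp: cells_def)
  have "(x, s, t) \<in> cell l L k (i, j, m) \<longleftrightarrow> (x, s, t) - (l / 2^k * real i, L / 2^k * real j, l / 2^k * real m) \<in> brick (l / 2^k) (L / 2^k)" for x s t
  proof -
    have "(x, s, t) \<in> cell l L k (i, j, m) \<longleftrightarrow> (0 \<le> x \<and> x < l \<and> nat \<lfloor>2^k * (x / l)\<rfloor> = i) \<and> (0 \<le> s \<and> s < L \<and> nat \<lfloor>2^k * (s / L)\<rfloor> = j)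
      \<and> (0 \<le> t \<and> t < l \<and> nat \<lfloor>2^k * (t / l)\<rfloor> = m)"
      unfolding cell_def cell_index_def mem_Collect_eq mem_Times_iff fst_conv snd_conv atLeastLessThan_iff prod.inject by blast
    also have "\<dots> \<longleftrightarrow> (l / 2^k * real i \<le> x \<and> x < l / 2^k * real i + l / 2^k) \<and> (L / 2^k * real j \<le> s \<and> s < L / 2^k * real j + L / 2^k)
      \<and> (l / 2^k * real m \<le> t \<and> t < l / 2^k * real m + l / 2^k)"
      by (simp only: coord[OF assms(1) ijm(1)] coord[OF assms(2) ijm(2)] coord[OF assms(1) ijm(3)])
    also have "\<dots> \<longleftrightarrow> (x, s, t) - (l / 2^k * real i, L / 2^k * real j, l / 2^k * real m) \<in> brick (l / 2^k) (L / 2^k)"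
    proof -
      have "(A \<le> y \<and> y < A + B) \<longleftrightarrow> (0 \<le> y - A \<and> y - A < B)" for A B y :: real by auto
      then show ?thesis by (simp only: diff_Pair mem_Times_iff fst_conv snd_conv atLeastLessThan_iff)
    qed
    finally show ?thesis .
  qed
  then have "q \<in> cell l L k (i, j, m) \<longleftrightarrow> q - (l / 2^k * real i, L / 2^k * real j, l / 2^k * real m) \<in> brick (l / 2^k) (L / 2^k)" for q
    by (cases q) (simp only:)
  then show ?thesis by (intro set_eqI) (simp only: in_translate)
qed

definition parent :: "nat \<times> nat \<times> nat \<Rightarrow> nat \<times> nat \<times> nat" where
  "parent = (\<lambda>(i, j, m). (i div 2, j div 2, m div 2))"

lemma cell_index_parent:
  assumes "0 < l" "0 < L" "q \<in> brick l L"
  shows "parent (cell_index l L (Suc k) q) = cell_index l L k q"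
proof -
  have "nat \<lfloor>2 ^ Suc k * (u / a)\<rfloor> div 2 = nat \<lfloor>2^k * (u / a)\<rfloor>" if "0 \<le> u" "0 < a" for u a :: real
  proof -
    have "2 ^ Suc k * (u / a) = 2 * (2^k * (u / a))" by simp
    moreover have "0 \<le> 2^k * (u / a)" using that by simp
    ultimately show ?thesis using floor_parent by presburger
  qed
  then show ?thesis using assms by (auto simp: parent_def cell_index_def)
qed

lemma cell_index_cells:
  assumes "0 < l" "0 < L" "q \<in> brick l L"
  shows "cell_index l L k q \<in> cells k"
proof -
  have "nat \<lfloor>2^k * (u / a)\<rfloor> < 2^k" if "0 \<le> u" "u < a" for u a :: real
  proof -
    have "2^k * (u / a) < 2^k * 1" using that by (intro mult_strict_left_mono) auto
    then have "\<lfloor>2^k * (u / a)\<rfloor> < 2^k" by (simp add: floor_less_iff)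
    then show ?thesis using that by (subst nat_less_iff) auto
  qed
  then show ?thesis using assms by (auto simp: cells_def cell_index_def)
qed

lemma card_children: "finite {i. parent i = q}" "card {i. parent i = q} \<le> 8"
proof -
  obtain a b c where q: "q = (a, b, c)" by (cases q)
  have sub: "{i. parent i = q} \<subseteq> {2*a, 2*a+1} \<times> {2*b, 2*b+1} \<times> {2*c, 2*c+1}"
  proof
    fix i assume "i \<in> {i. parent i = q}"
    moreover obtain x y z where i: "i = (x, y, z)" by (cases i)
    ultimately have "x div 2 = a" "y div 2 = b" "z div 2 = c" by (simp_all add: parent_def q)
    moreover have "x \<in> {2*a, 2*a+1}" if "x div 2 = a" for x a :: nat using that by (simp, presburger)
    ultimately show "i \<in> {2*a, 2*a+1} \<times> {2*b, 2*b+1} \<times> {2*c, 2*c+1}" unfolding i by blast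
  qed
  then show "finite {i. parent i = q}" by (rule finite_subset) auto
  have "card {i. parent i = q} \<le> card ({2*a, 2*a+1} \<times> {2*b, 2*b+1} \<times> {2*c, 2*c+1})"
    by (intro card_mono sub) auto
  also have "\<dots> = 8" by (simp add: card_cartesian_product)
  finally show "card {i. parent i = q} \<le> 8" .
qed

text \<open>A Whitney-type filling by the maximal dyadic cells inside \<open>R\<close>, from
  generation \<open>k0\<close> on. A cell that newly appears at generation \<open>k + 1\<close> has
  a parent that meets \<open>R\<close> without being contained in it, hence a parent in
  \<open>X k\<close>, and every parent has at most 8 children. After generation \<open>n\<close>,
  what is left of \<open>R\<close> is covered by the crossing cells of that generation and receives
  the zero displacement.\<close>

lemma fill:
  fixes l L p \<epsilon> H H0 :: real and e :: "nat \<Rightarrow> real"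
  assumes L: "0 < l" "0 < L" and p: "0 \<le> p" "p \<le> 3" and T: "tame T"
    and R: "R \<in> sets borel" "R \<subseteq> brick l L"
    and e: "\<And>k. k0 \<le> k \<Longrightarrow> adm p \<epsilon> T (brick (l / 2^k) (L / 2^k)) (e k)" "\<And>k. 0 \<le> e k"
    and X: "\<And>k i. k0 \<le> k \<Longrightarrow> i \<in> cells k \<Longrightarrow> \<not> cell l L k i \<subseteq> R \<Longrightarrow> cell l L k i \<inter> R \<noteq> {} \<Longrightarrow> i \<in> X k"
    and Xc: "\<And>k. k0 \<le> k \<Longrightarrow> finite (X k)" "\<And>k. k0 \<le> k \<Longrightarrow> real (card (X k)) \<le> H * 4^k"
    and H0: "real (card {i \<in> cells k0. cell l L k0 i \<subseteq> R}) \<le> H0"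
    and n: "k0 \<le> n"
  shows "adm p \<epsilon> T R (H0 * e k0 + (\<Sum>k=k0..<n. 8 * (H * 4^k) * e (Suc k)) + 4 * (H * 4^n * (l * (L * l) / 8^n)))"
proof -
  have fin: "finite (cells k)" for k by (simp add: cells_def)
  define I where "I = (\<lambda>k. {i \<in> cells k. cell l L k i \<subseteq> R})"
  define A where "A = (\<lambda>k. \<Union>i\<in>I k. cell l L k i)"
  have Ifin: "finite (I k)" for k unfolding I_def using fin by simp
  have ca: "adm p \<epsilon> T (cell l L k i) (e k)" if "k0 \<le> k" "i \<in> cells k" for k i
    using adm_translate[OF e(1)[OF that(1)]] cell_translate[OF L] that(2) by (cases i) auto
  have ne: "cell l L k i \<noteq> {}" if "i \<in> cells k" for k i
    using cell_translate[OF L] that L by (cases i) auto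
  have disj: "disjoint_family_on (cell l L k) S" for k S
    unfolding disjoint_family_on_def cell_def by auto
  have cp: "cell l L (Suc k) i \<subseteq> cell l L k (parent i)" for k i
    unfolding cell_def using cell_index_parent[OF L] by auto
  have mem: "q \<in> cell l L k (cell_index l L k q)" if "q \<in> brick l L" for q k
    using that by (simp add: cell_def)
  have A: "adm p \<epsilon> T (A n) (H0 * e k0 + (\<Sum>k=k0..<n. 8 * (H * 4^k) * e (Suc k)))" if "k0 \<le> n" for n
    using that
  proof (induction n rule: dec_induct)
    case base
    have "adm p \<epsilon> T (A k0) (\<Sum>i\<in>I k0. e k0)" unfolding A_def
      by (intro adm_UN ca disj Ifin) (auto simp: I_def)
    moreover have "(\<Sum>i\<in>I k0. e k0) \<le> H0 * e k0" using H0 e(2) by (simp add: I_def mult_right_mono)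
    ultimately show ?case by (auto elim: adm_mono)
  next
    case (step n)
    define N where "N = {i \<in> I (Suc n). parent i \<notin> I n}"
    have NX: "N \<subseteq> (\<Union>q\<in>X n. {i. parent i = q})"
    proof
      fix i assume i: "i \<in> N"
      then have ic: "i \<in> cells (Suc n)" "cell l L (Suc n) i \<subseteq> R" "parent i \<notin> I n" by (auto simp: N_def I_def)
      obtain q where q: "q \<in> cell l L (Suc n) i" using ne[OF ic(1)] by blast
      then have "q \<in> cell l L n (parent i) \<inter> R" using cp ic(2) by blast
      moreover have "parent i \<in> cells n" using ic(1) by (auto simp: cells_def parent_def)
      moreover then have "\<not> cell l L n (parent i) \<subseteq> R" using ic(3) by (simp add: I_def)
      ultimately have "parent i \<in> X n" using X[OF step(1)] by blast
      then show "i \<in> (\<Union>q\<in>X n. {i. parent i = q})" by simp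
    qed
    have "card N \<le> card (\<Union>q\<in>X n. {i. parent i = q})"
      by (intro card_mono NX finite_UN_I Xc(1) step card_children)
    also have "\<dots> \<le> (\<Sum>q\<in>X n. card {i. parent i = q})" by (intro card_UN_le Xc(1) step)
    also have "\<dots> \<le> (\<Sum>q\<in>X n. 8)" by (intro sum_mono card_children)
    finally have cN: "real (card N) \<le> 8 * (H * 4^n)" using Xc(2)[OF step(1)] by simp
    have "adm p \<epsilon> T (\<Union>i\<in>N. cell l L (Suc n) i) (\<Sum>i\<in>N. e (Suc n))"
      using step(1) by (intro adm_UN ca disj) (auto simp: N_def I_def fin)
    then have B: "adm p \<epsilon> T (\<Union>i\<in>N. cell l L (Suc n) i) (8 * (H * 4^n) * e (Suc n))"
      using mult_right_mono[OF cN e(2)[of "Suc n"]] by (auto elim: adm_mono)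
    have d: "A n \<inter> (\<Union>i\<in>N. cell l L (Suc n) i) = {}"
    proof (intro equals0I)
      fix q assume "q \<in> A n \<inter> (\<Union>i\<in>N. cell l L (Suc n) i)"
      then obtain i j where "i \<in> I n" "q \<in> cell l L n i" "j \<in> N" "q \<in> cell l L (Suc n) j" by (auto simp: A_def)
      then have "q \<in> cell l L n (parent j)" using cp by blast
      then have "i = parent j" using \<open>q \<in> cell l L n i\<close> by (simp add: cell_def)
      then show False using \<open>i \<in> I n\<close> \<open>j \<in> N\<close> by (simp add: N_def)
    qed
    have eq: "A (Suc n) = A n \<union> (\<Union>i\<in>N. cell l L (Suc n) i)"
    proof (intro equalityI subsetI)
      fix q assume "q \<in> A (Suc n)"
      then obtain i where i: "i \<in> I (Suc n)" "q \<in> cell l L (Suc n) i" by (auto simp: A_def)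
      show "q \<in> A n \<union> (\<Union>i\<in>N. cell l L (Suc n) i)"
      proof (cases "parent i \<in> I n")
        case True then show ?thesis using i cp[of n i] unfolding A_def by blast
      next
        case False then show ?thesis using i unfolding N_def by blast
      qed
    next
      fix q assume q: "q \<in> A n \<union> (\<Union>i\<in>N. cell l L (Suc n) i)"
      show "q \<in> A (Suc n)"
      proof (cases "q \<in> A n")
        case True
        then obtain i where i: "i \<in> I n" "q \<in> cell l L n i" by (auto simp: A_def)
        then have qb: "q \<in> brick l L" and ix: "cell_index l L n q = i" by (auto simp: cell_def)
        let ?j = "cell_index l L (Suc n) q"
        have "parent ?j = i" using cell_index_parent[OF L qb] ix by simp
        then have "cell l L (Suc n) ?j \<subseteq> R" using cp[of n ?j] i(1) by (auto simp: I_def)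
        then show ?thesis using mem[OF qb, of "Suc n"] cell_index_cells[OF L qb, of "Suc n"] unfolding A_def I_def by blast
      next
        case False then show ?thesis using q unfolding A_def N_def by blast
      qed
    qed
    show ?case unfolding eq using adm_union[OF step.IH B d] step(1) by (simp add: add.assoc)
  qed
  have cm: "emeasure lborel (cell l L n i) \<le> ennreal (l * (L * l) / 8^n)" "cell l L n i \<in> sets borel" if "i \<in> cells n" for i
  proof -
    obtain x y z where i: "i = (x, y, z)" by (cases i)
    define a where "a = (l / 2^n * real x, L / 2^n * real y, l / 2^n * real z)"
    have a: "cell l L n i = (+) a ` brick (l / 2^n) (L / 2^n)"
      using cell_translate[OF L, of x y z n] that unfolding i a_def by blast
    have eq: "l / 2^n * (L / 2^n * (l / 2^n)) = l * (L * l) / 8^n"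
    proof -
      have "(8::real)^n = 2^n * (2^n * 2^n)" by (simp flip: power_mult_distrib)
      then show ?thesis by simp
    qed
    have "0 \<le> l / 2^n" "0 \<le> L / 2^n" using L by auto
    note bm = brick_measure[OF this]
    show "emeasure lborel (cell l L n i) \<le> ennreal (l * (L * l) / 8^n)"
      unfolding a emeasure_translate[OF bm(1)] bm(2) eq by simp
    show "cell l L n i \<in> sets borel" unfolding a using bm(1) by (rule borel_translate)
  qed
  have sub: "R - A n \<subseteq> (\<Union>i\<in>X n \<inter> cells n. cell l L n i)"
  proof
    fix q assume q: "q \<in> R - A n"
    then have qb: "q \<in> brick l L" using R by auto
    let ?i = "cell_index l L n q"
    have ic: "?i \<in> cells n" by (rule cell_index_cells[OF L qb])
    then have "\<not> cell l L n ?i \<subseteq> R" using q mem[OF qb, of n] unfolding A_def I_def by blast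
    moreover have "cell l L n ?i \<inter> R \<noteq> {}" using q mem[OF qb, of n] by blast
    ultimately have "?i \<in> X n" using X[OF n ic] by blast
    then show "q \<in> (\<Union>i\<in>X n \<inter> cells n. cell l L n i)" using ic mem[OF qb, of n] by blast
  qed
  have V0: "0 \<le> l * (L * l) / 8^n" using L by auto
  have "emeasure lborel (R - A n) \<le> emeasure lborel (\<Union>i\<in>X n \<inter> cells n. cell l L n i)"
    using cm fin by (intro emeasure_mono sub) auto
  also have "\<dots> \<le> (\<Sum>i\<in>X n \<inter> cells n. emeasure lborel (cell l L n i))"
    using cm fin by (intro emeasure_subadditive_finite) auto
  also have "\<dots> \<le> (\<Sum>i\<in>X n \<inter> cells n. ennreal (l * (L * l) / 8^n))" by (intro sum_mono cm) auto
  also have "\<dots> = ennreal (real (card (X n \<inter> cells n)) * (l * (L * l) / 8^n))"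
    unfolding sum_constant ennreal_of_nat_eq_real_of_nat by (rule ennreal_mult[OF of_nat_0_le_iff V0, symmetric])
  also have "\<dots> \<le> ennreal (H * 4^n * (l * (L * l) / 8^n))"
  proof (intro ennreal_leI mult_right_mono V0)
    have "card (X n \<inter> cells n) \<le> card (X n)" using Xc(1)[OF n] by (intro card_mono) auto
    then show "real (card (X n \<inter> cells n)) \<le> H * 4^n" using Xc(2)[OF n] by linarith
  qed
  finally have m: "emeasure lborel (R - A n) \<le> ennreal (H * 4^n * (l * (L * l) / 8^n))" .
  have "0 \<le> H * 4^n" using Xc(2)[OF n] by (meson of_nat_0_le_iff order_trans)
  then have m0: "0 \<le> H * 4^n * (l * (L * l) / 8^n)" using V0 by (rule mult_nonneg_nonneg)
  show ?thesis
    using R T p m m0 by (intro adm_superset[OF A[OF n]]) (unfold A_def I_def, blast+)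
qed

section \<open>Scaling of the cost density and convergence of the filling\<close>

text \<open>Chosen so that \<open>2 * ratio = 2 powr (6/7)\<close>, where 6/7 is the value of
  \<open>2 * p / (2 * p + 1)\<close> at \<open>p = 3\<close>, its maximum on the admissible
  range.\<close>

definition ratio :: real where "ratio = 2 powr (-1/7)"

lemma ratio: "0 < ratio" "ratio < 1" "1 \<le> 2 * ratio"
proof -
  show "0 < ratio" by (simp add: ratio_def)
  have "2 powr (-1/7) < 2 powr (0::real)" by (rule powr_less_mono) auto
  then show "ratio < 1" by (simp add: ratio_def)
  have "2 powr (-1) \<le> 2 powr (-1/7 :: real)" by (rule powr_mono) auto
  then show "1 \<le> 2 * ratio" by (simp add: ratio_def powr_minus)
qed

text \<open>Under isotropic shrinking \<open>(L / l) powr p\<close> is invariant, and the other term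
  grows by \<open>2^k\<close> to the power \<open>2 * p / (2 * p + 1)\<close>, at most 6/7. The
  invariant term fits the same factor because \<open>2 * ratio\<close> is at least 1.\<close>

lemma rate_scale:
  assumes "0 < L" "0 < l" "0 < \<epsilon>" "1 \<le> p" "p \<le> 3"
  shows "rate p \<epsilon> (l / 2^k) (L / 2^k) \<le> rate p \<epsilon> l L * (2 * ratio)^k"
proof -
  define \<alpha> where "\<alpha> = 2 * p / (2 * p + 1)"
  have a: "\<alpha> \<le> 6/7" using assms by (simp add: \<alpha>_def field_simps)
  have "2 * ratio = 2 powr (6/7)" unfolding ratio_def using powr_add[of 2 1 "-1/7::real"] by simp
  then have r: "(2 * ratio)^k = 2 powr (6/7 * real k)" by (simp add: powr_powr powr_realpow[symmetric])
  have "(\<epsilon> / (L / 2^k)) powr \<alpha> = (\<epsilon> / L) powr \<alpha> * (2^k) powr \<alpha>"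
    using assms by (simp add: powr_mult[symmetric] del: powr_mult)
  also have "(2^k) powr \<alpha> = 2 powr (real k * \<alpha>)" by (simp add: powr_realpow[symmetric] powr_powr)
  also have "(\<epsilon> / L) powr \<alpha> * 2 powr (real k * \<alpha>) \<le> (\<epsilon> / L) powr \<alpha> * (2 * ratio)^k"
  proof -
    have "real k * \<alpha> \<le> 6/7 * real k" using mult_left_mono[OF a, of "real k"] by simp
    then show ?thesis unfolding r by (intro mult_left_mono powr_mono) auto
  qed
  finally have 1: "(\<epsilon> / (L / 2^k)) powr \<alpha> \<le> (\<epsilon> / L) powr \<alpha> * (2 * ratio)^k" .
  have "(L / l) powr p * 1 \<le> (L / l) powr p * (2 * ratio)^k"
    using one_le_power[OF ratio(3), of k] by (intro mult_left_mono) auto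
  moreover have "(L / 2^k) / (l / 2^k) = L / l" by simp
  ultimately show ?thesis using 1 unfolding rate_def \<alpha>_def[symmetric] distrib_right by simp
qed

lemma rate_nonneg: "0 \<le> rate p \<epsilon> l L" by (simp add: rate_def)

text \<open>At generation \<open>k + 1\<close> at most \<open>8 * H * 4^k\<close> cells are added,
  each of relative volume \<open>1 / 8^(k+1)\<close> and with density factor
  \<open>(2 * ratio)^(k+1)\<close>. The product is \<open>2 * H * ratio^(k+1)\<close>, a geometric
  series starting at \<open>k0\<close>. The unfilled volume decays like \<open>2^(-n)\<close> and
  disappears through \<open>adm_closure\<close>.\<close>

lemma fill_limit:
  fixes l L p \<epsilon> H H0 A :: real
  assumes L: "0 < l" "0 < L" and p: "0 \<le> p" "p \<le> 3" and T: "tame T"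
    and R: "R \<in> sets borel" "R \<subseteq> brick l L"
    and e: "\<And>k. k0 \<le> k \<Longrightarrow> adm p \<epsilon> T (brick (l / 2^k) (L / 2^k)) (l * (L * l) / 8^k * A * (2 * ratio)^k)" and A: "0 \<le> A"
    and X: "\<And>k i. k0 \<le> k \<Longrightarrow> i \<in> cells k \<Longrightarrow> \<not> cell l L k i \<subseteq> R \<Longrightarrow> cell l L k i \<inter> R \<noteq> {} \<Longrightarrow> i \<in> X k"
    and Xc: "\<And>k. k0 \<le> k \<Longrightarrow> finite (X k)" "\<And>k. k0 \<le> k \<Longrightarrow> real (card (X k)) \<le> H * 4^k"
    and H0: "real (card {i \<in> cells k0. cell l L k0 i \<subseteq> R}) \<le> H0"
  shows "adm p \<epsilon> T R (l * (L * l) * A * (H0 * (ratio / 4)^k0 + 2 * H * ratio^k0 / (1 - ratio)))"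
proof (rule adm_closure)
  fix \<eta> :: real assume \<eta>: "\<eta> > 0"
  define V where "V = l * (L * l)"
  have V: "0 < V" using L by (simp add: V_def)
  define e where "e = (\<lambda>k. V / 8^k * A * (2 * ratio)^k)"
  have e0: "0 \<le> e k" for k using V A ratio by (simp add: e_def)
  have "0 \<le> H * 4^k0" using Xc(2)[of k0] by (meson of_nat_0_le_iff order_refl order_trans)
  then have Hn: "0 \<le> H" using zero_le_mult_iff[of H "4^k0"] by (metis not_le zero_less_numeral zero_less_power)
  have "((\<lambda>n. 4 * H * V * (1/2)^n) \<longlongrightarrow> 4 * H * V * 0) sequentially"
    by (intro tendsto_intros LIMSEQ_realpow_zero) auto
  then have "eventually (\<lambda>n. 4 * H * V * (1/2)^n < \<eta>) sequentially"
    using \<eta> by (intro order_tendstoD(2)[of _ 0]) auto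
  then obtain n0 where n0: "\<And>n. n \<ge> n0 \<Longrightarrow> 4 * H * V * (1/2)^n < \<eta>" unfolding eventually_sequentially by blast
  define n where "n = max n0 k0"
  have "adm p \<epsilon> T R (H0 * e k0 + (\<Sum>k=k0..<n. 8 * (H * 4^k) * e (Suc k)) + 4 * (H * 4^n * (l * (L * l) / 8^n)))"
  proof (rule fill[OF L p T R _ e0 X Xc H0])
    show "adm p \<epsilon> T (brick (l / 2^k) (L / 2^k)) (e k)" if "k0 \<le> k" for k
      using assms(8)[OF that] by (simp add: e_def V_def)
  qed (simp_all add: n_def)
  moreover have "H0 * e k0 + (\<Sum>k=k0..<n. 8 * (H * 4^k) * e (Suc k)) + 4 * (H * 4^n * (l * (L * l) / 8^n))
     \<le> V * A * (H0 * (ratio / 4)^k0 + 2 * H * ratio^k0 / (1 - ratio)) + \<eta>"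
  proof -
    have q4: "(2 * ratio)^k / 8^k = (ratio / 4)^k" for k
    proof -
      have "2 * ratio / 8 = ratio / 4" by simp
      then show ?thesis by (simp only: power_divide[symmetric])
    qed
    have 1: "H0 * e k0 = V * A * (H0 * (ratio / 4)^k0)"
      unfolding e_def q4[symmetric] by simp
    have "8 * (H * 4^k) * e (Suc k) = 2 * H * V * A * ratio * ratio^k" for k
    proof -
      have "4 * (2 * ratio) / 8 = ratio" by simp
      then have "(4::real)^k * (2 * ratio)^k / 8^k = ratio^k" by (simp only: power_mult_distrib[symmetric] power_divide[symmetric])
      moreover have "8 * (H * 4^k) * e (Suc k) = 2 * H * V * A * ratio * ((4::real)^k * (2 * ratio)^k / 8^k)"
        by (simp add: e_def)
      ultimately show ?thesis by simp
    qed
    then have "(\<Sum>k=k0..<n. 8 * (H * 4^k) * e (Suc k)) = 2 * H * V * A * ratio * (\<Sum>k=k0..<n. ratio^k)"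
      by (simp only: sum_distrib_left)
    also have "\<dots> \<le> 2 * H * V * A * 1 * (ratio^k0 / (1 - ratio))"
    proof -
      have "(\<Sum>k=k0..<n. ratio^k) = (\<Sum>k=0..<n - k0. ratio^(k + k0))"
        using sum.shift_bounds_nat_ivl[of "\<lambda>k. ratio^k" 0 k0 "n - k0"] by (simp add: n_def)
      also have "\<dots> = ratio^k0 * (\<Sum>k<n - k0. ratio^k)" by (simp add: power_add sum_distrib_left mult.commute atLeast0LessThan)
      also have "\<dots> \<le> ratio^k0 * (1 / (1 - ratio))"
        using ratio sum_gp_strict[of ratio "n - k0"] by (intro mult_left_mono) (auto intro!: divide_right_mono)
      finally have "(\<Sum>k=k0..<n. ratio^k) \<le> ratio^k0 / (1 - ratio)" by simp
      moreover have "0 \<le> (\<Sum>k=k0..<n. ratio^k)" using ratio(1) by (intro sum_nonneg) simp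
      ultimately have "ratio * (\<Sum>k=k0..<n. ratio^k) \<le> 1 * (ratio^k0 / (1 - ratio))"
        using ratio(1,2) by (intro mult_mono[of ratio 1]) linarith+
      moreover have "0 \<le> 2 * H * V * A" using Hn V A by simp
      ultimately have "2 * H * V * A * (ratio * (\<Sum>k=k0..<n. ratio^k)) \<le> 2 * H * V * A * (1 * (ratio^k0 / (1 - ratio)))"
        by (rule mult_left_mono)
      then show ?thesis by (simp only: mult.assoc)
    qed
    finally have 2: "(\<Sum>k=k0..<n. 8 * (H * 4^k) * e (Suc k)) \<le> V * A * (2 * H * ratio^k0 / (1 - ratio))" by (simp only: mult_1_right times_divide_eq_right mult_ac)
    have "(4::real)^n / 8^n = (1/2)^n" by (simp flip: power_divide)
    moreover have "4 * (H * 4^n * (l * (L * l) / 8^n)) = 4 * H * V * (4^n / 8^n)" by (simp add: V_def)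
    ultimately have "4 * (H * 4^n * (l * (L * l) / 8^n)) = 4 * H * V * (1/2)^n" by (simp only:)
    then have 3: "4 * (H * 4^n * (l * (L * l) / 8^n)) \<le> \<eta>" using n0[of n] by (simp add: n_def)
    show ?thesis using 1 2 3 by (simp only: distrib_left)
  qed
  ultimately show "adm p \<epsilon> T R (l * (L * l) * A * (H0 * (ratio / 4)^k0 + 2 * H * ratio^k0 / (1 - ratio)) + \<eta>)"
    unfolding V_def by (rule adm_mono)
qed

section \<open>Cells crossed by a graph; the mixture below a profile\<close>

lemma card_near:
  fixes y r :: real assumes "0 \<le> r"
  shows "finite {j::nat. \<bar>real j - y\<bar> \<le> r}" "real (card {j::nat. \<bar>real j - y\<bar> \<le> r}) \<le> 2 * r + 1"
proof -
  have sub: "int ` {j::nat. \<bar>real j - y\<bar> \<le> r} \<subseteq> {\<lceil>y - r\<rceil>..\<lfloor>y + r\<rfloor>}"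
  proof
    fix i assume "i \<in> int ` {j::nat. \<bar>real j - y\<bar> \<le> r}"
    then obtain j where "i = int j" "\<bar>real j - y\<bar> \<le> r" by blast
    then show "i \<in> {\<lceil>y - r\<rceil>..\<lfloor>y + r\<rfloor>}" by (simp add: ceiling_le_iff le_floor_iff abs_le_iff)
  qed
  have "finite (int ` {j::nat. \<bar>real j - y\<bar> \<le> r})" by (rule finite_subset[OF sub]) simp
  then show "finite {j::nat. \<bar>real j - y\<bar> \<le> r}" by (rule finite_imageD) (simp add: inj_on_def)
  have "card {j::nat. \<bar>real j - y\<bar> \<le> r} = card (int ` {j::nat. \<bar>real j - y\<bar> \<le> r})"
    by (rule card_image[symmetric]) (simp add: inj_on_def)
  also have "\<dots> \<le> card {\<lceil>y - r\<rceil>..\<lfloor>y + r\<rfloor>}" by (intro card_mono sub) simp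
  also have "\<dots> = nat (\<lfloor>y + r\<rfloor> - \<lceil>y - r\<rceil> + 1)" by simp
  finally have c: "card {j::nat. \<bar>real j - y\<bar> \<le> r} \<le> nat (\<lfloor>y + r\<rfloor> - \<lceil>y - r\<rceil> + 1)" .
  have "real_of_int (\<lfloor>y + r\<rfloor> - \<lceil>y - r\<rceil> + 1) \<le> 2 * r + 1"
    using of_int_floor_le[of "y + r"] le_of_int_ceiling[of "y - r"] unfolding of_int_add of_int_diff of_int_1 by linarith
  then have "real (nat (\<lfloor>y + r\<rfloor> - \<lceil>y - r\<rceil> + 1)) \<le> 2 * r + 1"
  proof (cases "0 \<le> \<lfloor>y + r\<rfloor> - \<lceil>y - r\<rceil> + 1")
    case True
    from \<open>real_of_int (\<lfloor>y + r\<rfloor> - \<lceil>y - r\<rceil> + 1) \<le> 2 * r + 1\<close> show ?thesis by (simp only: of_nat_nat[OF True])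
  next
    case False
    then have "nat (\<lfloor>y + r\<rfloor> - \<lceil>y - r\<rceil> + 1) = 0" by (simp only: nat_eq_iff2)
    then show ?thesis using assms by simp
  qed
  then show "real (card {j::nat. \<bar>real j - y\<bar> \<le> r}) \<le> 2 * r + 1"
    using order_trans[OF of_nat_mono[OF c]] by blast
qed

text \<open>The middle index counts cells in the \<open>s\<close> direction; \<open>(i, m)\<close>
  names the column over the \<open>(x, t)\<close> square, and \<open>y\<close> gives the height of a
  graph in units of cells.\<close>

definition near_graph :: "(nat \<times> nat) set \<Rightarrow> (nat \<times> nat \<Rightarrow> real) \<Rightarrow> real \<Rightarrow> (nat \<times> nat \<times> nat) set" where
  "near_graph P y r = {(i, j, m). (i, m) \<in> P \<and> \<bar>real j - y (i, m)\<bar> \<le> r}"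

lemma near_graph_card:
  assumes "finite P" "0 \<le> r"
  shows "finite (near_graph P y r)" "real (card (near_graph P y r)) \<le> real (card P) * (2 * r + 1)"
proof -
  have eq: "near_graph P y r = (\<Union>c\<in>P. (\<lambda>j. (fst c, j, snd c)) ` {j. \<bar>real j - y c\<bar> \<le> r})"
    unfolding near_graph_def by force
  have f: "finite ((\<lambda>j. (fst c, j, snd c)) ` {j. \<bar>real j - y c\<bar> \<le> r})" for c :: "nat \<times> nat"
    using card_near(1)[OF assms(2)] by simp
  show "finite (near_graph P y r)" unfolding eq using f assms(1) by (intro finite_UN_I)
  have "card (near_graph P y r) \<le> (\<Sum>c\<in>P. card ((\<lambda>j. (fst c, j, snd c)) ` {j. \<bar>real j - y c\<bar> \<le> r}))"
    unfolding eq by (rule card_UN_le[OF assms(1)])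
  then have "real (card (near_graph P y r)) \<le> (\<Sum>c\<in>P. real (card ((\<lambda>j. (fst c, j, snd c)) ` {j. \<bar>real j - y c\<bar> \<le> r})))"
    by (simp only: of_nat_sum[symmetric] of_nat_le_iff)
  also have "\<dots> \<le> (\<Sum>c\<in>P. 2 * r + 1)"
  proof (intro sum_mono)
    fix c :: "nat \<times> nat"
    have "card ((\<lambda>j. (fst c, j, snd c)) ` {j. \<bar>real j - y c\<bar> \<le> r}) \<le> card {j::nat. \<bar>real j - y c\<bar> \<le> r}"
      by (rule card_image_le[OF card_near(1)[OF assms(2)]])
    then show "real (card ((\<lambda>j. (fst c, j, snd c)) ` {j. \<bar>real j - y c\<bar> \<le> r})) \<le> 2 * r + 1"
      using card_near(2)[OF assms(2), of "y c"] by linarith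
  qed
  also have "\<dots> = real (card P) * (2 * r + 1)" by simp
  finally show "real (card (near_graph P y r)) \<le> real (card P) * (2 * r + 1)" .
qed

text \<open>The height profile of an outer cell over the \<open>(x, t)\<close> square: equal to 1
  away from the edges, with a boundary layer of relative width of order \<open>b\<close>.\<close>

definition prof :: "real \<Rightarrow> real \<Rightarrow> real \<times> real \<Rightarrow> real" where
  "prof b l = cutoff (b / 2) b l l"

lemma prof_lip:
  assumes "0 < b" "b \<le> 1" "0 < l"
  shows "(240 / b / l)-lipschitz_on UNIV (prof b l)"
proof -
  have "(60 / (b - b / 2) / l + 60 / (b - b / 2) / l)-lipschitz_on UNIV (prof b l)"
    unfolding prof_def using assms by (intro lipschitz_2d[OF cutoff_deriv] cutoff_bounds) auto
  moreover have "60 / (b - b / 2) / l + 60 / (b - b / 2) / l = 240 / b / l" using assms by (simp add: field_simps)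
  ultimately show ?thesis by simp
qed

lemma cell_bounds:
  assumes "0 < l" "0 < L" "q \<in> cell l L k (i, j, m)"
  shows "\<bar>fst q - l / 2^k * real i\<bar> \<le> l / 2^k" "\<bar>snd (snd q) - l / 2^k * real m\<bar> \<le> l / 2^k"
    "real j \<le> 2^k * (fst (snd q) / L)" "2^k * (fst (snd q) / L) < real j + 1"
    "real i \<le> 2^k * (fst q / l)" "2^k * (fst q / l) < real i + 1"
    "real m \<le> 2^k * (snd (snd q) / l)" "2^k * (snd (snd q) / l) < real m + 1"
proof -
  have q: "0 \<le> fst q" "0 \<le> fst (snd q)" "0 \<le> snd (snd q)"
    using assms(3) unfolding cell_def mem_Collect_eq mem_Times_iff atLeastLessThan_iff by blast+
  have n: "nat \<lfloor>2^k * (fst q / l)\<rfloor> = i" "nat \<lfloor>2^k * (fst (snd q) / L)\<rfloor> = j" "nat \<lfloor>2^k * (snd (snd q) / l)\<rfloor> = m"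
    using assms(3) unfolding cell_def mem_Collect_eq cell_index_def prod.inject by blast+
  have fl: "real n \<le> w \<and> w < real n + 1" if "nat \<lfloor>w\<rfloor> = n" "0 \<le> w" for w :: real and n
  proof -
    have "int (nat \<lfloor>w\<rfloor>) = \<lfloor>w\<rfloor>" using that(2) by simp
    then have "real n = of_int \<lfloor>w\<rfloor>" using that(1) by (metis of_int_of_nat_eq)
    then show ?thesis using floor_correct[of w] by simp
  qed
  show "real j \<le> 2^k * (fst (snd q) / L)" "2^k * (fst (snd q) / L) < real j + 1"
    "real i \<le> 2^k * (fst q / l)" "2^k * (fst q / l) < real i + 1"
    "real m \<le> 2^k * (snd (snd q) / l)" "2^k * (snd (snd q) / l) < real m + 1"
    using fl[OF n(1)] fl[OF n(2)] fl[OF n(3)] q assms(1,2) by simp_all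
  show "\<bar>fst q - l / 2^k * real i\<bar> \<le> l / 2^k"
    using iffD1[OF floor_scaled[OF assms(1) q(1)] n(1)] by (simp only: abs_le_iff) linarith
  show "\<bar>snd (snd q) - l / 2^k * real m\<bar> \<le> l / 2^k"
    using iffD1[OF floor_scaled[OF assms(1) q(3)] n(3)] by (simp only: abs_le_iff) linarith
qed

lemma prof_cell:
  assumes "0 < b" "b \<le> 1" "0 < l" "0 < L" "q \<in> cell l L k (i, j, m)"
  shows "\<bar>prof b l (fst q, snd (snd q)) - prof b l (l / 2^k * real i, l / 2^k * real m)\<bar> \<le> 480 / b / 2^k"
proof -
  have "\<bar>prof b l (fst q, snd (snd q)) - prof b l (l / 2^k * real i, l / 2^k * real m)\<bar>
      \<le> 240 / b / l * norm (fst q - l / 2^k * real i, snd (snd q) - l / 2^k * real m)"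
    using lipschitz_onD[OF prof_lip[OF assms(1-3)], of "(fst q, snd (snd q))" "(l / 2^k * real i, l / 2^k * real m)"]
    by (simp add: dist_norm)
  also have "\<dots> \<le> 240 / b / l * (l / 2^k + l / 2^k)"
  proof (intro mult_left_mono)
    have "norm (fst q - l / 2^k * real i, snd (snd q) - l / 2^k * real m)
        \<le> norm (fst q - l / 2^k * real i) + norm (snd (snd q) - l / 2^k * real m)"
      by (rule norm_Pair_le)
    then show "norm (fst q - l / 2^k * real i, snd (snd q) - l / 2^k * real m) \<le> l / 2^k + l / 2^k"
      using cell_bounds(1,2)[OF assms(3,4,5)] unfolding real_norm_def by linarith
  qed (use assms in auto)
  also have "\<dots> = 480 / b / 2^k" using assms by simp
  finally show ?thesis .
qed

text \<open>Inside one cell of generation \<open>k\<close> the profile varies by at most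
  \<open>480 / b / 2^k\<close> from its value at the corner of the column. Both the graph and the
  cell heights scale with \<open>L\<close>, so in units of cell height this is
  \<open>480 / b\<close>, whatever the aspect ratio. The additional 1 accounts for the height of the
  cell itself.\<close>

lemma crossing:
  assumes b: "0 < b" "b \<le> 1" "0 < l" "0 < L" and g: "0 \<le> \<gamma>" "\<gamma> \<le> 1"
    and q: "q \<in> cell l L k (i, j, m)" "fst (snd q) < L * (\<gamma> * prof b l (fst q, snd (snd q)))"
    and r: "r \<in> cell l L k (i, j, m)" "L * (\<gamma> * prof b l (fst r, snd (snd r))) \<le> fst (snd r)"
  shows "\<bar>real j - 2^k * (\<gamma> * prof b l (l / 2^k * real i, l / 2^k * real m))\<bar> \<le> 480 / b + 1"
proof -
  define c where "c = prof b l (l / 2^k * real i, l / 2^k * real m)"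
  define K where "K = 480 / b"
  have K: "0 < K" using b by (simp add: K_def)
  have close: "\<bar>2^k * (\<gamma> * prof b l (fst q, snd (snd q))) - 2^k * (\<gamma> * c)\<bar> \<le> K" if "q \<in> cell l L k (i, j, m)" for q
  proof -
    have "\<bar>prof b l (fst q, snd (snd q)) - c\<bar> \<le> K / 2^k" using prof_cell[OF b that] by (simp add: c_def K_def)
    then have "2^k * (\<gamma> * \<bar>prof b l (fst q, snd (snd q)) - c\<bar>) \<le> 2^k * (1 * (K / 2^k))"
      using g K by (intro mult_left_mono mult_mono) auto
    moreover have "\<bar>2^k * (\<gamma> * prof b l (fst q, snd (snd q))) - 2^k * (\<gamma> * c)\<bar> = 2^k * (\<gamma> * \<bar>prof b l (fst q, snd (snd q)) - c\<bar>)"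
      using g by (simp add: abs_mult flip: right_diff_distrib)
    ultimately show ?thesis by simp
  qed
  have "fst (snd q) / L < \<gamma> * prof b l (fst q, snd (snd q))" using q(2) b by (simp add: divide_less_eq mult.commute)
  then have "2^k * (fst (snd q) / L) < 2^k * (\<gamma> * prof b l (fst q, snd (snd q)))" by (rule mult_strict_left_mono) simp
  then have 1: "real j < 2^k * (\<gamma> * c) + K" using close[OF q(1)] cell_bounds(3)[OF b(3,4) q(1)] by linarith
  have "\<gamma> * prof b l (fst r, snd (snd r)) \<le> fst (snd r) / L" using r(2) b by (simp add: le_divide_eq mult.commute)
  then have "2^k * (\<gamma> * prof b l (fst r, snd (snd r))) \<le> 2^k * (fst (snd r) / L)" by (rule mult_left_mono) simp
  then have 2: "2^k * (\<gamma> * c) - K < real j + 1" using close[OF r(1)] cell_bounds(4)[OF b(3,4) r(1)] by linarith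
  show ?thesis using 1 2 K unfolding c_def[symmetric] K_def[symmetric] by (simp add: abs_le_iff)
qed

definition below :: "real \<Rightarrow> real \<Rightarrow> real \<Rightarrow> real \<Rightarrow> r3 set" where
  "below b l L \<gamma> = {q \<in> brick l L. fst (snd q) < L * (\<gamma> * prof b l (fst q, snd (snd q)))}"

lemma prof_continuous: "continuous_on UNIV (prof b l)"
  unfolding prof_def
  by (intro continuous_at_imp_continuous_on ballI has_derivative_continuous[OF cutoff_deriv])

lemma below_borel:
  assumes "0 < l" "0 < L" shows "below b l L \<gamma> \<in> sets borel"
proof -
  have "open {q :: r3. fst (snd q) < L * (\<gamma> * prof b l (fst q, snd (snd q)))}"
    by (intro open_Collect_less continuous_intros continuous_on_compose2[OF prof_continuous]) auto
  moreover have "brick l L \<in> sets borel" using assms by (intro brick_measure) auto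
  moreover have "below b l L \<gamma> = brick l L \<inter> {q. fst (snd q) < L * (\<gamma> * prof b l (fst q, snd (snd q)))}"
    by (auto simp: below_def)
  ultimately show ?thesis by (simp only: sets.Int borel_open)
qed

text \<open>The inner laminate is available on bricks only, whereas the lower half of an outer cell
  has a curved top; it is filled with dyadic bricks starting from generation 0. Each of the
  \<open>4^k\<close> columns contains at most \<open>2 * (480 / b + 1) + 1\<close> crossing cells,
  which gives \<open>H = 960 / b + 3\<close>.\<close>

lemma mixture_adm:
  assumes b: "0 < b" "b \<le> 1" and L: "0 < L" "L \<le> l" and p: "1 \<le> p" "p \<le> 3" and eps: "0 < \<epsilon>"
  shows "adm p \<epsilon> mixT (below b l L (1/2)) (l * (L * l) * (10 * mix_const * rate p \<epsilon> l L) * (1 + 2 * (960 / b + 3) / (1 - ratio)))"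
proof -
  have l: "0 < l" using L by simp
  let ?X = "\<lambda>k. near_graph ({..<2^k} \<times> {..<2^k}) (\<lambda>(i, m). 2^k * (1/2 * prof b l (l / 2^k * real i, l / 2^k * real m))) (480 / b + 1)"
  have "adm p \<epsilon> mixT (below b l L (1/2)) (l * (L * l) * (10 * mix_const * rate p \<epsilon> l L) * (1 * (ratio / 4)^0 + 2 * (960 / b + 3) * ratio^0 / (1 - ratio)))"
  proof (rule fill_limit[where X="?X"])
    fix k
    have "adm p \<epsilon> mixT (brick (l / 2^k) (L / 2^k)) (10 * mix_const * (l / 2^k * (L / 2^k * (l / 2^k)) * rate p \<epsilon> (l / 2^k) (L / 2^k)))"
      using L p eps by (intro inner_brick) (auto intro: divide_right_mono)
    moreover have "10 * mix_const * (l / 2^k * (L / 2^k * (l / 2^k)) * rate p \<epsilon> (l / 2^k) (L / 2^k))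
      \<le> l * (L * l) / 8^k * (10 * mix_const * rate p \<epsilon> l L) * (2 * ratio)^k"
    proof -
      have "(8::real)^k = 2^k * (2^k * 2^k)" by (simp flip: power_mult_distrib)
      then have eq: "l / 2^k * (L / 2^k * (l / 2^k)) = l * (L * l) / 8^k" by simp
      have "10 * mix_const * (l * (L * l) / 8^k * rate p \<epsilon> (l / 2^k) (L / 2^k)) \<le> 10 * mix_const * (l * (L * l) / 8^k * (rate p \<epsilon> l L * (2 * ratio)^k))"
        using mix_const_ge L by (intro mult_left_mono rate_scale L l eps p) auto
      then show ?thesis unfolding eq by (simp add: mult_ac)
    qed
    ultimately show "adm p \<epsilon> mixT (brick (l / 2^k) (L / 2^k)) (l * (L * l) / 8^k * (10 * mix_const * rate p \<epsilon> l L) * (2 * ratio)^k)"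
      by (rule adm_mono)
  next
    fix k i assume i: "i \<in> cells k" "\<not> cell l L k i \<subseteq> below b l L (1/2)" "cell l L k i \<inter> below b l L (1/2) \<noteq> {}"
    obtain i1 j m where im: "i = (i1, j, m)" by (cases i)
    obtain q where q: "q \<in> cell l L k i" "q \<in> below b l L (1/2)" using i(3) by blast
    obtain r where r: "r \<in> cell l L k i" "r \<notin> below b l L (1/2)" using i(2) by blast
    have "r \<in> brick l L" using r(1) unfolding cell_def by blast
    then have "\<bar>real j - 2^k * (1/2 * prof b l (l / 2^k * real i1, l / 2^k * real m))\<bar> \<le> 480 / b + 1"
    proof (intro crossing[OF b l L(1), of "1/2" q k i1 j m r])
      show "q \<in> cell l L k (i1, j, m)" "r \<in> cell l L k (i1, j, m)" using q(1) r(1) unfolding im .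
      show "fst (snd q) < L * (1/2 * prof b l (fst q, snd (snd q)))" using q(2) unfolding below_def by blast
      show "L * (1/2 * prof b l (fst r, snd (snd r))) \<le> fst (snd r)" using r(2) \<open>r \<in> brick l L\<close> unfolding below_def mem_Collect_eq not_less[symmetric] by blast
    qed simp_all
    then show "i \<in> ?X k" using i(1) unfolding im near_graph_def cells_def by simp
  next
    fix k
    have r0: "0 \<le> 480 / b + 1" using b by simp
    show "finite (?X k)" using near_graph_card(1)[OF _ r0] by simp
    have "real (card (?X k)) \<le> real (card ({..<2^k::nat} \<times> {..<2^k::nat})) * (2 * (480 / b + 1) + 1)"
      by (intro near_graph_card(2) r0) simp
    also have "real (card ({..<2^k::nat} \<times> {..<2^k::nat})) = 4^k"
      by (simp add: card_cartesian_product flip: power_mult_distrib)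
    finally show "real (card (?X k)) \<le> (960 / b + 3) * 4^k" by (simp add: algebra_simps)
  next
    have "card {i \<in> cells 0. cell l L 0 i \<subseteq> below b l L (1/2)} \<le> card (cells 0)"
      by (intro card_mono) (auto simp: cells_def)
    also have "\<dots> = 1" by (simp add: cells_def card_cartesian_product)
    finally show "real (card {i \<in> cells 0. cell l L 0 i \<subseteq> below b l L (1/2)}) \<le> 1" by simp
    show "0 \<le> 10 * mix_const * rate p \<epsilon> l L" using mix_const_ge rate_nonneg by simp
    show "below b l L (1/2) \<subseteq> brick l L" unfolding below_def by blast
  qed (use l L p tame_mixT below_borel in simp_all)
  then show ?thesis by simp
qed

section \<open>The boundary layer left over by an outer cell\<close>

text \<open>The three wells minus \<open>F2\<close>, in the order of \<open>wells2\<close>. A matrix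
  \<open>diag3 a (-b) b\<close> has, in the rotated frame, \<open>xx\<close> entry \<open>a\<close>,
  \<open>st\<close> entry \<open>b\<close> and zeros otherwise.\<close>

definition outT :: "nat \<Rightarrow> real \<times> real" where
  "outT i = (if i = 0 then (-1/2, 1/2) else if i = 1 then (1/2, 1/2) else (0, -1/2))"

lemma tame_outT: "tame outT" by (simp add: tame_def outT_def)

lemma cut_lt1:
  assumes "cut a b y < 1" "a < b" "0 \<le> b" "0 \<le> y" "y \<le> 1"
  shows "y < 2 * b \<or> 1 - 2 * b < y"
proof (rule ccontr)
  assume "\<not> ?thesis"
  then have h: "2 * b \<le> y" "2 * b \<le> 1 - y" by auto
  have "b \<le> y * (1 - y)"
  proof (cases "y \<ge> 1/2")
    case True
    then have "1/2 * (2 * b) \<le> y * (1 - y)" using h assms by (intro mult_mono) auto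
    then show ?thesis by simp
  next
    case False
    then have "(2 * b) * (1/2) \<le> y * (1 - y)" using h assms by (intro mult_mono) auto
    then show ?thesis by simp
  qed
  then show False using cut_one[OF assms(2)] assms(1) by simp
qed

lemma prof_lt1:
  assumes "prof b l (x, t) < 1" "0 < b" "0 < l" "0 \<le> x" "x < l" "0 \<le> t" "t < l"
  shows "(x / l < 2 * b \<or> 1 - 2 * b < x / l) \<or> (t / l < 2 * b \<or> 1 - 2 * b < t / l)"
proof -
  have "cut (b / 2) b (x / l) < 1 \<or> cut (b / 2) b (t / l) < 1"
  proof (rule ccontr)
    assume "\<not> ?thesis"
    then have "cut (b / 2) b (x / l) = 1" "cut (b / 2) b (t / l) = 1"
      using cut_bound(2)[of "b / 2" b "x / l"] cut_bound(2)[of "b / 2" b "t / l"] by linarith+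
    then show False using assms(1) by (simp add: prof_def cutoff_def)
  qed
  moreover have "0 \<le> x / l" "x / l \<le> 1" "0 \<le> t / l" "t / l \<le> 1" using assms by simp_all
  ultimately show ?thesis using cut_lt1[of "b / 2" b "x / l"] cut_lt1[of "b / 2" b "t / l"] assms(2) by linarith
qed

text \<open>Indices of dyadic intervals that can meet the layers of relative width
  \<open>2 * b\<close> at either end; at the upper end the right end point \<open>i + 1\<close> of
  the interval decides.\<close>

definition edge :: "real \<Rightarrow> nat \<Rightarrow> nat set" where
  "edge b k = {i. i < 2^k \<and> (real i < 2 * b * 2^k \<or> 2^k - 2 * b * 2^k < real i + 1)}"

definition columns :: "real \<Rightarrow> nat \<Rightarrow> (nat \<times> nat) set" where
  "columns b k = edge b k \<times> {..<2^k} \<union> {..<2^k} \<times> edge b k"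

lemma edge_card:
  assumes "0 < b" "1 \<le> b * 2^k"
  shows "finite (edge b k)" "real (card (edge b k)) \<le> 6 * b * 2^k"
proof -
  define r where "r = b * 2^k"
  let ?A = "{j::nat. \<bar>real j - r\<bar> \<le> r}" and ?B = "{j::nat. \<bar>real j - (2^k - 1 - r)\<bar> \<le> r}"
  have r: "0 \<le> r" using assms by (simp add: r_def)
  have sub: "edge b k \<subseteq> ?A \<union> ?B"
  proof
    fix i assume i: "i \<in> edge b k"
    then have "Suc i \<le> 2^k" by (simp add: edge_def)
    then have "real (Suc i) \<le> real (2^k)" by (simp only: of_nat_le_iff)
    then have "real i + 1 \<le> 2^k" by simp
    moreover have "real i < 2 * r \<or> 2^k - 2 * r < real i + 1" using i by (simp add: edge_def r_def mult.assoc)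
    moreover have "\<bar>real i - r\<bar> \<le> r" if "real i < 2 * r" using that by (simp add: abs_le_iff)
    moreover have "\<bar>real i - (2^k - 1 - r)\<bar> \<le> r" if "2^k - 2 * r < real i + 1" "real i + 1 \<le> 2^k"
      using that by (simp add: abs_le_iff)
    ultimately show "i \<in> ?A \<union> ?B" by blast
  qed
  have f: "finite (?A \<union> ?B)" using card_near(1)[OF r] by blast
  then show "finite (edge b k)" using sub by (rule rev_finite_subset)
  have "card (edge b k) \<le> card (?A \<union> ?B)" by (rule card_mono[OF f sub])
  also have "\<dots> \<le> card ?A + card ?B" by (rule card_Un_le)
  finally have "real (card (edge b k)) \<le> real (card ?A) + real (card ?B)" by (simp only: of_nat_add[symmetric] of_nat_le_iff)
  also have "\<dots> \<le> (2 * r + 1) + (2 * r + 1)" by (intro add_mono card_near(2) r)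
  \<comment> \<open>Intervals no longer than the layer is wide, \<open>r \<ge> 1\<close>, allow the
    two rounding terms to be absorbed.\<close>
  also have "\<dots> \<le> 6 * r" using assms(2) by (simp add: r_def)
  finally show "real (card (edge b k)) \<le> 6 * b * 2^k" by (simp add: r_def)
qed

lemma columns_card:
  assumes "0 < b" "1 \<le> b * 2^k"
  shows "finite (columns b k)" "real (card (columns b k)) \<le> 16 * b * 4^k"
proof -
  note e = edge_card[OF assms]
  show "finite (columns b k)" using e unfolding columns_def by blast
  have "card (columns b k) \<le> card (edge b k \<times> {..<2^k::nat}) + card ({..<2^k::nat} \<times> edge b k)"
    unfolding columns_def by (rule card_Un_le)
  also have "\<dots> = 2 * card (edge b k) * 2^k" by (simp add: card_cartesian_product)
  finally have "real (card (columns b k)) \<le> real (2 * card (edge b k) * 2^k)" by (simp only: of_nat_le_iff)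
  also have "\<dots> = 2 * 2^k * real (card (edge b k))" by simp
  also have "\<dots> \<le> 2 * 2^k * (6 * b * 2^k)" by (intro mult_left_mono e) simp
  also have "\<dots> = 12 * b * (2^k * 2^k)" by simp
  also have "(2::real)^k * 2^k = 4^k" by (simp flip: power_mult_distrib)
  also have "12 * b * 4^k \<le> 16 * b * 4^k" using assms by simp
  finally show "real (card (columns b k)) \<le> 16 * b * 4^k" .
qed

text \<open>The layer has at most \<open>16 * b * 4^k\<close> columns, but the profile has slope of
  order \<open>1 / b\<close> there, so each column holds at most \<open>960 / b + 3\<close> crossing
  cells. The powers of \<open>b\<close> cancel and the crossing number is at most
  \<open>15408 * 4^k\<close>, uniformly in \<open>b\<close>. Since filling starts only at generation
  \<open>k0\<close>, the total cost carries the factor \<open>ratio^k0\<close>, which can be made as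
  small as desired.\<close>

lemma leftover_adm:
  fixes k0 :: nat and l L A p \<epsilon> :: real
  defines "b \<equiv> (1/2)^k0"
  assumes L: "0 < L" "0 < l" and p: "0 \<le> p" "p \<le> 3" and A: "0 \<le> A"
    and e: "\<And>k. adm p \<epsilon> outT (brick (l / 2^k) (L / 2^k)) (l * (L * l) / 8^k * A * (2 * ratio)^k)"
  shows "adm p \<epsilon> outT (brick l L - below b l L 1) (l * (L * l) * A * ((16 + 30816 / (1 - ratio)) * ratio^k0))"
proof -
  have b: "0 < b" "b \<le> 1" by (simp_all add: b_def power_le_one)
  have bk: "1 \<le> b * 2^k" if "k0 \<le> k" for k
  proof -
    have "b * 2^k0 = 1" by (simp add: b_def flip: power_mult_distrib)
    moreover have "b * 2^k0 \<le> b * 2^k" using b that by (intro mult_left_mono power_increasing) auto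
    ultimately show ?thesis by simp
  qed
  let ?N = "brick l L - below b l L 1"
  let ?X = "\<lambda>k. near_graph (columns b k) (\<lambda>(i, m). 2^k * (1 * prof b l (l / 2^k * real i, l / 2^k * real m))) (480 / b + 1)"
  have col: "(i, m) \<in> columns b k" if c: "(i, j, m) \<in> cells k" and q: "q \<in> cell l L k (i, j, m)" "q \<in> ?N" for k i j m q
  proof -
    have qb: "0 \<le> fst q" "fst q < l" "0 \<le> fst (snd q)" "fst (snd q) < L" "0 \<le> snd (snd q)" "snd (snd q) < l"
      using q(1) unfolding cell_def mem_Collect_eq mem_Times_iff atLeastLessThan_iff by blast+
    have im: "i < 2^k" "m < 2^k" using c by (simp_all add: cells_def)
    have "q \<in> brick l L" "q \<notin> below b l L 1" using q(2) by blast+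
    then have "L * (1 * prof b l (fst q, snd (snd q))) \<le> fst (snd q)" unfolding below_def mem_Collect_eq not_less[symmetric] by blast
    then have "L * prof b l (fst q, snd (snd q)) < L * 1" using qb(4) by simp
    then have "prof b l (fst q, snd (snd q)) < 1" using L(1) by (simp only: mult_less_cancel_left_pos)
    from prof_lt1[OF this b(1) L(2) qb(1,2,5,6)]
    consider "fst q / l < 2 * b" | "1 - 2 * b < fst q / l" | "snd (snd q) / l < 2 * b" | "1 - 2 * b < snd (snd q) / l" by blast
    then show ?thesis
    proof cases
      case 1
      then have "2^k * (fst q / l) < 2^k * (2 * b)" by (rule mult_strict_left_mono) simp
      then have "real i < 2 * b * 2^k" using cell_bounds(5)[OF L(2,1) q(1)] by (simp only: mult.commute)
      then show ?thesis using im by (simp add: columns_def edge_def)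
    next
      case 2
      then have "2^k * (1 - 2 * b) < 2^k * (fst q / l)" by (rule mult_strict_left_mono) simp
      then have "2^k * (1 - 2 * b) < real i + 1" using cell_bounds(6)[OF L(2,1) q(1)] by linarith
      then have "2^k - 2 * b * 2^k < real i + 1" by (simp add: right_diff_distrib mult_ac)
      then show ?thesis using im by (simp add: columns_def edge_def)
    next
      case 3
      then have "2^k * (snd (snd q) / l) < 2^k * (2 * b)" by (rule mult_strict_left_mono) simp
      then have "real m < 2 * b * 2^k" using cell_bounds(7)[OF L(2,1) q(1)] by (simp only: mult.commute)
      then show ?thesis using im by (simp add: columns_def edge_def)
    next
      case 4
      then have "2^k * (1 - 2 * b) < 2^k * (snd (snd q) / l)" by (rule mult_strict_left_mono) simp
      then have "2^k * (1 - 2 * b) < real m + 1" using cell_bounds(8)[OF L(2,1) q(1)] by linarith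
      then have "2^k - 2 * b * 2^k < real m + 1" by (simp add: right_diff_distrib mult_ac)
      then show ?thesis using im by (simp add: columns_def edge_def)
    qed
  qed
  have r0: "0 \<le> 480 / b + 1" using b by simp
  have "adm p \<epsilon> outT ?N (l * (L * l) * A * (16 * 4^k0 * (ratio / 4)^k0 + 2 * 15408 * ratio^k0 / (1 - ratio)))"
  proof (rule fill_limit[where X="?X"])
    fix k i assume k: "k0 \<le> k" and i: "i \<in> cells k" "\<not> cell l L k i \<subseteq> ?N" "cell l L k i \<inter> ?N \<noteq> {}"
    obtain i1 j m where im: "i = (i1, j, m)" by (cases i)
    obtain r where r: "r \<in> cell l L k i" "r \<in> ?N" using i(3) by blast
    obtain q where q: "q \<in> cell l L k i" "q \<notin> ?N" using i(2) by blast
    have "q \<in> brick l L" using q(1) unfolding cell_def by blast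
    then have q2: "q \<in> below b l L 1" using q(2) by blast
    have "\<bar>real j - 2^k * (1 * prof b l (l / 2^k * real i1, l / 2^k * real m))\<bar> \<le> 480 / b + 1"
    proof (intro crossing[OF b L(2,1), of 1 q k i1 j m r])
      show "q \<in> cell l L k (i1, j, m)" "r \<in> cell l L k (i1, j, m)" using q(1) r(1) unfolding im .
      show "fst (snd q) < L * (1 * prof b l (fst q, snd (snd q)))" using q2 unfolding below_def by blast
      have "r \<in> brick l L" "r \<notin> below b l L 1" using r(2) by blast+
      then show "L * (1 * prof b l (fst r, snd (snd r))) \<le> fst (snd r)" unfolding below_def mem_Collect_eq not_less[symmetric] by blast
    qed simp_all
    moreover have "(i1, m) \<in> columns b k" using col[of i1 j m k r] i(1) r unfolding im by blast
    ultimately show "i \<in> ?X k" unfolding im near_graph_def by simp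
  next
    fix k assume k: "k0 \<le> k"
    note c = columns_card[OF b(1) bk[OF k]]
    show "finite (?X k)" by (rule near_graph_card(1)[OF c(1) r0])
    have "real (card (?X k)) \<le> real (card (columns b k)) * (2 * (480 / b + 1) + 1)"
      by (rule near_graph_card(2)[OF c(1) r0])
    also have "\<dots> \<le> (16 * b * 4^k) * (2 * (480 / b + 1) + 1)" using b by (intro mult_right_mono c) simp
    also have "\<dots> = (15360 + 48 * b) * 4^k" using b by (simp add: field_simps)
    also have "\<dots> \<le> 15408 * 4^k" using b by (intro mult_right_mono) auto
    finally show "real (card (?X k)) \<le> 15408 * 4^k" .
  next
    note c = columns_card[OF b(1) bk[OF order_refl]]
    let ?I = "{i \<in> cells k0. cell l L k0 i \<subseteq> ?N}"
    \<comment> \<open>Initial cells inside the leftover lie over the boundary columns, with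
      \<open>2^k0\<close> heights each; \<open>b * 2^k0 = 1\<close> turns the count into
      \<open>16 * 4^k0\<close>, and the factor \<open>4^k0\<close> is compensated by
      \<open>(ratio / 4)^k0\<close>.\<close>
    have "?I \<subseteq> (\<lambda>((i, m), j). (i, j, m)) ` (columns b k0 \<times> {..<2^k0})"
    proof
      fix i assume i: "i \<in> ?I"
      obtain i1 j m where im: "i = (i1, j, m)" by (cases i)
      have ic: "(i1, j, m) \<in> cells k0" "cell l L k0 (i1, j, m) \<subseteq> ?N" using i unfolding im by blast+
      have "cell l L k0 (i1, j, m) \<noteq> {}" using cell_translate[OF L(2,1) ic(1)] L by simp
      then obtain q where q: "q \<in> cell l L k0 (i1, j, m)" by blast
      then have "(i1, m) \<in> columns b k0" using col[OF ic(1) q] ic(2) by blast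
      moreover have "j < 2^k0" using ic(1) by (simp add: cells_def)
      ultimately show "i \<in> (\<lambda>((i, m), j). (i, j, m)) ` (columns b k0 \<times> {..<2^k0})"
        unfolding im by (intro image_eqI[of _ _ "((i1, m), j)"]) simp_all
    qed
    then have "card ?I \<le> card ((\<lambda>((i, m), j). (i, j, m)) ` (columns b k0 \<times> {..<2^k0::nat}))"
      using c(1) by (intro card_mono) simp_all
    also have "\<dots> \<le> card (columns b k0 \<times> {..<2^k0::nat})" using c(1) by (intro card_image_le) simp
    also have "\<dots> = card (columns b k0) * 2^k0" by (simp add: card_cartesian_product)
    finally have "real (card ?I) \<le> real (card (columns b k0) * 2^k0)" by (simp only: of_nat_le_iff)
    also have "\<dots> \<le> (16 * b * 4^k0) * 2^k0" unfolding of_nat_mult using c(2) by (intro mult_mono) simp_all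
    also have "\<dots> = 16 * 4^k0 * (b * 2^k0)" by simp
    also have "b * 2^k0 = 1" by (simp add: b_def flip: power_mult_distrib)
    finally show "real (card ?I) \<le> 16 * 4^k0" by simp
    show "?N \<in> sets borel" using below_borel[OF L(2,1)] brick_measure(1)[of l L] L by (intro sets.Diff) simp_all
  qed (use L p A tame_outT e in \<open>simp_all\<close>)
  moreover have "16 * 4^k0 * (ratio / 4)^k0 + 2 * 15408 * ratio^k0 / (1 - ratio) = (16 + 30816 / (1 - ratio)) * ratio^k0"
    by (simp add: power_divide distrib_right)
  ultimately show ?thesis by (simp only:)
qed

section \<open>Measure preserving changes of coordinates\<close>

text \<open>Relabelling an orthonormal basis pulls boxes back to boxes with the same side lengths,
  and volumes of boxes determine Lebesgue measure.\<close>

lemma distr_basis_iso: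
  fixes f :: "'a::euclidean_space \<Rightarrow> 'b::euclidean_space" and g :: "'b \<Rightarrow> 'a"
  assumes f: "f \<in> borel_measurable borel" and bij: "bij_betw f Basis Basis"
    and fi: "\<And>x a. a \<in> Basis \<Longrightarrow> f x \<bullet> f a = x \<bullet> a" and gi: "\<And>y a. a \<in> Basis \<Longrightarrow> g y \<bullet> a = y \<bullet> f a"
  shows "distr lborel borel f = lborel"
proof (rule lborel_eqI[symmetric])
  fix l u :: 'b assume lu: "\<And>b. b \<in> Basis \<Longrightarrow> l \<bullet> b \<le> u \<bullet> b"
  have B: "f ` Basis = Basis" using bij by (simp add: bij_betw_def)
  have "f -` box l u = box (g l) (g u)"
  proof (intro set_eqI)
    fix x
    have "x \<in> f -` box l u \<longleftrightarrow> (\<forall>b\<in>f ` Basis. l \<bullet> b < f x \<bullet> b \<and> f x \<bullet> b < u \<bullet> b)" by (simp add: B mem_box)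
    also have "\<dots> \<longleftrightarrow> x \<in> box (g l) (g u)" by (simp add: mem_box fi gi)
    finally show "x \<in> f -` box l u \<longleftrightarrow> x \<in> box (g l) (g u)" .
  qed
  then have "emeasure (distr lborel borel f) (box l u) = emeasure lborel (box (g l) (g u))"
    using f by (subst emeasure_distr) simp_all
  also have "\<dots> = ennreal (\<Prod>a\<in>Basis. (g u - g l) \<bullet> a)"
  proof (rule emeasure_lborel_box)
    fix a :: 'a assume a: "a \<in> Basis"
    then have "f a \<in> Basis" using B by blast
    then show "g l \<bullet> a \<le> g u \<bullet> a" using lu a by (simp add: gi)
  qed
  also have "(\<Prod>a\<in>Basis. (g u - g l) \<bullet> a) = (\<Prod>a\<in>Basis. (u - l) \<bullet> f a)"
    by (intro prod.cong) (simp_all add: inner_diff_left gi)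
  also have "\<dots> = (\<Prod>b\<in>Basis. (u - l) \<bullet> b)" by (rule prod.reindex_bij_betw[OF bij])
  finally show "emeasure (distr lborel borel f) (box l u) = ennreal (\<Prod>b\<in>Basis. (u - l) \<bullet> b)" .
qed simp

lemma pbound_image:
  fixes f :: "'a::euclidean_space \<Rightarrow> 'b::euclidean_space" and g :: "'b \<Rightarrow> 'a"
  assumes f: "f \<in> borel_measurable borel" and g: "g \<in> borel_measurable borel"
    and gf: "\<And>x. g (f x) = x" and fg: "\<And>y. f (g y) = y"
    and add: "\<And>x y. f (x + y) = f x + f y" and nrm: "\<And>y. norm (g y) \<le> norm y"
    and mp: "distr lborel borel f = lborel" and E: "pbound E P"
  shows "pbound (f ` E) P"
  unfolding pbound_def
proof (intro conjI allI)
  have im: "f ` S = g -` S" for S using gf fg by (auto simp: image_iff) metis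
  have meas: "f ` S \<in> sets borel" if "S \<in> sets borel" for S
    using measurable_sets[OF g that] unfolding im by simp
  have em: "emeasure lborel (f ` S) = emeasure lborel S" if S: "S \<in> sets borel" for S
  proof -
    have "emeasure lborel (f ` S) = emeasure (distr lborel borel f) (f ` S)" by (simp only: mp)
    also have "\<dots> = emeasure lborel (f -` f ` S \<inter> space lborel)" using f meas[OF S] by (intro emeasure_distr) simp_all
    also have "f -` f ` S \<inter> space lborel = S" using gf unfolding im by auto
    finally show ?thesis .
  qed
  have Eb: "E \<in> sets borel" using E by (simp add: pbound_def)
  show "f ` E \<in> sets borel" by (rule meas[OF Eb])
  show P: "0 \<le> P" using E by (simp add: pbound_def)
  fix y
  have "(+) y ` f ` E = f ` (+) (g y) ` E" by (simp add: image_image add fg)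
  moreover have "inj f" using gf by (metis injI)
  ultimately have "sym_diff (f ` E) ((+) y ` f ` E) = f ` sym_diff E ((+) (g y) ` E)"
    by (simp add: image_Un image_set_diff)
  moreover have "sym_diff E ((+) (g y) ` E) \<in> sets borel" using Eb borel_translate[OF Eb] by (intro sets.Un sets.Diff)
  ultimately have "emeasure lborel (sym_diff (f ` E) ((+) y ` f ` E)) = emeasure lborel (sym_diff E ((+) (g y) ` E))"
    by (simp only: em)
  also have "\<dots> \<le> ennreal (P * norm (g y))" using E by (simp add: pbound_def)
  also have "\<dots> \<le> ennreal (P * norm y)" using nrm P by (intro ennreal_leI mult_left_mono) auto
  finally show "emeasure lborel (sym_diff (f ` E) ((+) y ` f ` E)) \<le> ennreal (P * norm y)" .
qed

text \<open>Brings \<open>s\<close> to the first position, so that the results on graphs in the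
  first coordinate apply to interfaces that are graphs over \<open>(x, t)\<close>.\<close>

definition swap :: "r3 \<Rightarrow> r3" where "swap = (\<lambda>(s, x, t). (x, s, t))"

lemma swap_swap: "swap (swap q) = q" by (simp add: swap_def split: prod.splits)

lemma swap_measurable: "swap \<in> borel_measurable borel"
  unfolding swap_def case_prod_beta by (intro borel_measurable_continuous_onI continuous_intros)

lemma swap_distr: "distr lborel borel swap = lborel"
proof (rule distr_basis_iso[where g=swap])
  have B: "(Basis :: r3 set) = {(1,0,0), (0,1,0), (0,0,1)}"
    by (auto simp: Basis_prod_def zero_prod_def)
  show "bij_betw swap Basis Basis" unfolding bij_betw_def
  proof
    show "inj_on swap Basis" by (rule inj_on_inverseI[of _ swap]) (simp add: swap_swap)
    show "swap ` Basis = Basis" unfolding B by (auto simp: swap_def)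
  qed
  show "swap x \<bullet> swap a = x \<bullet> a" for x a by (cases x; cases a) (simp add: swap_def)
  show "swap x \<bullet> a = x \<bullet> swap a" for x a by (cases x; cases a) (simp add: swap_def)
qed (rule swap_measurable)

lemma AE_swap:
  assumes "AE q in lborel. Q q"
  shows "AE q in lborel. Q (swap q)"
proof -
  have "AE q in distr lborel borel swap. Q q" using assms by (simp only: swap_distr)
  from AE_distrD[OF _ this] show ?thesis using swap_measurable by simp
qed

text \<open>Membership in the brick is automatic: the profile vanishes outside the square and is at
  most 1.\<close>

lemma in_below:
  assumes "0 < l" "0 < L" "0 < b" "0 \<le> \<gamma>" "\<gamma> \<le> 1"
  shows "q \<in> below b l L \<gamma> \<longleftrightarrow> 0 \<le> fst (snd q) \<and> fst (snd q) < L * (\<gamma> * prof b l (fst q, snd (snd q)))"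
proof
  assume "q \<in> below b l L \<gamma>"
  then show "0 \<le> fst (snd q) \<and> fst (snd q) < L * (\<gamma> * prof b l (fst q, snd (snd q)))"
    unfolding below_def by auto
next
  let ?G = "prof b l (fst q, snd (snd q))"
  assume *: "0 \<le> fst (snd q) \<and> fst (snd q) < L * (\<gamma> * ?G)"
  then have "?G \<noteq> 0" by auto
  then have z: "(fst q, snd (snd q)) \<in> rect l l"
    using cutoff_outside[of "b/2" b l l "(fst q, snd (snd q))"] assms unfolding prof_def by fastforce
  have "\<gamma> * ?G \<le> 1" using cutoff_range[of "b/2" b l l "(fst q, snd (snd q))"] assms unfolding prof_def
    by (intro mult_le_one) auto
  then have "L * (\<gamma> * ?G) \<le> L" using assms by (simp add: mult_left_le)
  then have "fst (snd q) < L" using * by linarith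
  then show "q \<in> below b l L \<gamma>" using * z unfolding below_def by (simp add: mem_Times_iff)
qed

lemma swap_add: "swap (x + y) = swap x + swap y"
  by (cases x; cases y) (simp add: swap_def)

lemma swap_norm: "norm (swap y) \<le> norm y"
  by (cases y) (simp add: swap_def norm_Pair add.left_commute)

section \<open>The outer cell and the recursion over bricks\<close>

text \<open>The tent \<open>w\<close>, the minimum of \<open>s\<close> and \<open>h - s\<close> cut
  off at zero, is the third displacement component. Its \<open>s\<close>-slope 1 or -1 realises the
  \<open>st\<close> entry 1/2 or -1/2. Below \<open>h / 2\<close> it equals \<open>s\<close> and
  contributes nothing else, so the mixture placed there keeps its errors unchanged. Above
  \<open>h / 2\<close> there is only the third well, and the error consists of the lateral slopes of
  \<open>h\<close>, of order \<open>L / (b * l)\<close>. The one new phase region lies between the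
  graphs of \<open>h / 2\<close> and \<open>h\<close>.\<close>

lemma outer_cell:
  assumes b: "0 < b" "b \<le> 1" and L: "0 < L" "L \<le> l" and p: "0 \<le> p" and eps: "0 \<le> \<epsilon>"
    and M: "adm p \<epsilon> mixT (below b l L (1/2)) e"
  shows "adm p \<epsilon> outT (below b l L 1) (e + (240 / b * (L / l)) powr p * (l * (L * l)) + \<epsilon> * (8 * (240 / b + 1) * (l * l)))"
  unfolding adm_def
proof (intro allI impI)
  fix \<eta> :: real assume "\<eta> > 0"
  then have M0: "adm0 p \<epsilon> mixT (below b l L (1/2)) (e + \<eta>)" using M unfolding adm_def by blast
  from M0 obtain v E1 E2 g P1 P2 I K where "below b l L (1/2) \<in> sets borel" and *:
    "K-lipschitz_on UNIV v" "\<And>z. z \<notin> below b l L (1/2) \<Longrightarrow> v z = 0"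
    "E1 \<subseteq> below b l L (1/2)" "E2 \<subseteq> below b l L (1/2)" "E1 \<inter> E2 = {}" "pbound E1 P1" "pbound E2 P2" "g \<in> borel_measurable borel"
    "AE z in lborel. \<exists>D. (v has_derivative D) (at z) \<and> (z \<notin> below b l L (1/2) \<longrightarrow> D = (\<lambda>_. 0)) \<and>
        (z \<in> below b l L (1/2) \<longrightarrow> err D (target mixT E1 E2 z) powr p \<le> g z)"
    "(\<integral>\<^sup>+z\<in>below b l L (1/2). ennreal (g z) \<partial>lborel) \<le> ennreal I" "0 \<le> I" "I + \<epsilon> * (P1 + P2) \<le> e + \<eta>"
    unfolding adm0_def by blast
  have l: "0 < l" using L by simp
  define G where "G = (\<lambda>q :: r3. prof b l (fst q, snd (snd q)))"
  define h where "h = (\<lambda>q. L * G q)"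
  define w where "w = (\<lambda>q. max 0 (min (fst (snd q)) (h q - fst (snd q))))"
  define V where "V = l * (L * l)"
  define X where "X = 240 / b * (L / l)"
  have X0: "0 \<le> X" using b L by (simp add: X_def)
  have G01: "0 \<le> G q" "G q \<le> 1" for q unfolding G_def prof_def by (simp_all add: cutoff_range)
  have h0: "0 \<le> h q" for q using G01 L by (simp add: h_def)
  have in1: "q \<in> below b l L 1 \<longleftrightarrow> 0 \<le> fst (snd q) \<and> fst (snd q) < h q" for q
    using in_below[OF l L(1) b(1), of 1 q] by (simp add: h_def G_def)
  have inh: "q \<in> below b l L (1/2) \<longleftrightarrow> 0 \<le> fst (snd q) \<and> fst (snd q) < h q / 2" for q
    using in_below[OF l L(1) b(1), of "1/2" q] by (simp add: h_def G_def)
  have sub: "below b l L (1/2) \<subseteq> below b l L 1"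
  proof
    fix q assume "q \<in> below b l L (1/2)"
    then show "q \<in> below b l L 1" unfolding in1 inh using h0[of q] by linarith
  qed
  have lp: "lip (prof b l)" using prof_lip[OF b l] unfolding lip_def by blast
  have lG: "lip G" unfolding G_def
    by (rule lip_compose[OF lp lip_Pair[OF lip_fst lip_compose[OF lip_snd lip_snd]]])
  have ls: "lip (\<lambda>q :: r3. fst (snd q))" by (rule lip_compose[OF lip_fst lip_snd])
  have lh: "lip h" unfolding h_def by (rule lip_cmult[OF lG])
  have lw: "lip w" unfolding w_def by (intro lip_max lip_min lip_diff lip_const ls lh)
  define u where "u = (\<lambda>q. (0 :: real, 0 :: real, w q))"
  have "lip u" unfolding u_def by (intro lip_Pair lip_const lw)
  then obtain Ku where Ku: "Ku-lipschitz_on UNIV u" unfolding lip_def by blast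
  define Gs where "Gs = (\<lambda>q :: r3. cutoff_s (b / 2) b l l (fst q, snd (snd q)))"
  define Gt where "Gt = (\<lambda>q :: r3. cutoff_t (b / 2) b l l (fst q, snd (snd q)))"
  have dh: "(h has_derivative (\<lambda>k. L * (Gs q * fst k + Gt q * snd (snd k)))) (at q)" for q
  proof -
    have "((\<lambda>q :: r3. (fst q, snd (snd q))) has_derivative (\<lambda>k. (fst k, snd (snd k)))) (at q)"
      by (intro has_derivative_Pair has_derivative_fst has_derivative_snd has_derivative_ident)
    from has_derivative_compose[OF this cutoff_deriv]
    have "(G has_derivative (\<lambda>k. Gs q * fst k + Gt q * snd (snd k))) (at q)"
      unfolding G_def prof_def Gs_def Gt_def by simp
    then show ?thesis unfolding h_def by (rule has_derivative_mult_right)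
  qed
  have "\<bar>Gs q\<bar> \<le> 60 / (b - b / 2) / l" "\<bar>Gt q\<bar> \<le> 60 / (b - b / 2) / l" for q
    unfolding Gs_def Gt_def using b l by (intro cutoff_bounds; simp)+
  moreover have "60 / (b - b / 2) / l = 120 / b / l" using b by simp
  ultimately have Gb: "\<bar>Gs q\<bar> \<le> 120 / b / l" "\<bar>Gt q\<bar> \<le> 120 / b / l" for q by simp_all
  have ds: "((\<lambda>q :: r3. fst (snd q)) has_derivative (\<lambda>k. fst (snd k))) (at q)" for q
    by (intro has_derivative_fst has_derivative_snd has_derivative_ident)
  define E where "E = {q. h q / 2 \<le> fst (snd q) \<and> fst (snd q) < h q}"
  have pE: "pbound E (8 * (240 / b + 1) * (l * l))"
  proof -
    have Lp: "(240 / b)-lipschitz_on UNIV (\<lambda>z. c * L * prof b l z)" if c: "0 \<le> c" "c \<le> 1" for c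
    proof -
      have "(\<bar>c * L\<bar> * (240 / b / l))-lipschitz_on UNIV (\<lambda>z. c * L * prof b l z)"
        by (rule lipschitz_on_cmult_real[OF prof_lip[OF b l]])
      moreover have "\<bar>c * L\<bar> * (240 / b / l) \<le> 240 / b"
      proof -
        have "c * L \<le> 1 * l" using c L by (intro mult_mono) auto
        then have "c * L * (240 / b / l) \<le> l * (240 / b / l)" using b l by (intro mult_right_mono) auto
        then show ?thesis using c L l by simp
      qed
      ultimately show ?thesis by (rule lipschitz_on_le)
    qed
    have "emeasure lborel (rect l l) = ennreal (l * l)" using l by (subst emeasure_rect) (simp_all add: ennreal_mult)
    then have "pbound {(s, z). 1/2 * L * prof b l z \<le> s \<and> s < 1 * L * prof b l z} (8 * (240 / b + 1) * (l * l))"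
      using l b by (intro pbound_graph[where Q="rect l l"] Lp)
        (auto simp: prof_def cutoff_outside intro!: borel_Times)
    from pbound_image[OF swap_measurable swap_measurable swap_swap swap_swap swap_add swap_norm swap_distr this]
    have "pbound (swap ` {(s, z). 1/2 * L * prof b l z \<le> s \<and> s < 1 * L * prof b l z}) (8 * (240 / b + 1) * (l * l))"
      .
    moreover have "swap ` {(s, z). 1/2 * L * prof b l z \<le> s \<and> s < 1 * L * prof b l z} = E"
    proof (intro set_eqI)
      fix q :: r3
      obtain x s t where q: "q = (x, s, t)" by (cases q)
      have "q \<in> swap ` S \<longleftrightarrow> swap q \<in> S" for S using swap_swap by (metis image_iff)
      then show "q \<in> swap ` {(s, z). 1/2 * L * prof b l z \<le> s \<and> s < 1 * L * prof b l z} \<longleftrightarrow> q \<in> E"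
        by (simp add: q swap_def E_def h_def G_def)
    qed
    ultimately show ?thesis by simp
  qed
  have AEs: "AE q in lborel. fst (snd q) \<noteq> c * h q" for c
  proof -
    have "AE q in lborel. fst q \<noteq> (\<lambda>z. c * (L * prof b l z)) (snd (q :: r3))"
      by (intro AE_off_graph continuous_intros prof_continuous)
    from AE_swap[OF this] show ?thesis
      by eventually_elim (auto simp: swap_def h_def G_def split: prod.splits)
  qed
  have AE0: "AE q in lborel. fst (snd (q :: r3)) \<noteq> 0" using AEs[of 0] by simp
  have cs: "continuous_on UNIV (\<lambda>q :: r3. fst (snd q))" "continuous_on UNIV h" using ls lh lip_continuous by blast+
  let ?g = "\<lambda>q. if q \<in> below b l L (1/2) then g q else X powr p"
  have bm: "below b l L \<gamma> \<in> sets borel" for \<gamma> using below_borel l L by simp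
  have main: "\<exists>D. ((\<lambda>q. v q + u q) has_derivative D) (at q) \<and> (q \<notin> below b l L 1 \<longrightarrow> D = (\<lambda>_. 0)) \<and>
        (q \<in> below b l L 1 \<longrightarrow> err D (target outT E1 E q) powr p \<le> ?g q)"
    if D: "(v has_derivative D) (at q)" "q \<notin> below b l L (1/2) \<longrightarrow> D = (\<lambda>_. 0)"
        "q \<in> below b l L (1/2) \<longrightarrow> err D (target mixT E1 E2 q) powr p \<le> g q"
      and n: "fst (snd q) \<noteq> 0" "fst (snd q) \<noteq> 1/2 * h q" "fst (snd q) \<noteq> 1 * h q" for D q
  proof -
    consider (1) "fst (snd q) < 0" | (2) "0 < fst (snd q)" "fst (snd q) < h q / 2" | (3) "h q / 2 < fst (snd q)" "fst (snd q) < h q" | (4) "h q < fst (snd q)"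
      using n by linarith
    then show ?thesis
    proof cases
      case 1
      have "(u has_derivative (\<lambda>_. 0)) (at q)"
      proof (rule has_derivative_transform_within_open[OF has_derivative_const])
        show "open {q :: r3. fst (snd q) < 0}" by (intro open_Collect_less cs continuous_intros)
        show "q \<in> {q :: r3. fst (snd q) < 0}" using 1 by simp
        show "0 = u q'" if "q' \<in> {q :: r3. fst (snd q) < 0}" for q'
          using that by (simp add: u_def w_def zero_prod_def)
      qed
      then have "((\<lambda>q. v q + u q) has_derivative (\<lambda>k. D k + 0)) (at q)" using D(1) by (intro has_derivative_add)
      moreover have "q \<notin> below b l L 1" "q \<notin> below b l L (1/2)" using 1 unfolding in1 inh by simp_all
      ultimately show ?thesis using D(2) by (intro exI[of _ "\<lambda>k. D k + 0"]) simp
    next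
      case 2
      have "(u has_derivative (\<lambda>k. (0, 0, fst (snd k)))) (at q)"
      proof (rule has_derivative_transform_within_open)
        show "((\<lambda>q. (0, 0, fst (snd q))) has_derivative (\<lambda>k. (0, 0, fst (snd k)))) (at q)"
          by (intro has_derivative_Pair has_derivative_const ds)
        show "open ({q. 0 < fst (snd q)} \<inter> {q. fst (snd q) < 1/2 * h q})"
          by (intro open_Int open_Collect_less cs continuous_intros)
        show "q \<in> {q. 0 < fst (snd q)} \<inter> {q. fst (snd q) < 1/2 * h q}" using 2 by simp
        show "(0, 0, fst (snd q')) = u q'" if "q' \<in> {q. 0 < fst (snd q)} \<inter> {q. fst (snd q) < 1/2 * h q}" for q'
          using that by (simp add: u_def w_def)
      qed
      then have d: "((\<lambda>q. v q + u q) has_derivative (\<lambda>k. D k + (0, 0, fst (snd k)))) (at q)" using D(1) by (intro has_derivative_add)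
      have qin: "q \<in> below b l L (1/2)" using 2 unfolding inh by simp
      have "q \<notin> E" using 2 by (simp add: E_def)
      \<comment> \<open>The added slope supplies exactly the \<open>st\<close> entry 1/2 common to
        the first two wells. A point of \<open>E2\<close> has the same mixture target as phase 0,
        and phase 0 is what it becomes.\<close>
      then have "err (\<lambda>k. D k + (0, 0, fst (snd k))) (target outT E1 E q) = err D (target mixT E1 E2 q)"
        unfolding err_def target_def outT_def mixT_def by simp
      then show ?thesis using d D(3) qin sub by (intro exI[of _ "\<lambda>k. D k + (0, 0, fst (snd k))"]) auto
    next
      case 3
      let ?D = "\<lambda>k :: r3. (0 :: real, 0 :: real, L * (Gs q * fst k + Gt q * snd (snd k)) - fst (snd k))"
      have qn: "q \<notin> below b l L (1/2)" using 3 unfolding inh by simp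
      have "(u has_derivative ?D) (at q)"
      proof (rule has_derivative_transform_within_open)
        show "((\<lambda>q. (0, 0, h q - fst (snd q))) has_derivative ?D) (at q)"
          by (intro has_derivative_Pair has_derivative_const has_derivative_diff dh ds)
        show "open ({q. 1/2 * h q < fst (snd q)} \<inter> {q. fst (snd q) < h q})"
          by (intro open_Int open_Collect_less cs continuous_intros)
        show "q \<in> {q. 1/2 * h q < fst (snd q)} \<inter> {q. fst (snd q) < h q}" using 3 by simp
        show "(0, 0, h q' - fst (snd q')) = u q'" if "q' \<in> {q. 1/2 * h q < fst (snd q)} \<inter> {q. fst (snd q) < h q}" for q'
          using that by (simp add: u_def w_def)
      qed
      then have "((\<lambda>q. v q + u q) has_derivative (\<lambda>k. D k + ?D k)) (at q)" using D(1) by (intro has_derivative_add)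
      then have d: "((\<lambda>q. v q + u q) has_derivative ?D) (at q)" using D(2) qn by simp
      have "q \<in> E" using 3 by (simp add: E_def)
      moreover have "q \<notin> E1" using qn *(3) by blast
      ultimately have t: "target outT E1 E q = (0, -1/2)" by (simp add: target_def outT_def)
      have "err ?D (0, -1/2) = L * (\<bar>Gt q\<bar> + \<bar>Gs q\<bar>)"
        using L by (simp add: err_def abs_mult distrib_left)
      also have "\<dots> \<le> L * (120 / b / l + 120 / b / l)" using L Gb[of q] by (intro mult_left_mono add_mono) auto
      also have "\<dots> = X" using b l by (simp add: X_def field_simps)
      finally have "err ?D (target outT E1 E q) powr p \<le> X powr p"
        unfolding t using p by (intro powr_mono2) (auto simp: err_def)
      moreover have "q \<in> below b l L 1" using 3 h0[of q] unfolding in1 by simp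
      ultimately show ?thesis using d qn by (intro exI[of _ ?D]) simp
    next
      case 4
      have "(u has_derivative (\<lambda>_. 0)) (at q)"
      proof (rule has_derivative_transform_within_open[OF has_derivative_const])
        show "open {q. h q < fst (snd q)}" by (intro open_Collect_less cs continuous_intros)
        show "q \<in> {q. h q < fst (snd q)}" using 4 by simp
        show "0 = u q'" if "q' \<in> {q. h q < fst (snd q)}" for q'
          using that by (simp add: u_def w_def zero_prod_def)
      qed
      then have "((\<lambda>q. v q + u q) has_derivative (\<lambda>k. D k + 0)) (at q)" using D(1) by (intro has_derivative_add)
      moreover have "q \<notin> below b l L 1" "q \<notin> below b l L (1/2)" using 4 h0[of q] unfolding in1 inh by simp_all
      ultimately show ?thesis using D(2) by (intro exI[of _ "\<lambda>k. D k + 0"]) simp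
    qed
  qed
  show "adm0 p \<epsilon> outT (below b l L 1) (e + (240 / b * (L / l)) powr p * (l * (L * l)) + \<epsilon> * (8 * (240 / b + 1) * (l * l)) + \<eta>)"
    unfolding X_def[symmetric] V_def[symmetric]
  proof (rule adm0I[where v="\<lambda>q. v q + u q" and K="K + Ku" and ?E1.0=E1 and ?E2.0=E and g="?g" and I="I + X powr p * V"
        and ?P1.0=P1 and ?P2.0="8 * (240 / b + 1) * (l * l)"])
    show "(K + Ku)-lipschitz_on UNIV (\<lambda>q. v q + u q)" by (rule lipschitz_on_add[OF *(1) Ku])
    show "v q + u q = 0" if "q \<notin> below b l L 1" for q
    proof -
      have "v q = 0" using that sub *(2) by blast
      moreover have "w q = 0" using that h0[of q] unfolding in1 w_def by (auto simp: max_def min_def)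
      ultimately show ?thesis by (simp add: u_def zero_prod_def)
    qed
    show "E1 \<subseteq> below b l L 1" using *(3) sub by blast
    show "E \<subseteq> below b l L 1"
    proof
      fix q assume "q \<in> E" then show "q \<in> below b l L 1" unfolding in1 E_def using h0[of q] by auto
    qed
    have "q \<notin> E" if "q \<in> E1" for q
    proof -
      have "q \<in> below b l L (1/2)" using that *(3) by blast
      then show ?thesis unfolding inh E_def by auto
    qed
    then show "E1 \<inter> E = {}" by blast
    show "AE q in lborel. \<exists>D. ((\<lambda>q. v q + u q) has_derivative D) (at q) \<and> (q \<notin> below b l L 1 \<longrightarrow> D = (\<lambda>_. 0)) \<and>
        (q \<in> below b l L 1 \<longrightarrow> err D (target outT E1 E q) powr p \<le> ?g q)"
      using *(9) AE0 AEs[of "1/2"] AEs[of 1]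
    proof eventually_elim
      case (elim q)
      then obtain D where "(v has_derivative D) (at q)" "q \<notin> below b l L (1/2) \<longrightarrow> D = (\<lambda>_. 0)"
        "q \<in> below b l L (1/2) \<longrightarrow> err D (target mixT E1 E2 q) powr p \<le> g q" by blast
      from main[OF this elim(2-4)] show ?case .
    qed
    show "?g \<in> borel_measurable borel" using *(8) bm by measurable
    have "(\<integral>\<^sup>+q\<in>below b l L 1. ennreal (?g q) \<partial>lborel)
      \<le> (\<integral>\<^sup>+q. ennreal (g q) * indicator (below b l L (1/2)) q + ennreal (X powr p) * indicator (brick l L) q \<partial>lborel)"
    proof (intro nn_integral_mono)
      fix q
      have "q \<in> below b l L 1 \<Longrightarrow> q \<in> brick l L" unfolding below_def by blast
      then show "ennreal (?g q) * indicator (below b l L 1) q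
          \<le> ennreal (g q) * indicator (below b l L (1/2)) q + ennreal (X powr p) * indicator (brick l L) q"
        using sub by (cases "q \<in> below b l L 1"; cases "q \<in> below b l L (1/2)") (auto simp: indicator_def)
    qed
    also have "\<dots> = (\<integral>\<^sup>+q\<in>below b l L (1/2). ennreal (g q) \<partial>lborel) + (\<integral>\<^sup>+q\<in>brick l L. ennreal (X powr p) \<partial>lborel)"
      using *(8) bm brick_measure(1)[of l L] l L by (intro nn_integral_add) auto
    also have "(\<integral>\<^sup>+q\<in>brick l L. ennreal (X powr p) \<partial>lborel) = ennreal (X powr p * V)"
      using brick_measure[of l L] l L by (subst nn_integral_cmult_indicator) (auto simp: V_def ennreal_mult')
    also have "(\<integral>\<^sup>+q\<in>below b l L (1/2). ennreal (g q) \<partial>lborel) + ennreal (X powr p * V) \<le> ennreal I + ennreal (X powr p * V)"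
      using *(10) by (intro add_mono) auto
    also have "\<dots> = ennreal (I + X powr p * V)" using *(11) l L by (simp add: V_def)
    finally show "(\<integral>\<^sup>+q\<in>below b l L 1. ennreal (?g q) \<partial>lborel) \<le> ennreal (I + X powr p * V)" .
    have "0 \<le> P2" using *(7) by (simp add: pbound_def)
    then have "\<epsilon> * P1 \<le> \<epsilon> * (P1 + P2)" using eps by (intro mult_left_mono) auto
    then show "I + X powr p * V + \<epsilon> * (P1 + 8 * (240 / b + 1) * (l * l)) \<le> e + X powr p * V + \<epsilon> * (8 * (240 / b + 1) * (l * l)) + \<eta>"
      using *(12) by (simp add: distrib_left)
    show "0 \<le> I + X powr p * V" using *(11) l L by (simp add: V_def)
  qed (use * bm pE in auto)
qed

definition cell_const :: "real \<Rightarrow> real" where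
  "cell_const b = 10 * mix_const * (1 + 2 * (960 / b + 3) / (1 - ratio)) + (240 / b)^3 + 8 * (240 / b + 1)"

lemma cell_const_ge:
  assumes "0 < b" "b \<le> 1" shows "4 \<le> cell_const b"
proof -
  have "0 \<le> 2 * (960 / b + 3) / (1 - ratio)" using assms ratio by simp
  then have "40 * 1 \<le> 10 * mix_const * (1 + 2 * (960 / b + 3) / (1 - ratio))"
    using mix_const_ge by (intro mult_mono) auto
  moreover have "0 \<le> (240 / b)^3" "0 \<le> 8 * (240 / b + 1)" using assms by simp_all
  ultimately show ?thesis unfolding cell_const_def by linarith
qed

text \<open>The interface of the outer cell costs \<open>\<epsilon> / L\<close> per volume; because
  \<open>\<epsilon> \<le> L\<close>, this is at most
  \<open>(\<epsilon> / L) powr (2 * p / (2 * p + 1))\<close> and fits into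
  \<open>rate\<close>.\<close>

lemma cell_adm:
  assumes b: "0 < b" "b \<le> 1" and L: "0 < L" "L \<le> l" and p: "1 \<le> p" "p \<le> 3" and eps: "0 < \<epsilon>" "\<epsilon> \<le> L"
  shows "adm p \<epsilon> outT (below b l L 1) (l * (L * l) * (cell_const b * rate p \<epsilon> l L))"
proof -
  have l: "0 < l" using L by simp
  define V where "V = l * (L * l)"
  define r where "r = rate p \<epsilon> l L"
  have V: "0 < V" using l L by (simp add: V_def)
  define M where "M = 10 * mix_const * (1 + 2 * (960 / b + 3) / (1 - ratio))"
  have "adm p \<epsilon> outT (below b l L 1) (V * (10 * mix_const * r) * (1 + 2 * (960 / b + 3) / (1 - ratio))
     + (240 / b * (L / l)) powr p * V + \<epsilon> * (8 * (240 / b + 1) * (l * l)))"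
    unfolding V_def r_def using p eps by (intro outer_cell b L mixture_adm) auto
  moreover have "V * (10 * mix_const * r) * (1 + 2 * (960 / b + 3) / (1 - ratio)) = V * (M * r)" by (simp add: M_def mult_ac)
  moreover have "(240 / b * (L / l)) powr p * V \<le> V * ((240 / b)^3 * r)"
  proof -
    have b1: "1 \<le> 240 / b" using b by simp
    have "(240 / b * (L / l)) powr p = (240 / b) powr p * (L / l) powr p" by (rule powr_mult)
    also have "\<dots> \<le> (240 / b)^3 * r"
    proof (intro mult_mono)
      have "(240 / b) powr p \<le> (240 / b) powr 3" using b1 p by (intro powr_mono) auto
      also have "\<dots> = (240 / b)^3" using b by (simp add: powr_numeral)
      finally show "(240 / b) powr p \<le> (240 / b)^3" .
      show "(L / l) powr p \<le> r" by (simp add: r_def rate_def)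
    qed (use b in auto)
    finally show ?thesis using V by (subst mult.commute) (intro mult_left_mono, auto)
  qed
  moreover have "\<epsilon> * (8 * (240 / b + 1) * (l * l)) \<le> V * (8 * (240 / b + 1) * r)"
  proof -
    have "2 * p / (2 * p + 1) \<le> 1" using p by simp
    then have "(\<epsilon> / L) powr 1 \<le> (\<epsilon> / L) powr (2 * p / (2 * p + 1))" using eps L by (intro powr_mono') auto
    then have "\<epsilon> / L \<le> r" using eps L by (simp add: r_def rate_def add_increasing)
    then have "V * (8 * (240 / b + 1)) * (\<epsilon> / L) \<le> V * (8 * (240 / b + 1)) * r" using V b by (intro mult_left_mono) auto
    moreover have "V * (8 * (240 / b + 1)) * (\<epsilon> / L) = \<epsilon> * (8 * (240 / b + 1) * (l * l))" using L by (simp add: V_def)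
    ultimately show ?thesis by (simp only: mult.assoc)
  qed
  moreover have "V * (cell_const b * r) = V * (M * r) + V * ((240 / b)^3 * r) + V * (8 * (240 / b + 1) * r)"
    unfolding cell_const_def M_def[symmetric] by (simp only: distrib_left distrib_right)
  ultimately show ?thesis unfolding V_def[symmetric] r_def[symmetric] by (elim adm_mono) linarith
qed

text \<open>Each step fills all but a thin layer of a brick with a cell and the layer with isotropically
  scaled copies of the brick. The copies lie in a layer of relative thickness \<open>(1/2)\<^sup>k\<^sup>0\<close>,
  so for large \<open>k0\<close> their total cost is at most half of the bound that is being iterated.\<close>

lemma outer_brick:
  "\<exists>C>0. \<forall>p \<epsilon> l L. 1 \<le> p \<and> p \<le> 3 \<and> 0 < \<epsilon> \<and> 0 < L \<and> L \<le> l \<longrightarrow>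
     adm p \<epsilon> outT (brick l L) (l * (L * l) * (C * rate p \<epsilon> l L))"
proof -
  have "((\<lambda>k. (16 + 30816 / (1 - ratio)) * ratio^k) \<longlongrightarrow> (16 + 30816 / (1 - ratio)) * 0) sequentially"
    using ratio by (intro tendsto_intros LIMSEQ_realpow_zero) auto
  then have "eventually (\<lambda>k. (16 + 30816 / (1 - ratio)) * ratio^k < 1/2) sequentially"
    by (intro order_tendstoD(2)[of _ 0]) auto
  \<comment> \<open>The leftover factor involves neither \<open>p\<close>,
    \<open>\<epsilon>\<close>, \<open>l\<close> nor \<open>L\<close>, so one layer width
    \<open>b\<close> serves all parameters.\<close>
  then obtain k0 where k0: "(16 + 30816 / (1 - ratio)) * ratio^k0 < 1/2" unfolding eventually_sequentially by blast
  define b :: real where "b = (1/2)^k0"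
  have b: "0 < b" "b \<le> 1" by (simp_all add: b_def power_le_one)
  \<comment> \<open>With this choice the iteration closes:
    \<open>cell_const b * r + (C * r + 4 * (1/2)^n) / 2\<close> equals
    \<open>C * r + 4 * (1/2)^(n+1)\<close>. The case \<open>n = 0\<close> is the zero
    displacement.\<close>
  define C where "C = 2 * cell_const b"
  have C4: "4 \<le> C" using cell_const_ge[OF b] by (simp add: C_def)
  have claim: "\<forall>l L. 0 < L \<and> L \<le> l \<longrightarrow> adm p \<epsilon> outT (brick l L) (l * (L * l) * (C * rate p \<epsilon> l L + 4 * (1/2)^n))"
    if p: "1 \<le> p" "p \<le> 3" and eps: "0 < \<epsilon>" for p \<epsilon> n
  proof (induction n)
    case 0
    show ?case
    proof (intro allI impI)
      fix l L :: real assume L: "0 < L \<and> L \<le> l"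
      have V: "0 \<le> l * (L * l)" using L by simp
      have "adm p \<epsilon> outT (brick l L) (4 * (l * (L * l)))"
        using L p V brick_measure[of l L] by (intro adm_trivial tame_outT) auto
      moreover have "l * (L * l) * 4 \<le> l * (L * l) * (C * rate p \<epsilon> l L + 4 * (1/2)^0)"
        using C4 rate_nonneg[of p \<epsilon> l L] by (intro mult_left_mono V) simp
      ultimately show "adm p \<epsilon> outT (brick l L) (l * (L * l) * (C * rate p \<epsilon> l L + 4 * (1/2)^0))"
        by (elim adm_mono) linarith
    qed
  next
    case (Suc n)
    show ?case
    proof (intro allI impI)
      fix l L :: real assume L': "0 < L \<and> L \<le> l"
      then have L: "0 < L" "L \<le> l" and l: "0 < l" by auto
      define V where "V = l * (L * l)"
      have V: "0 < V" using L l by (simp add: V_def)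
      define r where "r = rate p \<epsilon> l L"
      show "adm p \<epsilon> outT (brick l L) (l * (L * l) * (C * rate p \<epsilon> l L + 4 * (1/2)^Suc n))"
      proof (cases "\<epsilon> \<le> L")
        case False
        then have "1 \<le> (\<epsilon> / L) powr (2 * p / (2 * p + 1))" using L p by (intro ge_one_powr_ge_zero) auto
        then have "1 \<le> r" using powr_ge_zero[of "L / l" p] unfolding rate_def r_def by linarith
        then have "4 * 1 \<le> C * r" using C4 by (intro mult_mono) auto
        then have "4 \<le> C * r + 4 * (1/2)^Suc n" by (intro add_increasing2) simp_all
        then have "V * 4 \<le> V * (C * r + 4 * (1/2)^Suc n)" using V by (intro mult_left_mono) auto
        moreover have "adm p \<epsilon> outT (brick l L) (4 * V)"
          unfolding V_def using L l p brick_measure[of l L] by (intro adm_trivial tame_outT) auto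
        ultimately show ?thesis unfolding V_def[symmetric] r_def[symmetric] by (elim adm_mono) linarith
      next
        case True
        define A where "A = C * r + 4 * (1/2)^n"
        have r0: "0 \<le> r" by (simp add: r_def rate_nonneg)
        have A0: "0 \<le> A" using C4 r0 by (simp add: A_def)
        have "adm p \<epsilon> outT (brick (l / 2^k) (L / 2^k)) (l * (L * l) / 8^k * A * (2 * ratio)^k)" for k
        proof -
          have "adm p \<epsilon> outT (brick (l / 2^k) (L / 2^k)) (l / 2^k * (L / 2^k * (l / 2^k)) * (C * rate p \<epsilon> (l / 2^k) (L / 2^k) + 4 * (1/2)^n))"
          proof -
            have "0 < L / 2^k \<and> L / 2^k \<le> l / 2^k" using L by (simp add: divide_right_mono)
            then show ?thesis using Suc by blast
          qed
          moreover have "(8::real)^k = 2^k * (2^k * 2^k)" by (simp flip: power_mult_distrib)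
          then have "l / 2^k * (L / 2^k * (l / 2^k)) = V / 8^k" by (simp add: V_def)
          moreover have "V / 8^k * (C * rate p \<epsilon> (l / 2^k) (L / 2^k) + 4 * (1/2)^n) \<le> V / 8^k * (A * (2 * ratio)^k)"
          proof (intro mult_left_mono)
            have "C * rate p \<epsilon> (l / 2^k) (L / 2^k) \<le> C * (r * (2 * ratio)^k)"
              unfolding r_def using C4 by (intro mult_left_mono rate_scale L l eps p) auto
            \<comment> \<open>The iteration error does not depend on the scale, yet the filling
              expects the common growth factor; this is harmless as \<open>2 * ratio\<close> is at
              least 1.\<close>
            moreover have "4 * (1/2)^n * 1 \<le> 4 * (1/2)^n * (2 * ratio)^k"
              by (intro mult_left_mono one_le_power ratio) simp
            ultimately show "C * rate p \<epsilon> (l / 2^k) (L / 2^k) + 4 * (1/2)^n \<le> A * (2 * ratio)^k"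
              unfolding A_def distrib_right mult.assoc by linarith
          qed (use V in simp)
          ultimately show ?thesis unfolding V_def[symmetric] by (simp only: mult.assoc) (elim adm_mono)
        qed
        then have N: "adm p \<epsilon> outT (brick l L - below b l L 1) (l * (L * l) * A * ((16 + 30816 / (1 - ratio)) * ratio^k0))"
          unfolding b_def using p by (intro leftover_adm L l A0) auto
        have "adm p \<epsilon> outT (below b l L 1 \<union> (brick l L - below b l L 1))
            (l * (L * l) * (cell_const b * rate p \<epsilon> l L) + l * (L * l) * A * ((16 + 30816 / (1 - ratio)) * ratio^k0))"
          by (intro adm_union N cell_adm b L p eps True) blast
        moreover have "below b l L 1 \<union> (brick l L - below b l L 1) = brick l L" unfolding below_def by blast
        moreover have "V * (cell_const b * r) + V * A * ((16 + 30816 / (1 - ratio)) * ratio^k0) \<le> V * (C * r + 4 * (1/2)^Suc n)"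
        proof -
          have "V * A * ((16 + 30816 / (1 - ratio)) * ratio^k0) \<le> V * A * (1/2)"
            using V A0 k0 by (intro mult_left_mono) auto
          moreover have "V * (cell_const b * r) + V * A * (1/2) = V * (C * r + 4 * (1/2)^Suc n)"
            unfolding A_def C_def by (simp add: algebra_simps)
          ultimately show ?thesis by linarith
        qed
        ultimately show ?thesis unfolding V_def r_def by (auto elim: adm_mono)
      qed
    qed
  qed
  show ?thesis
  proof (intro exI[of _ C] conjI allI impI)
    show "0 < C" using C4 by simp
    fix p \<epsilon> l L :: real assume h: "1 \<le> p \<and> p \<le> 3 \<and> 0 < \<epsilon> \<and> 0 < L \<and> L \<le> l"
    show "adm p \<epsilon> outT (brick l L) (l * (L * l) * (C * rate p \<epsilon> l L))"
    proof (rule adm_closure)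
      fix \<eta> :: real assume "\<eta> > 0"
      have "((\<lambda>n. l * (L * l) * (4 * (1/2)^n)) \<longlongrightarrow> l * (L * l) * (4 * 0)) sequentially"
        by (intro tendsto_intros LIMSEQ_realpow_zero) auto
      then have "eventually (\<lambda>n. l * (L * l) * (4 * (1/2)^n) < \<eta>) sequentially"
        using \<open>\<eta> > 0\<close> by (intro order_tendstoD(2)[of _ "l * (L * l) * (4 * 0)"]) auto
      then obtain n where "l * (L * l) * (4 * (1/2)^n) < \<eta>" unfolding eventually_sequentially by blast
      then have "l * (L * l) * (C * rate p \<epsilon> l L + 4 * (1/2)^n) \<le> l * (L * l) * (C * rate p \<epsilon> l L) + \<eta>"
        by (simp only: distrib_left)
      then show "adm p \<epsilon> outT (brick l L) (l * (L * l) * (C * rate p \<epsilon> l L) + \<eta>)"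
        using claim[of p \<epsilon> n] h by (blast intro: adm_mono)
    qed
  qed
qed

text \<open>The cube is stacked in \<open>s\<close> from flat bricks of thickness \<open>L\<close>
  and unit lateral sides. Equating \<open>L^p\<close> with
  \<open>(\<epsilon> / L)^(2p / (2p + 1))\<close> gives \<open>L = \<epsilon>^(2 / (2p + 3))\<close>
  and the final exponent. Rounding to the reciprocal of an integer loses at most a factor 2 in
  \<open>L\<close>, and \<open>3 = 1 + 2\<close> collects the two terms.\<close>

lemma unit_cube_adm:
  "\<exists>C>0. \<forall>p \<epsilon>. 1 \<le> p \<and> p \<le> 3 \<and> 0 < \<epsilon> \<and> \<epsilon> < 1 \<longrightarrow>
     adm p \<epsilon> outT (brick 1 1) (C * \<epsilon> powr (2 * p / (2 * p + 3)))"
proof -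
  obtain C where C: "C > 0" "\<And>p \<epsilon> l L. 1 \<le> p \<Longrightarrow> p \<le> 3 \<Longrightarrow> 0 < \<epsilon> \<Longrightarrow> 0 < L \<Longrightarrow> L \<le> l \<Longrightarrow>
     adm p \<epsilon> outT (brick l L) (l * (L * l) * (C * rate p \<epsilon> l L))"
    using outer_brick by metis
  show ?thesis
  proof (intro exI[of _ "3 * C"] conjI allI impI)
    show "0 < 3 * C" using C by simp
    fix p \<epsilon> :: real assume h: "1 \<le> p \<and> p \<le> 3 \<and> 0 < \<epsilon> \<and> \<epsilon> < 1"
    define x where "x = \<epsilon> powr (2 / (2 * p + 3))"
    have x: "0 < x" "x \<le> 1" using h by (auto simp: x_def intro: powr_le1)
    define n where "n = nat \<lceil>1 / x\<rceil>"
    have x1: "1 \<le> 1 / x" using x by simp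
    have n: "1 / x \<le> real n" "real n \<le> 1 / x + 1" "0 < n" unfolding n_def using x1 by linarith+
    define L where "L = 1 / real n"
    have L: "0 < L" "L \<le> x" "x / 2 \<le> L"
    proof -
      show "0 < L" using n by (simp add: L_def)
      show "L \<le> x" using n x by (simp add: L_def field_simps)
      have "real n \<le> 2 / x" using n(2) x1 by simp
      then show "x / 2 \<le> L" using n x by (simp add: L_def field_simps)
    qed
    have "L \<le> 1" using L x by linarith
    then have B: "adm p \<epsilon> outT (brick 1 L) (1 * (L * 1) * (C * rate p \<epsilon> 1 L))" using h L by (intro C) auto
    have img: "(+) (0, real i * L, 0) ` brick 1 L = {0..<1} \<times> ((+) (real i * L) ` {0..<L}) \<times> {0..<1}" for i
    proof (intro set_eqI)
      fix q :: r3
      show "q \<in> (+) (0, real i * L, 0) ` brick 1 L \<longleftrightarrow> q \<in> {0..<1} \<times> ((+) (real i * L) ` {0..<L}) \<times> {0..<1}"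
        by (cases q) (simp only: in_translate mem_Times_iff diff_Pair fst_conv snd_conv diff_0_right)
    qed
    have A: "adm p \<epsilon> outT (\<Union>i<n. (+) (0, real i * L, 0) ` brick 1 L) (\<Sum>i<n. 1 * (L * 1) * (C * rate p \<epsilon> 1 L))"
    proof (intro adm_UN adm_translate B)
      show "disjoint_family_on (\<lambda>i. (+) (0, real i * L, 0) ` brick 1 L) {..<n}"
        unfolding disjoint_family_on_def
      proof (intro ballI impI equals0I)
        fix i j q assume "i \<noteq> j" "q \<in> (+) (0, real i * L, 0) ` brick 1 L \<inter> (+) (0, real j * L, 0) ` brick 1 L"
        then have "fst (snd q) \<in> (+) (real i * L) ` {0..<L}" "fst (snd q) \<in> (+) (real j * L) ` {0..<L}"
          unfolding img by (simp_all only: Int_iff mem_Times_iff)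
        then show False using interval_tiles_disjoint[OF L(1)] \<open>i \<noteq> j\<close> by blast
      qed
    qed simp
    have U: "(\<Union>i<n. (+) (0, real i * L, 0) ` brick 1 L) = brick 1 1"
    proof -
      have "(\<Union>i<n. (+) (0, real i * L, 0) ` brick 1 L) = {0..<1} \<times> (\<Union>i<n. (+) (real i * L) ` {0..<L}) \<times> {0..<1}"
        unfolding img by blast
      moreover have "real n * L = 1" using n by (simp add: L_def)
      ultimately show ?thesis unfolding interval_tiles[OF L(1), symmetric] by simp
    qed
    have S: "(\<Sum>i<n. 1 * (L * 1) * (C * rate p \<epsilon> 1 L)) = C * rate p \<epsilon> 1 L" using n by (simp add: L_def)
    have R: "C * rate p \<epsilon> 1 L \<le> 3 * C * \<epsilon> powr (2 * p / (2 * p + 3))"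
    proof -
      define \<alpha> where "\<alpha> = 2 * p / (2 * p + 1)"
      have a: "0 \<le> \<alpha>" "\<alpha> \<le> 1" using h by (simp_all add: \<alpha>_def)
      have "(L / 1) powr p \<le> x powr p" using L h by (intro powr_mono2) auto
      also have "x powr p = \<epsilon> powr (2 * p / (2 * p + 3))" by (simp add: x_def powr_powr)
      finally have 1: "(L / 1) powr p \<le> \<epsilon> powr (2 * p / (2 * p + 3))" .
      have "\<epsilon> / L \<le> \<epsilon> / (x / 2)" using L x h by (intro divide_left_mono) auto
      then have "(\<epsilon> / L) powr \<alpha> \<le> (2 * (\<epsilon> / x)) powr \<alpha>" using L x h a by (intro powr_mono2) (auto simp: mult.commute)
      also have "\<dots> = 2 powr \<alpha> * (\<epsilon> / x) powr \<alpha>" by (rule powr_mult)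
      also have "\<dots> \<le> 2 powr 1 * (\<epsilon> / x) powr \<alpha>" using a by (intro mult_right_mono powr_mono) auto
      also have "\<epsilon> / x = \<epsilon> powr (1 - 2 / (2 * p + 3))" using h by (simp add: x_def powr_diff)
      also have "(\<epsilon> powr (1 - 2 / (2 * p + 3))) powr \<alpha> = \<epsilon> powr (2 * p / (2 * p + 3))"
      proof -
        have "1 - 2 / (2 * p + 3) = (2 * p + 1) / (2 * p + 3)" using h by (simp add: field_simps)
        then have "(1 - 2 / (2 * p + 3)) * \<alpha> = 2 * p / (2 * p + 3)" using h by (simp add: \<alpha>_def)
        then show ?thesis by (simp only: powr_powr)
      qed
      finally have "rate p \<epsilon> 1 L \<le> 3 * \<epsilon> powr (2 * p / (2 * p + 3))"
        using 1 unfolding rate_def \<alpha>_def[symmetric] by simp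
      then have "C * rate p \<epsilon> 1 L \<le> C * (3 * \<epsilon> powr (2 * p / (2 * p + 3)))" using C(1) by (intro mult_left_mono) auto
      then show ?thesis by simp
    qed
    show "adm p \<epsilon> outT (brick 1 1) (3 * C * \<epsilon> powr (2 * p / (2 * p + 3)))"
      using adm_mono[OF A[unfolded U S] R] .
  qed
qed

section \<open>Lipschitz maps and their weak gradients\<close>

lemma C1c_props:
  fixes \<phi> :: "'a::euclidean_space \<Rightarrow> 'b::euclidean_space"
  assumes "\<phi> \<in> C1c S"
  obtains \<phi>' :: "'a \<Rightarrow> 'a \<Rightarrow>\<^sub>L 'b" and M r where "continuous_on UNIV \<phi>'" "\<And>x. (\<phi> has_derivative blinfun_apply (\<phi>' x)) (at x)"
    "\<And>x. norm (\<phi>' x) \<le> M" "0 \<le> M" "\<And>x. \<phi> x \<noteq> 0 \<Longrightarrow> x \<in> cball 0 r" "0 \<le> r" "\<And>x. x \<notin> S \<Longrightarrow> \<phi>' x = 0" "\<And>x. x \<notin> cball 0 r \<Longrightarrow> \<phi>' x = 0"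
    "continuous_on UNIV \<phi>" "M-lipschitz_on UNIV \<phi>"
proof -
  obtain \<phi>' :: "'a \<Rightarrow> 'a \<Rightarrow>\<^sub>L 'b" and T where c: "continuous_on UNIV \<phi>'" and d: "\<And>x. (\<phi> has_derivative blinfun_apply (\<phi>' x)) (at x)"
    and T: "compact T" "T \<subseteq> S" "\<And>x. x \<notin> T \<Longrightarrow> \<phi> x = 0"
    using assms unfolding C1c_def by blast
  have z: "\<phi>' x = 0" if "x \<notin> T" for x
  proof -
    have "open (- T)" using T(1) compact_imp_closed by blast
    then have "(\<phi> has_derivative (\<lambda>_. 0)) (at x)"
      by (rule has_derivative_transform_within_open[OF has_derivative_const]) (use that T(3) in auto)
    then have "blinfun_apply (\<phi>' x) = (\<lambda>_. 0)" using d by (rule has_derivative_unique[rotated])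
    then show ?thesis by (intro blinfun_eqI) simp
  qed
  have "compact (\<phi>' ` T)" using c T(1) by (intro compact_continuous_image continuous_on_subset[OF c]) auto
  then have "bounded (\<phi>' ` T)" by (rule compact_imp_bounded)
  then obtain M0 where "\<forall>y\<in>\<phi>' ` T. norm y \<le> M0" unfolding bounded_iff by blast
  then have M0: "\<And>x. x \<in> T \<Longrightarrow> norm (\<phi>' x) \<le> M0" by blast
  define M where "M = max 0 M0"
  have M: "norm (\<phi>' x) \<le> M" "0 \<le> M" for x
  proof -
    show "norm (\<phi>' x) \<le> M" using M0[of x] z[of x] by (cases "x \<in> T") (auto simp: M_def)
    show "0 \<le> M" by (simp add: M_def)
  qed
  obtain r0 where "\<forall>x\<in>T. norm x \<le> r0" using compact_imp_bounded[OF T(1)] unfolding bounded_iff by blast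
  then have r0: "\<And>x. x \<in> T \<Longrightarrow> norm x \<le> r0" by blast
  define r where "r = max 0 r0"
  have r: "T \<subseteq> cball 0 r"
  proof
    fix x assume "x \<in> T" then show "x \<in> cball 0 r" using r0[of x] by (simp add: r_def)
  qed
  show ?thesis
  proof (rule that[OF c d M])
    show "x \<in> cball 0 r" if "\<phi> x \<noteq> 0" for x using that T(3) r by blast
    show "0 \<le> r" by (simp add: r_def)
    show "\<phi>' x = 0" if "x \<notin> S" for x using that T(2) z by blast
    show "\<phi>' x = 0" if "x \<notin> cball 0 r" for x using that r z by blast
    show "continuous_on UNIV \<phi>" by (intro continuous_at_imp_continuous_on ballI has_derivative_continuous[OF d])
    show "M-lipschitz_on UNIV \<phi>"
    proof (rule bounded_derivative_imp_lipschitz[where f'="\<lambda>x. blinfun_apply (\<phi>' x)"])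
      show "(\<phi> has_derivative blinfun_apply (\<phi>' x)) (at x within UNIV)" for x using d by simp
      show "onorm (blinfun_apply (\<phi>' x)) \<le> M" for x using M(1)[of x] unfolding norm_blinfun.rep_eq .
    qed (use M in simp_all)
  qed
qed

lemma partial_deriv_eq:
  assumes "(\<phi> has_derivative D) (at x)" shows "partial_deriv j \<phi> x = D (axis j 1)"
  unfolding partial_deriv_def using frechet_derivative_at[OF assms] by simp

definition quot :: "(real^'n::finite \<Rightarrow> 'b::real_normed_vector) \<Rightarrow> 'n \<Rightarrow> nat \<Rightarrow> real^'n \<Rightarrow> 'b" where
  "quot f j n x = real (Suc n) *\<^sub>R (f (x + (1 / real (Suc n)) *\<^sub>R axis j 1) - f x)"

lemma quot_tendsto:
  fixes f :: "real^'n::finite \<Rightarrow> 'b::real_normed_vector"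
  assumes "(f has_derivative D) (at x)"
  shows "(\<lambda>n. quot f j n x) \<longlonglongrightarrow> D (axis j 1)"
proof -
  have lin: "linear D" using assms has_derivative_linear by blast
  define a :: "nat \<Rightarrow> real^'n" where "a = (\<lambda>n. (1 / real (Suc n)) *\<^sub>R axis j 1)"
  have na: "norm (a n) = 1 / real (Suc n)" "a n \<noteq> 0" for n by (simp_all add: a_def)
  have "(\<lambda>n. 1 / real (Suc n)) \<longlonglongrightarrow> 0" using LIMSEQ_inverse_real_of_nat by (simp add: inverse_eq_divide)
  then have "a \<longlonglongrightarrow> 0 *\<^sub>R axis j 1" unfolding a_def by (intro tendsto_scaleR tendsto_const)
  then have "filterlim a (at 0) sequentially" using na(2) by (simp add: filterlim_at)
  moreover have "((\<lambda>h. norm (f (x + h) - f x - D h) / norm h) \<longlongrightarrow> 0) (at 0)" using assms by (simp add: has_derivative_at)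
  ultimately have "(\<lambda>n. norm (f (x + a n) - f x - D (a n)) / norm (a n)) \<longlonglongrightarrow> 0" by (rule filterlim_compose[rotated])
  moreover have "norm (f (x + a n) - f x - D (a n)) / norm (a n) = norm (quot f j n x - D (axis j 1))" for n
  proof -
    have "D (a n) = (1 / real (Suc n)) *\<^sub>R D (axis j 1)" unfolding a_def by (rule linear_cmul[OF lin])
    then have "quot f j n x - D (axis j 1) = real (Suc n) *\<^sub>R (f (x + a n) - f x - D (a n))"
      by (simp add: quot_def a_def scaleR_diff_right)
    then show ?thesis by (simp add: na(1) mult.commute)
  qed
  ultimately have "(\<lambda>n. norm (quot f j n x - D (axis j 1))) \<longlonglongrightarrow> 0" by (simp only:)
  then show ?thesis by (rule LIM_zero_cancel[OF tendsto_norm_zero_cancel])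
qed

lemma quot_bound:
  assumes "K-lipschitz_on UNIV f" shows "norm (quot f j n x) \<le> K"
proof -
  have "norm (f (x + (1 / real (Suc n)) *\<^sub>R axis j 1) - f x) \<le> K * (1 / real (Suc n))"
    using lipschitz_onD[OF assms, of "x + (1 / real (Suc n)) *\<^sub>R axis j 1" x] by (simp add: dist_norm)
  then have "real (Suc n) * norm (f (x + (1 / real (Suc n)) *\<^sub>R axis j 1) - f x) \<le> real (Suc n) * (K * (1 / real (Suc n)))"
    by (intro mult_left_mono) auto
  then show ?thesis by (simp add: quot_def)
qed

lemma lborel_integral_translate:
  fixes f :: "'a::euclidean_space \<Rightarrow> real"
  assumes "f \<in> borel_measurable borel"
  shows "(\<integral>x. f (a + x) \<partial>lborel) = (\<integral>x. f x \<partial>lborel)"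
proof -
  have "(\<integral>x. f x \<partial>lborel) = (\<integral>x. f x \<partial>distr lborel borel ((+) a))" by (simp only: lborel_distr_plus)
  also have "\<dots> = (\<integral>x. f (a + x) \<partial>lborel)" using assms by (intro integral_distr) auto
  finally show ?thesis ..
qed

lemma integrable_cball: "integrable lborel (\<lambda>x. B * indicator (cball (0::'a::euclidean_space) r) x :: real)"
proof (intro integrable_mult_right integrable_real_indicator)
  show "emeasure lborel (cball (0::'a) r) < \<infinity>" by (rule emeasure_bounded_finite[OF bounded_cball])
qed simp

lemma integrable_compact_support:
  fixes f :: "'a::euclidean_space \<Rightarrow> real"
  assumes "f \<in> borel_measurable borel" "\<And>x. \<bar>f x\<bar> \<le> B" "\<And>x. x \<notin> cball 0 r \<Longrightarrow> f x = 0"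
  shows "integrable lborel f"
proof (rule Bochner_Integration.integrable_bound)
  show "integrable lborel (\<lambda>x. B * indicator (cball (0::'a) r) x)" by (rule integrable_cball)
  show "AE x in lborel. norm (f x) \<le> norm (B * indicator (cball (0::'a) r) x)"
  proof (intro AE_I2)
    fix x
    have "\<bar>f x\<bar> \<le> \<bar>B\<bar>" using assms(2)[of x] by linarith
    then show "norm (f x) \<le> norm (B * indicator (cball (0::'a) r) x)"
      using assms(3)[of x] by (cases "x \<in> cball 0 r") simp_all
  qed
qed (use assms in auto)

text \<open>Discrete integration by parts; the quotient of \<open>\<phi>\<close> is a backward one, obtained by translating.\<close>

lemma discrete_parts:
  fixes f \<phi> :: "real^'n::finite \<Rightarrow> real"
  assumes f: "f \<in> borel_measurable borel" "\<And>R. \<exists>B. \<forall>x\<in>cball 0 R. \<bar>f x\<bar> \<le> B"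
    and \<phi>: "continuous_on UNIV \<phi>" "\<And>x. \<phi> x \<noteq> 0 \<Longrightarrow> x \<in> cball 0 r" "\<And>x. \<bar>\<phi> x\<bar> \<le> M"
  shows "(\<integral>x. quot f j n x * \<phi> x \<partial>lborel)
    = - (\<integral>x. f x * (real (Suc n) * (\<phi> x - \<phi> (x - (1 / real (Suc n)) *\<^sub>R axis j 1))) \<partial>lborel)"
proof -
  define a :: "real^'n" where "a = (1 / real (Suc n)) *\<^sub>R axis j 1"
  have na: "norm a \<le> 1" by (simp add: a_def)
  have mf: "(\<lambda>x. f (x + a)) \<in> borel_measurable borel" using f(1) by measurable
  have m\<phi>: "\<phi> \<in> borel_measurable borel" using \<phi>(1) by (rule borel_measurable_continuous_onI)
  have m\<phi>a: "(\<lambda>x. \<phi> (x - a)) \<in> borel_measurable borel" using m\<phi> by measurable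
  have int: "integrable lborel (\<lambda>x. g x * \<psi> x)" if "g \<in> borel_measurable borel" "\<psi> \<in> borel_measurable borel"
    "\<And>R. \<exists>B. \<forall>x\<in>cball 0 R. \<bar>g x\<bar> \<le> B" "\<And>x. \<psi> x \<noteq> 0 \<Longrightarrow> x \<in> cball 0 (r + 1)" "\<And>x. \<bar>\<psi> x\<bar> \<le> M" for g \<psi> :: "real^'n \<Rightarrow> real"
  proof -
    have "\<exists>B. \<forall>x\<in>cball 0 (r + 1). \<bar>g x\<bar> \<le> B" using that(3) by blast
    then obtain B where B: "\<And>x. x \<in> cball 0 (r + 1) \<Longrightarrow> \<bar>g x\<bar> \<le> B" by blast
    have M: "0 \<le> M" using that(5) abs_ge_zero order_trans by blast
    show ?thesis
    proof (rule integrable_compact_support[where B="\<bar>B\<bar> * M" and r="r + 1"])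
      show "\<bar>g x * \<psi> x\<bar> \<le> \<bar>B\<bar> * M" for x
      proof (cases "x \<in> cball 0 (r + 1)")
        case True
        then have "\<bar>g x\<bar> \<le> \<bar>B\<bar>" using B[OF True] by linarith
        then show ?thesis unfolding abs_mult using that(5)[of x] by (intro mult_mono) auto
      next
        case False then have "\<psi> x = 0" using that(4) by blast
        then show ?thesis using M by simp
      qed
      show "g x * \<psi> x = 0" if "x \<notin> cball 0 (r + 1)" for x using that \<open>\<And>x. \<psi> x \<noteq> 0 \<Longrightarrow> x \<in> cball 0 (r + 1)\<close> by auto
    qed (use that in measurable)
  qed
  have fa: "\<exists>B. \<forall>x\<in>cball 0 R. \<bar>f (x + a)\<bar> \<le> B" for R
  proof -
    obtain B where "\<forall>x\<in>cball 0 (R + 1). \<bar>f x\<bar> \<le> B" using f(2) by blast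
    moreover have "x + a \<in> cball 0 (R + 1)" if "x \<in> cball 0 R" for x
      using that na norm_triangle_ineq[of x a] by simp
    ultimately show ?thesis by blast
  qed
  have s1: "x \<in> cball 0 (r + 1)" if "\<phi> x \<noteq> 0" for x using \<phi>(2)[OF that] by simp
  have s2: "x \<in> cball 0 (r + 1)" if "\<phi> (x - a) \<noteq> 0" for x
    using \<phi>(2)[OF that] na norm_triangle_ineq2[of x a] by simp
  have i1: "integrable lborel (\<lambda>x. f (x + a) * \<phi> x)" by (intro int mf m\<phi> fa s1 \<phi>(3))
  have i2: "integrable lborel (\<lambda>x. f x * \<phi> x)" by (intro int f m\<phi> s1 \<phi>(3))
  have i3: "integrable lborel (\<lambda>x. f x * \<phi> (x - a))" by (intro int f m\<phi>a s2 \<phi>(3))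
  have tr: "(\<integral>x. f (x + a) * \<phi> x \<partial>lborel) = (\<integral>x. f x * \<phi> (x - a) \<partial>lborel)"
  proof -
    have "(\<lambda>x. f x * \<phi> (x - a)) \<in> borel_measurable borel" using f(1) m\<phi>a by measurable
    from lborel_integral_translate[OF this, of a] show ?thesis by (simp add: add.commute)
  qed
  have "(\<integral>x. quot f j n x * \<phi> x \<partial>lborel) = (\<integral>x. real (Suc n) * (f (x + a) * \<phi> x - f x * \<phi> x) \<partial>lborel)"
    by (simp add: quot_def a_def algebra_simps)
  also have "\<dots> = real (Suc n) * ((\<integral>x. f (x + a) * \<phi> x \<partial>lborel) - (\<integral>x. f x * \<phi> x \<partial>lborel))"
    using i1 i2 by simp
  also have "\<dots> = - (real (Suc n) * ((\<integral>x. f x * \<phi> x \<partial>lborel) - (\<integral>x. f x * \<phi> (x - a) \<partial>lborel)))"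
    unfolding tr by (simp add: algebra_simps)
  also have "\<dots> = - (\<integral>x. real (Suc n) * (f x * \<phi> x - f x * \<phi> (x - a)) \<partial>lborel)"
    using i2 i3 by simp
  also have "\<dots> = - (\<integral>x. f x * (real (Suc n) * (\<phi> x - \<phi> (x - a))) \<partial>lborel)"
    by (simp add: algebra_simps)
  finally show ?thesis unfolding a_def .
qed

lemma backward_tendsto:
  fixes \<phi> f :: "real^'n::finite \<Rightarrow> real"
  assumes f: "f \<in> borel_measurable borel" "\<And>R. \<exists>B. \<forall>x\<in>cball 0 R. \<bar>f x\<bar> \<le> B" and \<phi>: "\<phi> \<in> C1c UNIV"
  shows "(\<lambda>n. \<integral>x. f x * (real (Suc n) * (\<phi> x - \<phi> (x - (1 / real (Suc n)) *\<^sub>R axis j 1))) \<partial>lborel)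
    \<longlonglongrightarrow> (\<integral>x. f x * partial_deriv j \<phi> x \<partial>lborel)"
proof -
  obtain \<phi>' :: "real^'n \<Rightarrow> (real^'n) \<Rightarrow>\<^sub>L real" and M r where
    c: "continuous_on UNIV \<phi>'" and d: "\<And>x. (\<phi> has_derivative blinfun_apply (\<phi>' x)) (at x)"
    and M: "0 \<le> M" and r: "\<And>x. \<phi> x \<noteq> 0 \<Longrightarrow> x \<in> cball 0 r"
    and cp: "continuous_on UNIV \<phi>" and L: "M-lipschitz_on UNIV \<phi>"
    by (rule C1c_props[OF \<phi>]) blast
  define a :: "nat \<Rightarrow> real^'n" where "a = (\<lambda>n. (1 / real (Suc n)) *\<^sub>R axis j 1)"
  have na: "norm (a n) = 1 / real (Suc n)" "norm (a n) \<le> 1" for n by (simp_all add: a_def)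
  have m\<phi>: "\<phi> \<in> borel_measurable borel" using cp by (rule borel_measurable_continuous_onI)
  have pd: "partial_deriv j \<phi> x = blinfun_apply (\<phi>' x) (axis j 1)" for x by (rule partial_deriv_eq[OF d])
  have mp: "(\<lambda>x. partial_deriv j \<phi> x) \<in> borel_measurable borel"
    unfolding pd by (intro borel_measurable_continuous_onI continuous_intros c)
  obtain B where B: "\<And>x. x \<in> cball 0 (r + 1) \<Longrightarrow> \<bar>f x\<bar> \<le> B" using f(2)[of "r + 1"] by blast
  show ?thesis
  proof (rule integral_dominated_convergence[where w="\<lambda>x. \<bar>B\<bar> * M * indicator (cball 0 (r + 1)) x"])
    show "(\<lambda>x. f x * partial_deriv j \<phi> x) \<in> borel_measurable lborel" using f(1) mp by simp
    show "(\<lambda>x. f x * (real (Suc n) * (\<phi> x - \<phi> (x - (1 / real (Suc n)) *\<^sub>R axis j 1)))) \<in> borel_measurable lborel" for n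
      using f(1) m\<phi> by measurable
    show "integrable lborel (\<lambda>x. \<bar>B\<bar> * M * indicator (cball (0 :: real^'n) (r + 1)) x)" by (rule integrable_cball)
    show "AE x in lborel. norm (f x * (real (Suc n) * (\<phi> x - \<phi> (x - (1 / real (Suc n)) *\<^sub>R axis j 1)))) \<le> \<bar>B\<bar> * M * indicator (cball 0 (r + 1)) x" for n
    proof (intro AE_I2)
      fix x
      have "norm (\<phi> x - \<phi> (x - a n)) \<le> M * (1 / real (Suc n))"
        using lipschitz_onD[OF L, of x "x - a n"] na(1) by (simp add: dist_norm)
      then have "real (Suc n) * norm (\<phi> x - \<phi> (x - a n)) \<le> real (Suc n) * (M * (1 / real (Suc n)))"
        by (intro mult_left_mono) auto
      then have q: "\<bar>real (Suc n) * (\<phi> x - \<phi> (x - a n))\<bar> \<le> M" by (simp add: abs_mult)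
      show "norm (f x * (real (Suc n) * (\<phi> x - \<phi> (x - (1 / real (Suc n)) *\<^sub>R axis j 1)))) \<le> \<bar>B\<bar> * M * indicator (cball 0 (r + 1)) x"
      proof (cases "x \<in> cball 0 (r + 1)")
        case True
        then have "\<bar>f x\<bar> \<le> \<bar>B\<bar>" using B[OF True] by linarith
        then have "\<bar>f x\<bar> * \<bar>real (Suc n) * (\<phi> x - \<phi> (x - a n))\<bar> \<le> \<bar>B\<bar> * M" using q by (intro mult_mono) auto
        then show ?thesis using True by (simp only: a_def real_norm_def abs_mult indicator_simps mult_1_right)
      next
        case False
        then have "\<phi> x = 0" using r[of x] by fastforce
        moreover have "\<phi> (x - a n) = 0"
        proof (rule ccontr)
          assume "\<phi> (x - a n) \<noteq> 0"
          then have "norm (x - a n) \<le> r" using r[of "x - a n"] by simp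
          then have "norm x \<le> r + 1" using norm_triangle_ineq2[of x "a n"] na(2)[of n] by linarith
          then show False using False by simp
        qed
        ultimately show ?thesis using False by (simp add: a_def)
      qed
    qed
    show "AE x in lborel. (\<lambda>n. f x * (real (Suc n) * (\<phi> x - \<phi> (x - (1 / real (Suc n)) *\<^sub>R axis j 1)))) \<longlonglongrightarrow> f x * partial_deriv j \<phi> x"
    proof (intro AE_I2 tendsto_mult_left)
      fix x
      \<comment> \<open>Point reflection at \<open>x\<close> turns the backward quotient of
        \<open>\<phi>\<close> into the forward quotient of \<open>\<psi>\<close>, and
        \<open>\<psi>\<close> has the same derivative at \<open>x\<close>.\<close>
      define \<psi> where "\<psi> = (\<lambda>y. - \<phi> (2 *\<^sub>R x - y))"
      have "(\<psi> has_derivative blinfun_apply (\<phi>' x)) (at x)"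
      proof -
        have "((\<lambda>y. 2 *\<^sub>R x - y) has_derivative (\<lambda>h. - h)) (at x)" by (auto intro!: derivative_eq_intros)
        moreover have "(\<phi> has_derivative blinfun_apply (\<phi>' x)) (at (2 *\<^sub>R x - x))" using d[of x] by (simp add: scaleR_2)
        ultimately have "((\<lambda>y. \<phi> (2 *\<^sub>R x - y)) has_derivative (\<lambda>h. blinfun_apply (\<phi>' x) (- h))) (at x)"
          by (rule has_derivative_compose)
        then have "((\<lambda>y. - \<phi> (2 *\<^sub>R x - y)) has_derivative (\<lambda>h. - blinfun_apply (\<phi>' x) (- h))) (at x)" by (rule has_derivative_minus)
        then show ?thesis unfolding \<psi>_def by (simp add: blinfun.minus_right)
      qed
      from quot_tendsto[OF this, of j]
      have "(\<lambda>n. quot \<psi> j n x) \<longlonglongrightarrow> partial_deriv j \<phi> x" unfolding pd .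
      moreover have "quot \<psi> j n x = real (Suc n) * (\<phi> x - \<phi> (x - (1 / real (Suc n)) *\<^sub>R axis j 1))" for n
      proof -
        have "2 *\<^sub>R x - (x + y) = x - y" for y by (simp add: scaleR_2)
        then show ?thesis by (simp add: quot_def \<psi>_def scaleR_2)
      qed
      ultimately show "(\<lambda>n. real (Suc n) * (\<phi> x - \<phi> (x - (1 / real (Suc n)) *\<^sub>R axis j 1))) \<longlonglongrightarrow> partial_deriv j \<phi> x"
        by (simp only:)
    qed
  qed
qed

lemma Lp_loc_bounded:
  fixes f :: "'a::euclidean_space \<Rightarrow> 'b::euclidean_space"
  assumes f: "f \<in> borel_measurable borel" "\<And>R. \<exists>B. \<forall>x\<in>cball 0 R. norm (f x) \<le> B" and q: "0 \<le> q"
  shows "f \<in> Lp_loc q"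
  unfolding Lp_loc_def mem_Collect_eq
proof (intro conjI allI impI)
  show "f \<in> borel_measurable lebesgue" using f(1) by (intro measurable_completion) simp
  fix T :: "'a set" assume T: "compact T"
  obtain R where "\<forall>x\<in>T. norm x \<le> R" using compact_imp_bounded[OF T] unfolding bounded_iff by blast
  then have R: "T \<subseteq> cball 0 R" by (intro subsetI) simp
  obtain B where B: "\<forall>x\<in>cball 0 R. norm (f x) \<le> B" using f(2) by blast
  have Tb: "T \<in> sets borel" using compact_imp_closed[OF T] by (rule borel_closed)
  have m: "(\<lambda>x. indicator T x * norm (f x) powr q) \<in> borel_measurable borel" using f(1) Tb by simp
  have "integrable lborel (\<lambda>x. indicator T x * norm (f x) powr q)"
  proof (rule integrable_compact_support[OF m, where B="\<bar>B\<bar> powr q" and r=R])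
    fix x :: 'a
    show "\<bar>indicator T x * norm (f x) powr q\<bar> \<le> \<bar>B\<bar> powr q"
    proof (cases "x \<in> T")
      case True
      then have "x \<in> cball 0 R" using R by blast
      then have "norm (f x) \<le> B" using B by blast
      then have "norm (f x) \<le> \<bar>B\<bar>" by linarith
      then have "norm (f x) powr q \<le> \<bar>B\<bar> powr q" using q by (intro powr_mono2) auto
      then show ?thesis using True by simp
    qed simp
    show "indicator T x * norm (f x) powr q = 0" if "x \<notin> cball 0 R"
    proof -
      have "x \<notin> T" using that R by blast
      then show ?thesis by simp
    qed
  qed
  then show "set_integrable lebesgue T (\<lambda>x. norm (f x) powr q)"
    unfolding set_integrable_def using m by (subst integrable_completion) simp_all
qed

lemma norm_matrix_le: "norm (A :: real^'n^'m) \<le> (\<Sum>i\<in>UNIV. \<Sum>j\<in>UNIV. \<bar>A $ i $ j\<bar>)"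
proof -
  have v: "norm (x :: 'b::real_normed_vector^'k) \<le> (\<Sum>i\<in>UNIV. norm (x $ i))" for x
    unfolding norm_vec_def by (rule L2_set_le_sum) simp
  have "norm A \<le> (\<Sum>i\<in>UNIV. norm (A $ i))" by (rule v)
  also have "\<dots> \<le> (\<Sum>i\<in>UNIV. \<Sum>j\<in>UNIV. norm (A $ i $ j))" by (intro sum_mono v)
  finally show ?thesis by simp
qed

lemma borel_measurable_matrix:
  fixes G :: "'a \<Rightarrow> real^'n^'m"
  assumes "\<And>i j. (\<lambda>x. G x $ i $ j) \<in> borel_measurable M"
  shows "G \<in> borel_measurable M"
proof (subst borel_measurable_euclidean_space, intro ballI)
  fix b :: "real^'n^'m" assume "b \<in> Basis"
  then obtain i c where "b = axis i c" "c \<in> Basis" unfolding Basis_vec_def by blast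
  then obtain j where "b = axis i (axis j 1)" unfolding Basis_vec_def by force
  then show "(\<lambda>x. G x \<bullet> b) \<in> borel_measurable M" using assms by (simp add: inner_axis)
qed

lemma lipschitz_locally_bounded:
  fixes u :: "'a::euclidean_space \<Rightarrow> 'b::euclidean_space"
  assumes "K-lipschitz_on UNIV u" shows "\<exists>B. \<forall>x\<in>cball 0 R. norm (u x) \<le> B"
proof (intro exI ballI)
  fix x :: 'a assume x: "x \<in> cball 0 R"
  have "norm (u x - u 0) \<le> K * norm x" using lipschitz_onD[OF assms, of x 0] by (simp add: dist_norm)
  also have "\<dots> \<le> K * R" using x lipschitz_on_nonneg[OF assms] by (intro mult_left_mono) auto
  finally show "norm (u x) \<le> norm (u 0) + K * R" using norm_triangle_ineq2[of "u x" "u 0"] by linarith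
qed

lemma lipschitz_component:
  fixes u :: "'a::metric_space \<Rightarrow> real^'n"
  assumes "K-lipschitz_on UNIV u" shows "K-lipschitz_on UNIV (\<lambda>x. u x $ i)"
proof (rule lipschitz_onI)
  fix x y
  have "\<bar>(u x - u y) $ i\<bar> \<le> norm (u x - u y)" by (rule component_le_norm_cart)
  also have "\<dots> \<le> K * dist x y" using lipschitz_onD[OF assms, of x y] by (simp add: dist_norm)
  finally show "dist (u x $ i) (u y $ i) \<le> K * dist x y" by (simp add: dist_real_def)
qed (rule lipschitz_on_nonneg[OF assms])

text \<open>Difference quotients are bounded by the Lipschitz constant and converge almost
  everywhere to the classical partial derivatives. Discrete integration by parts then passes to the
  limit on both sides by dominated convergence.\<close>

lemma lipschitz_weak_gradient:
  fixes u :: "real^'n \<Rightarrow> real^'n"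
  assumes L: "K-lipschitz_on UNIV u" and D: "AE x in lborel. \<exists>D. (u has_derivative D) (at x)"
  obtains G where "G \<in> borel_measurable borel" "\<exists>B. \<forall>x. norm (G x) \<le> B" "has_weak_gradient u G"
    "AE x in lborel. \<forall>D. (u has_derivative D) (at x) \<longrightarrow> (\<forall>i j. G x $ i $ j = D (axis j 1) $ i)"
proof -
  define q where "q = (\<lambda>i j n x. quot (\<lambda>x. u x $ i) j n x)"
  \<comment> \<open>Clamping makes \<open>G\<close> bounded even at points where the quotients have
    no limit; at points of differentiability the limit already lies in \<open>[-K, K]\<close> and
    clamping changes nothing.\<close>
  define G where "G = (\<lambda>x. \<chi> i j. max (-K) (min K (lim (\<lambda>n. q i j n x))))"
  have K: "0 \<le> K" by (rule lipschitz_on_nonneg[OF L])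
  have Li: "K-lipschitz_on UNIV (\<lambda>x. u x $ i)" for i by (rule lipschitz_component[OF L])
  have qb: "\<bar>q i j n x\<bar> \<le> K" for i j n x using quot_bound[OF Li[of i], of j n x] by (simp add: q_def)
  have ui: "(\<lambda>x. u x $ i) \<in> borel_measurable borel" for i
    by (intro borel_measurable_continuous_onI lipschitz_on_continuous_on[OF Li])
  have qm: "q i j n \<in> borel_measurable borel" for i j n
  proof -
    have "(\<lambda>x. u (x + a) $ i) \<in> borel_measurable borel" for a using ui[of i] by measurable
    then show ?thesis using ui[of i] unfolding q_def quot_def real_scaleR_def by measurable
  qed
  have Gij: "(\<lambda>x. G x $ i $ j) \<in> borel_measurable borel" for i j
    unfolding G_def using qm by simp
  have Gm: "G \<in> borel_measurable borel" by (rule borel_measurable_matrix[OF Gij])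
  have Gbij: "\<bar>G x $ i $ j\<bar> \<le> K" for x i j
  proof -
    have "\<bar>max (-K) (min K t)\<bar> \<le> K" for t using K by linarith
    then show ?thesis by (simp add: G_def)
  qed
  have Gb: "norm (G x) \<le> (\<Sum>i\<in>(UNIV :: 'n set). \<Sum>j\<in>(UNIV :: 'n set). K)" for x
    using norm_matrix_le[of "G x"] sum_mono[OF sum_mono[OF Gbij]] by (rule order_trans)
  have lim: "AE x in lborel. \<forall>D. (u has_derivative D) (at x) \<longrightarrow> (\<forall>i j. G x $ i $ j = D (axis j 1) $ i \<and> (\<lambda>n. q i j n x) \<longlonglongrightarrow> G x $ i $ j)"
  proof (intro AE_I2 allI impI)
    fix x D i j assume d: "(u has_derivative D) (at x)"
    have "((\<lambda>x. u x $ i) has_derivative (\<lambda>h. D h $ i)) (at x)"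
      using bounded_linear.has_derivative[OF bounded_linear_vec_nth d] .
    from quot_tendsto[OF this] have l: "(\<lambda>n. q i j n x) \<longlonglongrightarrow> D (axis j 1) $ i" unfolding q_def .
    have "\<bar>D (axis j 1) $ i\<bar> \<le> K"
      by (rule LIMSEQ_le_const2[OF tendsto_rabs[OF l]]) (use qb in blast)
    then have "max (-K) (min K (D (axis j 1) $ i)) = D (axis j 1) $ i" by linarith
    then have "G x $ i $ j = D (axis j 1) $ i" using limI[OF l] by (simp add: G_def)
    then show "G x $ i $ j = D (axis j 1) $ i \<and> (\<lambda>n. q i j n x) \<longlonglongrightarrow> G x $ i $ j" using l by simp
  qed
  have "has_weak_gradient u G"
    unfolding has_weak_gradient_def
  proof (intro conjI ballI allI)
    have "u \<in> borel_measurable borel" by (intro borel_measurable_continuous_onI lipschitz_on_continuous_on[OF L])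
    then show "u \<in> Lp_loc 1" by (intro Lp_loc_bounded lipschitz_locally_bounded[OF L]) simp_all
    show "G \<in> Lp_loc 1" using Gb by (intro Lp_loc_bounded[OF Gm] exI ballI) simp_all
    fix \<phi> :: "real^'n \<Rightarrow> real" and i j assume \<phi>: "\<phi> \<in> C1c UNIV"
    obtain \<phi>' :: "real^'n \<Rightarrow> (real^'n) \<Rightarrow>\<^sub>L real" and r where c: "continuous_on UNIV \<phi>'"
      and d: "\<And>x. (\<phi> has_derivative blinfun_apply (\<phi>' x)) (at x)"
      and r: "\<And>x. \<phi> x \<noteq> 0 \<Longrightarrow> x \<in> cball 0 r" and cp: "continuous_on UNIV \<phi>"
      by (rule C1c_props[OF \<phi>]) blast
    have "compact (\<phi> ` cball 0 r)" by (intro compact_continuous_image continuous_on_subset[OF cp]) auto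
    then have "bounded (\<phi> ` cball 0 r)" by (rule compact_imp_bounded)
    then obtain B where "\<forall>y\<in>\<phi> ` cball 0 r. norm y \<le> B" unfolding bounded_iff by blast
    then have B0: "\<And>x. x \<in> cball 0 r \<Longrightarrow> \<bar>\<phi> x\<bar> \<le> B" by auto
    have B: "\<bar>\<phi> x\<bar> \<le> \<bar>B\<bar>" for x
    proof (cases "\<phi> x = 0")
      case False then show ?thesis using B0[OF r[OF False]] by linarith
    qed simp
    have m\<phi>: "\<phi> \<in> borel_measurable borel" using cp by (rule borel_measurable_continuous_onI)
    have pd: "partial_deriv j \<phi> x = blinfun_apply (\<phi>' x) (axis j 1)" for x by (rule partial_deriv_eq[OF d])
    have mp: "(\<lambda>x. partial_deriv j \<phi> x) \<in> borel_measurable borel"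
      unfolding pd by (intro borel_measurable_continuous_onI continuous_intros c)
    have bd: "\<exists>B. \<forall>x\<in>cball 0 R. \<bar>u x $ i\<bar> \<le> B" for R using lipschitz_locally_bounded[OF Li[of i], of R] by simp
    have 1: "(\<lambda>n. \<integral>x. q i j n x * \<phi> x \<partial>lborel) \<longlonglongrightarrow> - (\<integral>x. u x $ i * partial_deriv j \<phi> x \<partial>lborel)"
    proof -
      have "(\<integral>x. q i j n x * \<phi> x \<partial>lborel) = - (\<integral>x. u x $ i * (real (Suc n) * (\<phi> x - \<phi> (x - (1 / real (Suc n)) *\<^sub>R axis j 1))) \<partial>lborel)" for n
        unfolding q_def by (rule discrete_parts[OF ui bd cp r B])
      moreover have "(\<lambda>n. - (\<integral>x. u x $ i * (real (Suc n) * (\<phi> x - \<phi> (x - (1 / real (Suc n)) *\<^sub>R axis j 1))) \<partial>lborel))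
        \<longlonglongrightarrow> - (\<integral>x. u x $ i * partial_deriv j \<phi> x \<partial>lborel)"
        by (rule tendsto_minus[OF backward_tendsto[OF ui bd \<phi>]])
      ultimately show ?thesis by (simp only:)
    qed
    have 2: "(\<lambda>n. \<integral>x. q i j n x * \<phi> x \<partial>lborel) \<longlonglongrightarrow> (\<integral>x. G x $ i $ j * \<phi> x \<partial>lborel)"
    proof (rule integral_dominated_convergence[where w="\<lambda>x. K * \<bar>B\<bar> * indicator (cball 0 r) x"])
      show "integrable lborel (\<lambda>x. K * \<bar>B\<bar> * indicator (cball (0 :: real^'n) r) x)" by (rule integrable_cball)
      show "(\<lambda>x. G x $ i $ j * \<phi> x) \<in> borel_measurable lborel" using Gij m\<phi> by simp
      show "(\<lambda>x. q i j n x * \<phi> x) \<in> borel_measurable lborel" for n using qm m\<phi> by simp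
      show "AE x in lborel. (\<lambda>n. q i j n x * \<phi> x) \<longlonglongrightarrow> G x $ i $ j * \<phi> x"
        using lim D by eventually_elim (intro tendsto_mult_right, blast)
      show "AE x in lborel. norm (q i j n x * \<phi> x) \<le> K * \<bar>B\<bar> * indicator (cball 0 r) x" for n
      proof (intro AE_I2)
        fix x
        have "\<bar>q i j n x\<bar> * \<bar>\<phi> x\<bar> \<le> K * \<bar>B\<bar>" using K by (intro mult_mono qb B) auto
        then show "norm (q i j n x * \<phi> x) \<le> K * \<bar>B\<bar> * indicator (cball 0 r) x"
          using r[of x] K by (cases "\<phi> x = 0") (simp_all add: abs_mult)
      qed
    qed
    have "- (\<integral>x. u x $ i * partial_deriv j \<phi> x \<partial>lborel) = (\<integral>x. G x $ i $ j * \<phi> x \<partial>lborel)"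
      by (rule LIMSEQ_unique[OF 1 2])
    moreover have "(\<integral>x. u x $ i * partial_deriv j \<phi> x \<partial>lebesgue) = (\<integral>x. u x $ i * partial_deriv j \<phi> x \<partial>lborel)"
      using ui mp by (intro integral_completion) simp
    moreover have "(\<integral>x. G x $ i $ j * \<phi> x \<partial>lebesgue) = (\<integral>x. G x $ i $ j * \<phi> x \<partial>lborel)"
      using Gij m\<phi> by (intro integral_completion) simp
    ultimately show "(\<integral>x. u x $ i * partial_deriv j \<phi> x \<partial>lebesgue) = - (\<integral>x. G x $ i $ j * \<phi> x \<partial>lebesgue)" by simp
  qed
  moreover have "AE x in lborel. \<forall>D. (u has_derivative D) (at x) \<longrightarrow> (\<forall>i j. G x $ i $ j = D (axis j 1) $ i)"
    using lim by eventually_elim blast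
  moreover have "\<exists>B. \<forall>x. norm (G x) \<le> B" using Gb by blast
  ultimately show ?thesis using that[OF Gm] by blast
qed

section \<open>Uniqueness of weak gradients\<close>

text \<open>Squaring smooths the kink of the positive part, so that penalties built from it are
  continuously differentiable.\<close>

definition possq :: "real \<Rightarrow> real" where "possq y = (max 0 y)\<^sup>2"

lemma possq_deriv: "(possq has_real_derivative 2 * max 0 y) (at y)"
proof -
  consider "y < 0" | "y = 0" | "0 < y" by linarith
  then show ?thesis
  proof cases
    case 1
    have "((\<lambda>_. 0) has_real_derivative 0) (at y)" by simp
    then have "(possq has_real_derivative 0) (at y)"
      by (rule has_field_derivative_transform_within_open[where S="{..<0}"]) (use 1 in \<open>auto simp: possq_def\<close>)
    then show ?thesis using 1 by simp
  next
    case 2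
    have "\<bar>possq z - possq 0\<bar> \<le> 1 * (z - 0)\<^sup>2" for z by (simp add: possq_def max_def)
    from DERIV_quadratic_zero[OF this] show ?thesis using 2 by simp
  next
    case 3
    have "((\<lambda>y. y\<^sup>2) has_real_derivative 2 * y) (at y)" by (auto intro!: derivative_eq_intros)
    then have "(possq has_real_derivative 2 * y) (at y)"
      by (rule has_field_derivative_transform_within_open[where S="{0<..}"]) (use 3 in \<open>auto simp: possq_def\<close>)
    then show ?thesis using 3 by simp
  qed
qed

text \<open>\<open>C\<^sup>1\<close> test functions decreasing to the indicator of a closed box, obtained from a smooth step
  function of a penalty that vanishes exactly on the box.\<close>

lemma box_test_functions:
  fixes a b :: "real^'n"
  obtains \<phi> :: "nat \<Rightarrow> real^'n \<Rightarrow> real" and T where "\<And>n. \<phi> n \<in> C1c UNIV" "compact T" "\<And>n x. \<phi> n x \<noteq> 0 \<Longrightarrow> x \<in> T" "\<And>n x. \<bar>\<phi> n x\<bar> \<le> 1"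
    "\<And>x. (\<lambda>n. \<phi> n x) \<longlonglongrightarrow> indicator (cbox a b) x"
proof -
  define \<psi> where "\<psi> = (\<lambda>x :: real^'n. \<Sum>k\<in>UNIV. possq (a $ k - x $ k) + possq (x $ k - b $ k))"
  define w where "w = (\<lambda>x :: real^'n. \<chi> k. 2 * max 0 (x $ k - b $ k) - 2 * max 0 (a $ k - x $ k))"
  define \<phi> where "\<phi> = (\<lambda>n x. 1 - step (real (Suc n) * \<psi> x))"
  define T where "T = cbox (\<chi> k. a $ k - 1) (\<chi> k. b $ k + 1)"
  have d\<psi>: "(\<psi> has_derivative (\<lambda>h. h \<bullet> w x)) (at x)" for x
  proof -
    have dk: "((\<lambda>x. possq (a $ k - x $ k) + possq (x $ k - b $ k)) has_derivative (\<lambda>h. h $ k * w x $ k)) (at x)" for k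
    proof -
      have l: "((\<lambda>x :: real^'n. x $ k) has_derivative (\<lambda>h. h $ k)) (at x)" by (intro bounded_linear_imp_has_derivative bounded_linear_vec_nth)
      have "((\<lambda>x. possq (a $ k - x $ k)) has_derivative (\<lambda>h. 2 * max 0 (a $ k - x $ k) * (0 - h $ k))) (at x)"
        using has_derivative_compose[OF has_derivative_diff[OF has_derivative_const l]] possq_deriv unfolding has_field_derivative_def by blast
      moreover have "((\<lambda>x. possq (x $ k - b $ k)) has_derivative (\<lambda>h. 2 * max 0 (x $ k - b $ k) * (h $ k - 0))) (at x)"
        using has_derivative_compose[OF has_derivative_diff[OF l has_derivative_const]] possq_deriv unfolding has_field_derivative_def by blast
      ultimately have "((\<lambda>x. possq (a $ k - x $ k) + possq (x $ k - b $ k)) has_derivative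
         (\<lambda>h. 2 * max 0 (a $ k - x $ k) * (0 - h $ k) + 2 * max 0 (x $ k - b $ k) * (h $ k - 0))) (at x)" by (rule has_derivative_add)
      then show ?thesis by (simp add: w_def algebra_simps)
    qed
    have "(\<psi> has_derivative (\<lambda>h. \<Sum>k\<in>UNIV. h $ k * w x $ k)) (at x)"
      unfolding \<psi>_def by (intro has_derivative_sum dk)
    then show ?thesis by (simp add: inner_vec_def)
  qed
  have c\<psi>: "continuous_on UNIV \<psi>" by (intro continuous_at_imp_continuous_on ballI has_derivative_continuous[OF d\<psi>])
  have cw: "continuous_on UNIV w" unfolding w_def by (intro continuous_intros)
  have c1: "continuous_on UNIV step1" by (intro continuous_at_imp_continuous_on ballI DERIV_isCont[OF step1_deriv])
  have \<psi>0: "0 \<le> possq y" for y by (simp add: possq_def)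
  have \<psi>nn: "0 \<le> \<psi> x" for x unfolding \<psi>_def by (intro sum_nonneg add_nonneg_nonneg \<psi>0)
  have \<psi>k: "possq (a $ k - x $ k) \<le> \<psi> x" "possq (x $ k - b $ k) \<le> \<psi> x" for x k
  proof -
    have "possq (a $ k - x $ k) + possq (x $ k - b $ k) \<le> \<psi> x"
      unfolding \<psi>_def by (rule member_le_sum[where f="\<lambda>k. possq (a $ k - x $ k) + possq (x $ k - b $ k)"]) (simp_all add: \<psi>0 add_nonneg_nonneg)
    then show "possq (a $ k - x $ k) \<le> \<psi> x" "possq (x $ k - b $ k) \<le> \<psi> x" using \<psi>0[of "a $ k - x $ k"] \<psi>0[of "x $ k - b $ k"] by linarith+
  qed
  have supp: "x \<in> T" if "\<phi> n x \<noteq> 0" for n x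
  proof -
    have "real (Suc n) * \<psi> x < 1" using that step_ge1[of "real (Suc n) * \<psi> x"] by (force simp: \<phi>_def)
    moreover have "1 * \<psi> x \<le> real (Suc n) * \<psi> x" using \<psi>nn by (intro mult_right_mono) auto
    ultimately have "\<psi> x < 1" by linarith
    have lt: "y < 1" if "possq y < 1" for y
    proof (rule ccontr)
      assume "\<not> y < 1"
      then have "1 \<le> (max 0 y)\<^sup>2" by (intro one_le_power) simp
      then show False using that by (simp add: possq_def)
    qed
    have "a $ k - x $ k < 1" "x $ k - b $ k < 1" for k using \<psi>k[where x=x and k=k] \<open>\<psi> x < 1\<close> lt by (meson le_less_trans)+
    then show ?thesis unfolding T_def mem_box_cart by (simp add: less_imp_le algebra_simps)
  qed
  show ?thesis
  proof (rule that[of \<phi> T])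
    show T: "compact T" unfolding T_def by (rule compact_cbox)
    show "x \<in> T" if "\<phi> n x \<noteq> 0" for n x using supp that .
    show "\<bar>\<phi> n x\<bar> \<le> 1" for n x using step_bound[of "real (Suc n) * \<psi> x"] by (simp add: \<phi>_def abs_le_iff)
    show "\<phi> n \<in> C1c UNIV" for n
      unfolding C1c_def mem_Collect_eq
    proof (intro conjI exI)
      show "continuous_on UNIV (\<lambda>x. blinfun_inner_left ((- (step1 (real (Suc n) * \<psi> x) * real (Suc n))) *\<^sub>R w x))"
        by (intro continuous_intros continuous_on_compose2[OF c1] c\<psi> cw bounded_linear.continuous_on[OF bounded_linear_blinfun_inner_left]) auto
      show "\<forall>x. (\<phi> n has_derivative blinfun_apply (blinfun_inner_left ((- (step1 (real (Suc n) * \<psi> x) * real (Suc n))) *\<^sub>R w x))) (at x)"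
      proof
        fix x
        have "((\<lambda>x. step (real (Suc n) * \<psi> x)) has_derivative (\<lambda>h. step1 (real (Suc n) * \<psi> x) * (real (Suc n) * (h \<bullet> w x)))) (at x)"
          using has_derivative_compose[OF has_derivative_mult_right[OF d\<psi>]] step_deriv unfolding has_field_derivative_def by blast
        then have "(\<phi> n has_derivative (\<lambda>h. 0 - step1 (real (Suc n) * \<psi> x) * (real (Suc n) * (h \<bullet> w x)))) (at x)"
          unfolding \<phi>_def by (intro has_derivative_diff has_derivative_const)
        moreover have "(\<lambda>h. 0 - step1 (real (Suc n) * \<psi> x) * (real (Suc n) * (h \<bullet> w x)))
          = blinfun_apply (blinfun_inner_left ((- (step1 (real (Suc n) * \<psi> x) * real (Suc n))) *\<^sub>R w x))"
          by (rule ext) (simp add: mult.assoc)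
        ultimately show "(\<phi> n has_derivative blinfun_apply (blinfun_inner_left ((- (step1 (real (Suc n) * \<psi> x) * real (Suc n))) *\<^sub>R w x))) (at x)"
          by simp
      qed
      show "compact T" by (rule T)
      show "\<forall>x. x \<notin> T \<longrightarrow> \<phi> n x = 0" using supp by blast
    qed simp
    show "(\<lambda>n. \<phi> n x) \<longlonglongrightarrow> indicator (cbox a b) x" for x
    proof (cases "x \<in> cbox a b")
      case True
      then have "a $ k - x $ k \<le> 0" "x $ k - b $ k \<le> 0" for k by (simp_all add: mem_box_cart)
      then have "\<psi> x = 0" unfolding \<psi>_def possq_def by (intro sum.neutral) simp
      then have "\<phi> n x = 1" for n by (simp add: \<phi>_def step_le0)
      then show ?thesis using True by simp
    next
      case False
      then obtain k where "x $ k < a $ k \<or> b $ k < x $ k" unfolding mem_box_cart by (meson not_le)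
      then have "0 < possq (a $ k - x $ k) \<or> 0 < possq (x $ k - b $ k)" by (auto simp: possq_def)
      then have pos: "0 < \<psi> x" using \<psi>k[where x=x and k=k] by linarith
      obtain N where N: "1 / \<psi> x < real N" using reals_Archimedean2 by blast
      have "\<phi> n x = 0" if "n \<ge> N" for n
      proof -
        have "1 / \<psi> x \<le> real (Suc n)" using N that by simp
        then have "1 \<le> real (Suc n) * \<psi> x" using pos by (simp only: divide_le_eq if_True)
        then show ?thesis by (simp add: \<phi>_def step_ge1)
      qed
      then have "eventually (\<lambda>n. \<phi> n x = 0) sequentially" unfolding eventually_sequentially by blast
      then show ?thesis using False tendsto_eventually by fastforce
    qed
  qed
qed

text \<open>Boxes form an intersection-stable generator, so vanishing integrals extend from boxes to
  Borel sets by a Dynkin argument; complements are where the vanishing of the total integral enters.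
  Open and closed boxes differ by a null set.\<close>

lemma AE_zero_of_boxes:
  fixes f :: "'a::euclidean_space \<Rightarrow> real"
  assumes f: "integrable lborel f" and z: "\<And>a b. (\<integral>x. indicator (cbox a b) x * f x \<partial>lborel) = 0" and all: "(\<integral>x. f x \<partial>lborel) = 0"
  shows "AE x in lborel. f x = 0"
proof (rule density_unique_real[OF f])
  show "integrable lborel (\<lambda>_ :: 'a. 0 :: real)" by simp
  fix A :: "'a set" assume "A \<in> sets lborel"
  then have A: "A \<in> sigma_sets UNIV (range (\<lambda>(a, b). box a b))" unfolding borel_eq_box by (simp add: borel_eq_box)
  have S: "Int_stable (range (\<lambda>(a, b). box a b :: 'a set))" "(range (\<lambda>(a, b). box a b :: 'a set)) \<subseteq> Pow UNIV"
    by (auto simp: Int_stable_def box_Int_box)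
  have sb: "B \<in> sets borel" if "B \<in> sigma_sets UNIV (range (\<lambda>(a, b). box a b))" for B :: "'a set" using that by (simp add: borel_eq_box)
  have int: "integrable lborel (\<lambda>x. indicator B x * f x)" if "B \<in> sets borel" for B
    using integrable_mult_indicator[OF _ f, of B] that by simp
  have "set_lebesgue_integral lborel A f = 0"
    using S A
  proof (induction rule: sigma_sets_induct_disjoint)
    case (basic A)
    then obtain a b where ab: "A = box a b" by auto
    have "AE x in lborel. indicator (box a b) x * f x = indicator (cbox a b) x * f x"
    proof -
      have "cbox a b - box a b \<in> null_sets lebesgue"
        using negligible_frontier_interval[of a b] by (simp add: negligible_iff_null_sets)
      then have "AE x in lebesgue. x \<notin> cbox a b - box a b" by (rule AE_not_in)
      then have "AE x in lborel. x \<notin> cbox a b - box a b" by (simp add: AE_completion_iff)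
      then show ?thesis by eventually_elim (use box_subset_cbox[of a b] in \<open>auto simp: indicator_def\<close>)
    qed
    then have "(\<integral>x. indicator (box a b) x * f x \<partial>lborel) = (\<integral>x. indicator (cbox a b) x * f x \<partial>lborel)"
      using int[of "box a b"] int[of "cbox a b"] by (intro integral_cong_AE) (auto dest: borel_measurable_integrable)
    then show ?case using z[of a b] by (simp add: ab set_lebesgue_integral_def)
  next
    case empty show ?case by (simp add: set_lebesgue_integral_def)
  next
    case (compl A)
    have "set_lebesgue_integral lborel (UNIV - A) f = (\<integral>x. f x - indicator A x * f x \<partial>lborel)"
      unfolding set_lebesgue_integral_def by (intro Bochner_Integration.integral_cong) (auto simp: indicator_def)
    also have "\<dots> = (\<integral>x. f x \<partial>lborel) - (\<integral>x. indicator A x * f x \<partial>lborel)"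
      using f int[OF sb[OF compl(1)]] by (rule Bochner_Integration.integral_diff)
    finally show ?case using compl(2) all by (simp add: set_lebesgue_integral_def)
  next
    case (union A)
    have "set_lebesgue_integral lborel (\<Union>i. A i) f = (\<Sum>i. set_lebesgue_integral lborel (A i) f)"
    proof (rule lebesgue_integral_countable_add)
      show m: "A i \<in> sets lborel" for i using union(2) sb by auto
      show "A i \<inter> A j = {}" if "i \<noteq> j" for i j using union(1) that by (auto simp: disjoint_family_on_def)
      show "set_integrable lborel (\<Union>i. A i) f" using m f unfolding set_integrable_def by (intro integrable_mult_indicator) auto
    qed
    then show ?case using union(3) by simp
  qed
  then show "set_lebesgue_integral lborel A f = set_lebesgue_integral lborel A (\<lambda>_. 0)" by simp
qed

text \<open>The fundamental lemma of the calculus of variations. Test functions approximating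
  indicators of boxes show that all integrals over boxes vanish. As \<open>g\<close> is only locally
  integrable, the conclusion is drawn on each cube \<open>Q r\<close>, for a Borel representative of
  \<open>g\<close>.\<close>

lemma test_functions_AE_zero:
  fixes g :: "real^'n \<Rightarrow> real"
  assumes g: "\<And>r. integrable lebesgue (\<lambda>x. indicator (cbox (\<chi> k. -r) (\<chi> k. r)) x * g x)" "g \<in> borel_measurable lebesgue"
    and z: "\<And>\<phi>. \<phi> \<in> C1c UNIV \<Longrightarrow> (\<integral>x. g x * \<phi> x \<partial>lebesgue) = 0"
  shows "AE x in lebesgue. g x = 0"
proof -
  define Q where "Q = (\<lambda>r. cbox (\<chi> k. -r) (\<chi> k. r) :: (real^'n) set)"
  have gi: "integrable lebesgue (\<lambda>x. indicator T x * g x)" if cT: "compact T" for T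
  proof -
    obtain r where r: "\<forall>x\<in>T. norm x \<le> r" using compact_imp_bounded[OF cT] unfolding bounded_iff by blast
    have T: "T \<subseteq> Q r"
    proof
      fix x assume "x \<in> T"
      then have "\<bar>x $ k\<bar> \<le> r" for k using r component_le_norm_cart[of x k] by (meson order_trans)
      then show "x \<in> Q r" unfolding Q_def mem_box_cart by (simp add: abs_le_iff minus_le_iff)
    qed
    have Tm: "T \<in> sets lebesgue" using compact_imp_closed[OF cT] by simp
    have "integrable lebesgue (\<lambda>x. indicator T x *\<^sub>R (indicator (Q r) x * g x))"
      using integrable_mult_indicator[OF Tm g(1)[of r]] unfolding Q_def .
    moreover have "indicator T x *\<^sub>R (indicator (Q r) x * g x) = indicator T x * g x" for x using T by (auto simp: indicator_def)
    ultimately show ?thesis by (simp only:)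
  qed
  have boxz: "(\<integral>x. indicator (cbox a b) x * g x \<partial>lebesgue) = 0" for a b
  proof -
    obtain \<phi> :: "nat \<Rightarrow> real^'n \<Rightarrow> real" and T where \<phi>: "\<And>n. \<phi> n \<in> C1c UNIV" and T: "compact T" "\<And>n x. \<phi> n x \<noteq> 0 \<Longrightarrow> x \<in> T" and b1: "\<And>n x. \<bar>\<phi> n x\<bar> \<le> 1"
      and l: "\<And>x. (\<lambda>n. \<phi> n x) \<longlonglongrightarrow> indicator (cbox a b) x" by (rule box_test_functions[of a b]) blast
    have m\<phi>: "\<phi> n \<in> borel_measurable lebesgue" for n
    proof -
      have "continuous_on UNIV (\<phi> n)" by (rule C1c_props[OF \<phi>[of n]])
      then show ?thesis by (intro measurable_completion) (simp add: borel_measurable_continuous_onI)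
    qed
    have "(\<lambda>n. \<integral>x. g x * \<phi> n x \<partial>lebesgue) \<longlonglongrightarrow> (\<integral>x. g x * indicator (cbox a b) x \<partial>lebesgue)"
    proof (rule integral_dominated_convergence[where w="\<lambda>x. \<bar>indicator T x * g x\<bar>"])
      show "integrable lebesgue (\<lambda>x. \<bar>indicator T x * g x\<bar>)" using gi[OF T(1)] by (rule integrable_abs)
      have "(indicator (cbox a b) :: real^'n \<Rightarrow> real) \<in> borel_measurable lebesgue" by (intro measurable_completion) simp
      then show "(\<lambda>x. g x * indicator (cbox a b) x) \<in> borel_measurable lebesgue" using g(2) by (intro borel_measurable_times)
      show "(\<lambda>x. g x * \<phi> n x) \<in> borel_measurable lebesgue" for n using g(2) m\<phi> by (intro borel_measurable_times)
      show "AE x in lebesgue. (\<lambda>n. g x * \<phi> n x) \<longlonglongrightarrow> g x * indicator (cbox a b) x" by (intro AE_I2 tendsto_mult_left l)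
      show "AE x in lebesgue. norm (g x * \<phi> n x) \<le> \<bar>indicator T x * g x\<bar>" for n
      proof (intro AE_I2)
        fix x
        have "\<bar>g x\<bar> * \<bar>\<phi> n x\<bar> \<le> \<bar>g x\<bar> * 1" by (intro mult_left_mono b1) simp
        then show "norm (g x * \<phi> n x) \<le> \<bar>indicator T x * g x\<bar>"
          proof (cases "x \<in> T")
            case False
            then have "\<phi> n x = 0" using T(2) by blast
            then show ?thesis by simp
          qed (simp add: abs_mult)
      qed
    qed
    then have "(\<lambda>n :: nat. 0) \<longlonglongrightarrow> (\<integral>x. g x * indicator (cbox a b) x \<partial>lebesgue)" using z[OF \<phi>] by simp
    then have "(\<integral>x. g x * indicator (cbox a b) x \<partial>lebesgue) = 0" by (simp add: LIMSEQ_const_iff)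
    then show ?thesis by (simp add: mult.commute)
  qed
  obtain g' where g': "g' \<in> borel_measurable lborel" "AE x in lborel. g x = g' x" using completion_ex_borel_measurable_real[OF g(2)] by blast
  have Qz: "AE x in lborel. indicator (Q r) x * g' x = 0" for r
  proof (rule AE_zero_of_boxes)
    have Qm: "Q r \<in> sets borel" unfolding Q_def by simp
    have ae: "AE x in lebesgue. g x = g' x" using g'(2) by (rule AE_completion)
    have m': "(\<lambda>x. indicator B x * g' x) \<in> borel_measurable borel" if "B \<in> sets borel" for B using g'(1) that by simp
    have ig: "integrable lborel (\<lambda>x. indicator B x * g' x) \<and> (\<integral>x. indicator B x * g' x \<partial>lborel) = (\<integral>x. indicator B x * g x \<partial>lebesgue)" if B: "compact B" for B
    proof -
      have Bb: "B \<in> sets borel" using compact_imp_closed[OF B] by (rule borel_closed)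
      have m2: "(\<lambda>x. indicator B x * g' x) \<in> borel_measurable lebesgue" using m'[OF Bb] by (intro measurable_completion) simp
      have e: "AE x in lebesgue. indicator B x * g x = indicator B x * g' x" using ae by eventually_elim simp
      have "integrable lebesgue (\<lambda>x. indicator B x * g' x)"
        using gi[OF B] m2 e by (rule integrable_cong_AE_imp)
      moreover have "(\<integral>x. indicator B x * g x \<partial>lebesgue) = (\<integral>x. indicator B x * g' x \<partial>lebesgue)"
        using e m2 borel_measurable_integrable[OF gi[OF B]] by (intro integral_cong_AE)
      ultimately show ?thesis using integrable_completion[of "\<lambda>x. indicator B x * g' x" lborel] integral_completion[of "\<lambda>x. indicator B x * g' x" lborel] m'[OF Bb] by simp
    qed
    show "integrable lborel (\<lambda>x. indicator (Q r) x * g' x)" using ig[of "Q r"] unfolding Q_def by simp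
    show "(\<integral>x. indicator (Q r) x * g' x \<partial>lborel) = 0" using ig[of "Q r"] boxz unfolding Q_def by simp
    show "(\<integral>x. indicator (cbox a b) x * (indicator (Q r) x * g' x) \<partial>lborel) = 0" for a b
    proof -
      obtain c d where cd: "cbox a b \<inter> Q r = cbox c d" unfolding Q_def Int_interval by blast
      have "indicator (cbox a b) x * (indicator (Q r) x * g' x) = indicator (cbox c d) x * g' x" for x
        unfolding cd[symmetric] by (simp add: indicator_inter_arith mult.assoc)
      then have "(\<lambda>x. indicator (cbox a b) x * (indicator (Q r) x * g' x)) = (\<lambda>x. indicator (cbox c d) x * g' x)" by (rule ext)
      then show ?thesis using ig[OF compact_cbox, of c d] boxz[of c d] by (simp only:)
    qed
  qed
  have "AE x in lborel. \<forall>n :: nat. indicator (Q (real n)) x * g' x = 0" using Qz by (intro AE_all_countable[THEN iffD2]) blast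
  then have "AE x in lborel. g x = 0" using g'(2)
  proof eventually_elim
    case (elim x)
    obtain n where n: "norm x \<le> real n" using real_arch_simple by blast
    have "\<bar>x $ k\<bar> \<le> real n" for k using n component_le_norm_cart[of x k] by linarith
    then have "x \<in> Q (real n)" unfolding Q_def mem_box_cart by (simp add: abs_le_iff minus_le_iff)
    then show ?case using elim(1)[rule_format, of n] elim(2) by simp
  qed
  then show ?thesis by (rule AE_completion)
qed

text \<open>\<open>weak_gradient\<close> is defined by choice; uniqueness transfers estimates for an
  explicitly constructed gradient to the chosen one.\<close>

lemma weak_gradient_unique:
  fixes u :: "real^'n \<Rightarrow> real^'n"
  assumes G: "has_weak_gradient u G" and H: "has_weak_gradient u H"
  shows "AE x in lebesgue. G x = H x"
proof -
  have ij: "AE x in lebesgue. G x $ i $ j - H x $ i $ j = 0" for i j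
  proof (rule test_functions_AE_zero)
    have mc: "(\<lambda>x. F x $ i $ j) \<in> borel_measurable lebesgue" if "has_weak_gradient u F" for F
    proof -
      have "F \<in> borel_measurable lebesgue" using that by (simp add: has_weak_gradient_def Lp_loc_def)
      moreover have "(\<lambda>A :: real^'n^'n. A $ i $ j) \<in> borel_measurable borel"
        by (intro borel_measurable_continuous_onI continuous_intros)
      ultimately show ?thesis by (rule measurable_compose)
    qed
    have ic: "integrable lebesgue (\<lambda>x. indicator T x * F x $ i $ j)" if F: "has_weak_gradient u F" and T: "compact T" for F T
    proof -
      have "set_integrable lebesgue T (\<lambda>x. norm (F x) powr 1)" using F T by (simp add: has_weak_gradient_def Lp_loc_def)
      then have I: "integrable lebesgue (\<lambda>x. indicator T x *\<^sub>R norm (F x) powr 1)" unfolding set_integrable_def .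
      have Tm: "T \<in> sets lebesgue" using compact_imp_closed[OF T] by simp
      have "(indicator T :: _ \<Rightarrow> real) \<in> borel_measurable lebesgue" using Tm by (intro borel_measurable_indicator)
      then have m: "(\<lambda>x. indicator T x * F x $ i $ j) \<in> borel_measurable lebesgue" using mc[OF F] by (intro borel_measurable_times)
      show ?thesis
      proof (rule Bochner_Integration.integrable_bound[OF I m], intro AE_I2)
        fix x
        have "\<bar>F x $ i $ j\<bar> \<le> norm (F x $ i)" by (rule component_le_norm_cart)
        also have "\<dots> \<le> norm (F x)" by (rule Finite_Cartesian_Product.norm_nth_le)
        finally show "norm (indicator T x * F x $ i $ j) \<le> norm (indicator T x *\<^sub>R norm (F x) powr 1)"
          by (cases "x \<in> T") simp_all
      qed
    qed
    show "integrable lebesgue (\<lambda>x. indicator (cbox (\<chi> k. -r) (\<chi> k. r)) x * (G x $ i $ j - H x $ i $ j))" for r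
      using Bochner_Integration.integrable_diff[OF ic[OF G compact_cbox] ic[OF H compact_cbox]] by (simp add: right_diff_distrib)
    show "(\<lambda>x. G x $ i $ j - H x $ i $ j) \<in> borel_measurable lebesgue" by (intro borel_measurable_diff mc G H)
    fix \<phi> :: "real^'n \<Rightarrow> real" assume \<phi>: "\<phi> \<in> C1c UNIV"
    obtain r where r: "\<And>x. \<phi> x \<noteq> 0 \<Longrightarrow> x \<in> cball 0 r" and cp: "continuous_on UNIV \<phi>"
      by (rule C1c_props[OF \<phi>]) blast
    have "compact (\<phi> ` cball 0 r)" by (intro compact_continuous_image continuous_on_subset[OF cp]) auto
    then have "bounded (\<phi> ` cball 0 r)" by (rule compact_imp_bounded)
    then obtain B where "\<forall>y\<in>\<phi> ` cball 0 r. norm y \<le> B" unfolding bounded_iff by blast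
    then have B: "\<And>x. x \<in> cball 0 r \<Longrightarrow> \<bar>\<phi> x\<bar> \<le> B" by simp
    have m\<phi>: "\<phi> \<in> borel_measurable lebesgue" using cp by (intro measurable_completion) (simp add: borel_measurable_continuous_onI)
    have i\<phi>: "integrable lebesgue (\<lambda>x. F x $ i $ j * \<phi> x)" if F: "has_weak_gradient u F" for F
    proof (rule Bochner_Integration.integrable_bound)
      show "integrable lebesgue (\<lambda>x. B * (indicator (cball 0 r) x * F x $ i $ j))"
        using ic[OF F compact_cball] by (rule integrable_mult_right)
      show "(\<lambda>x. F x $ i $ j * \<phi> x) \<in> borel_measurable lebesgue" using mc[OF F] m\<phi> by (rule borel_measurable_times)
      show "AE x in lebesgue. norm (F x $ i $ j * \<phi> x) \<le> norm (B * (indicator (cball 0 r) x * F x $ i $ j))"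
      proof (intro AE_I2)
        fix x
        show "norm (F x $ i $ j * \<phi> x) \<le> norm (B * (indicator (cball 0 r) x * F x $ i $ j))"
        proof (cases "\<phi> x = 0")
          case False
          then have x: "x \<in> cball 0 r" by (rule r)
          then have "\<bar>\<phi> x\<bar> \<le> \<bar>B\<bar>" using B[OF x] by linarith
          then have "\<bar>F x $ i $ j\<bar> * \<bar>\<phi> x\<bar> \<le> \<bar>F x $ i $ j\<bar> * \<bar>B\<bar>" by (intro mult_left_mono) auto
          then show ?thesis using x by (simp add: abs_mult mult.commute)
        qed simp
      qed
    qed
    have "(\<integral>x. (G x $ i $ j - H x $ i $ j) * \<phi> x \<partial>lebesgue) = (\<integral>x. G x $ i $ j * \<phi> x \<partial>lebesgue) - (\<integral>x. H x $ i $ j * \<phi> x \<partial>lebesgue)"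
      using Bochner_Integration.integral_diff[OF i\<phi>[OF G] i\<phi>[OF H]] by (simp add: left_diff_distrib)
    also have "\<dots> = 0"
    proof -
      have "(\<integral>x. u x $ i * partial_deriv j \<phi> x \<partial>lebesgue) = - (\<integral>x. G x $ i $ j * \<phi> x \<partial>lebesgue)"
        "(\<integral>x. u x $ i * partial_deriv j \<phi> x \<partial>lebesgue) = - (\<integral>x. H x $ i $ j * \<phi> x \<partial>lebesgue)"
        using G H \<phi> unfolding has_weak_gradient_def by blast+
      then show ?thesis by linarith
    qed
    finally show "(\<integral>x. (G x $ i $ j - H x $ i $ j) * \<phi> x \<partial>lebesgue) = 0" .
  qed
  have "AE x in lebesgue. \<forall>i\<in>UNIV. \<forall>j\<in>UNIV. G x $ i $ j - H x $ i $ j = 0"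
    by (intro AE_finite_allI ij) simp_all
  then show ?thesis by eventually_elim (simp add: vec_eq_iff)
qed

section \<open>From translation bounds to total variation\<close>

text \<open>The derivative is moved onto the indicator as a difference quotient. With step
  \<open>1 / (n + 1)\<close>, the integral of its modulus is at most \<open>n + 1\<close> times the
  measure of a symmetric difference bounded by \<open>P / (n + 1)\<close>, uniformly in
  \<open>n\<close>.\<close>

lemma partial_integral_bound:
  fixes E :: "(real^'n) set" and \<phi> :: "real^'n \<Rightarrow> real"
  assumes E: "pbound E P" and \<phi>: "\<phi> \<in> C1c UNIV" "\<And>x. \<bar>\<phi> x\<bar> \<le> 1"
  shows "\<bar>\<integral>x. indicator E x * partial_deriv j \<phi> x \<partial>lborel\<bar> \<le> P"
proof -
  obtain r where r: "\<And>x. \<phi> x \<noteq> 0 \<Longrightarrow> x \<in> cball 0 r" and cp: "continuous_on UNIV \<phi>"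
    by (rule C1c_props[OF \<phi>(1)]) blast
  have Em: "E \<in> sets borel" and P: "0 \<le> P" using E by (simp_all add: pbound_def)
  have f: "(indicator E :: real^'n \<Rightarrow> real) \<in> borel_measurable borel" using Em by simp
  have fb: "\<exists>B. \<forall>x\<in>cball 0 R. \<bar>indicator E x :: real\<bar> \<le> B" for R :: real by (intro exI[of _ 1]) simp
  have q: "\<bar>\<integral>x. quot (indicator E) j n x * \<phi> x \<partial>lborel\<bar> \<le> P" for n
  proof (cases "integrable lborel (\<lambda>x. quot (indicator E) j n x * \<phi> x)")
    \<comment> \<open>The integral of a non-integrable function is 0 by convention, so the bound is
      immediate.\<close>
    case False
    then show ?thesis using P by (simp add: not_integrable_integral_eq)
  next
    case True
    define a :: "real^'n" where "a = (1 / real (Suc n)) *\<^sub>R axis j 1"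
    have na: "norm (-a) = 1 / real (Suc n)" by (simp add: a_def)
    let ?S = "sym_diff E ((+) (-a) ` E)"
    have Sm: "?S \<in> sets borel" using Em borel_translate[OF Em] by (intro sets.Un sets.Diff)
    have "ennreal \<bar>\<integral>x. quot (indicator E) j n x * \<phi> x \<partial>lborel\<bar> \<le> (\<integral>\<^sup>+x. norm (quot (indicator E) j n x * \<phi> x) \<partial>lborel)"
      using integral_norm_bound_ennreal[OF True] by simp
    also have "\<dots> \<le> (\<integral>\<^sup>+x. ennreal (real (Suc n)) * indicator ?S x \<partial>lborel)"
    proof (intro nn_integral_mono)
      fix x
      have i: "x \<in> (+) (-a) ` E \<longleftrightarrow> x + a \<in> E" by (simp only: in_translate diff_minus_eq_add)
      have "\<bar>indicator E (x + a) - indicator E x\<bar> = (indicator ?S x :: real)"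
        using i by (cases "x \<in> E"; cases "x + a \<in> E") simp_all
      then have "norm (quot (indicator E) j n x * \<phi> x) = real (Suc n) * indicator ?S x * \<bar>\<phi> x\<bar>"
        unfolding quot_def a_def[symmetric] by (simp add: abs_mult)
      also have "\<dots> \<le> real (Suc n) * indicator ?S x * 1" by (intro mult_left_mono \<phi>(2)) simp
      finally have "ennreal (norm (quot (indicator E) j n x * \<phi> x)) \<le> ennreal (real (Suc n) * indicator ?S x)"
        by (intro ennreal_leI) simp
      also have "\<dots> = ennreal (real (Suc n)) * indicator ?S x" by (simp add: ennreal_mult' ennreal_indicator)
      finally show "ennreal (norm (quot (indicator E) j n x * \<phi> x)) \<le> ennreal (real (Suc n)) * indicator ?S x" .
    qed
    also have "\<dots> = ennreal (real (Suc n)) * emeasure lborel ?S" using Sm by (subst nn_integral_cmult_indicator) simp_all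
    also have "\<dots> \<le> ennreal (real (Suc n)) * ennreal (P * norm (-a))" using E unfolding pbound_def by (intro mult_left_mono zero_le) blast
    also have "\<dots> = ennreal (real (Suc n) * (P * (1 / real (Suc n))))" unfolding na by (rule ennreal_mult'[symmetric]) simp
    also have "\<dots> = ennreal P" by simp
    finally show ?thesis using P by (simp add: ennreal_le_iff)
  qed
  have M: "\<bar>\<phi> x\<bar> \<le> 1" for x by (rule \<phi>(2))
  have "(\<lambda>n. - (\<integral>x. indicator E x * (real (Suc n) * (\<phi> x - \<phi> (x - (1 / real (Suc n)) *\<^sub>R axis j 1))) \<partial>lborel))
      \<longlonglongrightarrow> - (\<integral>x. indicator E x * partial_deriv j \<phi> x \<partial>lborel)"
    by (rule tendsto_minus[OF backward_tendsto[OF f fb \<phi>(1)]])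
  moreover have "(\<integral>x. quot (indicator E) j n x * \<phi> x \<partial>lborel)
    = - (\<integral>x. indicator E x * (real (Suc n) * (\<phi> x - \<phi> (x - (1 / real (Suc n)) *\<^sub>R axis j 1))) \<partial>lborel)" for n
    by (rule discrete_parts[OF f fb cp r M])
  ultimately have "(\<lambda>n. \<integral>x. quot (indicator E) j n x * \<phi> x \<partial>lborel) \<longlonglongrightarrow> - (\<integral>x. indicator E x * partial_deriv j \<phi> x \<partial>lborel)"
    by (simp only:)
  from LIMSEQ_le_const2[OF tendsto_rabs[OF this]] q
  have "\<bar>- (\<integral>x. indicator E x * partial_deriv j \<phi> x \<partial>lborel)\<bar> \<le> P" by blast
  then show ?thesis by simp
qed

lemma C1c_component:
  fixes \<phi> :: "real^'n \<Rightarrow> real^'n"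
  assumes "\<phi> \<in> C1c S" shows "(\<lambda>x. \<phi> x $ i) \<in> C1c UNIV"
proof -
  obtain \<phi>' :: "real^'n \<Rightarrow> (real^'n) \<Rightarrow>\<^sub>L (real^'n)" and T where c: "continuous_on UNIV \<phi>'" and d: "\<And>x. (\<phi> has_derivative blinfun_apply (\<phi>' x)) (at x)"
    and T: "compact T" "T \<subseteq> S" "\<And>x. x \<notin> T \<Longrightarrow> \<phi> x = 0"
    using assms unfolding C1c_def by blast
  define p where "p = (Blinfun (\<lambda>y :: real^'n. y $ i))"
  have p: "blinfun_apply p y = y $ i" for y unfolding p_def by (simp add: bounded_linear_Blinfun_apply bounded_linear_vec_nth)
  show ?thesis
    unfolding C1c_def mem_Collect_eq
  proof (intro conjI exI allI impI)
    show "continuous_on UNIV (\<lambda>x. p o\<^sub>L \<phi>' x)" by (intro continuous_intros c)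
    show "((\<lambda>x. \<phi> x $ i) has_derivative blinfun_apply (p o\<^sub>L \<phi>' x)) (at x)" for x
    proof -
      have "((\<lambda>x. \<phi> x $ i) has_derivative (\<lambda>h. blinfun_apply (\<phi>' x) h $ i)) (at x)"
        using bounded_linear.has_derivative[OF bounded_linear_vec_nth d] .
      moreover have "blinfun_apply (p o\<^sub>L \<phi>' x) = (\<lambda>h. blinfun_apply (\<phi>' x) h $ i)" by (rule ext) (simp add: p)
      ultimately show ?thesis by simp
    qed
    show "compact T" by (rule T)
    show "\<phi> x $ i = 0" if "x \<notin> T" for x using T(3)[OF that] by simp
  qed simp
qed

text \<open>The divergence is split into its components. Each component of the test field is a
  scalar test function bounded by 1, so \<open>partial_integral_bound\<close> applies once per
  dimension.\<close>

lemma total_variation_le: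
  fixes f :: "real^'n \<Rightarrow> real"
  assumes E: "pbound E1 P1" "pbound E2 P2" and \<Omega>: "\<Omega> \<in> sets borel"
    and f: "\<And>x. x \<in> \<Omega> \<Longrightarrow> f x = a0 + a1 * indicator E1 x + a2 * indicator E2 x"
  shows "total_variation \<Omega> f \<le> ennreal (real CARD('n) * (\<bar>a1\<bar> * P1 + \<bar>a2\<bar> * P2))"
  unfolding total_variation_def
proof (rule SUP_least)
  fix \<phi> :: "real^'n \<Rightarrow> real^'n" assume "\<phi> \<in> {\<phi> \<in> C1c \<Omega>. \<forall>x. norm (\<phi> x) \<le> 1}"
  then have \<phi>: "\<phi> \<in> C1c \<Omega>" "\<And>x. norm (\<phi> x) \<le> 1" by auto
  obtain \<phi>' :: "real^'n \<Rightarrow> (real^'n) \<Rightarrow>\<^sub>L (real^'n)" and M r where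
    c: "continuous_on UNIV \<phi>'" and d: "\<And>x. (\<phi> has_derivative blinfun_apply (\<phi>' x)) (at x)"
    and M: "\<And>x. norm (\<phi>' x) \<le> M" and z: "\<And>x. x \<notin> \<Omega> \<Longrightarrow> \<phi>' x = 0" "\<And>x. x \<notin> cball 0 r \<Longrightarrow> \<phi>' x = 0"
    by (rule C1c_props[OF \<phi>(1)]) blast
  define D where "D = (\<lambda>i x. partial_deriv i (\<lambda>x. \<phi> x $ i) x)"
  have Dc: "D i x = blinfun_apply (\<phi>' x) (axis i 1) $ i" "partial_deriv i \<phi> x $ i = D i x" for i x
  proof -
    have "((\<lambda>x. \<phi> x $ i) has_derivative (\<lambda>h. blinfun_apply (\<phi>' x) h $ i)) (at x)"
      using bounded_linear.has_derivative[OF bounded_linear_vec_nth d] .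
    then show "D i x = blinfun_apply (\<phi>' x) (axis i 1) $ i" unfolding D_def by (rule partial_deriv_eq)
    then show "partial_deriv i \<phi> x $ i = D i x" using partial_deriv_eq[OF d] by simp
  qed
  have Dm: "D i \<in> borel_measurable borel" for i
    unfolding Dc[abs_def] by (intro borel_measurable_continuous_onI continuous_intros c)
  have Db: "\<bar>D i x\<bar> \<le> M" for i x
  proof -
    have "\<bar>D i x\<bar> \<le> norm (blinfun_apply (\<phi>' x) (axis i 1))" unfolding Dc by (rule component_le_norm_cart)
    also have "\<dots> \<le> norm (\<phi>' x) * norm (axis i (1::real) :: real^'n)" by (rule norm_blinfun)
    also have "\<dots> \<le> M" using M[of x] by simp
    finally show ?thesis .
  qed
  have int: "integrable lborel (\<lambda>x. indicator E x * D i x)" if "E \<in> sets borel" for E i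
  proof (rule integrable_compact_support[where B=M and r=r])
    show "(\<lambda>x. indicator E x * D i x) \<in> borel_measurable borel" using that Dm by simp
    show "\<bar>indicator E x * D i x\<bar> \<le> M" for x using Db[of i x] by (cases "x \<in> E") auto
    show "indicator E x * D i x = 0" if "x \<notin> cball 0 r" for x using z(2)[OF that] by (simp add: Dc(1))
  qed
  have one: "\<bar>\<integral>x. indicator E x * D i x \<partial>lborel\<bar> \<le> P" if "pbound E P" for E P i
    unfolding D_def
  proof (rule partial_integral_bound[OF that C1c_component[OF \<phi>(1)]])
    show "\<bar>\<phi> x $ i\<bar> \<le> 1" for x using component_le_norm_cart[of "\<phi> x" i] \<phi>(2)[of x] by linarith
  qed
  \<comment> \<open>The whole space is invariant under translation; hence the constant part
    \<open>a0\<close> of \<open>f\<close> does not contribute.\<close>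
  have U: "pbound (UNIV :: (real^'n) set) 0" by (simp add: pbound_def)
  have Em: "E1 \<in> sets borel" "E2 \<in> sets borel" using E by (simp_all add: pbound_def)
  have "set_lebesgue_integral lebesgue \<Omega> (\<lambda>x. f x * divergence \<phi> x)
     = (\<integral>x. (\<Sum>i\<in>UNIV. a0 * (indicator UNIV x * D i x) + a1 * (indicator E1 x * D i x) + a2 * (indicator E2 x * D i x)) \<partial>lebesgue)"
    unfolding set_lebesgue_integral_def
  proof (intro Bochner_Integration.integral_cong refl)
    fix x
    have dv: "divergence \<phi> x = (\<Sum>i\<in>UNIV. D i x)" by (simp add: divergence_def Dc(2))
    show "indicator \<Omega> x *\<^sub>R (f x * divergence \<phi> x)
      = (\<Sum>i\<in>UNIV. a0 * (indicator UNIV x * D i x) + a1 * (indicator E1 x * D i x) + a2 * (indicator E2 x * D i x))"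
    proof (cases "x \<in> \<Omega>")
      case True
      then show ?thesis unfolding dv sum_distrib_left by (simp add: f[OF True] algebra_simps sum_distrib_left)
    next
      case False
      then have "D i x = 0" for i using z(1)[OF False] by (simp add: Dc(1))
      then show ?thesis using False by simp
    qed
  qed
  also have "\<dots> = (\<integral>x. (\<Sum>i\<in>UNIV. a0 * (indicator UNIV x * D i x) + a1 * (indicator E1 x * D i x) + a2 * (indicator E2 x * D i x)) \<partial>lborel)"
    by (rule integral_completion) (use Dm Em in \<open>simp\<close>)
  also have "\<dots> = (\<Sum>i\<in>UNIV. \<integral>x. a0 * (indicator UNIV x * D i x) + a1 * (indicator E1 x * D i x) + a2 * (indicator E2 x * D i x) \<partial>lborel)"
    by (intro Bochner_Integration.integral_sum Bochner_Integration.integrable_add integrable_mult_right int Em) simp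
  also have "\<dots> \<le> (\<Sum>i\<in>(UNIV :: 'n set). \<bar>a1\<bar> * P1 + \<bar>a2\<bar> * P2)"
  proof (intro sum_mono)
    fix i
    have "(\<integral>x. a0 * (indicator UNIV x * D i x) + a1 * (indicator E1 x * D i x) + a2 * (indicator E2 x * D i x) \<partial>lborel)
      = a0 * (\<integral>x. indicator UNIV x * D i x \<partial>lborel) + a1 * (\<integral>x. indicator E1 x * D i x \<partial>lborel) + a2 * (\<integral>x. indicator E2 x * D i x \<partial>lborel)"
      using int[of UNIV i] int[OF Em(1), of i] int[OF Em(2), of i]
      by (subst Bochner_Integration.integral_add Bochner_Integration.integral_mult_right_zero; (intro Bochner_Integration.integrable_add integrable_mult_right)?; simp)+
    also have "\<dots> \<le> 0 + \<bar>a1\<bar> * P1 + \<bar>a2\<bar> * P2"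
    proof -
      have m: "a * t \<le> \<bar>a\<bar> * P" if "\<bar>t\<bar> \<le> P" for a t P :: real
      proof -
        have "a * t \<le> \<bar>a\<bar> * \<bar>t\<bar>" by (simp add: abs_mult[symmetric])
        also have "\<dots> \<le> \<bar>a\<bar> * P" using that by (intro mult_left_mono) auto
        finally show ?thesis .
      qed
      show ?thesis using m[OF one[OF U, of i], of a0] m[OF one[OF E(1), of i], of a1] m[OF one[OF E(2), of i], of a2] by simp
    qed
    finally show "(\<integral>x. a0 * (indicator UNIV x * D i x) + a1 * (indicator E1 x * D i x) + a2 * (indicator E2 x * D i x) \<partial>lborel) \<le> \<bar>a1\<bar> * P1 + \<bar>a2\<bar> * P2" by simp
  qed
  also have "\<dots> = real CARD('n) * (\<bar>a1\<bar> * P1 + \<bar>a2\<bar> * P2)" by simp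
  finally show "ennreal (set_lebesgue_integral lebesgue \<Omega> (\<lambda>x. f x * divergence \<phi> x)) \<le> ennreal (real CARD('n) * (\<bar>a1\<bar> * P1 + \<bar>a2\<bar> * P2))"
    by (rule ennreal_leI)
qed

section \<open>The rotation between the cube and the domain\<close>

definition half_root :: real where "half_root = sqrt 2 / 2"

lemma half_root: "half_root * half_root = 1/2" "half_root * (half_root * x) = x / 2" "0 \<le> half_root" "half_root \<le> 1"
proof -
  show h: "half_root * half_root = 1/2" by (simp add: half_root_def)
  show "half_root * (half_root * x) = x / 2" unfolding mult.assoc[symmetric] h by simp
  show "0 \<le> half_root" by (simp add: half_root_def)
  show "half_root \<le> 1" unfolding half_root_def using real_sqrt_le_mono[of 2 4] by simp
qed

lemma half_root_pair: "half_root * (half_root * a - half_root * b) = (a - b) / 2"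
  "half_root * (half_root * a + half_root * b) = (a + b) / 2"
  unfolding distrib_left right_diff_distrib half_root(2) by (simp_all only: add_divide_distrib diff_divide_distrib)

text \<open>On the last two coordinates \<open>unrot\<close> is \<open>\<Phi>\<close> and
  \<open>rot\<close> is its inverse, so the domain becomes the open unit cube in the variables
  \<open>(x, s, t)\<close>.\<close>

definition rot :: "r3 \<Rightarrow> real^3" where
  "rot z = vector [fst z, half_root * (fst (snd z) - snd (snd z)), half_root * (fst (snd z) + snd (snd z))]"

definition unrot :: "real^3 \<Rightarrow> r3" where
  "unrot y = (y $ 1, half_root * (y $ 2 + y $ 3), half_root * (y $ 3 - y $ 2))"

lemma unrot_rot: "unrot (rot z) = z"
proof (cases z)
  case (fields x s t)
  have "half_root * (half_root * (s - t) + half_root * (s + t)) = s" unfolding half_root_pair by (simp add: field_simps)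
  moreover have "half_root * (half_root * (s + t) - half_root * (s - t)) = t" unfolding half_root_pair by (simp add: field_simps)
  ultimately show ?thesis unfolding fields unrot_def rot_def vector_3 fst_conv snd_conv by (simp only:)
qed

lemma rot_unrot: "rot (unrot y) = y"
proof -
  have "half_root * (half_root * (y $ 2 + y $ 3) - half_root * (y $ 3 - y $ 2)) = y $ 2" unfolding half_root_pair by (simp add: field_simps)
  moreover have "half_root * (half_root * (y $ 2 + y $ 3) + half_root * (y $ 3 - y $ 2)) = y $ 3" unfolding half_root_pair by (simp add: field_simps)
  ultimately show ?thesis unfolding unrot_def rot_def vec_eq_iff forall_3 vector_3 fst_conv snd_conv by (simp only: simp_thms)
qed

lemma rot_linear: "linear rot"
  by (rule linearI) (simp_all add: rot_def vec_eq_iff forall_3 algebra_simps)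

lemma unrot_linear: "linear unrot"
  by (rule linearI) (simp_all add: unrot_def algebra_simps)

lemma rot_bl: "bounded_linear rot" using rot_linear by (simp only: linear_linear)

lemma unrot_bl: "bounded_linear unrot" using unrot_linear by (simp only: linear_linear)

lemma rot_norm: "norm (rot z) = norm z"
proof -
  have "rot z \<bullet> rot z = z \<bullet> z"
  proof (cases z)
    case (fields x s t)
    have "rot z \<bullet> rot z = x * x + (half_root * half_root) * ((s - t) * (s - t) + (s + t) * (s + t))"
      unfolding fields by (simp add: rot_def inner_vec_def sum_3 algebra_simps)
    then show ?thesis unfolding half_root(1) fields by (simp add: algebra_simps)
  qed
  then show ?thesis by (simp add: norm_eq_sqrt_inner)
qed

lemma unrot_norm: "norm (unrot y) = norm y" using rot_norm[of "unrot y"] by (simp add: rot_unrot)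

lemma distr_orthogonal:
  fixes f :: "real^'n::{finite,wellorder} \<Rightarrow> real^'n::{finite,wellorder}"
  assumes f: "orthogonal_transformation f"
  shows "distr lborel borel f = lborel"
proof (rule lborel_eqI[symmetric])
  fix l u :: "(real, 'n) vec" assume lu: "\<And>b. b \<in> Basis \<Longrightarrow> l \<bullet> b \<le> u \<bullet> b"
  have i: "orthogonal_transformation (inv f)" by (rule orthogonal_transformation_inv[OF f])
  have lf: "linear f" by (rule orthogonal_transformation_linear[OF f])
  have m: "f \<in> borel_measurable borel"
    using lf by (intro borel_measurable_continuous_onI linear_continuous_on) (simp add: linear_linear)
  have v: "f -` box l u = inv f ` box l u"
    by (rule bij_vimage_eq_inv_image[OF orthogonal_transformation_bij[OF f]])
  have b: "box l u \<in> sets borel" by simp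
  have "f -` box l u \<in> sets borel" using measurable_sets[OF m b] by (simp only: space_borel Int_UNIV_right)
  then have vb: "inv f ` box l u \<in> sets lborel" by (simp only: v sets_lborel)
  have "f \<in> measurable lborel borel" using m by simp
  from emeasure_distr[OF this b]
  have "emeasure (distr lborel borel f) (box l u) = emeasure lborel (inv f ` box l u)"
    by (simp only: v space_lborel space_borel Int_UNIV_right)
  also have "\<dots> = emeasure lebesgue (inv f ` box l u)" using emeasure_completion[OF sets_completionI_sets[OF vb]] vb by simp
  also have "\<dots> = ennreal (measure lebesgue (inv f ` box l u))"
    using measurable_orthogonal_image[OF i lmeasurable_box] by (rule emeasure_eq_measure2)
  also have "\<dots> = ennreal (measure lebesgue (box l u))"
    unfolding measure_orthogonal_image[OF i lmeasurable_box] ..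
  also have "\<dots> = emeasure lebesgue (box l u)" by (rule emeasure_eq_measure2[OF lmeasurable_box, symmetric])
  also have "\<dots> = ennreal (\<Prod>b\<in>Basis. (u - l) \<bullet> b)"
    using emeasure_lborel_box[OF lu] by simp
  finally show "emeasure (distr lborel borel f) (box l u) = ennreal (\<Prod>b\<in>Basis. (u - l) \<bullet> b)" .
qed simp

lemma rot_borel: "rot \<in> borel_measurable borel" and unrot_borel: "unrot \<in> borel_measurable borel"
  by (intro borel_measurable_continuous_onI linear_continuous_on rot_bl unrot_bl)+

text \<open>\<open>rot\<close> connects two different types. It factors into the relabelling of
  triples as vectors, treated by \<open>distr_basis_iso\<close>, and an orthogonal transformation of
  \<open>real^3\<close>.\<close>

lemma rot_distr: "distr lborel borel rot = lborel"
proof -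
  let ?V = "\<lambda>z :: r3. vector [fst z, fst (snd z), snd (snd z)] :: real^3"
  let ?W = "\<lambda>y :: real^3. (y $ 1, y $ 2, y $ 3)"
  let ?R = "\<lambda>y. rot (?W y)"
  have lV: "linear ?V" by (auto intro!: linearI simp: vec_eq_iff forall_3)
  have lW: "linear ?W" by (auto intro!: linearI)
  have Vm: "?V \<in> borel_measurable borel"
    using lV by (intro borel_measurable_continuous_onI linear_continuous_on) (simp add: linear_linear)
  have ax: "?V (1,0,0) = axis 1 1" "?V (0,1,0) = axis 2 1" "?V (0,0,1) = axis 3 1"
    by (simp_all add: vec_eq_iff forall_3 axis_def)
  have B3: "(Basis :: r3 set) = {(1,0,0),(0,1,0),(0,0,1)}" by (auto simp: Basis_prod_def zero_prod_def)
  have UN3: "(UNIV :: 3 set) = {1,2,3}" by (rule UNIV_3)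
  have Bv: "(Basis :: (real^3) set) = {axis 1 1, axis 2 1, axis 3 1}" by (auto simp: Basis_vec_def UN3)
  have V: "distr lborel borel ?V = lborel"
  proof (rule distr_basis_iso[OF Vm, where g="?W"])
    have "inj ?V" by (rule inj_on_inverseI[of _ ?W]) simp
    moreover have "?V ` Basis = Basis" unfolding B3 Bv image_insert image_empty ax ..
    ultimately show "bij_betw ?V Basis Basis" by (auto simp: bij_betw_def intro: inj_on_subset)
    show "?V x \<bullet> ?V a = x \<bullet> a" for x a by (cases x; cases a) (simp add: inner_vec_def sum_3)
    show "?W y \<bullet> a = y \<bullet> ?V a" for y a by (cases a) (simp add: inner_vec_def sum_3)
  qed
  have nW: "norm (?W y) = norm y" for y
    by (simp add: norm_eq_sqrt_inner inner_vec_def sum_3)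
  have R: "orthogonal_transformation ?R"
    unfolding orthogonal_transformation
    using linear_compose[OF lW rot_linear] by (simp add: o_def rot_norm nW)
  have Rm: "?R \<in> borel_measurable borel"
    using orthogonal_transformation_linear[OF R]
    by (intro borel_measurable_continuous_onI linear_continuous_on) (simp add: linear_linear)
  have "distr lborel borel rot = distr lborel borel (?R \<circ> ?V)" by (simp add: o_def)
  also have "\<dots> = distr (distr lborel borel ?V) borel ?R" using Vm Rm by (subst distr_distr) simp_all
  also have "\<dots> = lborel" by (simp only: V distr_orthogonal[OF R])
  finally show ?thesis .
qed

lemma unrot_distr: "distr lborel borel unrot = lborel"
proof -
  have "distr lborel borel unrot = distr (distr lborel borel rot) borel unrot" by (simp only: rot_distr)
  also have "\<dots> = distr lborel borel (unrot \<circ> rot)" using rot_borel unrot_borel by (subst distr_distr) simp_all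
  also have "\<dots> = distr lborel lborel (\<lambda>x. x)" by (simp add: o_def unrot_rot cong: distr_cong)
  finally show ?thesis by (simp add: distr_id2)
qed

lemma AE_unrot:
  assumes "AE z in lborel. Q z" shows "AE y in lborel. Q (unrot y)"
proof -
  have "AE z in distr lborel borel unrot. Q z" using assms by (simp only: unrot_distr)
  from AE_distrD[OF _ this] show ?thesis using unrot_borel by simp
qed

lemma rot_pbound:
  assumes "pbound E P" shows "pbound (rot ` E) P"
  by (rule pbound_image[OF rot_borel unrot_borel unrot_rot rot_unrot _ _ rot_distr assms])
     (simp_all add: linear_add[OF rot_linear] unrot_norm)

lemma mem_rot: "y \<in> rot ` E \<longleftrightarrow> unrot y \<in> E"
  using unrot_rot rot_unrot by (metis image_iff)

abbreviation open_cube :: "r3 set" where "open_cube \<equiv> {0<..<1} \<times> {0<..<1} \<times> {0<..<1}"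

lemma mem_\<Omega>2: "y \<in> \<Omega>2 \<longleftrightarrow> unrot y \<in> open_cube"
  unfolding \<Omega>2_def unrot_def \<Phi>_def half_root_def mem_Collect_eq vimage_eq forall_2
  by (simp only: vector_scaleR_component vector_2 real_scaleR_def mem_Times_iff fst_conv snd_conv
      greaterThanLessThan_iff conj_assoc)

lemma open_\<Omega>2: "open \<Omega>2"
proof -
  have "\<Omega>2 = unrot -` open_cube" by (rule set_eqI) (simp only: mem_\<Omega>2 vimage_eq)
  moreover have "open (unrot -` open_cube)"
    by (intro open_vimage open_Times open_greaterThanLessThan linear_continuous_on unrot_bl)
  ultimately show ?thesis by (simp only:)
qed

lemma bounded_\<Omega>2: "bounded \<Omega>2"
proof -
  have I: "bounded {0<..<1::real}" by (rule bounded_subset[OF bounded_closed_interval, of _ 0 1]) (rule greaterThanLessThan_subseteq_atLeastAtMost_iff[THEN iffD2], simp)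
  have "bounded open_cube" by (intro bounded_Times I)
  then have "bounded (rot ` open_cube)" using rot_bl by (rule bounded_linear_image)
  moreover have "\<Omega>2 \<subseteq> rot ` open_cube" by (rule subsetI) (simp only: mem_\<Omega>2 mem_rot)
  ultimately show ?thesis by (rule bounded_subset)
qed

text \<open>Half-open bricks tile well but contain three of their faces, whereas the boundary
  condition concerns the complement of the open domain. Continuity gives zero values on those faces
  too.\<close>

lemma lipschitz_zero_boundary:
  assumes L: "K-lipschitz_on UNIV v" and z: "\<And>z. z \<notin> brick 1 1 \<Longrightarrow> v z = (0::r3)" and "z \<notin> open_cube"
  shows "v z = 0"
proof (cases "z \<in> brick 1 1")
  case True
  \<comment> \<open>A point of the half-open brick on its boundary has a vanishing coordinate, so
    moving diagonally downwards leaves the brick at once.\<close>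
  let ?w = "\<lambda>n. z - inverse (real (Suc n)) *\<^sub>R (1,1,1)"
  have w: "?w \<longlonglongrightarrow> z - 0 *\<^sub>R (1,1,1)" by (intro tendsto_intros LIMSEQ_inverse_real_of_nat)
  have "isCont v (z - 0 *\<^sub>R (1,1,1))"
    using lipschitz_on_continuous_on[OF L] by (simp only: continuous_on_eq_continuous_at[OF open_UNIV]) blast
  then have "(\<lambda>n. v (?w n)) \<longlonglongrightarrow> v (z - 0 *\<^sub>R (1,1,1))" using w by (rule isCont_tendsto_compose)
  moreover have "z - 0 *\<^sub>R (1,1,1) = z" by (cases z) simp
  ultimately have "(\<lambda>n. v (?w n)) \<longlonglongrightarrow> v z" by (simp only:)
  moreover have "v (?w n) = 0" for n
  proof (rule z)
    define d where "d = inverse (real (Suc n))"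
    have d: "0 < d" unfolding d_def by (rule positive_imp_inverse_positive) (rule of_nat_0_less_iff[THEN iffD2], rule zero_less_Suc)
    obtain x s t where xyz: "z = (x, s, t)" by (metis prod_cases3)
    have "x = 0 \<or> s = 0 \<or> t = 0" using True assms(3) unfolding xyz by (simp add: not_less less_eq_real_def) linarith
    then have "x - d < 0 \<or> s - d < 0 \<or> t - d < 0" using d by linarith
    then have "(x - d, s - d, t - d) \<notin> brick 1 1"
      unfolding mem_Times_iff fst_conv snd_conv atLeastLessThan_iff by linarith
    then show "?w n \<notin> brick 1 1" unfolding xyz d_def[symmetric] by simp
  qed
  ultimately have "(\<lambda>n::nat. 0) \<longlonglongrightarrow> v z" by simp
  then show ?thesis by (simp add: LIMSEQ_const_iff)
qed (rule z)

section \<open>Transfer of the energy to the original coordinates\<close>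

lemma diag3_nth: "diag3 a b c $ 1 $ 1 = a" "diag3 a b c $ 2 $ 2 = b" "diag3 a b c $ 3 $ 3 = c"
  "diag3 a b c $ 1 $ 2 = 0" "diag3 a b c $ 1 $ 3 = 0" "diag3 a b c $ 2 $ 1 = 0"
  "diag3 a b c $ 2 $ 3 = 0" "diag3 a b c $ 3 $ 1 = 0" "diag3 a b c $ 3 $ 2 = 0"
  by (simp_all add: diag3_def)

text \<open>Rotating back, each entry of the deviation from the well is a combination of deviations
  in the rotated frame with coefficients at most 1 in modulus, hence at most
  \<open>err D (a, b)\<close>; there are nine entries.\<close>

lemma matrix_estimate:
  assumes D: "linear D" and M: "\<And>i j. M $ i $ j = rot (D (unrot (axis j 1))) $ i + (F2 *v axis j 1) $ i"
  shows "norm (sym_part M - diag3 (1/2 + a) (1/2 - b) (b - 1/2)) \<le> 9 * err D (a, b)"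
proof -
  define h where "h = half_root"
  note h = half_root[folded h_def]
  obtain a1 b1 c1 where d1: "D (1,0,0) = (a1,b1,c1)" by (metis prod_cases3)
  obtain a2 b2 c2 where d2: "D (0,1,0) = (a2,b2,c2)" by (metis prod_cases3)
  obtain a3 b3 c3 where d3: "D (0,0,1) = (a3,b3,c3)" by (metis prod_cases3)
  define e where "e = err D (a, b)"
  have e: "e = \<bar>a1 - a\<bar> + \<bar>b3 + c2 - 2 * b\<bar> + \<bar>b2\<bar> + \<bar>c3\<bar> + \<bar>a2 + b1\<bar> + \<bar>a3 + c1\<bar>"
    by (simp add: e_def err_def d1 d2 d3)
  have u: "unrot (axis 1 1) = (1,0,0)" "unrot (axis 2 1) = h *\<^sub>R (0,1,0) - h *\<^sub>R (0,0,1)"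
    "unrot (axis 3 1) = h *\<^sub>R (0,1,0) + h *\<^sub>R (0,0,1)"
    by (simp_all add: unrot_def axis_def h_def)
  have Du: "D (unrot (axis 1 1)) = (a1,b1,c1)" "D (unrot (axis 2 1)) = (h * (a2 - a3), h * (b2 - b3), h * (c2 - c3))"
    "D (unrot (axis 3 1)) = (h * (a2 + a3), h * (b2 + b3), h * (c2 + c3))"
    unfolding u linear_diff[OF D] linear_add[OF D] linear_scale[OF D] d1 d2 d3
    by (simp_all add: algebra_simps)
  have r: "rot (a1,b1,c1) $ 1 = a1" "rot (x, h * y, h * z) $ 2 = (y - z) / 2" "rot (x, h * y, h * z) $ 3 = (y + z) / 2"
    "rot (x, y, z) $ 1 = x" "rot (a1,b1,c1) $ 2 = h * (b1 - c1)" "rot (a1,b1,c1) $ 3 = h * (b1 + c1)" for x y z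
    by (simp_all add: rot_def h_def[symmetric] half_root_pair[folded h_def])
  have F: "(F2 *v axis j 1) $ i = F2 $ i $ j" for i j by (simp add: matrix_vector_mult_basis column_def)
  have m: "M $ 1 $ 1 = a1 + 1/2" "M $ 2 $ 1 = h * (b1 - c1)" "M $ 3 $ 1 = h * (b1 + c1)"
    "M $ 1 $ 2 = h * (a2 - a3)" "M $ 2 $ 2 = (b2 - b3 - (c2 - c3)) / 2 + 1/2" "M $ 3 $ 2 = (b2 - b3 + (c2 - c3)) / 2"
    "M $ 1 $ 3 = h * (a2 + a3)" "M $ 2 $ 3 = (b2 + b3 - (c2 + c3)) / 2" "M $ 3 $ 3 = (b2 + b3 + (c2 + c3)) / 2 - 1/2"
    unfolding M F Du r unfolding F2_def by (simp_all add: diag3_nth)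
  let ?N = "sym_part M - diag3 (1/2 + a) (1/2 - b) (b - 1/2)"
  have hb: "\<bar>h * x / 2\<bar> \<le> \<bar>x\<bar>" for x
  proof -
    have "h * \<bar>x\<bar> \<le> 1 * \<bar>x\<bar>" by (intro mult_right_mono h) simp
    then show ?thesis using h(3) by (simp add: abs_mult)
  qed
  have s: "?N $ i $ j = (M $ i $ j + M $ j $ i) / 2 - diag3 (1/2 + a) (1/2 - b) (b - 1/2) $ i $ j" for i j
    by (simp add: sym_part_def transpose_def)
  have n: "?N $ 1 $ 1 = a1 - a" "?N $ 2 $ 2 = (b2 + c3) / 2 - (b3 + c2 - 2 * b) / 2" "?N $ 3 $ 3 = (b2 + c3) / 2 + (b3 + c2 - 2 * b) / 2"
    "?N $ 1 $ 2 = h * ((a2 + b1) - (a3 + c1)) / 2" "?N $ 2 $ 1 = h * ((a2 + b1) - (a3 + c1)) / 2"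
    "?N $ 1 $ 3 = h * ((a2 + b1) + (a3 + c1)) / 2" "?N $ 3 $ 1 = h * ((a2 + b1) + (a3 + c1)) / 2"
    "?N $ 2 $ 3 = (b2 - c3) / 2" "?N $ 3 $ 2 = (b2 - c3) / 2"
    unfolding s m diag3_nth by (simp_all add: field_simps)
  have half: "\<bar>(x + y) / 2 - z / 2\<bar> \<le> e" "\<bar>(x + y) / 2 + z / 2\<bar> \<le> e" "\<bar>(x - y) / 2\<bar> \<le> e" if "X + Y + Z \<le> e" "x \<le> X" "- x \<le> X" "y \<le> Y" "- y \<le> Y" "z \<le> Z" "- z \<le> Z" for x y z X Y Z
    by (rule abs_leI; use that in \<open>simp add: field_simps\<close>)+
  have "x3 + x4 + x2 \<le> x1 + x2 + x3 + x4 + x5 + x6 \<and> x5 + x6 \<le> x1 + x2 + x3 + x4 + x5 + x6 \<and> x1 \<le> x1 + x2 + x3 + x4 + x5 + x6"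
    if "0 \<le> x1" "0 \<le> x2" "0 \<le> x3" "0 \<le> x4" "0 \<le> x5" "0 \<le> x6" for x1 x2 x3 x4 x5 x6 :: real
    using that by simp
  from this[OF abs_ge_zero abs_ge_zero abs_ge_zero abs_ge_zero abs_ge_zero abs_ge_zero, of b2 c3 "b3 + c2 - 2 * b" "a1 - a" "a2 + b1" "a3 + c1"]
  have part: "\<bar>b2\<bar> + \<bar>c3\<bar> + \<bar>b3 + c2 - 2 * b\<bar> \<le> e" "\<bar>a2 + b1\<bar> + \<bar>a3 + c1\<bar> \<le> e" "\<bar>a1 - a\<bar> \<le> e"
    unfolding e by blast+
  have "\<bar>?N $ 2 $ 2\<bar> \<le> e" "\<bar>?N $ 3 $ 3\<bar> \<le> e" "\<bar>?N $ 2 $ 3\<bar> \<le> e" "\<bar>?N $ 3 $ 2\<bar> \<le> e"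
    using half[OF part(1) abs_ge_self abs_ge_minus_self abs_ge_self abs_ge_minus_self abs_ge_self abs_ge_minus_self] unfolding n by blast+
  moreover have "\<bar>?N $ 1 $ 1\<bar> \<le> e" unfolding n by (rule part)
  moreover have "\<bar>?N $ 1 $ 2\<bar> \<le> e" "\<bar>?N $ 2 $ 1\<bar> \<le> e"
    unfolding n by (rule order_trans[OF hb order_trans[OF abs_triangle_ineq4 part(2)]])+
  moreover have "\<bar>?N $ 1 $ 3\<bar> \<le> e" "\<bar>?N $ 3 $ 1\<bar> \<le> e"
    unfolding n by (rule order_trans[OF hb order_trans[OF abs_triangle_ineq part(2)]])+
  ultimately have "\<forall>i j. \<bar>?N $ i $ j\<bar> \<le> e" unfolding forall_3 by blast
  then have "(\<Sum>i\<in>UNIV. \<Sum>j\<in>UNIV. \<bar>?N $ i $ j\<bar>) \<le> (\<Sum>i\<in>(UNIV :: 3 set). \<Sum>j\<in>(UNIV :: 3 set). e)"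
    by (intro sum_mono) blast
  also have "\<dots> = 9 * e" by simp
  finally have "(\<Sum>i\<in>UNIV. \<Sum>j\<in>UNIV. \<bar>?N $ i $ j\<bar>) \<le> 9 * e" .
  then show ?thesis using norm_matrix_le[of ?N] unfolding e_def by linarith
qed


text \<open>\<open>F2\<close> plus the matrix that the pair of \<open>xx\<close> and
  \<open>st\<close> entries encodes, in the original basis.\<close>

definition well :: "real \<times> real \<Rightarrow> real^3^3" where
  "well ab = diag3 (1/2 + fst ab) (1/2 - snd ab) (snd ab - 1/2)"

lemma wells2_nth: "wells2 ! 0 = well (outT 0)" "wells2 ! 1 = well (outT 1)" "wells2 ! 2 = well (outT 2)" "length wells2 = 3"
  by (simp_all add: wells2_def well_def outT_def)

lemma wells2_distinct: "well (outT 1) \<noteq> well (outT 0)" "well (outT 1) \<noteq> well (outT 2)" "well (outT 2) \<noteq> well (outT 0)"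
proof -
  have "A \<noteq> B" if "A $ 1 $ 1 \<noteq> B $ 1 $ 1" for A B :: "real^3^3" using that by auto
  then show "well (outT 1) \<noteq> well (outT 0)" "well (outT 1) \<noteq> well (outT 2)" "well (outT 2) \<noteq> well (outT 0)"
    by (simp_all add: well_def outT_def diag3_nth)
qed

definition phases :: "r3 set \<Rightarrow> r3 set \<Rightarrow> real^3 \<Rightarrow> real^3^3" where
  "phases E1 E2 y = well (target outT E1 E2 (unrot y))"

lemma phases_cases:
  "phases E1 E2 y = (if y \<in> rot ` E1 then well (outT 1) else if y \<in> rot ` E2 then well (outT 2) else well (outT 0))"
  by (simp add: phases_def target_def mem_rot)

text \<open>Every matrix entry is a constant plus multiples of the indicators of the two rotated
  phase sets, so the translation bounds control its variation.\<close>

lemma phases_BV: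
  assumes E: "pbound E1 P1" "pbound E2 P2" "E1 \<inter> E2 = {}"
  shows "phases E1 E2 \<in> BV_into \<Omega>2 (set wells2)"
  unfolding BV_into_def mem_Collect_eq
proof (intro conjI ballI allI)
  show "phases E1 E2 y \<in> set wells2" for y
    unfolding phases_cases wells2_nth(1-3)[symmetric] using wells2_nth(4) by (auto intro!: nth_mem)
  fix i j
  define a0 a1 a2 where "a0 = well (outT 0) $ i $ j" "a1 = well (outT 1) $ i $ j - a0" "a2 = well (outT 2) $ i $ j - a0"
  have dis: "\<not> (x \<in> rot ` E1 \<and> x \<in> rot ` E2)" for x using E(3) unfolding mem_rot by blast
  have f: "phases E1 E2 x $ i $ j = a0 + a1 * indicator (rot ` E1) x + a2 * indicator (rot ` E2) x" for x
    unfolding phases_cases a0_a1_a2_def using dis[of x]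
    by (cases "x \<in> rot ` E1"; cases "x \<in> rot ` E2"; simp)
  note P = rot_pbound[OF E(1)] rot_pbound[OF E(2)]
  have Ob: "\<Omega>2 \<in> sets borel" using open_\<Omega>2 by simp
  have "total_variation \<Omega>2 (\<lambda>x. phases E1 E2 x $ i $ j) \<le> ennreal (real CARD(3) * (\<bar>a1\<bar> * P1 + \<bar>a2\<bar> * P2))"
    by (rule total_variation_le[OF P Ob f])
  then have tv: "total_variation \<Omega>2 (\<lambda>x. phases E1 E2 x $ i $ j) < \<infinity>" by (rule order.strict_trans1) simp
  have Ol: "\<Omega>2 \<in> lmeasurable" using bounded_\<Omega>2 open_\<Omega>2 by (rule lmeasurable_open)
  have int: "integrable lebesgue (indicator (\<Omega>2 \<inter> E) :: _ \<Rightarrow> real)" if "E \<in> sets borel" for E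
  proof (rule integrable_real_indicator)
    show m: "\<Omega>2 \<inter> E \<in> sets lebesgue" using Ob that by simp
    have "emeasure lebesgue (\<Omega>2 \<inter> E) \<le> emeasure lebesgue \<Omega>2" using Ob by (intro emeasure_mono) auto
    also have "\<dots> < \<infinity>" using Ol unfolding fmeasurable_def by blast
    finally show "emeasure lebesgue (\<Omega>2 \<inter> E) < \<infinity>" .
  qed
  have Em: "rot ` E1 \<in> sets borel" "rot ` E2 \<in> sets borel" using P by (simp_all add: pbound_def)
  have "integrable lebesgue (\<lambda>x. a0 * indicator (\<Omega>2 \<inter> UNIV) x + a1 * indicator (\<Omega>2 \<inter> rot ` E1) x + a2 * indicator (\<Omega>2 \<inter> rot ` E2) x)"
    by (intro Bochner_Integration.integrable_add integrable_mult_right int Em) simp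
  moreover have "indicator \<Omega>2 x *\<^sub>R phases E1 E2 x $ i $ j = a0 * indicator (\<Omega>2 \<inter> UNIV) x + a1 * indicator (\<Omega>2 \<inter> rot ` E1) x + a2 * indicator (\<Omega>2 \<inter> rot ` E2) x" for x
    unfolding f by (simp add: indicator_inter_arith algebra_simps)
  ultimately have "set_integrable lebesgue \<Omega>2 (\<lambda>x. phases E1 E2 x $ i $ j)" unfolding set_integrable_def by (simp only:)
  then show "(\<lambda>x. phases E1 E2 x $ i $ j) \<in> BV \<Omega>2" using tv by (simp add: BV_def)
qed

lemma phases_variation:
  assumes E: "pbound E1 P1" "pbound E2 P2" "E1 \<inter> E2 = {}"
  shows "total_variation \<Omega>2 (phase wells2 (phases E1 E2) 1) \<le> ennreal (3 * P1)"
    "total_variation \<Omega>2 (phase wells2 (phases E1 E2) 2) \<le> ennreal (3 * P2)"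
proof -
  note P = rot_pbound[OF E(1)] rot_pbound[OF E(2)]
  have Ob: "\<Omega>2 \<in> sets borel" using open_\<Omega>2 by (rule borel_open)
  have dis: "\<not> (x \<in> rot ` E1 \<and> x \<in> rot ` E2)" for x using E(3) unfolding mem_rot by blast
  note ne = wells2_distinct wells2_distinct[symmetric]
  have ph: "phase wells2 (phases E1 E2) j x = (if phases E1 E2 x = wells2 ! j then 1 else 0)" for j x
    unfolding phase_def indicator_def by (simp only: mem_Collect_eq of_bool_def)
  have "phase wells2 (phases E1 E2) 1 x = 0 + 1 * indicator (rot ` E1) x + 0 * indicator (rot ` E2) x" for x
    unfolding ph phases_cases wells2_nth using ne
    by (cases "x \<in> rot ` E1"; cases "x \<in> rot ` E2"; simp)
  from total_variation_le[OF P Ob this]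
  show "total_variation \<Omega>2 (phase wells2 (phases E1 E2) 1) \<le> ennreal (3 * P1)" by simp
  have "phase wells2 (phases E1 E2) 2 x = 0 + 0 * indicator (rot ` E1) x + 1 * indicator (rot ` E2) x" for x
    unfolding ph phases_cases wells2_nth using ne dis[of x]
    by (cases "x \<in> rot ` E1"; cases "x \<in> rot ` E2"; simp)
  from total_variation_le[OF P Ob this]
  show "total_variation \<Omega>2 (phase wells2 (phases E1 E2) 2) \<le> ennreal (3 * P2)" by simp
qed

text \<open>The competitor is the rotated displacement plus the affine map of \<open>F2\<close>.
  Rotation preserves volume, Lipschitz constants and translation bounds. The constant
  \<open>729 = 9^3\<close> comes from \<open>matrix_estimate\<close> with \<open>p \<le> 3\<close>
  and dominates the factor 3 that total variation loses by splitting into components.\<close>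

lemma energy_of_adm0:
  assumes p: "1 \<le> p" "p \<le> 3" and \<epsilon>: "0 < \<epsilon>" and adm: "adm0 p \<epsilon> outT (brick 1 1) e"
  shows "min_energy p \<epsilon> \<Omega>2 wells2 F2 \<le> ennreal (729 * e)"
proof -
  let ?R = "brick 1 1 :: r3 set"
  obtain v E1 E2 g P1 P2 I K where Rm: "?R \<in> sets borel" and L: "K-lipschitz_on UNIV v"
    and vz0: "\<forall>z. z \<notin> ?R \<longrightarrow> v z = 0" and E: "E1 \<inter> E2 = {}" and P: "pbound E1 P1" "pbound E2 P2"
    and gm: "g \<in> borel_measurable borel"
    and ae: "AE z in lborel. \<exists>D. (v has_derivative D) (at z) \<and> (z \<notin> ?R \<longrightarrow> D = (\<lambda>_. 0)) \<and>
        (z \<in> ?R \<longrightarrow> err D (target outT E1 E2 z) powr p \<le> g z)"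
    and I: "(\<integral>\<^sup>+z\<in>?R. ennreal (g z) \<partial>lborel) \<le> ennreal I" "0 \<le> I" and e: "I + \<epsilon> * (P1 + P2) \<le> e"
    using adm unfolding adm0_def by ((elim conjE exE, rule that; assumption) | blast)
  have vz: "\<And>z. z \<notin> ?R \<Longrightarrow> v z = 0" using vz0 by blast
  have P0: "0 \<le> P1" "0 \<le> P2" using P by (simp_all add: pbound_def)
  define u where "u = (\<lambda>y. rot (v (unrot y)) + F2 *v y)"
  have Fbl: "bounded_linear (\<lambda>y. F2 *v y)" by (rule matrix_vector_mul_bounded_linear)
  obtain B where B: "0 \<le> B" "\<And>y. norm (F2 *v y) \<le> norm y * B" using bounded_linear.nonneg_bounded[OF Fbl] by blast
  have uL: "(K + B)-lipschitz_on UNIV u"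
    unfolding u_def
  proof (rule lipschitz_on_add)
    show "K-lipschitz_on UNIV (\<lambda>y. rot (v (unrot y)))"
    proof (rule lipschitz_onI)
      fix x y
      have "dist (rot (v (unrot x))) (rot (v (unrot y))) = dist (v (unrot x)) (v (unrot y))"
        unfolding dist_norm linear_diff[OF rot_linear, symmetric] rot_norm ..
      also have "\<dots> \<le> K * dist (unrot x) (unrot y)" by (rule lipschitz_onD[OF L UNIV_I UNIV_I])
      also have "dist (unrot x) (unrot y) = dist x y"
        unfolding dist_norm linear_diff[OF unrot_linear, symmetric] unrot_norm ..
      finally show "dist (rot (v (unrot x))) (rot (v (unrot y))) \<le> K * dist x y" .
    qed (rule lipschitz_on_nonneg[OF L])
    show "B-lipschitz_on UNIV (\<lambda>y. F2 *v y)"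
    proof (rule lipschitz_onI)
      fix x y
      show "dist (F2 *v x) (F2 *v y) \<le> B * dist x y"
        using B(2)[of "x - y"] unfolding dist_norm matrix_vector_mult_diff_distrib by (simp only: mult.commute)
    qed (rule B(1))
  qed
  have uD: "(u has_derivative (\<lambda>h. rot (D (unrot h)) + F2 *v h)) (at y)" if "(v has_derivative D) (at (unrot y))" for y D
  proof -
    have "((\<lambda>y. v (unrot y)) has_derivative (\<lambda>h. D (unrot h))) (at y)"
      by (rule has_derivative_compose[OF bounded_linear_imp_has_derivative[OF unrot_bl] that])
    then show ?thesis unfolding u_def
      by (intro has_derivative_add bounded_linear.has_derivative[OF rot_bl] bounded_linear_imp_has_derivative[OF Fbl])
  qed
  note ae' = AE_unrot[OF ae]
  have ud: "AE y in lborel. \<exists>D. (u has_derivative D) (at y)" using ae' by eventually_elim (blast intro: uD)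
  obtain G where Gm: "G \<in> borel_measurable borel" and Gb: "\<exists>B. \<forall>x. norm (G x) \<le> B"
    and Gw: "has_weak_gradient u G" and Ga: "AE x in lborel. \<forall>D. (u has_derivative D) (at x) \<longrightarrow> (\<forall>i j. G x $ i $ j = D (axis j 1) $ i)"
    by (rule lipschitz_weak_gradient[OF uL ud]) (rule that; assumption)
  have p0: "0 \<le> p" using p by simp
  have um: "u \<in> borel_measurable borel" by (intro borel_measurable_continuous_onI lipschitz_on_continuous_on[OF uL])
  have ul: "u \<in> Lp_loc p" by (rule Lp_loc_bounded[OF um lipschitz_locally_bounded[OF uL] p0])
  have Gl: "\<exists>B. \<forall>x\<in>cball 0 R. norm (G x) \<le> B" for R using Gb by blast
  have "G \<in> Lp_loc p" by (rule Lp_loc_bounded[OF Gm Gl p0])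
  with ul have uW: "u \<in> W1p_loc p" using Gw unfolding W1p_loc_def by blast
  have "u y = F2 *v y + 0" if "y \<notin> \<Omega>2" for y
    using lipschitz_zero_boundary[OF L vz, of "unrot y"] that by (simp add: u_def mem_\<Omega>2 linear_0[OF rot_linear])
  then have "AE y in lebesgue. y \<notin> \<Omega>2 \<longrightarrow> u y = F2 *v y + 0" by (intro AE_I2 impI)
  then have uA: "u \<in> A_dir p \<Omega>2 F2" using uW unfolding A_dir_def by blast
  have "has_weak_gradient u (weak_gradient u)" unfolding weak_gradient_def by (rule someI[where P="has_weak_gradient u", OF Gw])
  then have W: "AE x in lebesgue. weak_gradient u x = G x" using Gw by (rule weak_gradient_unique)
  let ?c = "phases E1 E2"
  define f where "f = (\<lambda>z. ennreal (729 * g z) * indicator ?R z)"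
  have fm: "f \<in> borel_measurable borel" unfolding f_def using gm Rm by measurable
  have est: "AE y in lebesgue. ennreal (norm (sym_part (weak_gradient u y) - ?c y) powr p) * indicator \<Omega>2 y \<le> f (unrot y)"
    using W AE_completion[OF Ga] AE_completion[OF ae']
  proof eventually_elim
    case (elim y)
    show ?case
    proof (cases "y \<in> \<Omega>2")
      case True
      then have yR: "unrot y \<in> ?R" unfolding mem_\<Omega>2 by auto
      obtain D where D: "(v has_derivative D) (at (unrot y))" and eg: "err D (target outT E1 E2 (unrot y)) powr p \<le> g (unrot y)"
        using elim(3) yR by blast
      let ?n = "norm (sym_part (weak_gradient u y) - ?c y)" and ?e = "err D (target outT E1 E2 (unrot y))"
      have M: "weak_gradient u y $ i $ j = rot (D (unrot (axis j 1))) $ i + (F2 *v axis j 1) $ i" for i j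
        using elim(1,2) uD[OF D] by simp
      have n: "?n \<le> 9 * ?e"
        using matrix_estimate[OF has_derivative_linear[OF D] M, of "fst (target outT E1 E2 (unrot y))" "snd (target outT E1 E2 (unrot y))"]
        by (simp add: phases_def well_def)
      have e0: "0 \<le> ?e" unfolding err_def by (intro add_nonneg_nonneg abs_ge_zero)
      have "?n powr p \<le> (9 * ?e) powr p" by (rule powr_mono2[OF p0 norm_ge_zero n])
      also have "\<dots> = 9 powr p * ?e powr p" by (rule powr_mult)
      also have "\<dots> \<le> 729 * g (unrot y)"
      proof (rule mult_mono)
        have "(9::real) powr p \<le> 9 powr 3" using p(2) by (intro powr_mono) simp_all
        also have "\<dots> = 729" by simp
        finally show "(9::real) powr p \<le> 729" .
      qed (use eg in simp_all)
      finally have "ennreal (?n powr p) \<le> ennreal (729 * g (unrot y))" by (rule ennreal_leI)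
      then show ?thesis using True yR by (simp add: f_def)
    qed simp
  qed
  have "(\<integral>\<^sup>+y\<in>\<Omega>2. ennreal (norm (sym_part (weak_gradient u y) - ?c y) powr p) \<partial>lebesgue) \<le> (\<integral>\<^sup>+y. f (unrot y) \<partial>lebesgue)"
    by (rule nn_integral_mono_AE[OF est])
  also have "\<dots> = (\<integral>\<^sup>+y. f (unrot y) \<partial>lborel)" by (rule nn_integral_completion)
  also have "\<dots> = (\<integral>\<^sup>+z. f z \<partial>distr lborel borel unrot)" using fm unrot_borel by (subst nn_integral_distr) simp_all
  also have "\<dots> = (\<integral>\<^sup>+z. 729 * (ennreal (g z) * indicator ?R z) \<partial>lborel)"
    unfolding unrot_distr f_def by (simp add: ennreal_mult' mult.assoc)
  also have "\<dots> = 729 * (\<integral>\<^sup>+z\<in>?R. ennreal (g z) \<partial>lborel)" using gm Rm by (intro nn_integral_cmult) simp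
  also have "\<dots> \<le> 729 * ennreal I" by (rule mult_left_mono[OF I(1)]) simp
  also have "\<dots> = ennreal (729 * I)" by (simp add: ennreal_mult')
  finally have bulk: "(\<integral>\<^sup>+y\<in>\<Omega>2. ennreal (norm (sym_part (weak_gradient u y) - ?c y) powr p) \<partial>lebesgue) \<le> ennreal (729 * I)" .
  have "{1..<length wells2} = {1, 2}" by (auto simp: wells2_nth)
  then have "(\<Sum>j\<in>{1..<length wells2}. total_variation \<Omega>2 (phase wells2 ?c j)) \<le> ennreal (3 * P1) + ennreal (3 * P2)"
    using add_mono[OF phases_variation[OF P E]] by simp
  also have "\<dots> = ennreal (3 * (P1 + P2))" using P0 by (simp add: ennreal_plus[symmetric] distrib_left del: ennreal_plus)
  finally have "ennreal \<epsilon> * (\<Sum>j\<in>{1..<length wells2}. total_variation \<Omega>2 (phase wells2 ?c j)) \<le> ennreal \<epsilon> * ennreal (3 * (P1 + P2))"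
    by (rule mult_left_mono) simp
  also have "\<dots> = ennreal (\<epsilon> * (3 * (P1 + P2)))" using \<epsilon> by (simp add: ennreal_mult')
  finally have "energy p \<epsilon> \<Omega>2 wells2 u ?c \<le> ennreal (729 * I) + ennreal (\<epsilon> * (3 * (P1 + P2)))"
    unfolding energy_def using bulk by (intro add_mono)
  also have "\<dots> = ennreal (729 * I + \<epsilon> * (3 * (P1 + P2)))" using I(2) \<epsilon> P0 by (intro ennreal_plus[symmetric]) auto
  also have "\<dots> \<le> ennreal (729 * e)"
  proof (rule ennreal_leI)
    have "0 \<le> \<epsilon> * (P1 + P2)" using \<epsilon> P0 by simp
    then show "729 * I + \<epsilon> * (3 * (P1 + P2)) \<le> 729 * e" using e by (simp add: algebra_simps)
  qed
  finally show ?thesis unfolding min_energy_def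
    by (intro INF_lower2[OF phases_BV[OF P E]] INF_lower2[OF uA])
qed

section \<open>Lamination order of the datum and conclusion\<close>

lemma diag3_add: "diag3 a b c + diag3 a' b' c' = diag3 (a + a') (b + b') (c + c')"
  and diag3_minus: "diag3 a b c - diag3 a' b' c' = diag3 (a - a') (b - b') (c - c')"
  and diag3_scale: "r *\<^sub>R diag3 a b c = diag3 (r * a) (r * b) (r * c)"
  by (simp_all add: vec_eq_iff forall_3 diag3_nth)

lemma diag3_eq_iff: "diag3 a b c = diag3 a' b' c' \<longleftrightarrow> a = a' \<and> b = b' \<and> c = c'"
  by (auto simp: vec_eq_iff forall_3 diag3_nth)

text \<open>The first two wells have midpoint \<open>diag3 (1/2) 0 0\<close>, and the midpoint of
  that matrix and the third well is \<open>F2\<close>. Compatibility at the second stage rests on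
  \<open>diag3 0 (-1) 1\<close> being the symmetrised product of \<open>(0, 1, 1)\<close> and
  \<open>(0, -1, 1)\<close>.\<close>

lemma F2_laminate: "F2 \<in> laminates (set wells2) 2"
proof -
  let ?A0 = "diag3 0 0 0" and ?A1 = "diag3 1 0 0" and ?A2 = "diag3 (1/2) 1 (-1)" and ?B = "diag3 (1/2) 0 0"
  have n1: "?A1 \<noteq> ?A0" and n2: "?B \<noteq> ?A2" by (simp_all add: diag3_eq_iff)
  have "?A1 - ?A0 = sym_tensor (vector [1,0,0]) (vector [1,0,0])"
    by (simp add: vec_eq_iff forall_3 sym_tensor_def tensor_def diag3_nth)
  moreover have "vector [1,0,0] \<noteq> (0 :: real^3)" by (simp add: vec_eq_iff forall_3)
  ultimately have c1: "compatible ?A1 ?A0"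
    unfolding compatible_def using n1 by blast
  have "?B - ?A2 = sym_tensor (vector [0,1,1]) (vector [0,-1,1])"
    by (simp add: vec_eq_iff forall_3 sym_tensor_def tensor_def diag3_nth)
  moreover have "vector [0,1,1] \<noteq> (0 :: real^3)" "vector [0,-1,1] \<noteq> (0 :: real^3)" by (simp_all add: vec_eq_iff forall_3)
  ultimately have c2: "compatible ?B ?A2"
    unfolding compatible_def using n2 by blast
  have "?B = (1/2) *\<^sub>R ?A1 + (1 - 1/2) *\<^sub>R ?A0" by (simp add: diag3_add diag3_scale)
  moreover have "?A1 \<in> laminates (set wells2) 0" "?A0 \<in> laminates (set wells2) 0" "?A2 \<in> laminates (set wells2) 0" by (simp_all add: wells2_def)
  moreover have "(0::real) < 1/2" "(1/2::real) < 1" by simp_all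
  ultimately have B: "?B \<in> laminates (set wells2) (Suc 0)" "?A2 \<in> laminates (set wells2) (Suc 0)"
    using c1 unfolding laminates.simps(2) by blast+
  have "F2 = (1/2) *\<^sub>R ?B + (1 - 1/2) *\<^sub>R ?A2" by (simp add: F2_def diag3_add diag3_scale)
  then have "F2 \<in> laminates (set wells2) (Suc (Suc 0))"
    using B c2 \<open>(0::real) < 1/2\<close> \<open>(1/2::real) < 1\<close> unfolding laminates.simps(2)[of _ "Suc 0"] by blast
  then show ?thesis by (simp only: numeral_2_eq_2)
qed

text \<open>\<open>F2\<close> lies on no line through two of the wells, compatible or not: comparing
  the last diagonal entries determines the coefficient, and the first entry then disagrees.\<close>

lemma F2_not_laminate: "F2 \<notin> laminates (set wells2) 1"
proof
  assume "F2 \<in> laminates (set wells2) 1"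
  then have "F2 \<in> laminates (set wells2) (Suc 0)" by simp
  then have "F2 \<in> set wells2 \<or> (\<exists>l B1 B2. F2 = l *\<^sub>R B1 + (1 - l) *\<^sub>R B2 \<and> B1 \<in> set wells2 \<and> B2 \<in> set wells2)"
    unfolding laminates.simps by blast
  then show False
    by ((auto simp: wells2_def F2_def diag3_add diag3_scale diag3_eq_iff; fail)
      | (auto simp: wells2_def F2_def diag3_add diag3_scale diag3_eq_iff field_simps))
qed

theorem theorem1p4:
  fixes p :: real
  assumes "1 \<le> p" and "p \<le> 3"
  shows "F2 \<in> laminates (set wells2) 2 - laminates (set wells2) 1 \<and>
    (\<exists>C::real. C > 0 \<and> (\<forall>\<epsilon>::real. 0 < \<epsilon> \<and> \<epsilon> < 1 \<longrightarrow>
       min_energy p \<epsilon> \<Omega>2 wells2 F2 \<le> ennreal (C * \<epsilon> powr (2 * p / (2 * p + 3)))))"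
proof (intro conjI)
  show "F2 \<in> laminates (set wells2) 2 - laminates (set wells2) 1"
    using F2_laminate F2_not_laminate by blast
  obtain C where C: "C > 0" "\<And>p \<epsilon>. 1 \<le> p \<and> p \<le> 3 \<and> 0 < \<epsilon> \<and> \<epsilon> < 1 \<Longrightarrow>
     adm p \<epsilon> outT (brick 1 1) (C * \<epsilon> powr (2 * p / (2 * p + 3)))"
    using unit_cube_adm by blast
  show "\<exists>C::real. C > 0 \<and> (\<forall>\<epsilon>::real. 0 < \<epsilon> \<and> \<epsilon> < 1 \<longrightarrow>
       min_energy p \<epsilon> \<Omega>2 wells2 F2 \<le> ennreal (C * \<epsilon> powr (2 * p / (2 * p + 3))))"
  proof (intro exI[of _ "729 * (2 * C)"] conjI allI impI)
    show "0 < 729 * (2 * C)" using C by simp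
    fix \<epsilon> :: real assume \<epsilon>: "0 < \<epsilon> \<and> \<epsilon> < 1"
    define b where "b = C * \<epsilon> powr (2 * p / (2 * p + 3))"
    have "0 < b" unfolding b_def using C(1) \<epsilon> by simp
    moreover have "adm p \<epsilon> outT (brick 1 1) b" unfolding b_def using C(2) assms \<epsilon> by blast
    \<comment> \<open>The slack is taken equal to the positive bound \<open>b\<close> itself, which
      explains the factor 2 in the final constant.\<close>
    ultimately have "adm0 p \<epsilon> outT (brick 1 1) (b + b)" unfolding adm_def by blast
    then have "min_energy p \<epsilon> \<Omega>2 wells2 F2 \<le> ennreal (729 * (b + b))"
      using assms \<epsilon> by (intro energy_of_adm0) auto
    also have "729 * (b + b) = 729 * (2 * C) * \<epsilon> powr (2 * p / (2 * p + 3))" unfolding b_def by simp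
    finally show "min_energy p \<epsilon> \<Omega>2 wells2 F2 \<le> ennreal (729 * (2 * C) * \<epsilon> powr (2 * p / (2 * p + 3)))" .
  qed
qed

end
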